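(* Let $A_1,\ldots,A_d$ be (real) random variables with $P(A_j=0)=0$ for $j=1,\ldots,d$, and let $\mathbf A={\rm diag}(A_1,\ldots,A_d)$. Let $\mathbf Z$ be a $d$-dimensional random vector independent of $\mathbf A$, such that $\mathbf X=\mathbf A\mathbf Z$ is regularly varying with index $\alpha>0$. If $E\|\mathbf A\|^{\alpha+\delta}<\infty$ for some $\delta>0$ and $$E\Bigl(|A_j|^\alpha\prod_{k=1}^d\bigl(|A_k|^{i\theta_k}({\rm sign}(A_k))^{m_k}\bigr)\Bigr)\neq 0$$ for each $j=1,\ldots,d$, all $m_1,\ldots,m_d\in\{0,1\}$ and all $\theta_1,\ldots,\theta_d\in\mathbb R$, then $\mathbf Z$ is regularly varying with index $\alpha$. Moreover, with $\mu_{\mathbf Z}$ the tail measure of $\mathbf Z$, $$\frac{P(s^{-1}\mathbf X\in\cdot)}{P(\|\mathbf Z\|>s)}\ \to\ E\bigl[\mu_{\mathbf Z}\circ\mathbf A^{-1}\bigr]\qquad\text{vaguely in }\overline{\mathbb R}_0^d\text{ as }s\to\infty .$$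
   Context: $\|\cdot\|$ is a fixed norm on $\mathbb R^d$ and $\|\mathbf A\|$ the matrix norm; in exponents $i$ is the imaginary unit. The variables $A_1,\dots,A_d$ need not be independent of each other. $\overline{\mathbb R}=[-\infty,\infty]$, $\overline{\mathbb R}_0^d=\overline{\mathbb R}^d\setminus\{\mathbf 0\}$; a Borel measure on $\overline{\mathbb R}_0^d$ is Radon if it is finite outside every ball of positive radius centered at the origin; vague convergence is convergence of integrals of continuous functions with compact support in $\overline{\mathbb R}_0^d$ (supports bounded away from the origin). A random vector $\mathbf X$ in $\mathbb R^d$ is regularly varying if there is a non-null Radon measure $\mu_{\mathbf X}$ on $\overline{\mathbb R}_0^d$, not charging the set of infinite points, such that $P(s^{-1}\mathbf X\in\cdot)/P(\|\mathbf X\|>s)\to\mu_{\mathbf X}$ vaguely in $\overline{\mathbb R}_0^d$ as $s\to\infty$. Then $\mu_{\mathbf X}(tA)=t^{-\alpha}\mu_{\mathbf X}(A)$, $t>0$, $A$ Borel, for some $\alpha>0$, called the index; $\mu_{\mathbf X}$ is the tail measure. Here $E[\mu_{\mathbf Z}\circ\mathbf A^{-1}](B)=E[\mu_{\mathbf Z}(\{\mathbf z:\mathbf A\mathbf z\in B\})]$, the expectation being over $\mathbf A$. *)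

theory Defs
  imports "HOL-Probability.Probability"
begin

definition is_norm :: "(real^'n \<Rightarrow> real) \<Rightarrow> bool" where
  "is_norm N \<longleftrightarrow>
     (\<forall>x. 0 \<le> N x) \<and> (\<forall>x. N x = 0 \<longleftrightarrow> x = 0) \<and>
     (\<forall>c x. N (c *\<^sub>R x) = \<bar>c\<bar> * N x) \<and>
     (\<forall>x y. N (x + y) \<le> N x + N y)"

(* The operator norm induced by N; the quotient is 0 at x = 0. *)
definition matrix_norm :: "(real^'n \<Rightarrow> real) \<Rightarrow> real^'n^'n \<Rightarrow> real" where
  "matrix_norm N A = (SUP x. N (A *v x) / N x)"

definition diag_matrix :: "real^'n \<Rightarrow> real^'n^'n" where
  "diag_matrix v = (\<chi> i j. if i = j then v $ i else 0)"

definition ereal_vec :: "real^'n \<Rightarrow> ereal^'n" where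
  "ereal_vec x = (\<chi> i. ereal (x $ i))"

definition ereal_vec_scale :: "real \<Rightarrow> ereal^'n \<Rightarrow> ereal^'n" where
  "ereal_vec_scale t x = (\<chi> i. ereal t * x $ i)"

(* Matrix-vector product on the compactified space; the convention 0 * \<infinity> = 0 of ereal
   makes a diagonal matrix act coordinatewise. *)
definition ereal_matrix_vec :: "real^'n^'n \<Rightarrow> ereal^'n \<Rightarrow> ereal^'n" where
  "ereal_matrix_vec A z = (\<chi> i. \<Sum>j\<in>UNIV. ereal (A $ i $ j) * z $ j)"

(* The Borel sigma-algebra of [-\<infinity>,\<infinity>]^d - {0}. *)
definition punctured_borel :: "(ereal^'n) measure" where
  "punctured_borel = restrict_space borel (- {0})"

(* Balls are balls of R^d, so their complements contain all infinite points. *)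
definition radon_measure :: "(real^'n \<Rightarrow> real) \<Rightarrow> (ereal^'n) measure \<Rightarrow> bool" where
  "radon_measure N \<mu> \<longleftrightarrow>
     sets \<mu> = sets punctured_borel \<and>
     (\<forall>r>0. emeasure \<mu> (- (ereal_vec ` {x. N x < r})) < \<infinity>)"

definition vague_tendsto ::
  "('b \<Rightarrow> (ereal^'n) measure) \<Rightarrow> (ereal^'n) measure \<Rightarrow> 'b filter \<Rightarrow> bool" where
  "vague_tendsto \<nu> \<mu> F \<longleftrightarrow>
     (\<forall>f :: ereal^'n \<Rightarrow> real.
        continuous_on (- {0}) f \<and>
        (\<exists>K. compact K \<and> K \<subseteq> - {0} \<and> (\<forall>x\<in>- {0} - K. f x = 0)) \<longrightarrow>
        ((\<lambda>s. \<integral>x. f x \<partial>\<nu> s) \<longlongrightarrow> (\<integral>x. f x \<partial>\<mu>)) F)"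

(* The measure P(X / s \<in> _) / c on the punctured space, zero if c = 0. *)
definition scaled_law :: "'w measure \<Rightarrow> ('w \<Rightarrow> real^'n) \<Rightarrow> real \<Rightarrow> real \<Rightarrow> (ereal^'n) measure" where
  "scaled_law M X s c =
     scale_measure (ennreal (1 / c))
       (restrict_space (distr M borel (\<lambda>\<omega>. ereal_vec (inverse s *\<^sub>R X \<omega>))) (- {0}))"

(* Non-nullness excludes the degenerate case P(N X > s) = 0 for large s, in which
   the left-hand measures below are eventually zero. *)
definition tail_measure ::
  "'w measure \<Rightarrow> (real^'n \<Rightarrow> real) \<Rightarrow> ('w \<Rightarrow> real^'n) \<Rightarrow> (ereal^'n) measure \<Rightarrow> bool" where
  "tail_measure M N X \<mu> \<longleftrightarrow>
     radon_measure N \<mu> \<and> emeasure \<mu> (space \<mu>) \<noteq> 0 \<and>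
     emeasure \<mu> (- range ereal_vec) = 0 \<and>
     vague_tendsto (\<lambda>s. scaled_law M X s (measure M {\<omega> \<in> space M. N (X \<omega>) > s})) \<mu> at_top"

definition homogeneous :: "real \<Rightarrow> (ereal^'n) measure \<Rightarrow> bool" where
  "homogeneous \<alpha> \<mu> \<longleftrightarrow>
     (\<forall>t>0. \<forall>B\<in>sets \<mu>. emeasure \<mu> (ereal_vec_scale t ` B) = ennreal (t powr - \<alpha>) * emeasure \<mu> B)"

definition regularly_varying ::
  "'w measure \<Rightarrow> (real^'n \<Rightarrow> real) \<Rightarrow> ('w \<Rightarrow> real^'n) \<Rightarrow> real \<Rightarrow> bool" where
  "regularly_varying M N X \<alpha> \<longleftrightarrow>
     X \<in> borel_measurable M \<and> \<alpha> > 0 \<and> (\<exists>\<mu>. tail_measure M N X \<mu> \<and> homogeneous \<alpha> \<mu>)"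

(* E[\<mu> \<circ> A^-1]; see emeasure_expected_image below for its values. *)
definition expected_image ::
  "'w measure \<Rightarrow> ('w \<Rightarrow> real^'n^'n) \<Rightarrow> (ereal^'n) measure \<Rightarrow> (ereal^'n) measure" where
  "expected_image M A \<mu> =
     measure_of (- {0}) (sets punctured_borel)
       (\<lambda>B. \<integral>\<^sup>+\<omega>. emeasure \<mu> {z \<in> space \<mu>. ereal_matrix_vec (A \<omega>) z \<in> B} \<partial>M)"



lemma borel_measurable_vecI:
  fixes f :: "'a \<Rightarrow> 'b::second_countable_topology ^ 'n"
  assumes "\<And>i. (\<lambda>x. f x $ i) \<in> borel_measurable M"
  shows "f \<in> borel_measurable M"
proof (rule borel_measurableI)
  fix S :: "('b ^ 'n) set"
  assume S: "open S"
  obtain \<B> :: "'b set set" where \<B>: "countable \<B>" "topological_basis \<B>"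
    using ex_countable_basis by auto
  define \<U> where "\<U> = {U \<in> PiE (UNIV :: 'n set) (\<lambda>_. \<B>). {x. \<forall>i. x $ i \<in> U i} \<subseteq> S}"
  have "countable (PiE (UNIV :: 'n set) (\<lambda>_. \<B>))"
    by (intro countable_PiE) (auto simp: \<B>)
  then have cU: "countable \<U>"
    unfolding \<U>_def by (rule countable_subset[rotated]) auto
  have "x \<in> (\<Union>U\<in>\<U>. {x. \<forall>i. x $ i \<in> U i})" if "x \<in> S" for x
  proof -
    have "\<exists>V. (\<forall>i. open (V i) \<and> x $ i \<in> V i) \<and> (\<forall>y. (\<forall>i. y $ i \<in> V i) \<longrightarrow> y \<in> S)"
      using S that unfolding open_vec_def by (rule bspec)
    then obtain V where V: "\<And>i. open (V i) \<and> x $ i \<in> V i"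
        and VS: "\<And>y. (\<forall>i. y $ i \<in> V i) \<Longrightarrow> y \<in> S"
      by auto
    have "\<exists>W\<in>\<B>. x $ i \<in> W \<and> W \<subseteq> V i" for i
      by (rule topological_basisE[OF \<B>(2), of "V i" "x $ i"]) (use V in auto)
    then have "\<forall>i. \<exists>U. U \<in> \<B> \<and> x $ i \<in> U \<and> U \<subseteq> V i"
      by auto
    from choice[OF this]
    obtain W where W: "\<And>i. W i \<in> \<B> \<and> x $ i \<in> W i \<and> W i \<subseteq> V i"
      by auto
    have "W \<in> \<U>"
      unfolding \<U>_def using W by (auto intro!: VS)
    then show ?thesis using W by blast
  qed
  then have S_eq: "S = (\<Union>U\<in>\<U>. {x. \<forall>i. x $ i \<in> U i})"
    by (auto simp: \<U>_def)
  have "f -` S \<inter> space M = (\<Union>U\<in>\<U>. {x \<in> space M. \<forall>i. f x $ i \<in> U i})"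
    by (subst S_eq) auto
  also have "\<dots> \<in> sets M"
  proof (intro sets.countable_UN'[OF cU])
    have "{x \<in> space M. \<forall>i. f x $ i \<in> U i} \<in> sets M" if "U \<in> \<U>" for U
    proof -
      have "open (U i)" for i
        using that topological_basis_open[OF \<B>(2)] by (auto simp: \<U>_def PiE_def Pi_def)
      then have "{x \<in> space M. f x $ i \<in> U i} \<in> sets M" for i
        using assms[of i] measurable_sets_Collect[OF assms[of i], of "\<lambda>y. y \<in> U i"]
        by (simp add: borel_open)
      then show ?thesis
        using sets.sets_Collect_finite_All[of UNIV M "\<lambda>i x. f x $ i \<in> U i"] by simp
    qed
    then show "(\<lambda>U. {x \<in> space M. \<forall>i. f x $ i \<in> U i}) ` \<U> \<subseteq> sets M" by auto
  qed
  finally show "f -` S \<inter> space M \<in> sets M" .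
qed

lemma borel_measurable_vec_nth_gen:
  "(\<lambda>x :: 'b::second_countable_topology ^ 'n. x $ i) \<in> borel_measurable borel"
  by (intro borel_measurable_continuous_onI continuous_intros) 

lemma space_punctured_borel: "space punctured_borel = - {0}"
  by (simp add: punctured_borel_def space_restrict_space)


lemma borel_measurable_ereal_matrix_vec:
  "(\<lambda>(A :: real^'n^'n, z). ereal_matrix_vec A z) \<in> borel_measurable (borel \<Otimes>\<^sub>M borel)"
proof (rule borel_measurable_vecI)
  fix i :: 'n
  have 1: "(\<lambda>x :: (real^'n^'n) \<times> (ereal^'n). snd x $ j) \<in> borel_measurable (borel \<Otimes>\<^sub>M borel)" for j
    using measurable_compose[OF measurable_snd borel_measurable_vec_nth_gen] .
  have 2: "(\<lambda>x :: (real^'n^'n) \<times> (ereal^'n). fst x $ i $ j) \<in> borel_measurable (borel \<Otimes>\<^sub>M borel)" for j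
    by (rule measurable_compose[OF measurable_fst])
      (intro borel_measurable_continuous_onI continuous_intros)
  show "(\<lambda>x. (case x of (A, z) \<Rightarrow> ereal_matrix_vec A z) $ i) \<in> borel_measurable (borel \<Otimes>\<^sub>M borel)"
    unfolding ereal_matrix_vec_def case_prod_beta vec_lambda_beta
    by (intro borel_measurable_ereal_sum borel_measurable_ereal_times borel_measurable_ereal 1 2)
qed

lemma ereal_vec_image_borel:
  fixes S :: "(real^'n) set"
  assumes "S \<in> sets borel"
  shows "ereal_vec ` S \<in> sets borel"
proof -
  let ?r = "\<lambda>x :: ereal^'n. \<chi> i. real_of_ereal (x $ i)"
  have r: "?r \<in> borel_measurable borel"
    by (rule borel_measurable_vecI)
      (simp add: borel_measurable_real_of_ereal borel_measurable_vec_nth_gen)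
  have fin: "{x :: ereal^'n. \<forall>i. x $ i \<in> - {\<infinity>, - \<infinity>}} \<in> sets borel"
    by (intro borel_open open_vector_box) (auto intro!: open_Compl)
  have "ereal_vec ` S = {x. \<forall>i. x $ i \<in> - {\<infinity>, - \<infinity>}} \<inter> (?r -` S \<inter> space borel)"
    (is "?L = ?R")
  proof
    show "?L \<subseteq> ?R" by (auto simp: ereal_vec_def)
    show "?R \<subseteq> ?L"
    proof
      fix x assume x: "x \<in> ?R"
      then have "x = ereal_vec (?r x)"
        by (auto simp: ereal_vec_def vec_eq_iff ereal_real)
      with x show "x \<in> ?L" by blast
    qed
  qed
  with fin measurable_sets[OF r assms] show ?thesis by simp
qed

lemma is_norm_continuous:
  assumes "is_norm N"
  shows "continuous_on UNIV N"
proof (rule convex_on_continuous)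
  show "convex_on UNIV N"
  proof (rule convex_onI)
    fix t :: real and x y assume "0 < t" "t < 1"
    have hom: "\<And>c x. N (c *\<^sub>R x) = \<bar>c\<bar> * N x" and tri: "\<And>x y. N (x + y) \<le> N x + N y"
      using assms by (auto simp: is_norm_def)
    have "N ((1 - t) *\<^sub>R x + t *\<^sub>R y) \<le> N ((1 - t) *\<^sub>R x) + N (t *\<^sub>R y)"
      by (rule tri)
    also have "\<dots> = \<bar>1 - t\<bar> * N x + \<bar>t\<bar> * N y"
      by (simp only: hom)
    finally show "N ((1 - t) *\<^sub>R x + t *\<^sub>R y) \<le> (1 - t) * N x + t * N y"
      using \<open>0 < t\<close> \<open>t < 1\<close> by simp
  qed simp
qed simp

lemma ereal_vec_eq_0_iff: "ereal_vec x = 0 \<longleftrightarrow> x = 0"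
  by (auto simp: ereal_vec_def vec_eq_iff zero_ereal_def)

lemma Compl_0_borel: "- {0 :: ereal^'n} \<in> sets borel"
proof -
  have "ereal_vec 0 = (0 :: ereal^'n)" by (simp add: ereal_vec_eq_0_iff)
  then have "ereal_vec ` {0} = {0 :: ereal^'n}" by simp
  then have "{0 :: ereal^'n} \<in> sets borel"
    using ereal_vec_image_borel[of "{0 :: real^'n}"] by simp
  then show ?thesis using sets.compl_sets[of _ borel] by (fastforce simp: Compl_eq_Diff_UNIV)
qed

lemma sets_punctured_borel_iff: "B \<in> sets punctured_borel \<longleftrightarrow> B \<subseteq> - {0} \<and> B \<in> sets borel"
  unfolding punctured_borel_def using Compl_0_borel by (subst sets_restrict_space_iff) auto

lemma radon_measure_sigma_finite:
  fixes N :: "real^'n \<Rightarrow> real"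
  assumes N: "is_norm N" and \<mu>: "radon_measure N \<mu>"
  shows "sigma_finite_measure \<mu>"
proof
  have sets: "sets \<mu> = sets punctured_borel"
    using \<mu> by (simp add: radon_measure_def)
  have sp: "space \<mu> = - {0}"
    using sets_eq_imp_space_eq[OF sets] by (simp add: space_punctured_borel)
  define E where "E n = - (ereal_vec ` {x. N x < 1 / real (Suc n)})" for n
  have N0: "N 0 = 0" and Npos: "\<And>x. x \<noteq> 0 \<Longrightarrow> 0 < N x"
    using N unfolding is_norm_def by (auto simp: less_le)
  have sub: "E n \<subseteq> - {0}" for n
  proof -
    have "(0 :: ereal^'n) = ereal_vec 0" by (simp add: ereal_vec_eq_0_iff eq_commute[of 0])
    then have "(0 :: ereal^'n) \<in> ereal_vec ` {x. N x < 1 / real (Suc n)}"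
      using N0 by (intro image_eqI[of _ _ 0]) auto
    then show ?thesis by (auto simp: E_def)
  qed
  have op: "open {x. N x < 1 / real (Suc n)}" for n
    using is_norm_continuous[OF N] by (intro open_Collect_less) auto
  have "E n \<in> sets borel" for n
    using sets.compl_sets[OF ereal_vec_image_borel[OF borel_open[OF op[of n]]]]
    by (simp only: E_def Compl_eq_Diff_UNIV space_borel)
  then have E: "E n \<in> sets \<mu>" for n
    using sub[of n] by (auto simp: sets sets_punctured_borel_iff)
  have fin: "emeasure \<mu> (E n) < \<infinity>" for n
    using \<mu> unfolding E_def radon_measure_def by (metis of_nat_0_less_iff zero_less_Suc zero_less_divide_1_iff)
  have cover: "\<exists>n. y \<in> E n" if "y \<noteq> 0" for y
  proof (cases "y \<in> range ereal_vec")
    case True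
    then obtain x where x: "y = ereal_vec x" by auto
    with that ereal_vec_eq_0_iff Npos have "0 < N x" by auto
    then obtain n where n: "1 / real (Suc n) < N x"
      using nat_approx_posE by blast
    have "inj (ereal_vec :: real^'n \<Rightarrow> _)"
      by (auto simp: inj_def ereal_vec_def vec_eq_iff)
    with n x have "y \<in> E n" by (auto simp: E_def dest: injD)
    then show ?thesis ..
  qed (auto simp: E_def)
  show "\<exists>A. countable A \<and> A \<subseteq> sets \<mu> \<and> \<Union> A = space \<mu> \<and> (\<forall>a\<in>A. emeasure \<mu> a \<noteq> \<infinity>)"
  proof (intro exI[of _ "range E"] conjI ballI)
    show "\<Union> (range E) = space \<mu>" using cover sub by (fastforce simp: sp)
    show "\<And>a. a \<in> range E \<Longrightarrow> emeasure \<mu> a \<noteq> \<infinity>" using fin by (auto simp: less_top)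
  qed (use E in auto)
qed

lemma emeasure_expected_image:
  fixes N :: "real^'n \<Rightarrow> real"
  assumes N: "is_norm N" and \<mu>: "radon_measure N \<mu>" and A: "A \<in> borel_measurable M"
    and B: "B \<in> sets punctured_borel"
  shows "emeasure (expected_image M A \<mu>) B =
    (\<integral>\<^sup>+\<omega>. emeasure \<mu> {z \<in> space \<mu>. ereal_matrix_vec (A \<omega>) z \<in> B} \<partial>M)"
proof -
  let ?Q = "\<lambda>B. \<integral>\<^sup>+\<omega>. emeasure \<mu> {z \<in> space \<mu>. ereal_matrix_vec (A \<omega>) z \<in> B} \<partial>M"
  let ?T = "\<lambda>(\<omega>, z). ereal_matrix_vec (A \<omega>) z"
  interpret sigma_finite_measure \<mu> by (rule radon_measure_sigma_finite[OF N \<mu>])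
  have sets: "sets \<mu> = sets punctured_borel"
    using \<mu> by (simp add: radon_measure_def)
  have "id \<in> measurable \<mu> borel"
    by (subst measurable_cong_sets[OF sets refl])
      (simp add: punctured_borel_def measurable_restrict_space1 id_def)
  then have id: "(\<lambda>z. z) \<in> measurable \<mu> borel" by (simp add: id_def)
  have "(\<lambda>x. (A (fst x), snd x)) \<in> measurable (M \<Otimes>\<^sub>M \<mu>) (borel \<Otimes>\<^sub>M borel)"
    using measurable_compose[OF measurable_fst A] measurable_compose[OF measurable_snd id]
    by (intro measurable_Pair) auto
  from measurable_compose[OF this borel_measurable_ereal_matrix_vec]
  have T: "?T \<in> measurable (M \<Otimes>\<^sub>M \<mu>) borel"
    by (simp add: case_prod_beta)
  have Q: "emeasure (distr (M \<Otimes>\<^sub>M \<mu>) borel ?T) C = ?Q C" if "C \<in> sets borel" for C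
  proof -
    have "emeasure (distr (M \<Otimes>\<^sub>M \<mu>) borel ?T) C
        = emeasure (M \<Otimes>\<^sub>M \<mu>) (?T -` C \<inter> space (M \<Otimes>\<^sub>M \<mu>))"
      by (rule emeasure_distr[OF T that])
    also have "\<dots> = (\<integral>\<^sup>+\<omega>. emeasure \<mu> (Pair \<omega> -` (?T -` C \<inter> space (M \<Otimes>\<^sub>M \<mu>))) \<partial>M)"
      by (intro emeasure_pair_measure_alt measurable_sets[OF T that])
    also have "\<dots> = ?Q C"
      by (intro nn_integral_cong arg_cong2[where f=emeasure]) (auto simp: space_pair_measure)
    finally show ?thesis .
  qed
  have borel: "C \<in> sets borel" if "C \<in> sets punctured_borel" for C :: "(ereal^'n) set"
    using that by (auto simp: sets_punctured_borel_iff)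
  have sa: "sigma_algebra (- {0}) (sets punctured_borel)"
    using sets.sigma_algebra_axioms[of punctured_borel] by (simp add: space_punctured_borel)
  show ?thesis
    unfolding expected_image_def
  proof (rule emeasure_measure_of_sigma[OF sa _ _ B])
    show "positive (sets punctured_borel) ?Q" by (simp add: positive_def)
    show "countably_additive (sets punctured_borel) ?Q"
    proof (rule countably_additiveI)
      fix C :: "nat \<Rightarrow> (ereal^'n) set"
      assume C: "range C \<subseteq> sets punctured_borel" "disjoint_family C"
        "(\<Union>i. C i) \<in> sets punctured_borel"
      then have Cb: "range C \<subseteq> sets borel" using borel by auto
      have "(\<Sum>i. emeasure (distr (M \<Otimes>\<^sub>M \<mu>) borel ?T) (C i))
          = emeasure (distr (M \<Otimes>\<^sub>M \<mu>) borel ?T) (\<Union>i. C i)"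
        by (rule suminf_emeasure) (use Cb C in auto)
      moreover have "emeasure (distr (M \<Otimes>\<^sub>M \<mu>) borel ?T) (C i) = ?Q (C i)" for i
        using Q Cb by blast
      ultimately show "(\<Sum>i. ?Q (C i)) = ?Q (\<Union>i. C i)"
        using Q[OF borel[OF C(3)]] by (simp only:)
    qed
  qed
qed

end

theory Submission
  imports Defs
begin

text \<open>
  By independence and \<open>P(A\<^sub>j = 0) = 0\<close>, the tail of \<open>Z\<close> is dominated by that of \<open>X\<close>. Potter bounds for
  \<open>V(s) = P(\<parallel>X\<parallel> > s)\<close> then make the measures \<open>P(Z/s \<in> \<cdot>) / V(s)\<close> relatively compact, and Breiman's
  dominated convergence argument shows that every limit \<open>\<nu>\<close> solves \<open>E[\<nu> \<circ> A\<^sup>-\<^sup>1] = \<mu>\<^sub>X\<close>. So it suffices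
  that this equation has at most one solution with tail \<open>O(r\<^sup>-\<^sup>\<alpha>)\<close>.

  Integrating two solutions against a function of \<open>\<bar>x\<^sub>j\<bar>\<close> times a character of the multiplicative group
  in all coordinates yields, on a logarithmic scale, a bounded continuous \<open>g\<close> with \<open>\<integral> w(\<omega>) g(t - L(\<omega>)) = 0\<close> for
  all \<open>t\<close>, where \<open>L = ln \<bar>A\<^sub>j\<bar>\<close> and \<open>w = \<bar>A\<^sub>j\<bar>\<^sup>\<alpha> \<chi>(A)\<close>; the moment hypothesis says precisely that the
  characteristic function of \<open>L\<close> under \<open>w\<close> has no zero. Such a \<open>g\<close> vanishes: otherwise its one-sided
  Laplace transforms near the imaginary axis, suitably normalised, accumulate at a nonzero multiple of
  some \<open>x \<mapsto> exp(i\<theta>x)\<close>, which would also be annihilated.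
\<close>

section \<open>Convolution equations on the line\<close>

text \<open>Two obstacles shape the argument. First, a bounded function \<open>g\<close> on the line
  has no Fourier transform, so the convolution equation cannot simply be divided by the
  characteristic function. Instead \<open>g\<close> is damped by exp(-eps |t|) and split at 0: each
  half solves F' = z F - g up to sign, the two terms g cancel in the sum, and an error of order eps
  is left. A Fejer average keeps the sum away from 0 at some frequency in a window independent of
  eps. Second, the limit measures may be infinite near 0, may charge points with vanishing
  coordinates, and live on a space to which infinity has been adjoined. Hence integrals are cut off
  in one coordinate j only, characters have a variant that detects x_k = 0 (its multiplier is 1,
  which is a zero exponent in the moment hypothesis), and the analysis is done on R^d with test
  functions vanishing near 0, infinity being controlled by tail bounds. All quotients are normalised
  by \<open>V\<close> until the end, because at first only an upper bound for the tail of
  \<open>Z\<close> is available; the convergence of P(N Z > s) / V(s) then follows from the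
  homogeneity of the limit.\<close>

lemma vector_derivative_bound:
  fixes f :: "real \<Rightarrow> 'a::real_normed_vector"
  assumes "\<And>x. (f has_vector_derivative f' x) (at x)" "\<And>x. norm (f' x) \<le> B"
  shows "norm (f x - f y) \<le> B * \<bar>x - y\<bar>"
proof -
  have "norm (f x - f y) \<le> B * norm (x - y)"
  proof (rule differentiable_bound[of UNIV f "\<lambda>x h. h *\<^sub>R f' x"])
    fix x :: real
    show "(f has_derivative (\<lambda>h. h *\<^sub>R f' x)) (at x within UNIV)"
      using assms(1)[of x] by (simp add: has_vector_derivative_def)
    have "0 \<le> B" using assms(2)[of 0] norm_ge_zero order_trans by blast
    show "onorm (\<lambda>h. h *\<^sub>R f' x) \<le> B"
      by (rule onorm_bound) (use assms(2)[of x] \<open>0 \<le> B\<close> in \<open>auto simp: mult.commute[of B] intro!: mult_left_mono\<close>)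
  qed auto
  then show ?thesis by simp
qed

text \<open>Along a subsequence \<open>F n\<close> converges to a multiple of the character with frequency \<open>lim \<theta> n\<close>, which
  \<open>w\<close> does not annihilate.\<close>
lemma approx_eigenfunction_contradiction:
  fixes F :: "nat \<Rightarrow> real \<Rightarrow> complex" and w :: "'a \<Rightarrow> complex"
  assumes w: "integrable M w" and L: "L \<in> borel_measurable M"
    and nz: "\<And>\<theta>. (\<integral>x. w x * cis (- \<theta> * L x) \<partial>M) \<noteq> 0"
    and meas: "\<And>n. F n \<in> borel_measurable borel"
    and bd: "\<And>n x. cmod (F n x) \<le> 1" and c: "0 < c" "\<And>n. c \<le> cmod (F n 0)"
    and dF: "\<And>n x. (F n has_vector_derivative (\<i> * complex_of_real (\<theta> n) * F n x + r n x)) (at x)"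
    and r: "\<And>n x. cmod (r n x) \<le> \<kappa> n" and \<kappa>: "\<kappa> \<longlonglongrightarrow> 0"
    and \<theta>: "\<And>n. \<bar>\<theta> n\<bar> \<le> W"
    and ann: "\<And>n. (\<integral>x. w x * F n (- L x) \<partial>M) = 0"
  shows False
proof -
  \<comment> \<open>The subsequence is chosen by compactness for the pairs of frequency and value at
    0; on a line of approximate exponentials these two numbers determine the limit function.\<close>
  have cpt: "compact ({-W..W} \<times> cball (0::complex) 1)" by (intro compact_Times) auto
  have mem: "(\<theta> n, F n 0) \<in> {-W..W} \<times> cball 0 1" for n
    using \<theta>[of n] bd[of n 0] by (auto simp: abs_le_iff)
  from cpt[unfolded compact_def, rule_format, of "\<lambda>n. (\<theta> n, F n 0)"] mem obtain l \<sigma> where \<sigma>: "strict_mono (\<sigma> :: nat \<Rightarrow> nat)"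
    and lim: "((\<lambda>n. (\<theta> n, F n 0)) \<circ> \<sigma>) \<longlonglongrightarrow> l"
    by auto
  define \<theta>' f where "\<theta>' = fst l" and "f = snd l"
  have lim1: "(\<lambda>n. \<theta> (\<sigma> n)) \<longlonglongrightarrow> \<theta>'" and lim2: "(\<lambda>n. F (\<sigma> n) 0) \<longlonglongrightarrow> f"
    using tendsto_fst[OF lim] tendsto_snd[OF lim] by (auto simp: \<theta>'_def f_def o_def)
  have \<kappa>': "(\<lambda>n. \<kappa> (\<sigma> n)) \<longlonglongrightarrow> 0"
    using LIMSEQ_subseq_LIMSEQ[OF \<kappa> \<sigma>] by (simp add: o_def)
  have close: "cmod (F n s - cis (\<theta> n * s) * F n 0) \<le> \<kappa> n * \<bar>s\<bar>" for n s
  proof -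
    \<comment> \<open>Multiplying by \<open>cis (- \<theta> n * x)\<close> removes the eigenvalue,
      so the derivative of \<open>?H\<close> is only the rotated remainder and \<open>?H\<close> is
      nearly constant on bounded sets.\<close>
    let ?H = "\<lambda>x. cis (- \<theta> n * x) * F n x"
    have "(?H has_vector_derivative (cis (- \<theta> n * x) * r n x)) (at x)" for x
    proof -
      have 1: "((\<lambda>x. cis (- \<theta> n * x)) has_vector_derivative (- \<i> * \<theta> n * cis (- \<theta> n * x))) (at x)"
        unfolding cis_conv_exp
        by (auto intro!: derivative_eq_intros has_vector_derivative_real_field)
      from has_vector_derivative_mult[OF 1 dF[of n x]] show ?thesis
        by (simp add: algebra_simps)
    qed
    then have "cmod (?H s - ?H 0) \<le> \<kappa> n * \<bar>s - 0\<bar>"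
      by (rule vector_derivative_bound) (simp add: norm_mult r)
    moreover have "F n s - cis (\<theta> n * s) * F n 0 = cis (\<theta> n * s) * (?H s - ?H 0)"
      by (simp add: algebra_simps cis_mult)
    ultimately show ?thesis by (simp add: norm_mult)
  qed
  have lim3: "(\<lambda>n. F (\<sigma> n) s) \<longlonglongrightarrow> cis (\<theta>' * s) * f" for s
  proof -
    have "(\<lambda>n. \<kappa> (\<sigma> n) * \<bar>s\<bar>) \<longlonglongrightarrow> 0"
      using tendsto_mult_right[OF \<kappa>', of "\<bar>s\<bar>"] by simp
    then have "(\<lambda>n. F (\<sigma> n) s - cis (\<theta> (\<sigma> n) * s) * F (\<sigma> n) 0) \<longlonglongrightarrow> 0"
      by (rule Lim_null_comparison[rotated]) (auto intro!: always_eventually close)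
    moreover have "(\<lambda>n. cis (\<theta> (\<sigma> n) * s) * F (\<sigma> n) 0) \<longlonglongrightarrow> cis (\<theta>' * s) * f"
      by (intro tendsto_intros lim1 lim2)
    ultimately have "(\<lambda>n. (F (\<sigma> n) s - cis (\<theta> (\<sigma> n) * s) * F (\<sigma> n) 0) + cis (\<theta> (\<sigma> n) * s) * F (\<sigma> n) 0) \<longlonglongrightarrow> 0 + cis (\<theta>' * s) * f"
      by (rule tendsto_add)
    then show ?thesis by simp
  qed
  have "(\<lambda>n. \<integral>x. w x * F (\<sigma> n) (- L x) \<partial>M) \<longlonglongrightarrow> (\<integral>x. w x * (cis (\<theta>' * - L x) * f) \<partial>M)"
  proof (rule integral_dominated_convergence[where w="\<lambda>x. cmod (w x)"])
    show "(\<lambda>x. w x * F (\<sigma> n) (- L x)) \<in> borel_measurable M" for n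
      using borel_measurable_integrable[OF w] L measurable_compose[OF _ meas[of "\<sigma> n"], of "\<lambda>x. - L x" M]
      by measurable
    show "(\<lambda>x. w x * (cis (\<theta>' * - L x) * f)) \<in> borel_measurable M"
      using borel_measurable_integrable[OF w] L unfolding cis_conv_exp by measurable
    show "integrable M (\<lambda>x. cmod (w x))" using w by simp
    show "AE x in M. (\<lambda>n. w x * F (\<sigma> n) (- L x)) \<longlonglongrightarrow> w x * (cis (\<theta>' * - L x) * f)"
      by (intro AE_I2 tendsto_mult tendsto_const lim3)
    show "AE x in M. cmod (w x * F (\<sigma> n) (- L x)) \<le> cmod (w x)" for n
      using bd by (auto simp: norm_mult intro!: AE_I2 mult_left_le)
  qed
  then have "(\<integral>x. w x * (cis (\<theta>' * - L x) * f) \<partial>M) = 0"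
    unfolding ann by (simp add: LIMSEQ_const_iff)
  moreover have "(\<integral>x. w x * (cis (\<theta>' * - L x) * f) \<partial>M) = (\<integral>x. w x * cis (- \<theta>' * L x) \<partial>M) * f"
    by (subst integral_mult_left_zero[symmetric]) (simp add: mult.assoc)
  ultimately have "f = 0" using nz[of \<theta>'] by simp
  moreover have "c \<le> cmod f"
    by (rule LIMSEQ_le_const[OF tendsto_norm[OF lim2]]) (use c in auto)
  ultimately show False using c by simp
qed

section \<open>One-sided Laplace transforms of bounded functions\<close>

definition laplace :: "(real \<Rightarrow> complex) \<Rightarrow> complex \<Rightarrow> real \<Rightarrow> complex" where
  "laplace g z x = (\<integral>u. indicator {0<..} u *\<^sub>R (exp (- (z * complex_of_real u)) * g (x + u)) \<partial>lborel)"

lemma laplace_integrable: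
  assumes g: "g \<in> borel_measurable borel" and B: "\<And>x. cmod (g x) \<le> B" and z: "0 < Re z"
  shows "integrable lborel (\<lambda>u. indicator {0<..} u *\<^sub>R (exp (- (z * complex_of_real u)) * g (x + u)))"
    and "cmod (laplace g z x) \<le> B / Re z"
proof -
  have B0: "0 \<le> B" using B[of 0] norm_ge_zero order_trans by blast
  have i: "integrable lborel (\<lambda>u. B * (indicator {0<..} u *\<^sub>R exp (- (u * Re z))))"
    using integrable_I0i_exp_mscale[OF z] by (simp add: set_integrable_def)
  have m: "(\<lambda>u. indicator {0<..} u *\<^sub>R (exp (- (z * complex_of_real u)) * g (x + u))) \<in> borel_measurable lborel"
    using g by measurable
  have bd: "norm (indicator {0<..} u *\<^sub>R (exp (- (z * complex_of_real u)) * g (x + u))) \<le> B * (indicator {0<..} u *\<^sub>R exp (- (u * Re z)))" for u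
    using B[of "x+u"] by (auto simp: norm_mult indicator_def mult.commute[of B] mult.commute[of u] intro!: mult_left_mono)
  show I: "integrable lborel (\<lambda>u. indicator {0<..} u *\<^sub>R (exp (- (z * complex_of_real u)) * g (x + u)))"
    by (rule Bochner_Integration.integrable_bound[OF i m]) (intro AE_I2 order_trans[OF bd], simp)
  have "cmod (laplace g z x) \<le> (\<integral>u. B * (indicator {0<..} u *\<^sub>R exp (- (u * Re z))) \<partial>lborel)"
    unfolding laplace_def
    by (rule order_trans[OF integral_norm_bound]) (intro integral_mono integrable_norm I i bd)
  also have "\<dots> = B / Re z"
    using LBINT_I0i_exp_mscale[OF z] by (simp add: interval_lebesgue_integral_0_infty set_lebesgue_integral_def)
  finally show "cmod (laplace g z x) \<le> B / Re z" .
qed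

text \<open>The substitution t = x + u turns the transform into exp(z x) times a tail integral
  starting at \<open>x\<close>. In this form the dependence on \<open>x\<close> is differentiable
  although \<open>g\<close> is merely continuous.\<close>

lemma laplace_alt:
  assumes g: "continuous_on UNIV g" and B: "\<And>x. cmod (g x) \<le> B" and z: "0 < Re z"
  shows "laplace g z x = exp (z * complex_of_real x) * (laplace g z 0 - (LBINT t=0..x. exp (- (z * complex_of_real t)) * g t))"
proof -
  let ?h = "\<lambda>t. exp (- (z * complex_of_real t)) * g t"
  have gm: "g \<in> borel_measurable borel" using g by (rule borel_measurable_continuous_onI)
  have I: "set_integrable lborel {y<..} ?h" for y
  proof -
    have "integrable lborel (\<lambda>u. exp (- (z * complex_of_real y)) * (indicator {0<..} u *\<^sub>R (exp (- (z * complex_of_real u)) * g (y + u))))"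
      by (rule integrable_mult_right) (rule laplace_integrable(1)[OF gm B z, of y])
    also have "(\<lambda>u. exp (- (z * complex_of_real y)) * (indicator {0<..} u *\<^sub>R (exp (- (z * complex_of_real u)) * g (y + u))))
       = (\<lambda>u. (\<lambda>t. indicator {y<..} t *\<^sub>R ?h t) (y + 1 * u))"
      by (auto simp: indicator_def exp_add[symmetric] algebra_simps)
    finally show ?thesis
      unfolding set_integrable_def
      using lborel_integrable_real_affine_iff[of 1 "\<lambda>t. indicator {y<..} t *\<^sub>R ?h t" y] by simp
  qed
  have eq: "laplace g z y = exp (z * complex_of_real y) * (LBINT t=y..\<infinity>. ?h t)" for y
  proof -
    have "(LBINT t=y..\<infinity>. ?h t) = (\<integral>t. indicator {y<..} t *\<^sub>R ?h t \<partial>lborel)"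
      by (simp add: interval_integral_to_infinity_eq set_lebesgue_integral_def)
    also have "\<dots> = (\<integral>u. indicator {y<..} (y + 1 * u) *\<^sub>R ?h (y + 1 * u) \<partial>lborel)"
      by (subst lborel_integral_real_affine[where c=1 and t=y]) auto
    also have "\<dots> = (\<integral>u. exp (- (z * complex_of_real y)) * (indicator {0<..} u *\<^sub>R (exp (- (z * complex_of_real u)) * g (y + u))) \<partial>lborel)"
      by (intro Bochner_Integration.integral_cong) (auto simp: indicator_def exp_add[symmetric] algebra_simps)
    also have "\<dots> = exp (- (z * complex_of_real y)) * laplace g z y"
      unfolding laplace_def by (rule integral_mult_right_zero)
    finally show ?thesis by (simp add: mult.assoc[symmetric] exp_add[symmetric])
  qed
  have "(LBINT t=0..x. ?h t) + (LBINT t=x..\<infinity>. ?h t) = (LBINT t=0..\<infinity>. ?h t)"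
  proof (rule interval_integral_sum)
    have eqs: "min 0 (min (ereal x) \<infinity>) = ereal (min 0 x)" "max 0 (max (ereal x) \<infinity>) = \<infinity>"
      by (auto simp: min_def max_def zero_ereal_def)
    show "interval_lebesgue_integrable lborel (min 0 (min (ereal x) \<infinity>)) (max 0 (max (ereal x) \<infinity>)) ?h"
      unfolding eqs interval_integrable_to_infinity_eq by (rule I)
  qed
  then have "laplace g z 0 - (LBINT t=0..x. ?h t) = (LBINT t=x..\<infinity>. ?h t)"
    using eq[of 0] by (simp add: zero_ereal_def algebra_simps)
  with eq[of x] show ?thesis by (simp only:)
qed

text \<open>For z = eps + i theta the right side is i theta F plus the remainder eps F - g. So the
  transform is nearly an eigenfunction of differentiation as soon as it is large compared with the
  bound on \<open>g\<close>.\<close>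

lemma laplace_deriv:
  assumes g: "continuous_on UNIV g" and B: "\<And>x. cmod (g x) \<le> B" and z: "0 < Re z"
  shows "(laplace g z has_vector_derivative (z * laplace g z x - g x)) (at x)"
proof -
  let ?h = "\<lambda>t. exp (- (z * complex_of_real t)) * g t"
  have "((\<lambda>u. LBINT t=ereal 0..u. ?h t) has_vector_derivative ?h x) (at x within {min 0 x - 1 .. max 0 x + 1})"
    by (rule interval_integral_FTC2) (auto intro!: continuous_intros continuous_on_subset[OF g])
  then have 1: "((\<lambda>u. LBINT t=0..u. ?h t) has_vector_derivative ?h x) (at x)"
    by (subst (asm) at_within_interior) (auto simp: zero_ereal_def)
  have 2: "((\<lambda>x. exp (z * complex_of_real x)) has_vector_derivative (z * exp (z * complex_of_real x))) (at x)"
    by (auto intro!: derivative_eq_intros has_vector_derivative_real_field)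
  have "((\<lambda>x. exp (z * complex_of_real x) * (laplace g z 0 - (LBINT t=0..x. ?h t))) has_vector_derivative
     (exp (z * complex_of_real x) * (0 - ?h x) + (z * exp (z * complex_of_real x)) * (laplace g z 0 - (LBINT t=0..x. ?h t)))) (at x)"
    by (intro has_vector_derivative_mult 2 has_vector_derivative_diff 1 has_vector_derivative_const)
  moreover have "exp (z * complex_of_real x) * (0 - ?h x) + (z * exp (z * complex_of_real x)) * (laplace g z 0 - (LBINT t=0..x. ?h t)) = z * laplace g z x - g x"
    by (subst laplace_alt[OF assms, of x]) (simp_all add: algebra_simps exp_add[symmetric] exp_minus)
  moreover have "(\<lambda>x. exp (z * complex_of_real x) * (laplace g z 0 - (LBINT t=0..x. ?h t))) = laplace g z"
    by (rule ext) (rule laplace_alt[OF assms, symmetric])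
  ultimately show ?thesis by (simp only:)
qed

lemma laplace_continuous:
  assumes "continuous_on UNIV g" and "\<And>x. cmod (g x) \<le> B" and "0 < Re z"
  shows "continuous_on UNIV (laplace g z)"
  using laplace_deriv[OF assms] by (meson continuous_at_imp_continuous_on has_vector_derivative_continuous)

lemma (in pair_sigma_finite) integrable_mult_prod:
  fixes f :: "'a \<Rightarrow> real" and g :: "'b \<Rightarrow> real"
  assumes f: "integrable M1 f" and g: "integrable M2 g"
  shows "integrable (M1 \<Otimes>\<^sub>M M2) (\<lambda>(x, y). f x * g y)"
proof (rule Fubini_integrable)
  show "(\<lambda>(x, y). f x * g y) \<in> borel_measurable (M1 \<Otimes>\<^sub>M M2)"
    using borel_measurable_integrable[OF f] borel_measurable_integrable[OF g] by measurable
  show "integrable M1 (\<lambda>x. \<integral>y. norm (case (x, y) of (x, y) \<Rightarrow> f x * g y) \<partial>M2)"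
    using f by (simp add: abs_mult)
  show "AE x in M1. integrable M2 (\<lambda>y. case (x, y) of (x, y) \<Rightarrow> f x * g y)"
    using g by (intro AE_I2) simp
qed

text \<open>The transform is an integral of translates of \<open>g\<close>, each of which is
  annihilated by the weight; Fubini exchanges the two integrations, absolute integrability coming
  from Re z > 0.\<close>

lemma laplace_annihilated:
  fixes w :: "'a \<Rightarrow> complex"
  assumes M: "sigma_finite_measure M" and w: "integrable M w" and L: "L \<in> borel_measurable M"
    and g: "continuous_on UNIV g" and B: "\<And>x. cmod (g x) \<le> B" and z: "0 < Re z"
    and ann: "\<And>t. (\<integral>x. w x * g (t - L x) \<partial>M) = 0"
  shows "(\<integral>x. w x * laplace g z (t - L x) \<partial>M) = 0"
proof -
  interpret sigma_finite_measure M by fact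
  interpret P: pair_sigma_finite M lborel ..
  have [measurable]: "g \<in> borel_measurable borel" using g by (rule borel_measurable_continuous_onI)
  have [measurable]: "w \<in> borel_measurable M" "L \<in> borel_measurable M" using w L by auto
  have B0: "0 \<le> B" using B[of 0] norm_ge_zero order_trans by blast
  let ?f = "\<lambda>(x, u). w x * (indicator {0<..} u *\<^sub>R (exp (- (z * complex_of_real u)) * g (t - L x + u)))"
  have int: "integrable (M \<Otimes>\<^sub>M lborel) ?f"
  proof (rule Bochner_Integration.integrable_bound)
    have i: "integrable lborel (\<lambda>u. B * (indicator {0<..} u *\<^sub>R exp (- (u * Re z))))"
      using integrable_I0i_exp_mscale[OF z] by (simp add: set_integrable_def)
    show "integrable (M \<Otimes>\<^sub>M lborel) (\<lambda>(x, u). cmod (w x) * (B * (indicator {0<..} u *\<^sub>R exp (- (u * Re z)))))"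
      using P.integrable_mult_prod[OF integrable_norm[OF w] i] by simp
    show "?f \<in> borel_measurable (M \<Otimes>\<^sub>M lborel)" by measurable
    have "indicator {0<..} u * cmod (w x * (exp (- (z * complex_of_real u)) * g (t - L x + u)))
      \<le> cmod (w x) * (B * (indicator {0<..} u *\<^sub>R exp (- (u * Re z))))" for x u
      using B[of "t - L x + u"] by (auto simp: norm_mult indicator_def mult.commute[of B] mult.commute[of u] intro!: mult_left_mono)
    then show "AE p in M \<Otimes>\<^sub>M lborel. norm (?f p) \<le> norm (case p of (x, u) \<Rightarrow> cmod (w x) * (B * (indicator {0<..} u *\<^sub>R exp (- (u * Re z)))))"
      by (intro AE_I2) (auto intro!: order_trans[OF _ abs_ge_self])
  qed
  have "(\<integral>x. w x * laplace g z (t - L x) \<partial>M) = (\<integral>x. (\<integral>u. ?f (x, u) \<partial>lborel) \<partial>M)"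
    unfolding laplace_def integral_mult_right_zero[symmetric] prod.case ..
  also have "\<dots> = (\<integral>u. (\<integral>x. ?f (x, u) \<partial>M) \<partial>lborel)"
    using P.Fubini_integral[of "\<lambda>x u. ?f (x, u)"] int by simp
  also have "(\<lambda>u. \<integral>x. ?f (x, u) \<partial>M) = (\<lambda>u. 0)"
  proof
    fix u
    have "(\<integral>x. ?f (x, u) \<partial>M) = (\<integral>x. (indicator {0<..} u *\<^sub>R exp (- (z * complex_of_real u))) * (w x * g ((t + u) - L x)) \<partial>M)"
      by (intro Bochner_Integration.integral_cong) (auto simp: algebra_simps)
    also have "\<dots> = 0" unfolding integral_mult_right_zero ann by simp
    finally show "(\<integral>x. ?f (x, u) \<partial>M) = 0" .
  qed
  finally show ?thesis by simp
qed

section \<open>Fejer summation on the line\<close>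

lemma integrable_indicator_Icc: "integrable lborel (indicat_real {a..b::real})"
  by (intro integrable_real_indicator) (auto simp: emeasure_lborel_Icc_eq)

text \<open>A function that is not integrable has integral 0 by convention, so the bound covers that
  case as well.\<close>

lemma norm_integral_le:
  fixes f :: "'a \<Rightarrow> 'b::{banach, second_countable_topology}"
  assumes g: "integrable M g" and le: "\<And>x. norm (f x) \<le> g x"
  shows "norm (\<integral>x. f x \<partial>M) \<le> (\<integral>x. g x \<partial>M)"
proof (cases "integrable M f")
  case True
  show ?thesis
    by (rule order_trans[OF integral_norm_bound]) (intro integral_mono integrable_norm True g le)
next
  case False
  have "0 \<le> g x" for x using le[of x] norm_ge_zero order_trans by blast
  then show ?thesis using False by (simp add: not_integrable_integral_eq)
qed

lemma integrable_even:
  fixes f :: "real \<Rightarrow> real"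
  assumes "f \<in> borel_measurable borel" "\<And>x. f (- x) = f x" "set_integrable lborel {0<..} f"
  shows "integrable lborel f"
proof -
  have 1: "integrable lborel (\<lambda>x. indicator {0<..} x *\<^sub>R f x)"
    using assms(3) by (simp add: set_integrable_def)
  have 2: "integrable lborel (\<lambda>x. indicator {0<..} (0 + (-1) * x) *\<^sub>R f (0 + (-1) * x))"
    using lborel_integrable_real_affine_iff[of "-1" "\<lambda>x. indicator {0<..} x *\<^sub>R f x" 0] 1 by simp
  have "integrable lborel (\<lambda>x. indicator {0<..} x *\<^sub>R f x + indicator {0<..} (0 + (-1) * x) *\<^sub>R f (0 + (-1) * x))"
    using 1 2 by (rule Bochner_Integration.integrable_add)
  then show ?thesis
  proof (rule integrable_cong_AE_imp)
    \<comment> \<open>The two open half-lines miss only the point 0, a null set.\<close>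
    show "AE x in lborel. indicator {0<..} x *\<^sub>R f x + indicator {0<..} (0 + (-1) * x) *\<^sub>R f (0 + (-1) * x) = f x"
      using AE_lborel_singleton[of "0::real"]
      by eventually_elim (auto simp: indicator_def assms(2))
  qed (use assms(1) in auto)
qed

lemma integrable_exp_abs:
  assumes "0 < \<epsilon>"
  shows "integrable lborel (\<lambda>t::real. exp (- (\<epsilon> * \<bar>t\<bar>)))"
proof (rule integrable_even)
  have "set_integrable lborel {0<..} (\<lambda>x. exp (- (x * \<epsilon>)))"
    by (rule integrable_I0i_exp_mscale[OF assms])
  then show "set_integrable lborel {0<..} (\<lambda>t::real. exp (- (\<epsilon> * \<bar>t\<bar>)))"
    by (subst set_integrable_cong[OF refl refl, of _ _ "\<lambda>x. exp (- (x * \<epsilon>))"]) (auto simp: mult.commute)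
qed auto

text \<open>This is (sin (u/2) / (u/2))^2 with its limit value at 0, the Fourier transform of the
  triangle function on [-1, 1].\<close>

definition fejer :: "real \<Rightarrow> real" where
  "fejer u = (if u = 0 then 1 else 2 * (1 - cos u) / u\<^sup>2)"

lemma borel_measurable_fejer [measurable]: "fejer \<in> borel_measurable borel"
  unfolding fejer_def[abs_def] by measurable

lemma fejer_nonneg: "0 \<le> fejer u"
  by (simp add: fejer_def)

lemma one_minus_cos_le: "1 - cos (u::real) \<le> u\<^sup>2 / 2"
proof -
  have "1 - cos u = 2 * (sin (u / 2))\<^sup>2"
    using cos_double_sin[of "u/2"] by simp
  moreover have "(sin (u/2))\<^sup>2 \<le> (u/2)\<^sup>2"
    using abs_sin_x_le_abs_x[of "u/2"] by (simp only: abs_le_square_iff)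
  ultimately show ?thesis by (simp add: power_divide)
qed

lemma fejer_le_1: "fejer u \<le> 1"
  using one_minus_cos_le[of u] by (simp add: fejer_def field_simps)

lemma fejer_le: "fejer u \<le> 8 / (1 + u\<^sup>2)"
proof (cases "u\<^sup>2 \<le> 1")
  case True
  then have "1 \<le> 8 / (1 + u\<^sup>2)" by (simp add: field_simps add_pos_nonneg)
  with fejer_le_1[of u] show ?thesis by linarith
next
  case False
  then have "u \<noteq> 0" by auto
  have "1 - cos u \<le> 1 - (- 1)" by (rule diff_left_mono) (rule cos_ge_minus_one)
  from mult_left_mono[OF this, of 2] have "2 * (1 - cos u) \<le> 4" by simp
  then have "fejer u \<le> 4 / u\<^sup>2" using \<open>u \<noteq> 0\<close> by (simp add: fejer_def divide_right_mono)
  also have "\<dots> \<le> 8 / (1 + u\<^sup>2)" using False \<open>u \<noteq> 0\<close> by (simp add: field_simps add_pos_nonneg)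
  finally show ?thesis .
qed

lemma integrable_fejer: "integrable lborel fejer"
proof (rule Bochner_Integration.integrable_bound)
  have "integrable lborel (\<lambda>x::real. 1 / (1 + x\<^sup>2))"
  proof (rule integrable_even)
    show "set_integrable lborel {0<..} (\<lambda>x::real. 1 / (1 + x\<^sup>2))"
      using integrable_I0i_1_div_plus_square
      by (simp add: interval_lebesgue_integrable_def zero_ereal_def einterval_eq inverse_eq_divide)
  qed auto
  then show "integrable lborel (\<lambda>x::real. 8 * (1 / (1 + x\<^sup>2)))" by (rule integrable_mult_right)
  show "AE x in lborel. norm (fejer x) \<le> norm (8 * (1 / (1 + x\<^sup>2)))"
    using fejer_le fejer_nonneg by (intro AE_I2) (auto simp: abs_of_nonneg)
qed auto

definition fejer_mass :: real where "fejer_mass = (\<integral>u. fejer u \<partial>lborel)"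

text \<open>The kernel is nonnegative and strictly positive on (0, 1), where cos stays below 1, so
  its integral cannot vanish.\<close>

lemma fejer_mass_pos: "0 < fejer_mass"
proof -
  have "fejer_mass \<noteq> 0"
  proof
    assume "fejer_mass = 0"
    then have "AE u in lborel. fejer u = 0"
      unfolding fejer_mass_def
      by (subst (asm) integral_nonneg_eq_0_iff_AE[OF integrable_fejer]) (auto simp: fejer_nonneg)
    then have "AE u in lborel. u \<notin> {0<..<1::real}"
    proof eventually_elim
      case (elim u)
      have "cos u < 1" if "0 < u" "u < 1"
        using cos_monotone_0_pi[of 0 u] that pi_gt3 by simp
      with elim show ?case by (auto simp: fejer_def)
    qed
    then have "emeasure lborel {0<..<1::real} = 0"
      by (subst (asm) AE_iff_measurable[of "{0<..<1}"]) auto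
    then show False by simp
  qed
  moreover have "0 \<le> fejer_mass" unfolding fejer_mass_def by (intro integral_nonneg_AE AE_I2 fejer_nonneg)
  ultimately show ?thesis by simp
qed

text \<open>The weight 2 cos folds the Fourier integral of the triangle on [-W, W] onto [0, W]. The
  case t = 0 is separate because the antiderivative divides by \<open>t\<close>.\<close>

lemma fejer_integral:
  assumes W: "0 < W"
  shows "(\<integral>\<theta>. indicator {0..W} \<theta> * (2 * (1 - \<theta> / W) * cos (\<theta> * t)) \<partial>lborel) = W * fejer (W * t)"
proof (cases "t = 0")
  case True
  have "(\<integral>\<theta>. indicator {0..W} \<theta> *\<^sub>R (2 * (1 - \<theta> / W) * cos (\<theta> * t)) \<partial>lborel) = (2 * W - W^2/W) - (2 * 0 - 0^2/W)"
    by (rule integral_FTC_Icc)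
      (use W True in \<open>auto intro!: derivative_eq_intros continuous_intros
         simp: has_real_derivative_iff_has_vector_derivative[symmetric] field_simps\<close>)
  then show ?thesis using W True by (simp add: fejer_def power2_eq_square)
next
  case False
  let ?F = "\<lambda>\<theta>. 2 * ((1 - \<theta> / W) * sin (\<theta> * t) / t - cos (\<theta> * t) / (W * t^2))"
  have "(\<integral>\<theta>. indicator {0..W} \<theta> *\<^sub>R (2 * (1 - \<theta> / W) * cos (\<theta> * t)) \<partial>lborel) = ?F W - ?F 0"
    by (rule integral_FTC_Icc)
      (use W False in \<open>auto intro!: derivative_eq_intros continuous_intros
         simp: has_real_derivative_iff_has_vector_derivative[symmetric] field_simps power2_eq_square\<close>)
  also have "?F W - ?F 0 = W * fejer (W * t)"
    using W False by (simp add: fejer_def field_simps power2_eq_square)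
  finally show ?thesis by simp
qed

lemma fejer_approx_identity:
  fixes g :: "nat \<Rightarrow> real \<Rightarrow> complex"
  assumes [measurable]: "\<And>n. g n \<in> borel_measurable borel" and B: "\<And>n x. cmod (g n x) \<le> B"
    and lim: "\<And>u. (\<lambda>n. g n u) \<longlonglongrightarrow> l"
  shows "(\<lambda>n. \<integral>u. complex_of_real (fejer u) * g n u \<partial>lborel) \<longlonglongrightarrow> complex_of_real fejer_mass * l"
proof -
  have "(\<lambda>n. \<integral>u. complex_of_real (fejer u) * g n u \<partial>lborel) \<longlonglongrightarrow> (\<integral>u. complex_of_real (fejer u) * l \<partial>lborel)"
  proof (rule integral_dominated_convergence[where w="\<lambda>u. fejer u * B"])
    show "integrable lborel (\<lambda>u. fejer u * B)" using integrable_fejer by simp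
    show "AE u in lborel. cmod (complex_of_real (fejer u) * g n u) \<le> fejer u * B" for n
      using B by (intro AE_I2) (auto simp: norm_mult fejer_nonneg intro!: mult_left_mono)
  qed (auto intro!: tendsto_intros lim)
  moreover have "(\<integral>u. complex_of_real (fejer u) * l \<partial>lborel) = complex_of_real fejer_mass * l"
    unfolding fejer_mass_def by (simp only: integral_mult_left_zero integral_complex_of_real)
  ultimately show ?thesis by (simp only:)
qed

text \<open>Reflecting the second transform moves it to the negative half-line with the matching
  frequency. Together the halves form the Fourier transform of the damped function exp(-eps |t|)
  g(t) on the whole line.\<close>

lemma laplace_sum_eq:
  assumes g: "g \<in> borel_measurable borel" and B: "\<And>x. cmod (g x) \<le> B" and \<epsilon>: "0 < \<epsilon>"
  shows "laplace g (Complex \<epsilon> \<theta>) 0 + laplace (\<lambda>x. g (- x)) (Complex \<epsilon> (- \<theta>)) 0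
     = (\<integral>t. exp (- (\<epsilon> * \<bar>t\<bar>)) *\<^sub>R (cis (- (\<theta> * t)) * g t) \<partial>lborel)"
proof -
  note [measurable] = g
  have e: "exp (- (Complex \<epsilon> \<theta> * complex_of_real u)) = exp (- (\<epsilon> * u)) *\<^sub>R cis (- (\<theta> * u))" for \<theta> u
    by (simp add: exp_eq_polar complex_eq_iff) 
  let ?f = "\<lambda>u. indicator {0<..} u *\<^sub>R (exp (- (\<epsilon> * u)) *\<^sub>R (cis (- (\<theta> * u)) * g u))"
  let ?h = "\<lambda>u. indicator {0<..} u *\<^sub>R (exp (- (\<epsilon> * u)) *\<^sub>R (cis (\<theta> * u) * g (- u)))"
  have i1: "integrable lborel ?f" and l1: "laplace g (Complex \<epsilon> \<theta>) 0 = (\<integral>u. ?f u \<partial>lborel)"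
    using laplace_integrable(1)[OF g B, of "Complex \<epsilon> \<theta>" 0] \<epsilon> by (simp_all add: e laplace_def)
  have gm: "(\<lambda>x. g (- x)) \<in> borel_measurable borel" by measurable
  have i2: "integrable lborel ?h" and l2: "laplace (\<lambda>x. g (- x)) (Complex \<epsilon> (- \<theta>)) 0 = (\<integral>u. ?h u \<partial>lborel)"
    using laplace_integrable(1)[OF gm B, of "Complex \<epsilon> (- \<theta>)" 0] \<epsilon> by (simp_all add: e laplace_def)
  have i3: "integrable lborel (\<lambda>u. ?h (0 + (-1) * u))"
    using i2 lborel_integrable_real_affine_iff[of "-1" ?h 0] by simp
  have l3: "(\<integral>u. ?h u \<partial>lborel) = (\<integral>u. ?h (0 + (-1) * u) \<partial>lborel)"
    by (subst lborel_integral_real_affine[where c="-1" and t=0]) auto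
  have "(\<integral>u. ?f u \<partial>lborel) + (\<integral>u. ?h u \<partial>lborel) = (\<integral>u. ?f u + ?h (0 + (-1) * u) \<partial>lborel)"
    unfolding l3 using i1 i3 by (rule Bochner_Integration.integral_add[symmetric])
  also have "\<dots> = (\<integral>t. exp (- (\<epsilon> * \<bar>t\<bar>)) *\<^sub>R (cis (- (\<theta> * t)) * g t) \<partial>lborel)"
  proof (rule integral_cong_AE)
    show "AE t in lborel. ?f t + ?h (0 + (-1) * t) = exp (- (\<epsilon> * \<bar>t\<bar>)) *\<^sub>R (cis (- (\<theta> * t)) * g t)"
      using AE_lborel_singleton[of "0::real"]
      by eventually_elim (auto simp: indicator_def)
  qed (unfold cis_conv_exp, measurable)
  finally show ?thesis unfolding l1 l2 .
qed

text \<open>A Fejer average of the damped Fourier transform over the frequencies up to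
  \<open>W\<close> is a smoothed value of \<open>g\<close> near 0. For large \<open>W\<close> it is
  close to \<open>fejer_mass * g 0\<close>, uniformly for eps at most 1, so the transform cannot be
  small on the whole window. That \<open>W\<close> and \<open>c\<close> are independent of eps is
  what later lets the frequencies accumulate as eps tends to 0.\<close>

lemma laplace_sum_lower_bound:
  assumes g: "continuous_on UNIV g" and B: "\<And>x. cmod (g x) \<le> B" and g0: "g 0 \<noteq> 0"
  obtains W c where "0 < W" "0 < c"
    "\<And>\<epsilon>. 0 < \<epsilon> \<Longrightarrow> \<epsilon> \<le> 1 \<Longrightarrow> \<exists>\<theta>. \<bar>\<theta>\<bar> \<le> W \<and> c \<le> cmod (laplace g (Complex \<epsilon> \<theta>) 0 + laplace (\<lambda>x. g (- x)) (Complex \<epsilon> (- \<theta>)) 0)"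
proof -
  have gm [measurable]: "g \<in> borel_measurable borel" using g by (rule borel_measurable_continuous_onI)
  have B0: "0 \<le> B" using B[of 0] norm_ge_zero order_trans by blast
  define Q where "Q \<epsilon> \<theta> = (\<integral>t. exp (- (\<epsilon> * \<bar>t\<bar>)) *\<^sub>R (cis (- (\<theta> * t)) * g t) \<partial>lborel)" for \<epsilon> \<theta>
  have int: "integrable lborel (\<lambda>t. exp (- (\<epsilon> * \<bar>t\<bar>)) *\<^sub>R (cis (- (\<theta> * t)) * g t))" if "0 < \<epsilon>" for \<epsilon> \<theta>
  proof (rule Bochner_Integration.integrable_bound)
    show "integrable lborel (\<lambda>t. exp (- (\<epsilon> * \<bar>t\<bar>)) * B)" using integrable_exp_abs[OF that] by simp
    show "(\<lambda>t. exp (- (\<epsilon> * \<bar>t\<bar>)) *\<^sub>R (cis (- (\<theta> * t)) * g t)) \<in> borel_measurable lborel"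
      unfolding cis_conv_exp by measurable
  qed (use B B0 in \<open>auto simp: norm_mult intro!: AE_I2 mult_left_mono\<close>)
  \<comment> \<open>Fubini brings the frequency integral inside, where it is
    \<open>fejer_integral\<close>; the substitution u = W t then moves the scale from the kernel to
    \<open>g\<close>.\<close>
  have key: "(\<integral>\<theta>. indicator {0..W} \<theta> *\<^sub>R ((1 - \<theta> / W) *\<^sub>R (Q \<epsilon> \<theta> + Q \<epsilon> (- \<theta>))) \<partial>lborel)
       = (\<integral>u. complex_of_real (fejer u) * (exp (- (\<epsilon> * \<bar>u / W\<bar>)) *\<^sub>R g (u / W)) \<partial>lborel)"
    if \<epsilon>: "0 < \<epsilon>" and W: "0 < W" for \<epsilon> W
  proof -
    let ?k = "\<lambda>\<theta> t. indicator {0..W} \<theta> * (2 * (1 - \<theta> / W) * cos (\<theta> * t))"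
    let ?f = "\<lambda>(\<theta>, t). (?k \<theta> t * exp (- (\<epsilon> * \<bar>t\<bar>))) *\<^sub>R g t"
    have Qs: "Q \<epsilon> \<theta> + Q \<epsilon> (- \<theta>) = (\<integral>t. (2 * cos (\<theta> * t) * exp (- (\<epsilon> * \<bar>t\<bar>))) *\<^sub>R g t \<partial>lborel)" for \<theta>
    proof -
      have "Q \<epsilon> \<theta> + Q \<epsilon> (- \<theta>) = (\<integral>t. exp (- (\<epsilon> * \<bar>t\<bar>)) *\<^sub>R (cis (- (\<theta> * t)) * g t) + exp (- (\<epsilon> * \<bar>t\<bar>)) *\<^sub>R (cis (- (- \<theta> * t)) * g t) \<partial>lborel)"
        unfolding Q_def by (rule Bochner_Integration.integral_add[symmetric]) (rule int[OF \<epsilon>])+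
      also have "\<dots> = (\<integral>t. (2 * cos (\<theta> * t) * exp (- (\<epsilon> * \<bar>t\<bar>))) *\<^sub>R g t \<partial>lborel)"
        by (intro Bochner_Integration.integral_cong) (auto simp: complex_eq_iff algebra_simps)
      finally show ?thesis .
    qed
    have fint: "integrable (lborel \<Otimes>\<^sub>M lborel) ?f"
    proof (rule Bochner_Integration.integrable_bound)
      have i: "integrable lborel (\<lambda>\<theta>. indicator {0..W} \<theta> * (2::real))"
        by (intro integrable_mult_left integrable_indicator_Icc)
      show "integrable (lborel \<Otimes>\<^sub>M lborel) (\<lambda>(\<theta>, t). (indicator {0..W} \<theta> * 2) * (exp (- (\<epsilon> * \<bar>t\<bar>)) * B))"
        by (rule lborel_pair.integrable_mult_prod[OF i]) (use integrable_exp_abs[OF \<epsilon>] in simp)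
      have "norm (?f (\<theta>, t)) \<le> (indicator {0..W} \<theta> * 2) * (exp (- (\<epsilon> * \<bar>t\<bar>)) * B)" for \<theta> t
      proof (cases "\<theta> \<in> {0..W}")
        case True
        then have "\<bar>1 - \<theta> / W\<bar> \<le> 1" using W by (auto simp: field_simps)
        then have "\<bar>1 - \<theta> / W\<bar> * \<bar>cos (\<theta> * t)\<bar> \<le> 1 * 1" by (intro mult_mono) auto
        then have "(\<bar>1 - \<theta> / W\<bar> * \<bar>cos (\<theta> * t)\<bar>) * (cmod (g t) * exp (- (\<epsilon> * \<bar>t\<bar>))) \<le> 1 * (B * exp (- (\<epsilon> * \<bar>t\<bar>)))"
          using B[of t] B0 by (intro mult_mono) auto
        moreover have "norm (?f (\<theta>, t)) = 2 * ((\<bar>1 - \<theta> / W\<bar> * \<bar>cos (\<theta> * t)\<bar>) * (cmod (g t) * exp (- (\<epsilon> * \<bar>t\<bar>))))"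
          using True by (simp only: prod.case norm_scaleR abs_mult indicator_simps abs_numeral abs_one abs_exp_cancel mult_1_left mult_ac)
        moreover have "(indicator {0..W} \<theta> * 2) * (exp (- (\<epsilon> * \<bar>t\<bar>)) * B) = 2 * (B * exp (- (\<epsilon> * \<bar>t\<bar>)))"
          using True by (simp add: mult_ac)
        ultimately show ?thesis by linarith
      qed auto
      then show "AE p in lborel \<Otimes>\<^sub>M lborel. norm (?f p) \<le> norm (case p of (\<theta>, t) \<Rightarrow> (indicator {0..W} \<theta> * 2) * (exp (- (\<epsilon> * \<bar>t\<bar>)) * B))"
        by (intro AE_I2) (auto intro!: order_trans[OF _ abs_ge_self])
    qed measurable
    have "(\<integral>\<theta>. indicator {0..W} \<theta> *\<^sub>R ((1 - \<theta> / W) *\<^sub>R (Q \<epsilon> \<theta> + Q \<epsilon> (- \<theta>))) \<partial>lborel) = (\<integral>\<theta>. (\<integral>t. ?f (\<theta>, t) \<partial>lborel) \<partial>lborel)"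
      unfolding Qs integral_scaleR_right[symmetric] by (intro Bochner_Integration.integral_cong refl) (auto simp: algebra_simps)
    also have "\<dots> = (\<integral>t. (\<integral>\<theta>. ?f (\<theta>, t) \<partial>lborel) \<partial>lborel)"
      using lborel_pair.Fubini_integral[of "\<lambda>\<theta> t. ?f (\<theta>, t)"] fint by simp
    also have "(\<lambda>t. \<integral>\<theta>. ?f (\<theta>, t) \<partial>lborel) = (\<lambda>t. (W * fejer (W * t) * exp (- (\<epsilon> * \<bar>t\<bar>))) *\<^sub>R g t)"
    proof
      fix t
      have cont: "continuous_on {0..W} (\<lambda>\<theta>. 2 * (1 - \<theta> / W) * cos (\<theta> * t))"
        using W by (intro continuous_intros) auto
      have i: "integrable lborel (\<lambda>\<theta>. ?k \<theta> t)"
        using borel_integrable_compact[OF compact_Icc cont] by simp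
      have "(\<integral>\<theta>. ?f (\<theta>, t) \<partial>lborel) = (\<integral>\<theta>. ?k \<theta> t *\<^sub>R (exp (- (\<epsilon> * \<bar>t\<bar>)) *\<^sub>R g t) \<partial>lborel)"
        by (intro Bochner_Integration.integral_cong) auto
      also have "\<dots> = (\<integral>\<theta>. ?k \<theta> t \<partial>lborel) *\<^sub>R (exp (- (\<epsilon> * \<bar>t\<bar>)) *\<^sub>R g t)"
        by (rule integral_scaleR_left) (rule i)
      finally show "(\<integral>\<theta>. ?f (\<theta>, t) \<partial>lborel) = (W * fejer (W * t) * exp (- (\<epsilon> * \<bar>t\<bar>))) *\<^sub>R g t"
        unfolding fejer_integral[OF W] by simp
    qed
    also have "(\<integral>t. (W * fejer (W * t) * exp (- (\<epsilon> * \<bar>t\<bar>))) *\<^sub>R g t \<partial>lborel) = (\<integral>u. complex_of_real (fejer u) * (exp (- (\<epsilon> * \<bar>u / W\<bar>)) *\<^sub>R g (u / W)) \<partial>lborel)"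
    proof -
      have "(\<integral>t. (W * fejer (W * t) * exp (- (\<epsilon> * \<bar>t\<bar>))) *\<^sub>R g t \<partial>lborel)
         = \<bar>1/W\<bar> *\<^sub>R (\<integral>u. (W * fejer (W * (0 + (1/W) * u)) * exp (- (\<epsilon> * \<bar>0 + (1/W) * u\<bar>))) *\<^sub>R g (0 + (1/W) * u) \<partial>lborel)"
        using W by (intro lborel_integral_real_affine) auto
      also have "\<dots> = (\<integral>u. \<bar>1/W\<bar> *\<^sub>R ((W * fejer (W * (0 + (1/W) * u)) * exp (- (\<epsilon> * \<bar>0 + (1/W) * u\<bar>))) *\<^sub>R g (0 + (1/W) * u)) \<partial>lborel)"
        by (rule integral_scaleR_right[symmetric])
      also have "\<dots> = (\<integral>u. complex_of_real (fejer u) * (exp (- (\<epsilon> * \<bar>u / W\<bar>)) *\<^sub>R g (u / W)) \<partial>lborel)"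
        using W by (intro Bochner_Integration.integral_cong) (auto simp: scaleR_conv_of_real)
      finally show ?thesis .
    qed
    finally show ?thesis .
  qed
  \<comment> \<open>Origin of the 4: were every \<open>Q\<close> below c = fejer_mass |g 0| / (4 W)
    on the window, the average, which involves two values of \<open>Q\<close> and a window of length
    \<open>W\<close>, would be at most 2 c W. That is half of the limit fejer_mass |g 0|, a
    contradiction.\<close>
  have "\<exists>n. \<forall>\<epsilon>. 0 < \<epsilon> \<longrightarrow> \<epsilon> \<le> 1 \<longrightarrow> (\<exists>\<theta>. \<bar>\<theta>\<bar> \<le> real (Suc n) \<and> fejer_mass * cmod (g 0) / (4 * real (Suc n)) \<le> cmod (Q \<epsilon> \<theta>))"
  proof (rule ccontr)
    assume "\<not> ?thesis"
    then have "\<forall>n. \<exists>\<epsilon>. 0 < \<epsilon> \<and> \<epsilon> \<le> 1 \<and> (\<forall>\<theta>. \<bar>\<theta>\<bar> \<le> real (Suc n) \<longrightarrow> cmod (Q \<epsilon> \<theta>) < fejer_mass * cmod (g 0) / (4 * real (Suc n)))"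
      by (meson not_le)
    from choice[OF this] obtain \<epsilon> where \<epsilon>: "\<And>n. 0 < \<epsilon> n" "\<And>n. \<epsilon> n \<le> 1"
      and Qs: "\<And>n \<theta>. \<bar>\<theta>\<bar> \<le> real (Suc n) \<Longrightarrow> cmod (Q (\<epsilon> n) \<theta>) < fejer_mass * cmod (g 0) / (4 * real (Suc n))"
      by auto
    let ?S = "\<lambda>n. \<integral>u. complex_of_real (fejer u) * (exp (- (\<epsilon> n * \<bar>u / real (Suc n)\<bar>)) *\<^sub>R g (u / real (Suc n))) \<partial>lborel"
    have "?S \<longlonglongrightarrow> complex_of_real fejer_mass * g 0"
    proof (rule fejer_approx_identity)
      show "(\<lambda>u. exp (- (\<epsilon> n * \<bar>u / real (Suc n)\<bar>)) *\<^sub>R g (u / real (Suc n))) \<in> borel_measurable borel" for n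
        by measurable
      show "cmod (exp (- (\<epsilon> n * \<bar>x / real (Suc n)\<bar>)) *\<^sub>R g (x / real (Suc n))) \<le> B" for n x
      proof -
        have "exp (- (\<epsilon> n * \<bar>x / real (Suc n)\<bar>)) \<le> 1" using \<epsilon>(1)[of n] by simp
        then have "exp (- (\<epsilon> n * \<bar>x / real (Suc n)\<bar>)) * cmod (g (x / real (Suc n))) \<le> 1 * B"
          using B by (intro mult_mono) auto
        then show ?thesis by simp
      qed
      fix u :: real
      have l1: "(\<lambda>n. u / real (Suc n)) \<longlonglongrightarrow> 0" by (rule LIMSEQ_Suc) (rule lim_const_over_n)
      have l2: "(\<lambda>n. \<epsilon> n * \<bar>u / real (Suc n)\<bar>) \<longlonglongrightarrow> 0"
      proof (rule Lim_null_comparison[OF always_eventually tendsto_rabs_zero[OF l1]], rule allI)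
        fix n
        have "\<epsilon> n * \<bar>u / real (Suc n)\<bar> \<le> 1 * \<bar>u / real (Suc n)\<bar>"
          using \<epsilon>(2) by (intro mult_right_mono) auto
        then show "norm (\<epsilon> n * \<bar>u / real (Suc n)\<bar>) \<le> \<bar>u / real (Suc n)\<bar>"
          using \<epsilon>(1)[of n] by (simp only: real_norm_def abs_mult abs_abs abs_of_pos mult_1_left)
      qed
      have l3: "(\<lambda>n. g (u / real (Suc n))) \<longlonglongrightarrow> g 0"
        using g l1 by (rule continuous_on_tendsto_compose) auto
      have "(\<lambda>n. exp (- (\<epsilon> n * \<bar>u / real (Suc n)\<bar>)) *\<^sub>R g (u / real (Suc n))) \<longlonglongrightarrow> exp (- 0) *\<^sub>R g 0"
        by (intro tendsto_intros l2 l3)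
      then show "(\<lambda>n. exp (- (\<epsilon> n * \<bar>u / real (Suc n)\<bar>)) *\<^sub>R g (u / real (Suc n))) \<longlonglongrightarrow> g 0" by simp
    qed
    moreover have "cmod (?S n) \<le> fejer_mass * cmod (g 0) / 2" for n
    proof -
      define W where "W = real (Suc n)"
      define c where "c = fejer_mass * cmod (g 0) / (4 * W)"
      have W: "0 < W" by (simp add: W_def)
      have c0: "0 \<le> c" using W fejer_mass_pos by (simp add: c_def)
      have "cmod (\<integral>\<theta>. indicator {0..W} \<theta> *\<^sub>R ((1 - \<theta> / W) *\<^sub>R (Q (\<epsilon> n) \<theta> + Q (\<epsilon> n) (- \<theta>))) \<partial>lborel) \<le> (\<integral>\<theta>. indicator {0..W} \<theta> * (2 * c) \<partial>lborel)"
      proof (rule norm_integral_le)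
        show "integrable lborel (\<lambda>\<theta>. indicator {0..W} \<theta> * (2 * c))" by (intro integrable_mult_left integrable_indicator_Icc)
        fix \<theta> :: real
        show "cmod (indicator {0..W} \<theta> *\<^sub>R ((1 - \<theta> / W) *\<^sub>R (Q (\<epsilon> n) \<theta> + Q (\<epsilon> n) (- \<theta>)))) \<le> indicator {0..W} \<theta> * (2 * c)"
        proof (cases "\<theta> \<in> {0..W}")
          case True
          then have "cmod (Q (\<epsilon> n) \<theta>) \<le> c" "cmod (Q (\<epsilon> n) (- \<theta>)) \<le> c"
            using Qs[of \<theta> n] Qs[of "-\<theta>" n] by (auto simp: W_def c_def less_imp_le)
          then have "cmod (Q (\<epsilon> n) \<theta> + Q (\<epsilon> n) (- \<theta>)) \<le> 2 * c" by norm
          moreover have "\<bar>1 - \<theta> / W\<bar> \<le> 1" using W True by (auto simp: field_simps)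
          ultimately have "\<bar>1 - \<theta> / W\<bar> * cmod (Q (\<epsilon> n) \<theta> + Q (\<epsilon> n) (- \<theta>)) \<le> 1 * (2 * c)"
            by (intro mult_mono) auto
          with True show ?thesis by simp
        qed auto
      qed
      also have "\<dots> = W * (2 * c)" using W by simp
      also have "\<dots> = fejer_mass * cmod (g 0) / 2" using W by (simp add: c_def)
      finally show ?thesis
        unfolding key[OF \<epsilon>(1) W] by (simp add: W_def)
    qed
    ultimately have "cmod (complex_of_real fejer_mass * g 0) \<le> fejer_mass * cmod (g 0) / 2"
      by (intro LIMSEQ_le_const2[OF tendsto_norm]) auto
    then show False using fejer_mass_pos g0 by (simp add: norm_mult)
  qed
  then obtain n where n: "\<And>\<epsilon>. 0 < \<epsilon> \<Longrightarrow> \<epsilon> \<le> 1 \<Longrightarrow> \<exists>\<theta>. \<bar>\<theta>\<bar> \<le> real (Suc n) \<and> fejer_mass * cmod (g 0) / (4 * real (Suc n)) \<le> cmod (Q \<epsilon> \<theta>)"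
    by blast
  show thesis
  proof (rule that[of "real (Suc n)" "fejer_mass * cmod (g 0) / (4 * real (Suc n))"])
    show "0 < fejer_mass * cmod (g 0) / (4 * real (Suc n))" using g0 fejer_mass_pos by simp
    show "\<exists>\<theta>. \<bar>\<theta>\<bar> \<le> real (Suc n) \<and> fejer_mass * cmod (g 0) / (4 * real (Suc n)) \<le> cmod (laplace g (Complex \<epsilon> \<theta>) 0 + laplace (\<lambda>x. g (- x)) (Complex \<epsilon> (- \<theta>)) 0)"
      if "0 < \<epsilon>" "\<epsilon> \<le> 1" for \<epsilon>
      using n[OF that] unfolding Q_def laplace_sum_eq[OF gm B that(1)] .
  qed simp
qed

section \<open>Wiener's theorem for bounded continuous functions\<close>

lemma approx_eigenfunction_contradiction':
  fixes F :: "nat \<Rightarrow> real \<Rightarrow> complex" and w :: "'a \<Rightarrow> complex"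
  assumes w: "integrable M w" and L: "L \<in> borel_measurable M"
    and nz: "\<And>\<theta>. (\<integral>x. w x * cis (- \<theta> * L x) \<partial>M) \<noteq> 0"
    and m: "\<And>n. 0 < m n" and bd: "\<And>n x. cmod (F n x) \<le> m n" and c: "0 < c" "\<And>n. c * m n \<le> cmod (F n (y n))"
    and dF: "\<And>n x. (F n has_vector_derivative (\<i> * complex_of_real (\<theta> n) * F n x + r n x)) (at x)"
    and r: "\<And>n x. cmod (r n x) \<le> \<kappa> n * m n" and \<kappa>: "\<kappa> \<longlonglongrightarrow> 0"
    and \<theta>: "\<And>n. \<bar>\<theta> n\<bar> \<le> W"
    and ann: "\<And>n t. (\<integral>x. w x * F n (t - L x) \<partial>M) = 0"
  shows False
proof -
  have cont: "continuous_on UNIV (F n)" for n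
    using dF by (meson continuous_at_imp_continuous_on has_vector_derivative_continuous)
  \<comment> \<open>Recentring at the near-maximum \<open>y n\<close> and dividing by the bound
    \<open>m n\<close> gives functions bounded by 1 and at least \<open>c\<close> at the origin. The
    annihilation is assumed at every \<open>t\<close>, hence survives the translation.\<close>
  define G where "G n x = F n (y n + x) / complex_of_real (m n)" for n x
  have Gd: "G n = (\<lambda>x. F n (y n + x) * complex_of_real (1 / m n))" for n
    by (auto simp: G_def)
  show False
  proof (rule approx_eigenfunction_contradiction[OF w L nz, where F=G and c=c and \<theta>=\<theta> and W=W and \<kappa>=\<kappa>
        and r="\<lambda>n x. r n (y n + x) * complex_of_real (1 / m n)"])
    show "G n \<in> borel_measurable borel" for n
      unfolding Gd using m[of n]
      by (intro borel_measurable_continuous_onI continuous_intros continuous_on_compose2[OF cont]) auto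
    show "cmod (G n x) \<le> 1" for n x
      using m[of n] bd[of n "y n + x"] by (simp add: G_def norm_divide)
    show "c \<le> cmod (G n 0)" for n
      using m[of n] c(2)[of n] by (simp add: G_def norm_divide field_simps)
    show "(G n has_vector_derivative (\<i> * complex_of_real (\<theta> n) * G n x + r n (y n + x) * complex_of_real (1 / m n))) (at x)" for n x
    proof -
      have "((F n \<circ> (\<lambda>x. y n + x)) has_vector_derivative 1 *\<^sub>R (\<i> * complex_of_real (\<theta> n) * F n (y n + x) + r n (y n + x))) (at x)"
        by (intro vector_diff_chain_at dF) (auto intro!: derivative_eq_intros)
      then have "((\<lambda>x. F n (y n + x)) has_vector_derivative (\<i> * complex_of_real (\<theta> n) * F n (y n + x) + r n (y n + x))) (at x)"
        by (simp add: o_def)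
      from has_vector_derivative_mult_left[OF this, of "complex_of_real (1 / m n)"]
      have "((\<lambda>x. F n (y n + x) * complex_of_real (1 / m n)) has_vector_derivative
        ((\<i> * complex_of_real (\<theta> n) * F n (y n + x) + r n (y n + x)) * complex_of_real (1 / m n))) (at x)" .
      then show ?thesis unfolding Gd by (simp only: distrib_right mult.assoc)
    qed
    show "cmod (r n (y n + x) * complex_of_real (1 / m n)) \<le> \<kappa> n" for n x
      using m[of n] r[of n "y n + x"] by (simp add: norm_mult norm_divide field_simps)
    show "(\<integral>x. w x * G n (- L x) \<partial>M) = 0" for n
    proof -
      have "(\<integral>x. w x * G n (- L x) \<partial>M) = (\<integral>x. (w x * F n (y n - L x)) * complex_of_real (1 / m n) \<partial>M)"
        by (intro Bochner_Integration.integral_cong) (auto simp: Gd mult.assoc)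
      also have "\<dots> = (\<integral>x. w x * F n (y n - L x) \<partial>M) * complex_of_real (1 / m n)"
        by (rule integral_mult_left_zero)
      finally show ?thesis unfolding ann by simp
    qed
  qed (use c \<kappa> \<theta> in auto)
qed

text \<open>If unbounded, the transforms divided by their suprema would be approximate eigenfunctions of the
  derivative.\<close>
lemma laplace_bounded_uniformly:
  fixes w :: "'a \<Rightarrow> complex"
  assumes M: "sigma_finite_measure M" and w: "integrable M w" and L: "L \<in> borel_measurable M"
    and nz: "\<And>\<theta>. (\<integral>x. w x * cis (- \<theta> * L x) \<partial>M) \<noteq> 0"
    and g: "continuous_on UNIV g" and B: "\<And>x. cmod (g x) \<le> B"
    and ann: "\<And>t. (\<integral>x. w x * g (t - L x) \<partial>M) = 0"
  shows "\<exists>C. \<forall>\<epsilon> \<theta> x. 0 < \<epsilon> \<longrightarrow> \<bar>\<theta>\<bar> \<le> W \<longrightarrow> cmod (laplace g (Complex \<epsilon> \<theta>) x) \<le> C"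
proof (rule ccontr)
  assume "\<not> ?thesis"
  then have "\<forall>n::nat. \<exists>\<epsilon> \<theta> x. 0 < \<epsilon> \<and> \<bar>\<theta>\<bar> \<le> W \<and> real (Suc n) < cmod (laplace g (Complex \<epsilon> \<theta>) x)"
    by (simp add: not_le)
  then obtain \<epsilon> \<theta> x where \<epsilon>: "\<And>n::nat. 0 < \<epsilon> n" and \<theta>: "\<And>n. \<bar>\<theta> n\<bar> \<le> W"
    and big: "\<And>n. real (Suc n) < cmod (laplace g (Complex (\<epsilon> n) (\<theta> n)) (x n))"
    by metis
  have B0: "0 \<le> B" using B[of 0] norm_ge_zero order_trans by blast
  define F where "F n = laplace g (Complex (\<epsilon> n) (\<theta> n))" for n
  have z: "0 < Re (Complex (\<epsilon> n) (\<theta> n))" for n using \<epsilon> by simp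
  \<comment> \<open>The supremum is finite for each fixed \<open>n\<close> because the damping gives
    the bound B / eps, even though these bounds have no common value.\<close>
  define m where "m n = (SUP x. cmod (F n x))" for n
  have gm: "g \<in> borel_measurable borel" using g by (rule borel_measurable_continuous_onI)
  have Fb: "cmod (F n x) \<le> B / \<epsilon> n" for n x
    using laplace_integrable(2)[OF gm B z] by (simp add: F_def)
  then have bdd: "bdd_above (range (\<lambda>x. cmod (F n x)))" for n
    by (intro bdd_aboveI) auto
  have Fm: "cmod (F n x) \<le> m n" for n x
    unfolding m_def by (rule cSUP_upper[OF _ bdd]) simp
  have mbig: "real (Suc n) < m n" for n using big[of n] Fm[of n "x n"] by (simp add: F_def)
  have m0: "0 < m n" for n by (rule le_less_trans[OF _ mbig[of n]]) simp
  have "\<exists>y. m n / 2 \<le> cmod (F n y)" for n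
  proof -
    have "m n / 2 < (SUP x. cmod (F n x))" using m0[of n] by (simp add: m_def[symmetric])
    then show ?thesis using less_cSUP_iff[OF _ bdd, of "m n / 2"] by (auto intro: less_imp_le)
  qed
  then obtain y where y: "\<And>n. m n / 2 \<le> cmod (F n (y n))" by metis
  have mle: "m n \<le> B / \<epsilon> n" for n unfolding m_def by (rule cSUP_least) (auto intro: Fb)
  show False
  proof (rule approx_eigenfunction_contradiction'[OF w L nz, where F=F and m=m and c="1/2" and y=y and \<theta>=\<theta> and W=W
        and r="\<lambda>n x. \<epsilon> n *\<^sub>R F n x - g x" and \<kappa>="\<lambda>n. 2 * B / real (Suc n)"])
    show "(F n has_vector_derivative (\<i> * complex_of_real (\<theta> n) * F n x + (\<epsilon> n *\<^sub>R F n x - g x))) (at x)" for n x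
    proof -
      have "Complex (\<epsilon> n) (\<theta> n) * F n x - g x = \<i> * complex_of_real (\<theta> n) * F n x + (\<epsilon> n *\<^sub>R F n x - g x)"
        by (simp add: complex_eq_iff algebra_simps)
      moreover have "(F n has_vector_derivative (Complex (\<epsilon> n) (\<theta> n) * F n x - g x)) (at x)"
        unfolding F_def by (rule laplace_deriv[OF g B z])
      ultimately show ?thesis by (simp only:)
    qed
    \<comment> \<open>Damping times transform is at most \<open>B\<close>, so the remainder is at
      most 2 B. Relative to \<open>m n\<close>, which exceeds \<open>Suc n\<close>, this tends to
      0.\<close>
    show "cmod (\<epsilon> n *\<^sub>R F n x - g x) \<le> 2 * B / real (Suc n) * m n" for n x
    proof -
      have "cmod (\<epsilon> n *\<^sub>R F n x - g x) \<le> \<epsilon> n * cmod (F n x) + cmod (g x)"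
        using \<epsilon>[of n] norm_triangle_ineq4[of "\<epsilon> n *\<^sub>R F n x" "g x"] by simp
      also have "\<dots> \<le> \<epsilon> n * (B / \<epsilon> n) + B"
        using \<epsilon>[of n] Fb[of n x] B[of x] by (intro add_mono mult_left_mono) auto
      also have "\<dots> = 2 * B" using \<epsilon>[of n] by simp
      also have "\<dots> \<le> 2 * B * (m n / real (Suc n))"
      proof -
        have "1 \<le> m n / real (Suc n)"
          using mbig[of n] by (subst le_divide_eq_1_pos) auto
        from mult_left_mono[OF this, of "2 * B"] B0 show ?thesis by simp
      qed
      finally show ?thesis by simp
    qed
    show "(\<lambda>n. 2 * B / real (Suc n)) \<longlonglongrightarrow> 0"
      by (rule LIMSEQ_Suc) (rule lim_const_over_n)
    show "(\<integral>x. w x * F n (t - L x) \<partial>M) = 0" for n t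
      unfolding F_def by (rule laplace_annihilated[OF M w L g B z ann])
  qed (use m0 Fm y \<theta> in auto)
qed

text \<open>Dual form of Wiener's Tauberian theorem for the complex measure that \<open>L\<close>
  carries over from \<open>w\<close>. After moving \<open>t\<close> to 0, the transforms of the two
  half-lines stay bounded by \<open>laplace_bounded_uniformly\<close> and their sum stays away from
  0 by \<open>laplace_sum_lower_bound\<close>. Their sum is an approximate eigenfunction with
  remainder of order eps, which is impossible.\<close>

theorem wiener_uniqueness:
  fixes w :: "'a \<Rightarrow> complex"
  assumes M: "sigma_finite_measure M" and w: "integrable M w" and L: "L \<in> borel_measurable M"
    and nz: "\<And>\<theta>. (\<integral>x. w x * cis (\<theta> * L x) \<partial>M) \<noteq> 0"
    and g: "continuous_on UNIV g" and B: "\<And>x. cmod (g x) \<le> B"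
    and ann: "\<And>t. (\<integral>x. w x * g (t - L x) \<partial>M) = 0"
  shows "g t = 0"
proof (rule ccontr)
  assume "g t \<noteq> 0"
  define f where "f x = g (t + x)" for x
  \<comment> \<open>The left half-line is treated as the right half-line of the reflected function,
    which is annihilated with \<open>L\<close> replaced by its negative.\<close>
  define f' where "f' x = f (- x)" for x
  have f: "continuous_on UNIV f" "\<And>x. cmod (f x) \<le> B" and f0: "f 0 \<noteq> 0"
    using B \<open>g t \<noteq> 0\<close> unfolding f_def
    by (auto intro!: continuous_intros continuous_on_compose2[OF g])
  have f': "continuous_on UNIV f'" "\<And>x. cmod (f' x) \<le> B"
    using f(2) unfolding f'_def
    by (auto intro!: continuous_intros continuous_on_compose2[OF f(1)])
  have annf: "(\<integral>x. w x * f (s - L x) \<partial>M) = 0" for s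
    using ann[of "t + s"] by (simp add: f_def add_diff_eq)
  have annf': "(\<integral>x. w x * f' (s - - L x) \<partial>M) = 0" for s
    using annf[of "- s"] by (simp add: f'_def algebra_simps)
  have L': "(\<lambda>x. - L x) \<in> borel_measurable M" using L by simp
  have nz1: "(\<integral>x. w x * cis (- \<theta> * L x) \<partial>M) \<noteq> 0" for \<theta> using nz[of "-\<theta>"] .
  have nz2: "(\<integral>x. w x * cis (- \<theta> * - L x) \<partial>M) \<noteq> 0" for \<theta> using nz[of \<theta>] by simp
  obtain W c where W: "0 < W" "0 < c" and low: "\<And>\<epsilon>. 0 < \<epsilon> \<Longrightarrow> \<epsilon> \<le> 1 \<Longrightarrow> \<exists>\<theta>. \<bar>\<theta>\<bar> \<le> W \<and> c \<le> cmod (laplace f (Complex \<epsilon> \<theta>) 0 + laplace f' (Complex \<epsilon> (- \<theta>)) 0)"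
    unfolding f'_def[abs_def] using laplace_sum_lower_bound[OF f f0] by blast
  from laplace_bounded_uniformly[OF M w L nz1 f annf, of W] obtain C1
    where C1: "\<And>\<epsilon> \<theta> x. 0 < \<epsilon> \<Longrightarrow> \<bar>\<theta>\<bar> \<le> W \<Longrightarrow> cmod (laplace f (Complex \<epsilon> \<theta>) x) \<le> C1" by blast
  from laplace_bounded_uniformly[OF M w L' nz2 f' annf', of W] obtain C2
    where C2: "\<And>\<epsilon> \<theta> x. 0 < \<epsilon> \<Longrightarrow> \<bar>\<theta>\<bar> \<le> W \<Longrightarrow> cmod (laplace f' (Complex \<epsilon> \<theta>) x) \<le> C2" by blast
  \<comment> \<open>The maximum with 1 keeps \<open>C\<close> positive, since the contradiction
    lemma divides by it.\<close>
  define C where "C = max 1 (C1 + C2)"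
  define \<epsilon> where "\<epsilon> n = 1 / real (Suc n)" for n
  have \<epsilon>: "0 < \<epsilon> n" "\<epsilon> n \<le> 1" for n by (auto simp: \<epsilon>_def)
  obtain \<theta> where \<theta>: "\<And>n. \<bar>\<theta> n\<bar> \<le> W" and lowc: "\<And>n. c \<le> cmod (laplace f (Complex (\<epsilon> n) (\<theta> n)) 0 + laplace f' (Complex (\<epsilon> n) (- \<theta> n)) 0)"
    using low[OF \<epsilon>] by metis
  define K1 where "K1 n = laplace f (Complex (\<epsilon> n) (\<theta> n))" for n
  \<comment> \<open>Evaluation at \<open>- x\<close> undoes the reflection, so that both pieces are
    functions of the same point and may be added.\<close>
  define K2 where "K2 n x = laplace f' (Complex (\<epsilon> n) (- \<theta> n)) (- x)" for n x
  have Kb: "cmod (K1 n x) + cmod (K2 n x) \<le> C" for n x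
    using C1[OF \<epsilon>(1)[of n] \<theta>[of n], of x] C2[OF \<epsilon>(1)[of n], of "- \<theta> n" "- x"] \<theta>[of n] by (simp add: K1_def K2_def C_def)
  have z: "0 < Re (Complex (\<epsilon> n) y)" for n y using \<epsilon> by simp
  show False
  proof (rule approx_eigenfunction_contradiction'[OF w L nz1, where F="\<lambda>n x. K1 n x + K2 n x" and m="\<lambda>n. C" and c="c / C" and y="\<lambda>n. 0" and \<theta>=\<theta> and W=W
        and r="\<lambda>n x. \<epsilon> n *\<^sub>R (K1 n x - K2 n x)" and \<kappa>=\<epsilon>])
    show "0 < C" by (simp add: C_def)
    then show "0 < c / C" "c / C * C \<le> cmod (K1 n 0 + K2 n 0)" for n
      using W lowc[of n] by (auto simp: K1_def K2_def)
    show "cmod (K1 n x + K2 n x) \<le> C" for n x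
      using norm_triangle_ineq[of "K1 n x" "K2 n x"] Kb[of n x] by linarith
    \<comment> \<open>The decisive cancellation: \<open>K1\<close> contributes \<open>- f x\<close>
      and the reflected \<open>K2\<close> contributes \<open>+ f x\<close>. Only the damping terms
      survive, with opposite signs, as eps (K1 - K2).\<close>
    show "((\<lambda>x. K1 n x + K2 n x) has_vector_derivative (\<i> * complex_of_real (\<theta> n) * (K1 n x + K2 n x) + \<epsilon> n *\<^sub>R (K1 n x - K2 n x))) (at x)" for n x
    proof -
      have d1: "(K1 n has_vector_derivative (Complex (\<epsilon> n) (\<theta> n) * K1 n x - f x)) (at x)"
        unfolding K1_def by (rule laplace_deriv[OF f z])
      have "((laplace f' (Complex (\<epsilon> n) (- \<theta> n)) \<circ> uminus) has_vector_derivative (-1) *\<^sub>R (Complex (\<epsilon> n) (- \<theta> n) * laplace f' (Complex (\<epsilon> n) (- \<theta> n)) (- x) - f' (- x))) (at x)"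
        by (rule vector_diff_chain_at) (auto intro!: derivative_eq_intros laplace_deriv[OF f' z])
      then have d2: "(K2 n has_vector_derivative - (Complex (\<epsilon> n) (- \<theta> n) * K2 n x - f x)) (at x)"
        by (simp add: o_def K2_def[abs_def] f'_def)
      have "(Complex (\<epsilon> n) (\<theta> n) * K1 n x - f x) + - (Complex (\<epsilon> n) (- \<theta> n) * K2 n x - f x)
         = \<i> * complex_of_real (\<theta> n) * (K1 n x + K2 n x) + \<epsilon> n *\<^sub>R (K1 n x - K2 n x)"
        by (simp add: complex_eq_iff algebra_simps)
      with has_vector_derivative_add[OF d1 d2] show ?thesis by simp
    qed
    show "cmod (\<epsilon> n *\<^sub>R (K1 n x - K2 n x)) \<le> \<epsilon> n * C" for n x
    proof -
      have "cmod (K1 n x - K2 n x) \<le> C"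
        using norm_triangle_ineq4[of "K1 n x" "K2 n x"] Kb[of n x] by linarith
      then show ?thesis using \<epsilon>(1)[of n] by simp
    qed
    show "\<epsilon> \<longlonglongrightarrow> 0" unfolding \<epsilon>_def by (rule LIMSEQ_Suc) (rule lim_const_over_n)
    show "(\<integral>x. w x * (K1 n (t - L x) + K2 n (t - L x)) \<partial>M) = 0" for n t
    proof -
      have b: "cmod (K1 n x) \<le> C" "cmod (K2 n x) \<le> C" for x
        using Kb[of n x] norm_ge_zero[of "K1 n x"] norm_ge_zero[of "K2 n x"] by linarith+
      have c1: "continuous_on UNIV (K1 n)" unfolding K1_def by (rule laplace_continuous[OF f z])
      have c2: "continuous_on UNIV (K2 n)" unfolding K2_def
        by (intro continuous_intros continuous_on_compose2[OF laplace_continuous[OF f' z]]) auto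
      have [measurable]: "w \<in> borel_measurable M" "L \<in> borel_measurable M" "K1 n \<in> borel_measurable borel" "K2 n \<in> borel_measurable borel"
        using w L c1 c2 by (auto intro: borel_measurable_continuous_onI)
      have i: "integrable M (\<lambda>x. w x * K (t - L x))" if [measurable]: "K \<in> borel_measurable borel" and "\<And>x. cmod (K x) \<le> C" for K
      proof (rule Bochner_Integration.integrable_bound)
        show "integrable M (\<lambda>x. cmod (w x) * C)" using w by simp
        show "(\<lambda>x. w x * K (t - L x)) \<in> borel_measurable M" by measurable
        show "AE x in M. cmod (w x * K (t - L x)) \<le> norm (cmod (w x) * C)"
          by (intro AE_I2) (auto simp: norm_mult abs_mult intro!: mult_left_mono order_trans[OF that(2)])
      qed
      have "(\<integral>x. w x * (K1 n (t - L x) + K2 n (t - L x)) \<partial>M) = (\<integral>x. w x * K1 n (t - L x) \<partial>M) + (\<integral>x. w x * K2 n (t - L x) \<partial>M)"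
        unfolding distrib_left by (rule Bochner_Integration.integral_add) (intro i b; measurable)+
      also have "(\<integral>x. w x * K1 n (t - L x) \<partial>M) = 0"
        unfolding K1_def by (rule laplace_annihilated[OF M w L f z annf])
      also have "(\<integral>x. w x * K2 n (t - L x) \<partial>M) = 0"
        using laplace_annihilated[OF M w L' f' z[of n "- \<theta> n"] annf', of "- t"] by (simp add: K2_def algebra_simps)
      finally show ?thesis by simp
    qed
  qed (use \<theta> in auto)
qed

section \<open>Uniqueness of Fourier transforms\<close>

text \<open>Fejer means of the complex measure carried by \<open>L\<close> depend only on its
  Fourier transform \<open>T\<close>; this is where equality of transforms becomes equality of
  measures.\<close>

lemma fourier_fejer:
  fixes h :: "'a \<Rightarrow> complex"
  assumes M: "sigma_finite_measure M" and h: "integrable M h" and L: "L \<in> borel_measurable M" and W: "0 < W"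
  defines "T \<theta> \<equiv> \<integral>x. cis (\<theta> * L x) * h x \<partial>M"
  shows "(\<integral>x. h x * complex_of_real (W * fejer (W * (v - L x))) \<partial>M)
    = (\<integral>\<theta>. (indicator {0..W} \<theta> * (1 - \<theta> / W)) *\<^sub>R (cis (\<theta> * v) * T (- \<theta>) + cis (- \<theta> * v) * T \<theta>) \<partial>lborel)"
proof -
  interpret sigma_finite_measure M by fact
  interpret P: pair_sigma_finite M lborel ..
  have [measurable]: "h \<in> borel_measurable M" "L \<in> borel_measurable M" using h L by auto
  let ?k = "\<lambda>\<theta> t. indicator {0..W} \<theta> * (2 * (1 - \<theta> / W) * cos (\<theta> * t))"
  let ?f = "\<lambda>(x, \<theta>). ?k \<theta> (v - L x) *\<^sub>R h x"
  have cont: "continuous_on {0..W} (\<lambda>\<theta>. 2 * (1 - \<theta> / W) * cos (\<theta> * t))" for t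
    using W by (intro continuous_intros) auto
  have i: "integrable lborel (\<lambda>\<theta>. ?k \<theta> t)" for t
    using borel_integrable_compact[OF compact_Icc cont] by simp
  have hc: "integrable M (\<lambda>x. cis (\<theta> * L x) * h x)" for \<theta>
    by (rule Bochner_Integration.integrable_bound[OF h]) (auto simp: norm_mult cis_conv_exp intro!: AE_I2)
  have fint: "integrable (M \<Otimes>\<^sub>M lborel) ?f"
  proof (rule Bochner_Integration.integrable_bound)
    have i: "integrable lborel (\<lambda>\<theta>. indicator {0..W} \<theta> * (2::real))"
      by (intro integrable_mult_left integrable_indicator_Icc)
    show "integrable (M \<Otimes>\<^sub>M lborel) (\<lambda>(x, \<theta>). cmod (h x) * (indicator {0..W} \<theta> * 2))"
      by (rule P.integrable_mult_prod[OF integrable_norm[OF h] i])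
    have "norm (?f (x, \<theta>)) \<le> cmod (h x) * (indicator {0..W} \<theta> * 2)" for \<theta> x
    proof (cases "\<theta> \<in> {0..W}")
      case True
      then have "\<bar>1 - \<theta> / W\<bar> \<le> 1" using W by (auto simp: field_simps)
      then have "\<bar>1 - \<theta> / W\<bar> * \<bar>cos (\<theta> * (v - L x))\<bar> \<le> 1 * 1" by (intro mult_mono) auto
      then have "(\<bar>1 - \<theta> / W\<bar> * \<bar>cos (\<theta> * (v - L x))\<bar>) * cmod (h x) \<le> 1 * cmod (h x)"
        by (intro mult_mono) auto
      moreover have "norm (?f (x, \<theta>)) = 2 * ((\<bar>1 - \<theta> / W\<bar> * \<bar>cos (\<theta> * (v - L x))\<bar>) * cmod (h x))"
        using True by (simp only: prod.case norm_scaleR abs_mult indicator_simps abs_numeral abs_one mult_1_left mult_ac)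
      moreover have "cmod (h x) * (indicator {0..W} \<theta> * 2) = 2 * (1 * cmod (h x))"
        using True by simp
      ultimately show ?thesis by linarith
    qed auto
    then show "AE p in M \<Otimes>\<^sub>M lborel. norm (?f p) \<le> norm (case p of (x, \<theta>) \<Rightarrow> cmod (h x) * (indicator {0..W} \<theta> * 2))"
      by (intro AE_I2) (auto intro!: order_trans[OF _ abs_ge_self])
  qed measurable
  have "(\<integral>x. h x * complex_of_real (W * fejer (W * (v - L x))) \<partial>M) = (\<integral>x. (\<integral>\<theta>. ?f (x, \<theta>) \<partial>lborel) \<partial>M)"
  proof (rule Bochner_Integration.integral_cong[OF refl])
    fix x
    have "(\<integral>\<theta>. ?f (x, \<theta>) \<partial>lborel) = (\<integral>\<theta>. ?k \<theta> (v - L x) \<partial>lborel) *\<^sub>R h x"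
      unfolding prod.case by (rule integral_scaleR_left) (rule i)
    then show "h x * complex_of_real (W * fejer (W * (v - L x))) = (\<integral>\<theta>. ?f (x, \<theta>) \<partial>lborel)"
      unfolding fejer_integral[OF W] scaleR_conv_of_real by (simp only: mult.commute)
  qed
  also have "\<dots> = (\<integral>\<theta>. (\<integral>x. ?f (x, \<theta>) \<partial>M) \<partial>lborel)"
    using P.Fubini_integral[of "\<lambda>x \<theta>. ?f (x, \<theta>)"] fint by simp
  also have "(\<lambda>\<theta>. \<integral>x. ?f (x, \<theta>) \<partial>M) = (\<lambda>\<theta>. (indicator {0..W} \<theta> * (1 - \<theta> / W)) *\<^sub>R (cis (\<theta> * v) * T (- \<theta>) + cis (- \<theta> * v) * T \<theta>))"
  proof
    fix \<theta>
    have "(\<integral>x. ?f (x, \<theta>) \<partial>M) = (\<integral>x. (indicator {0..W} \<theta> * (1 - \<theta> / W)) *\<^sub>R (cis (\<theta> * v) * (cis (- \<theta> * L x) * h x) + cis (- \<theta> * v) * (cis (\<theta> * L x) * h x)) \<partial>M)"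
    proof (rule Bochner_Integration.integral_cong[OF refl])
      fix x
      have "cis (\<theta> * v) * cis (- \<theta> * L x) + cis (- \<theta> * v) * cis (\<theta> * L x) = complex_of_real (2 * cos (\<theta> * (v - L x)))"
        by (simp add: cis_mult complex_eq_iff algebra_simps cos_diff cos_add sin_add sin_diff)
      then have "cis (\<theta> * v) * (cis (- \<theta> * L x) * h x) + cis (- \<theta> * v) * (cis (\<theta> * L x) * h x) = (2 * cos (\<theta> * (v - L x))) *\<^sub>R h x"
        by (metis (no_types, lifting) distrib_right mult.assoc scaleR_conv_of_real)
      then show "?f (x, \<theta>) = (indicator {0..W} \<theta> * (1 - \<theta> / W)) *\<^sub>R (cis (\<theta> * v) * (cis (- \<theta> * L x) * h x) + cis (- \<theta> * v) * (cis (\<theta> * L x) * h x))"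
        by simp
    qed
    also have "\<dots> = (indicator {0..W} \<theta> * (1 - \<theta> / W)) *\<^sub>R (cis (\<theta> * v) * T (- \<theta>) + cis (- \<theta> * v) * T \<theta>)"
      unfolding T_def using hc[of \<theta>] hc[of "-\<theta>"]
      by (subst integral_scaleR_right, subst Bochner_Integration.integral_add) (auto simp: integral_mult_right_zero)
    finally show "(\<integral>x. ?f (x, \<theta>) \<partial>M) = (indicator {0..W} \<theta> * (1 - \<theta> / W)) *\<^sub>R (cis (\<theta> * v) * T (- \<theta>) + cis (- \<theta> * v) * T \<theta>)" .
  qed
  finally show ?thesis .
qed

text \<open>Fubini shifts the smoothing from the measure to the test function. There the Fejer
  kernel is an approximate identity and continuity of \<open>\<psi>\<close> gives pointwise
  convergence under a common bound.\<close>

lemma fourier_limit: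
  fixes h :: "'a \<Rightarrow> complex" and \<psi> :: "real \<Rightarrow> complex"
  assumes M: "sigma_finite_measure M" and h: "integrable M h" and L: "L \<in> borel_measurable M"
    and \<psi>: "continuous_on UNIV \<psi>" "\<And>x. cmod (\<psi> x) \<le> B" "integrable lborel \<psi>"
  shows "(\<lambda>n. \<integral>v. \<psi> v * (\<integral>x. h x * complex_of_real (real (Suc n) * fejer (real (Suc n) * (v - L x))) \<partial>M) \<partial>lborel)
    \<longlonglongrightarrow> complex_of_real fejer_mass * (\<integral>x. \<psi> (L x) * h x \<partial>M)"
proof -
  interpret sigma_finite_measure M by fact
  interpret P: pair_sigma_finite M lborel ..
  have [measurable]: "h \<in> borel_measurable M" "L \<in> borel_measurable M" "\<psi> \<in> borel_measurable borel"
    using h L \<psi> by (auto intro: borel_measurable_continuous_onI)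
  have B0: "0 \<le> B" using \<psi>(2)[of 0] norm_ge_zero order_trans by blast
  \<comment> \<open>Up to the factor \<open>fejer_mass\<close> this is the Fejer mean of
    \<open>\<psi>\<close> around \<open>y\<close> at scale 1 / (n + 1).\<close>
  let ?c = "\<lambda>n y. \<integral>u. complex_of_real (fejer u) * \<psi> (y + u / real (Suc n)) \<partial>lborel"
  have eq: "(\<integral>v. \<psi> v * (\<integral>x. h x * complex_of_real (real (Suc n) * fejer (real (Suc n) * (v - L x))) \<partial>M) \<partial>lborel)
     = (\<integral>x. ?c n (L x) * h x \<partial>M)" for n
  proof -
    define W where "W = real (Suc n)"
    have W: "0 < W" by (simp add: W_def)
    let ?f = "\<lambda>(x, v). h x * (\<psi> v * complex_of_real (W * fejer (W * (v - L x))))"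
    have fint: "integrable (M \<Otimes>\<^sub>M lborel) ?f"
    proof (rule Bochner_Integration.integrable_bound)
      show "integrable (M \<Otimes>\<^sub>M lborel) (\<lambda>(x, v). cmod (h x) * (cmod (\<psi> v) * W))"
        using \<psi>(3) by (intro P.integrable_mult_prod integrable_norm h) auto
      have "norm (?f (x, v)) \<le> cmod (h x) * (cmod (\<psi> v) * W)" for x v
        using W fejer_le_1 fejer_nonneg
        by (auto simp: norm_mult intro!: mult_left_mono)
      then show "AE p in M \<Otimes>\<^sub>M lborel. norm (?f p) \<le> norm (case p of (x, v) \<Rightarrow> cmod (h x) * (cmod (\<psi> v) * W))"
        by (intro AE_I2) (auto intro!: order_trans[OF _ abs_ge_self])
    qed measurable
    have "(\<integral>v. \<psi> v * (\<integral>x. h x * complex_of_real (W * fejer (W * (v - L x))) \<partial>M) \<partial>lborel) = (\<integral>v. (\<integral>x. ?f (x, v) \<partial>M) \<partial>lborel)"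
      unfolding integral_mult_right_zero[symmetric] by (intro Bochner_Integration.integral_cong refl) (auto simp: mult_ac)
    also have "\<dots> = (\<integral>x. (\<integral>v. ?f (x, v) \<partial>lborel) \<partial>M)"
      using P.Fubini_integral[of "\<lambda>x v. ?f (x, v)"] fint by simp
    also have "\<dots> = (\<integral>x. ?c n (L x) * h x \<partial>M)"
    proof (rule Bochner_Integration.integral_cong[OF refl])
      fix x
      have "(\<integral>v. ?f (x, v) \<partial>lborel) = h x * (\<integral>v. \<psi> v * complex_of_real (W * fejer (W * (v - L x))) \<partial>lborel)"
        unfolding prod.case by (rule integral_mult_right_zero)
      also have "(\<integral>v. \<psi> v * complex_of_real (W * fejer (W * (v - L x))) \<partial>lborel)
         = \<bar>1/W\<bar> *\<^sub>R (\<integral>u. \<psi> (L x + (1/W) * u) * complex_of_real (W * fejer (W * (L x + (1/W) * u - L x))) \<partial>lborel)"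
        using W by (intro lborel_integral_real_affine) auto
      also have "\<dots> = (\<integral>u. \<bar>1/W\<bar> *\<^sub>R (\<psi> (L x + (1/W) * u) * complex_of_real (W * fejer (W * (L x + (1/W) * u - L x)))) \<partial>lborel)"
        by (rule integral_scaleR_right[symmetric])
      also have "\<dots> = ?c n (L x)"
        using W unfolding W_def[symmetric] by (intro Bochner_Integration.integral_cong) (auto simp: scaleR_conv_of_real)
      finally show "(\<integral>v. ?f (x, v) \<partial>lborel) = ?c n (L x) * h x" by (simp add: mult.commute)
    qed
    finally show ?thesis unfolding W_def .
  qed
  have cl: "(\<lambda>n. ?c n y) \<longlonglongrightarrow> complex_of_real fejer_mass * \<psi> y" for y
  proof (rule fejer_approx_identity[where B=B])
    fix u :: real
    have l1: "(\<lambda>n. u / real (Suc n)) \<longlonglongrightarrow> 0" by (rule LIMSEQ_Suc) (rule lim_const_over_n)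
    from tendsto_add[OF tendsto_const[of y] l1] have l2: "(\<lambda>n. y + u / real (Suc n)) \<longlonglongrightarrow> y" by simp
    show "(\<lambda>n. \<psi> (y + u / real (Suc n))) \<longlonglongrightarrow> \<psi> y"
      by (rule continuous_on_tendsto_compose[OF \<psi>(1) l2]) auto
  qed (use \<psi>(2) in auto)
  have cb: "cmod (?c n y) \<le> fejer_mass * B" for n y
  proof -
    have "cmod (?c n y) \<le> (\<integral>u. fejer u * B \<partial>lborel)"
      by (rule norm_integral_le)
        (use integrable_fejer \<psi>(2) in \<open>auto simp: norm_mult fejer_nonneg intro!: mult_left_mono\<close>)
    then show ?thesis by (simp add: fejer_mass_def)
  qed
  have "(\<lambda>n. \<integral>x. ?c n (L x) * h x \<partial>M) \<longlonglongrightarrow> (\<integral>x. (complex_of_real fejer_mass * \<psi> (L x)) * h x \<partial>M)"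
  proof (rule integral_dominated_convergence[where w="\<lambda>x. (fejer_mass * B) * cmod (h x)"])
    show "integrable M (\<lambda>x. (fejer_mass * B) * cmod (h x))" using h by simp
    show "AE x in M. cmod (?c n (L x) * h x) \<le> (fejer_mass * B) * cmod (h x)" for n
      using cb by (intro AE_I2) (auto simp: norm_mult intro!: mult_right_mono)
    show "AE x in M. (\<lambda>n. ?c n (L x) * h x) \<longlonglongrightarrow> (complex_of_real fejer_mass * \<psi> (L x)) * h x"
      by (rule AE_I2) (rule tendsto_mult[OF cl tendsto_const])
  qed measurable
  then show ?thesis unfolding eq by (simp add: mult.assoc integral_mult_right_zero)
qed

text \<open>Equal transforms have equal Fejer means, and their limits identify the integrals of all
  bounded continuous integrable functions. Half-lines are reached by dominated convergence. The two
  sides may live on different measure spaces.\<close>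

lemma fourier_unique:
  fixes h1 :: "'a \<Rightarrow> complex" and h2 :: "'b \<Rightarrow> complex"
  assumes 1: "sigma_finite_measure M1" "integrable M1 h1" "L1 \<in> borel_measurable M1"
    and 2: "sigma_finite_measure M2" "integrable M2 h2" "L2 \<in> borel_measurable M2"
    and eq: "\<And>\<theta>. (\<integral>x. cis (\<theta> * L1 x) * h1 x \<partial>M1) = (\<integral>x. cis (\<theta> * L2 x) * h2 x \<partial>M2)"
  shows "(\<integral>x. indicator {..c} (L1 x) *\<^sub>R h1 x \<partial>M1) = (\<integral>x. indicator {..c} (L2 x) *\<^sub>R h2 x \<partial>M2)"
proof -
  have a: "(\<integral>x. \<psi> (L1 x) * h1 x \<partial>M1) = (\<integral>x. \<psi> (L2 x) * h2 x \<partial>M2)"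
    if \<psi>: "continuous_on UNIV \<psi>" "\<And>x. cmod (\<psi> x) \<le> B" "integrable lborel \<psi>" for \<psi> B
  proof -
    have "complex_of_real fejer_mass * (\<integral>x. \<psi> (L1 x) * h1 x \<partial>M1) = complex_of_real fejer_mass * (\<integral>x. \<psi> (L2 x) * h2 x \<partial>M2)"
    proof (rule LIMSEQ_unique[OF fourier_limit[OF 1 \<psi>]])
      show "(\<lambda>n. \<integral>v. \<psi> v * (\<integral>x. h1 x * complex_of_real (real (Suc n) * fejer (real (Suc n) * (v - L1 x))) \<partial>M1) \<partial>lborel)
        \<longlonglongrightarrow> complex_of_real fejer_mass * (\<integral>x. \<psi> (L2 x) * h2 x \<partial>M2)"
        using fourier_limit[OF 2 \<psi>]
        unfolding fourier_fejer[OF 1 of_nat_0_less_iff[THEN iffD2, OF zero_less_Suc]]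
          fourier_fejer[OF 2 of_nat_0_less_iff[THEN iffD2, OF zero_less_Suc]] eq .
    qed
    then show ?thesis using fejer_mass_pos by simp
  qed
  \<comment> \<open>Trapezoids: they rise from 0 to 1 on [-m, 1 - m], equal 1 up to
    \<open>c\<close>, and fall to 0 on [c, c + 1/m]. The left ramp is there only to make them
    integrable, and both ramps disappear in the limit.\<close>
  define \<psi> :: "nat \<Rightarrow> real \<Rightarrow> real" where
    "\<psi> m v = max 0 (min 1 (min (v + real m) (1 + real m * (c - v))))" for m v
  have \<psi>c: "continuous_on UNIV (\<lambda>v. complex_of_real (\<psi> m v))" for m
    unfolding \<psi>_def by (intro continuous_intros)
  have \<psi>b: "0 \<le> \<psi> m v" "\<psi> m v \<le> 1" for m v by (auto simp: \<psi>_def)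
  have \<psi>i: "integrable lborel (\<lambda>v. complex_of_real (\<psi> m v))" if "m \<noteq> 0" for m
  proof (rule Bochner_Integration.integrable_bound)
    show "integrable lborel (indicat_real {- real m..c + 1})"
      by (rule integrable_indicator_Icc)
    show "(\<lambda>v. complex_of_real (\<psi> m v)) \<in> borel_measurable lborel"
      using borel_measurable_continuous_onI[OF \<psi>c] by simp
    have "\<psi> m v = 0" if "v < - real m \<or> c + 1 < v" for v
      using that
    proof
      assume "c + 1 < v"
      then have "real m * 1 \<le> real m * (v - c)" by (intro mult_left_mono) auto
      moreover have "1 \<le> real m" using \<open>m \<noteq> 0\<close> by simp
      ultimately have "1 \<le> real m * (v - c)" by linarith
      then have "1 + real m * (c - v) \<le> 0" by (simp add: algebra_simps)
      then show ?thesis unfolding \<psi>_def by linarith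
    qed (auto simp: \<psi>_def)
    then show "AE v in lborel. norm (complex_of_real (\<psi> m v)) \<le> norm (indicat_real {- real m..c + 1} v)"
      using \<psi>b by (intro AE_I2) (auto simp: indicator_def not_le)
  qed
  have lim: "(\<lambda>m. complex_of_real (\<psi> (Suc m) v)) \<longlonglongrightarrow> complex_of_real (indicator {..c} v)" for v
  proof (rule tendsto_of_real, cases "v \<le> c")
    case True
    obtain k :: nat where k: "1 - v \<le> real k" using real_arch_simple by blast
    have "\<psi> (Suc m) v = 1" if "k \<le> m" for m
    proof -
      have "1 \<le> v + real (Suc m)" using k that by (simp add: algebra_simps)
      moreover have "1 \<le> 1 + real (Suc m) * (c - v)" using True by (simp del: of_nat_Suc)
      ultimately show ?thesis unfolding \<psi>_def by linarith
    qed
    then show "(\<lambda>m. \<psi> (Suc m) v) \<longlonglongrightarrow> indicator {..c} v"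
      using True by (intro tendsto_eventually eventually_sequentiallyI[of k]) auto
  next
    case False
    obtain k :: nat where k: "1 / (v - c) \<le> real k" using real_arch_simple by blast
    have "\<psi> (Suc m) v = 0" if "k \<le> m" for m
    proof -
      have "1 / (v - c) \<le> real (Suc m)" using k that by simp
      then have "1 \<le> real (Suc m) * (v - c)" using False by (simp add: field_simps)
      then have "1 + real (Suc m) * (c - v) \<le> 0" by (simp add: algebra_simps)
      then show ?thesis unfolding \<psi>_def by linarith
    qed
    then show "(\<lambda>m. \<psi> (Suc m) v) \<longlonglongrightarrow> indicator {..c} v"
      using False by (intro tendsto_eventually eventually_sequentiallyI[of k]) auto
  qed
  have lims: "(\<lambda>m. \<integral>x. complex_of_real (\<psi> (Suc m) (L x)) * h x \<partial>M) \<longlonglongrightarrow> (\<integral>x. complex_of_real (indicator {..c} (L x)) * h x \<partial>M)"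
    if h: "integrable M h" and L: "L \<in> borel_measurable M" for h :: "'c \<Rightarrow> complex" and L M
  proof (rule integral_dominated_convergence[where w="\<lambda>x. cmod (h x)"])
    have [measurable]: "h \<in> borel_measurable M" "L \<in> borel_measurable M" using h L by auto
    show "(\<lambda>x. complex_of_real (\<psi> (Suc m) (L x)) * h x) \<in> borel_measurable M" for m
      unfolding \<psi>_def by measurable
    show "(\<lambda>x. complex_of_real (indicator {..c} (L x)) * h x) \<in> borel_measurable M"
      by measurable
    show "integrable M (\<lambda>x. cmod (h x))" using h by simp
    show "AE x in M. cmod (complex_of_real (\<psi> (Suc m) (L x)) * h x) \<le> cmod (h x)" for m
      using \<psi>b by (intro AE_I2) (auto simp: norm_mult intro!: mult_left_le_one_le)
  qed (auto intro!: tendsto_intros lim)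
  have "(\<integral>x. complex_of_real (indicator {..c} (L1 x)) * h1 x \<partial>M1) = (\<integral>x. complex_of_real (indicator {..c} (L2 x)) * h2 x \<partial>M2)"
  proof (rule LIMSEQ_unique[OF lims[OF 1(2,3)]])
    have "(\<integral>x. complex_of_real (\<psi> (Suc m) (L1 x)) * h1 x \<partial>M1) = (\<integral>x. complex_of_real (\<psi> (Suc m) (L2 x)) * h2 x \<partial>M2)" for m
      by (rule a[OF \<psi>c _ \<psi>i, of _ 1]) (use \<psi>b in auto)
    then show "(\<lambda>m. \<integral>x. complex_of_real (\<psi> (Suc m) (L1 x)) * h1 x \<partial>M1) \<longlonglongrightarrow> (\<integral>x. complex_of_real (indicator {..c} (L2 x)) * h2 x \<partial>M2)"
      using lims[OF 2(2,3)] by simp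
  qed
  then show ?thesis by (simp add: scaleR_conv_of_real)
qed

section \<open>Compactness on the extended space\<close>

text \<open>Compactness of laws on \<open>[-\<infinity>,\<infinity>]\<^sup>d\<close> is pulled back from Helly's theorem on the unit interval along
  Schoenberg's space-filling curve, which has a measurable right inverse.\<close>

definition schoenberg :: "real \<Rightarrow> real" where
  "schoenberg t = max 0 (min 1 (1/2 - cos (pi * t)))"

lemma schoenberg_bounds: "0 \<le> schoenberg t" "schoenberg t \<le> 1"
  by (auto simp: schoenberg_def)

text \<open>The sum is a point of the Cantor set with ternary digits 0 and 2. Multiplying by 3^k
  brings digit k to the front: modulo 2 the result lies in [0, 1/3] or in [2/3, 1] according to
  \<open>c k\<close>, and on these intervals the clipped cosine is constantly 0 or 1.\<close>

lemma schoenberg_digit: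
  fixes c :: "nat \<Rightarrow> real"
  assumes c: "\<And>m. c m = 0 \<or> c m = 1"
  shows "summable (\<lambda>m. 2 * c m / 3 ^ Suc m)"
    and "0 \<le> (\<Sum>m. 2 * c m / 3 ^ Suc m)" "(\<Sum>m. 2 * c m / 3 ^ Suc m) \<le> 1"
    and "schoenberg (3 ^ k * (\<Sum>m. 2 * c m / 3 ^ Suc m)) = c k"
proof -
  have c01: "0 \<le> c m" "c m \<le> 1" for m using c[of m] by auto
  have geo: "(\<lambda>m. 2 / 3 ^ Suc m :: real) sums 1"
    using sums_mult[OF geometric_sums[of "1/3::real"], of "2/3"] by (simp add: power_divide field_simps)
  have summ: "summable (\<lambda>m. 2 * d m / 3 ^ Suc m)" and bd: "0 \<le> (\<Sum>m. 2 * d m / 3 ^ Suc m)" "(\<Sum>m. 2 * d m / 3 ^ Suc m) \<le> 1"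
    if d: "\<And>m. 0 \<le> d m" "\<And>m. d m \<le> 1" for d :: "nat \<Rightarrow> real"
  proof -
    show s: "summable (\<lambda>m. 2 * d m / 3 ^ Suc m)"
    proof (rule summable_comparison_test[OF _ sums_summable[OF geo]], intro exI allI impI)
      show "norm (2 * d m / 3 ^ Suc m) \<le> 2 / 3 ^ Suc m" for m
        using d[of m] by (simp add: divide_right_mono)
    qed
    show "0 \<le> (\<Sum>m. 2 * d m / 3 ^ Suc m)" using d by (intro suminf_nonneg s) auto
    have "(\<Sum>m. 2 * d m / 3 ^ Suc m) \<le> (\<Sum>m. 2 / 3 ^ Suc m)"
    proof (rule suminf_le[OF _ s sums_summable[OF geo]])
      show "2 * d m / 3 ^ Suc m \<le> 2 / 3 ^ Suc m" for m
        using d[of m] by (simp add: divide_right_mono)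
    qed
    then show "(\<Sum>m. 2 * d m / 3 ^ Suc m) \<le> 1" using sums_unique[OF geo] by simp
  qed
  show "summable (\<lambda>m. 2 * c m / 3 ^ Suc m)" "0 \<le> (\<Sum>m. 2 * c m / 3 ^ Suc m)" "(\<Sum>m. 2 * c m / 3 ^ Suc m) \<le> 1"
    by (rule summ bd c01)+
  define r where "r = (\<Sum>m. 2 * c (m + Suc k) / 3 ^ Suc m)"
  have r: "0 \<le> r" "r \<le> 1" unfolding r_def by (rule bd c01)+
  \<comment> \<open>After multiplication by 3^k the digits before position \<open>k\<close> add up
    to the even integer 2 N, a whole number of periods of the cosine.\<close>
  define N where "N = (\<Sum>m<k. (if c m = 1 then 1 else 0) * 3 ^ (k - Suc m) :: int)"
  have "(\<Sum>m. 2 * c m / 3 ^ Suc m) = (\<Sum>m. 2 * c (m + Suc k) / 3 ^ Suc (m + Suc k)) + (\<Sum>m<Suc k. 2 * c m / 3 ^ Suc m)"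
    by (rule suminf_split_initial_segment[OF summ[OF c01]])
  also have "(\<Sum>m. 2 * c (m + Suc k) / 3 ^ Suc (m + Suc k)) = r / 3 ^ Suc k"
  proof -
    have "(\<Sum>m. 2 * c (m + Suc k) / 3 ^ Suc (m + Suc k)) = (\<Sum>m. (2 * c (m + Suc k) / 3 ^ Suc m) / 3 ^ Suc k)"
      by (intro suminf_cong) (simp add: power_add)
    also have "\<dots> = r / 3 ^ Suc k" unfolding r_def by (rule suminf_divide[OF summ[OF c01]])
    finally show ?thesis .
  qed
  finally have "3 ^ k * (\<Sum>m. 2 * c m / 3 ^ Suc m) = r / 3 + 2 * c k / 3 + 3 ^ k * (\<Sum>m<k. 2 * c m / 3 ^ Suc m)"
    by (simp add: algebra_simps)
  also have "3 ^ k * (\<Sum>m<k. 2 * c m / 3 ^ Suc m) = (\<Sum>m<k. 2 * of_int ((if c m = 1 then 1 else 0) * 3 ^ (k - Suc m)))"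
    unfolding sum_distrib_left
  proof (rule sum.cong[OF refl])
    fix m assume "m \<in> {..<k}"
    then have "(3::real) ^ k = 3 ^ (k - Suc m) * 3 ^ Suc m" by (simp del: power_Suc flip: power_add)
    then show "3 ^ k * (2 * c m / 3 ^ Suc m) = 2 * real_of_int ((if c m = 1 then 1 else 0) * 3 ^ (k - Suc m))"
      using c[of m] by auto
  qed
  also have "\<dots> = 2 * of_int N" by (simp add: N_def sum_distrib_left)
  finally have eq: "3 ^ k * (\<Sum>m. 2 * c m / 3 ^ Suc m) = r / 3 + 2 * c k / 3 + 2 * of_int N" .
  have "cos (pi * (3 ^ k * (\<Sum>m. 2 * c m / 3 ^ Suc m))) = cos (pi * (r / 3 + 2 * c k / 3) + of_int N * (2 * pi))"
    unfolding eq by (simp add: algebra_simps)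
  also have "\<dots> = cos (pi * (r / 3 + 2 * c k / 3))"
    by (simp add: cos_add mult.commute[of "of_int N"])
  finally have cos: "cos (pi * (3 ^ k * (\<Sum>m. 2 * c m / 3 ^ Suc m))) = cos (pi * (r / 3 + 2 * c k / 3))" .
  show "schoenberg (3 ^ k * (\<Sum>m. 2 * c m / 3 ^ Suc m)) = c k"
    using c[of k]
  proof
    assume ck: "c k = 0"
    have "cos (pi / 3) \<le> cos (pi * (r / 3))"
      using r pi_gt_zero by (intro cos_monotone_0_pi_le) (auto simp: field_simps)
    then have "1/2 \<le> cos (pi * (r / 3))" by (simp add: cos_60)
    then show ?thesis unfolding schoenberg_def cos using ck by simp
  next
    assume ck: "c k = 1"
    have "cos (pi * (r / 3 + 2 / 3)) \<le> cos (2 / 3 * pi)"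
      using r pi_gt_zero by (intro cos_monotone_0_pi_le) (auto simp: field_simps)
    also have "cos (2 / 3 * pi) = - 1/2" by (simp add: cos_120)
    finally show ?thesis unfolding schoenberg_def cos using ck by simp
  qed
qed

section \<open>Binary expansions and the space-filling curve\<close>

definition binary_digit :: "real \<Rightarrow> nat \<Rightarrow> real" where
  "binary_digit v k = of_int (\<lfloor>2 ^ Suc k * v\<rfloor> mod 2)"

lemma binary_digit_01: "binary_digit v k = 0 \<or> binary_digit v k = 1"
  unfolding binary_digit_def by (metis mod_2_eq_odd of_bool_def of_int_0 of_int_1)

lemma binary_digit_sums:
  assumes "0 \<le> v" "v < 1"
  shows "(\<lambda>k. binary_digit v k / 2 ^ Suc k) sums v"
proof -
  \<comment> \<open>The partial sums telescope to the dyadic approximation from below; the case n =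
    0 uses that \<open>v\<close> lies in [0, 1).\<close>
  have part: "(\<Sum>k<n. binary_digit v k / 2 ^ Suc k) = of_int \<lfloor>2 ^ n * v\<rfloor> / 2 ^ n" for n
  proof (induction n)
    case 0
    then show ?case using assms by (simp add: floor_eq_iff)
  next
    case (Suc n)
    have "\<lfloor>2 ^ n * v\<rfloor> = \<lfloor>2 ^ Suc n * v\<rfloor> div 2"
      using floor_divide_real_eq_div[of 2 "2 ^ Suc n * v"] by (simp add: mult.commute mult.left_commute)
    then have "\<lfloor>2 ^ Suc n * v\<rfloor> = 2 * \<lfloor>2 ^ n * v\<rfloor> + \<lfloor>2 ^ Suc n * v\<rfloor> mod 2"
      by simp
    then have "real_of_int \<lfloor>2 ^ Suc n * v\<rfloor> = 2 * of_int \<lfloor>2 ^ n * v\<rfloor> + binary_digit v n"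
      unfolding binary_digit_def by (metis of_int_add of_int_mult of_int_numeral)
    then show ?case using Suc.IH by (simp add: field_simps)
  qed
  have "(\<lambda>n. of_int \<lfloor>2 ^ n * v\<rfloor> / 2 ^ n) \<longlonglongrightarrow> v"
  proof (rule tendsto_sandwich)
    show "\<forall>\<^sub>F n in sequentially. v - 1 / 2 ^ n \<le> of_int \<lfloor>2 ^ n * v\<rfloor> / 2 ^ n"
    proof (intro always_eventually allI)
      fix n
      have "2 ^ n * v - 1 \<le> of_int \<lfloor>2 ^ n * v\<rfloor>" by linarith
      then have "(2 ^ n * v - 1) / 2 ^ n \<le> of_int \<lfloor>2 ^ n * v\<rfloor> / 2 ^ n" by (intro divide_right_mono) auto
      then show "v - 1 / 2 ^ n \<le> of_int \<lfloor>2 ^ n * v\<rfloor> / 2 ^ n" by (simp add: diff_divide_distrib)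
    qed
    show "\<forall>\<^sub>F n in sequentially. of_int \<lfloor>2 ^ n * v\<rfloor> / 2 ^ n \<le> v"
    proof (intro always_eventually allI)
      fix n
      have "of_int \<lfloor>2 ^ n * v\<rfloor> \<le> 2 ^ n * v" by linarith
      then show "of_int \<lfloor>2 ^ n * v\<rfloor> / 2 ^ n \<le> v" by (simp add: field_simps)
    qed
    have "(\<lambda>n. v - (1/2) ^ n) \<longlonglongrightarrow> v - 0"
      by (intro tendsto_intros LIMSEQ_power_zero) auto
    then show "(\<lambda>n. v - 1 / 2 ^ n) \<longlonglongrightarrow> v" by (simp add: power_divide)
  qed auto
  then show ?thesis unfolding sums_def part .
qed

lemma borel_measurable_binary_digit [measurable]: "(\<lambda>v. binary_digit v k) \<in> borel_measurable borel"
  unfolding binary_digit_def by measurable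

text \<open>The ternary positions are distributed among the coordinates through
  \<open>to_nat\<close>: position \<open>to_nat (i, k)\<close> carries binary digit \<open>k\<close>
  of coordinate \<open>i\<close>.\<close>

definition peano_coord :: "'n::finite \<Rightarrow> real \<Rightarrow> real" where
  "peano_coord i t = (\<Sum>k. schoenberg (3 ^ to_nat (i, k) * t) / 2 ^ Suc k)"

lemma peano_coord_continuous: "continuous_on UNIV (peano_coord i)"
proof -
  have "uniform_limit UNIV (\<lambda>n t. \<Sum>k<n. schoenberg (3 ^ to_nat (i, k) * t) / 2 ^ Suc k) (peano_coord i) sequentially"
    unfolding peano_coord_def[abs_def]
  proof (rule Weierstrass_m_test)
    show "summable (\<lambda>k. 1 / 2 ^ Suc k :: real)"
      using summable_mult[OF summable_geometric[of "1/2::real"], of "1/2"] by (simp add: power_divide)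
    show "norm (schoenberg (3 ^ to_nat (i, k) * t) / 2 ^ Suc k) \<le> 1 / 2 ^ Suc k" for k t
      using schoenberg_bounds[of "3 ^ to_nat (i, k) * t"] by (simp add: divide_right_mono)
  qed
  then show ?thesis
  proof (rule uniform_limit_theorem[rotated])
    show "\<forall>\<^sub>F n in sequentially. continuous_on UNIV (\<lambda>t. \<Sum>k<n. schoenberg (3 ^ to_nat (i, k) * t) / 2 ^ Suc k)"
      unfolding schoenberg_def by (intro always_eventually allI continuous_intros) auto
  qed simp
qed

text \<open>Positions \<open>m\<close> outside the range of \<open>to_nat\<close> receive some
  arbitrary digit from \<open>from_nat\<close>; this is harmless, since \<open>peano_coord\<close>
  never reads them.\<close>

definition cantor_section :: "real^'n \<Rightarrow> real" where
  "cantor_section v = (\<Sum>m. 2 * binary_digit (v $ fst (from_nat m :: 'n \<times> nat)) (snd (from_nat m :: 'n \<times> nat)) / 3 ^ Suc m)"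

lemma cantor_section_bounds: "0 \<le> cantor_section v" "cantor_section v \<le> 1"
  unfolding cantor_section_def by (rule schoenberg_digit binary_digit_01)+

lemma borel_measurable_cantor_section: "cantor_section \<in> borel_measurable borel"
proof -
  have [measurable]: "(\<lambda>v :: real^'n. v $ i) \<in> borel_measurable borel" for i
    by (rule borel_measurable_vec_nth_gen)
  show ?thesis unfolding cantor_section_def[abs_def] by measurable
qed

text \<open>The curve reads back exactly the digits written by the section. The strict upper bound
  matters: the floor digits of 1 are all 0, so 1 would be read as 0.\<close>

lemma peano_coord_section:
  assumes "\<And>i. 0 \<le> v $ i" "\<And>i. v $ i < 1"
  shows "peano_coord i (cantor_section v) = v $ i"
proof -
  have "schoenberg (3 ^ to_nat (i, k) * cantor_section v) = binary_digit (v $ i) k" for k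
    unfolding cantor_section_def by (subst schoenberg_digit(4)) (rule binary_digit_01, simp)
  then show ?thesis
    unfolding peano_coord_def using sums_unique[OF binary_digit_sums[OF assms, of i]] by simp
qed

text \<open>\<open>y / (1 - \<bar>y\<bar>)\<close> with \<open>y = 4 u - 2\<close> clipped to \<open>[-1, 1]\<close>; the end points go to \<open>\<plusminus>\<infinity>\<close> because
  \<open>inverse 0 = \<infinity>\<close> in \<open>ereal\<close>.\<close>
definition ereal_stretch :: "real \<Rightarrow> ereal" where
  "ereal_stretch u = ereal (max (-1) (min 1 (4 * u - 2))) * inverse (ereal (1 - \<bar>max (-1) (min 1 (4 * u - 2))\<bar>))"

text \<open>The image is the open interval (1/4, 3/4). It stays below 1, as the binary expansion
  requires, and leaves the points 1/4 and 3/4 free to represent the two infinite values.\<close>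

definition real_shrink :: "real \<Rightarrow> real" where
  "real_shrink x = (2 + x / (1 + \<bar>x\<bar>)) / 4"

lemma real_shrink_bounds: "0 \<le> real_shrink x" "real_shrink x < 1"
proof -
  define y where "y = x / (1 + \<bar>x\<bar>)"
  have "\<bar>y\<bar> \<le> 1" by (simp add: y_def abs_divide field_simps)
  then have "0 \<le> (2 + y) / 4" "(2 + y) / 4 < 1" by auto
  then show "0 \<le> real_shrink x" "real_shrink x < 1" by (simp_all only: real_shrink_def y_def)
qed

lemma ereal_stretch_shrink: "ereal_stretch (real_shrink x) = ereal x"
proof -
  have "4 * ((2 + y) / 4) - 2 = y" for y :: real by (simp add: add_divide_distrib)
  from this[of "x / (1 + \<bar>x\<bar>)"] have 1: "4 * real_shrink x - 2 = x / (1 + \<bar>x\<bar>)"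
    by (simp only: real_shrink_def)
  have b: "\<bar>x / (1 + \<bar>x\<bar>)\<bar> \<le> 1" by (simp add: abs_divide field_simps)
  then have 2: "max (-1) (min 1 (x / (1 + \<bar>x\<bar>))) = x / (1 + \<bar>x\<bar>)" by linarith
  have 3: "1 - \<bar>x / (1 + \<bar>x\<bar>)\<bar> = 1 / (1 + \<bar>x\<bar>)" by (simp add: abs_divide field_simps)
  have "1 + \<bar>x\<bar> \<noteq> 0" by linarith
  then show ?thesis unfolding ereal_stretch_def 1 2 3 by simp
qed

lemma ereal_stretch_continuous: "continuous_on UNIV ereal_stretch"
proof -
  let ?v = "\<lambda>u::real. max (-1) (min 1 (4 * u - 2))"
  have 1: "continuous_on UNIV (\<lambda>u. ereal (?v u))" by (intro continuous_intros)
  have 2: "continuous_on UNIV (\<lambda>u. inverse (ereal (1 - \<bar>?v u\<bar>)))"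
    by (rule continuous_on_compose2[OF continuous_on_inverse_ereal, where f="\<lambda>u. ereal (1 - \<bar>?v u\<bar>)"])
      (auto intro!: continuous_intros)
  show ?thesis
    unfolding ereal_stretch_def[abs_def] continuous_on_def
  proof
    fix u :: real
    \<comment> \<open>Extended multiplication is continuous except at products of 0 with infinity.
      Here \<open>v\<close> is finite, and v = 0 makes the other factor 1.\<close>
    have nz: "\<not> ((ereal v = 0 \<and> \<bar>inverse (ereal (1 - \<bar>v\<bar>))\<bar> = \<infinity>) \<or> (inverse (ereal (1 - \<bar>v\<bar>)) = 0 \<and> \<bar>ereal v\<bar> = \<infinity>))" for v
      by auto
    show "((\<lambda>u. ereal (?v u) * inverse (ereal (1 - \<bar>?v u\<bar>))) \<longlongrightarrow> ereal (?v u) * inverse (ereal (1 - \<bar>?v u\<bar>))) (at u within UNIV)"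
    proof (rule tendsto_mult_ereal)
      show "((\<lambda>u. ereal (?v u)) \<longlongrightarrow> ereal (?v u)) (at u within UNIV)"
        using 1 unfolding continuous_on_def by blast
      show "((\<lambda>u. inverse (ereal (1 - \<bar>?v u\<bar>))) \<longlongrightarrow> inverse (ereal (1 - \<bar>?v u\<bar>))) (at u within UNIV)"
        using 2 unfolding continuous_on_def by blast
    qed (rule nz)
  qed
qed

definition peano_curve :: "real \<Rightarrow> ereal^'n" where
  "peano_curve t = (\<chi> i. ereal_stretch (peano_coord i t))"

lemma peano_curve_continuous: "continuous_on UNIV (peano_curve :: real \<Rightarrow> ereal^'n)"
  unfolding peano_curve_def[abs_def]
  by (intro continuous_on_vec_lambda continuous_on_compose2[OF ereal_stretch_continuous peano_coord_continuous]) auto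

definition peano_section :: "real^'n \<Rightarrow> real" where
  "peano_section x = cantor_section (\<chi> i. real_shrink (x $ i))"

lemma peano_section_bounds: "0 \<le> peano_section v" "peano_section v \<le> 1"
  unfolding peano_section_def by (rule cantor_section_bounds)+

lemma borel_measurable_peano_section: "peano_section \<in> borel_measurable borel"
proof -
  have [measurable]: "(\<lambda>v :: real^'n. v $ i) \<in> borel_measurable borel" for i
    by (rule borel_measurable_vec_nth_gen)
  have "(\<lambda>x::real^'n. \<chi> i. real_shrink (x $ i)) \<in> borel_measurable borel"
    by (rule borel_measurable_vecI) (simp add: real_shrink_def)
  then show ?thesis unfolding peano_section_def[abs_def]
    by (rule measurable_compose) (rule borel_measurable_cantor_section)
qed

lemma peano_curve_section: "peano_curve (peano_section x) = ereal_vec x"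
proof -
  have "peano_coord i (peano_section x) = real_shrink (x $ i)" for i
    unfolding peano_section_def by (subst peano_coord_section) (auto simp: real_shrink_bounds)
  then show ?thesis by (simp add: peano_curve_def ereal_vec_def ereal_stretch_shrink)
qed

text \<open>The space-filling curve is onto, infinite coordinates included, so the extended space is
  a continuous image of [0, 1].\<close>

lemma compact_UNIV_ereal_vec: "compact (UNIV :: (ereal^'n) set)"
proof -
  have "y \<in> peano_curve ` {0..1}" for y :: "ereal^'n"
  proof -
    have "\<exists>v. 0 \<le> v \<and> v < 1 \<and> ereal_stretch v = y $ i" for i
    proof (cases "y $ i")
      case (real r)
      then show ?thesis using real_shrink_bounds[of r] ereal_stretch_shrink[of r] by auto
    next
      case PInf
      then show ?thesis by (intro exI[of _ "3/4"]) (auto simp: ereal_stretch_def)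
    next
      case MInf
      then show ?thesis by (intro exI[of _ "1/4"]) (auto simp: ereal_stretch_def)
    qed
    then obtain v where v: "\<And>i. 0 \<le> v i" "\<And>i. v i < 1" "\<And>i. ereal_stretch (v i) = y $ i"
      by metis
    have "peano_coord i (cantor_section (\<chi> i. v i)) = v i" for i
      by (subst peano_coord_section) (auto simp: v)
    then have "y = peano_curve (cantor_section (\<chi> i. v i))"
      by (simp add: peano_curve_def v vec_eq_iff)
    then show ?thesis using cantor_section_bounds by (intro image_eqI) auto
  qed
  then have "UNIV = (peano_curve :: real \<Rightarrow> ereal^'n) ` {0..1}" by auto
  then show ?thesis
    using compact_continuous_image[OF continuous_on_subset[OF peano_curve_continuous subset_UNIV] compact_Icc] by metis
qed

text \<open>Carried over by the section, all laws live on [0, 1] and are therefore tight. A weak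
  limit there is pushed forward by the curve. Measurability of the section is enough: test functions
  are composed only with the continuous curve, and the curve after the section is
  \<open>ereal_vec\<close>.\<close>

lemma ereal_vec_prohorov:
  fixes P :: "nat \<Rightarrow> (real^'n) measure"
  assumes P: "\<And>n. prob_space (P n)" "\<And>n. sets (P n) = sets borel"
  obtains r and Q :: "(ereal^'n) measure" where "strict_mono (r :: nat \<Rightarrow> nat)" "prob_space Q" "sets Q = sets borel"
    "\<And>f :: ereal^'n \<Rightarrow> real. continuous_on UNIV f \<Longrightarrow> (\<lambda>n. \<integral>x. f (ereal_vec x) \<partial>P (r n)) \<longlonglongrightarrow> (\<integral>y. f y \<partial>Q)"
proof -
  define \<mu> where "\<mu> n = distr (P n) borel peano_section" for n
  have m: "peano_section \<in> measurable (P n) borel" for n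
    using borel_measurable_peano_section by (simp cong: measurable_cong_sets add: P(2))
  have \<mu>: "real_distribution (\<mu> n)" for n
  proof -
    interpret prob_space "P n" by (rule P)
    show ?thesis unfolding \<mu>_def by (rule real_distribution_distr[OF m])
  qed
  have "tight \<mu>"
    unfolding tight_def
  proof (intro conjI allI impI \<mu>)
    fix \<epsilon> :: real assume "0 < \<epsilon>"
    \<comment> \<open>Tightness is phrased with half-open intervals, so the left end must lie
      strictly below the possible value 0.\<close>
    have "measure (\<mu> n) {-1<..1} = 1" for n
    proof -
      interpret prob_space "P n" by (rule P)
      have "measure (\<mu> n) {-1<..1} = measure (P n) (peano_section -` {-1<..1} \<inter> space (P n))"
        unfolding \<mu>_def by (rule measure_distr[OF m]) simp
      also have "peano_section -` {-1<..1} \<inter> space (P n) = space (P n)"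
      proof -
        have "-1 < peano_section x" "peano_section x \<le> 1" for x :: "real^'n"
          using peano_section_bounds[of x] by linarith+
        then show ?thesis by auto
      qed
      finally show ?thesis by (simp add: prob_space)
    qed
    then show "\<exists>a b. a < b \<and> (\<forall>n. 1 - \<epsilon> < measure (\<mu> n) {a<..b})"
      using \<open>0 < \<epsilon>\<close> by (intro exI[of _ "-1"] exI[of _ 1]) auto
  qed
  from tight_imp_convergent_subsubsequence[OF this strict_mono_id] obtain r M
    where r: "strict_mono (r :: nat \<Rightarrow> nat)" and M: "real_distribution M" and conv: "weak_conv_m (\<mu> \<circ> id \<circ> r) M"
    by blast
  interpret M: real_distribution M by (rule M)
  have pm: "peano_curve \<in> measurable borel borel"
    by (rule borel_measurable_continuous_onI) (rule peano_curve_continuous)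
  show thesis
  proof (rule that[OF r, of "distr M borel peano_curve"])
    show "prob_space (distr M borel (peano_curve :: real \<Rightarrow> ereal^'n))"
      by (rule M.prob_space_distr) (simp add: pm)
    fix f :: "ereal^'n \<Rightarrow> real" assume f: "continuous_on UNIV f"
    have fm: "f \<in> borel_measurable borel" using f by (rule borel_measurable_continuous_onI)
    have "bounded (f ` UNIV)"
      by (intro compact_imp_bounded compact_continuous_image f compact_UNIV_ereal_vec)
    then obtain B where B: "\<And>x. norm (f x) \<le> B" unfolding bounded_iff by auto
    have "(\<lambda>n. \<integral>x. f (peano_curve x) \<partial>(\<mu> \<circ> id \<circ> r) n) \<longlonglongrightarrow> (\<integral>x. f (peano_curve x) \<partial>M)"
    proof (rule weak_conv_imp_integral_bdd_continuous_conv[OF _ M conv])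
      show "real_distribution ((\<mu> \<circ> id \<circ> r) n)" for n using \<mu> by simp
      show "isCont (\<lambda>x. f (peano_curve x)) x" for x
        using continuous_on_compose2[OF f peano_curve_continuous] by (simp add: continuous_on_eq_continuous_at)
      show "norm (f (peano_curve x)) \<le> B" for x by (rule B)
    qed
    also have "(\<lambda>n. \<integral>x. f (peano_curve x) \<partial>(\<mu> \<circ> id \<circ> r) n) = (\<lambda>n. \<integral>x. f (ereal_vec x) \<partial>P (r n))"
      unfolding \<mu>_def o_def id_def
      by (subst integral_distr[OF m]) (auto simp: peano_curve_section intro: measurable_compose[OF pm fm])
    also have "(\<integral>x. f (peano_curve x) \<partial>M) = (\<integral>y. f y \<partial>distr M borel peano_curve)"
      by (subst integral_distr) (auto simp: pm fm)
    finally show "(\<lambda>n. \<integral>x. f (ereal_vec x) \<partial>P (r n)) \<longlonglongrightarrow> (\<integral>y. f y \<partial>distr M borel peano_curve)" .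
  qed simp
qed

section \<open>Test functions vanishing near the origin\<close>

lemma is_norm_equiv:
  fixes N :: "real^'n \<Rightarrow> real"
  assumes N: "is_norm N"
  obtains c C where "0 < c" "0 < C" "\<And>x. c * norm x \<le> N x" "\<And>x. N x \<le> C * norm x"
proof -
  let ?S = "sphere (0::real^'n) 1"
  have ne: "?S \<noteq> {}" by simp
  have cont: "continuous_on ?S N" using is_norm_continuous[OF N] continuous_on_subset by blast
  obtain x0 where x0: "x0 \<in> ?S" "\<And>x. x \<in> ?S \<Longrightarrow> N x0 \<le> N x"
    using continuous_attains_inf[OF compact_sphere ne cont] by blast
  obtain x1 where x1: "x1 \<in> ?S" "\<And>x. x \<in> ?S \<Longrightarrow> N x \<le> N x1"
    using continuous_attains_sup[OF compact_sphere ne cont] by blast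
  have hom: "N (t *\<^sub>R x) = \<bar>t\<bar> * N x" for t x using N by (simp add: is_norm_def)
  have pos: "0 < N x" if "x \<noteq> 0" for x using N that unfolding is_norm_def by (metis less_le)
  have sc: "N x = norm x * N (x /\<^sub>R norm x)" "x /\<^sub>R norm x \<in> ?S" if "x \<noteq> 0" for x
    using that by (auto simp: hom)
  have "N 0 = 0" using N by (simp add: is_norm_def)
  show thesis
  proof (rule that[of "N x0" "N x1"])
    have "x0 \<noteq> 0" "x1 \<noteq> 0" using x0(1) x1(1) by auto
    then show "0 < N x0" "0 < N x1" by (auto intro: pos)
    show "N x0 * norm x \<le> N x" for x
      using sc[of x] x0(2)[of "x /\<^sub>R norm x"] \<open>N 0 = 0\<close> by (cases "x = 0") (auto simp: mult.commute[of "N x0"])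
    show "N x \<le> N x1 * norm x" for x
      using sc[of x] x1(2)[of "x /\<^sub>R norm x"] \<open>N 0 = 0\<close> by (cases "x = 0") (auto simp: mult.commute[of "N x1"])
  qed
qed

text \<open>Test functions on R^d rather than on its compactification. Nothing is asked of them at
  infinity beyond boundedness, so they need not extend continuously to infinite points.\<close>

definition far_test :: "(real^'n \<Rightarrow> real) \<Rightarrow> bool" where
  "far_test g \<longleftrightarrow> continuous_on UNIV g \<and> (\<exists>B. \<forall>x. \<bar>g x\<bar> \<le> B) \<and> (\<exists>r>0. \<forall>x. norm x < r \<longrightarrow> g x = 0)"

text \<open>Counterpart on R^d of a Radon measure on the punctured extended space. The origin is
  kept in the space but made a null set, so that ordinary Borel measures can be used.\<close>

definition tail_finite :: "(real^'n) measure \<Rightarrow> bool" where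
  "tail_finite \<nu> \<longleftrightarrow> sets \<nu> = sets borel \<and> emeasure \<nu> {0} = 0 \<and> (\<forall>r>0. emeasure \<nu> {x. r \<le> norm x} < \<infinity>)"

lemma tail_finite_sets: "tail_finite \<nu> \<Longrightarrow> sets \<nu> = sets borel"
  and tail_finite_space: "tail_finite \<nu> \<Longrightarrow> space \<nu> = UNIV"
  and tail_finite_fin: "tail_finite \<nu> \<Longrightarrow> 0 < r \<Longrightarrow> emeasure \<nu> {x. r \<le> norm x} < \<infinity>"
  by (auto simp: tail_finite_def dest: sets_eq_imp_space_eq)

lemma tail_finite_sigma_finite:
  assumes "tail_finite \<nu>"
  shows "sigma_finite_measure \<nu>"
proof
  have [simp]: "sets \<nu> = sets borel" "space \<nu> = UNIV"
    using assms tail_finite_sets tail_finite_space by auto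
  show "\<exists>A. countable A \<and> A \<subseteq> sets \<nu> \<and> \<Union> A = space \<nu> \<and> (\<forall>a\<in>A. emeasure \<nu> a \<noteq> \<infinity>)"
  proof (intro exI[of _ "insert {0} (range (\<lambda>n. {x. 1 / real (Suc n) \<le> norm x}))"] conjI)
    show "\<Union> (insert {0} (range (\<lambda>n. {x. 1 / real (Suc n) \<le> norm x}))) = space \<nu>"
    proof -
      have "\<exists>n. 1 / real (Suc n) \<le> norm x" if "x \<noteq> 0" for x :: "real^'a"
        using nat_approx_posE[of "norm x"] that by (metis less_imp_le zero_less_norm_iff)
      then show ?thesis by auto
    qed
    show "\<forall>a\<in>insert {0} (range (\<lambda>n. {x. 1 / real (Suc n) \<le> norm x})). emeasure \<nu> a \<noteq> \<infinity>"
      using assms unfolding tail_finite_def by (auto simp: less_top[symmetric])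
    show "insert {0} (range (\<lambda>n. {x. 1 / real (Suc n) \<le> norm x})) \<subseteq> sets \<nu>" by auto
  qed auto
qed

lemma tail_finite_integrable:
  fixes g :: "real^'n \<Rightarrow> 'b::{banach, second_countable_topology}"
  assumes \<nu>: "tail_finite \<nu>" and g: "g \<in> borel_measurable borel"
    and B: "\<And>x. norm (g x) \<le> B" and r: "0 < r" "\<And>x. norm x < r \<Longrightarrow> g x = 0"
  shows "integrable \<nu> g"
proof (rule Bochner_Integration.integrable_bound)
  have "{x. r \<le> norm x} \<in> sets \<nu>" by (simp add: tail_finite_sets[OF \<nu>])
  then show "integrable \<nu> (\<lambda>x. indicator {x. r \<le> norm x} x * B)"
    using tail_finite_fin[OF \<nu> r(1)] by (intro integrable_mult_left integrable_real_indicator)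
  show "g \<in> borel_measurable \<nu>" using g by (simp cong: measurable_cong_sets add: tail_finite_sets[OF \<nu>])
  show "AE x in \<nu>. norm (g x) \<le> norm (indicator {x. r \<le> norm x} x * B)"
    using B r(2) by (intro AE_I2) (auto simp: indicator_def not_le intro: order_trans[OF _ abs_ge_self])
qed

lemma far_testE:
  assumes "far_test g"
  obtains r B where "0 < r" "\<And>x. norm x < r \<Longrightarrow> g x = 0" "\<And>x. \<bar>g x\<bar> \<le> B" "g \<in> borel_measurable borel"
  using assms unfolding far_test_def by (metis borel_measurable_continuous_onI)

lemma far_test_integrable: "tail_finite \<nu> \<Longrightarrow> far_test g \<Longrightarrow> integrable \<nu> g"
  by (elim far_testE) (rule tail_finite_integrable, auto)

text \<open>Cutting \<open>E\<close> along the disjointed cover reduces equality to pieces contained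
  in one \<open>S n\<close>. Only sums of masses occur, so infinite total mass causes no
  difficulty.\<close>

lemma measure_eqI_cover:
  fixes S :: "nat \<Rightarrow> 'a set"
  assumes sets: "sets A = sets B" and S: "\<And>n. S n \<in> sets A"
    and eq: "\<And>n E. E \<in> sets A \<Longrightarrow> emeasure A (E \<inter> S n) = emeasure B (E \<inter> S n)"
    and null: "emeasure A (space A - (\<Union>n. S n)) = 0" "emeasure B (space A - (\<Union>n. S n)) = 0"
  shows "A = B"
proof (rule measure_eqI[OF sets])
  fix E assume E: "E \<in> sets A"
  let ?D = "disjointed S"
  let ?N = "space A - (\<Union>n. S n)"
  have D: "?D n \<in> sets A" for n using sets.range_disjointed_sets[of S A] S by auto
  have N: "?N \<in> sets A" using S by auto
  have decomp: "emeasure L E = (\<Sum>n. emeasure L (E \<inter> ?D n))" if L: "sets L = sets A" and Ln: "emeasure L ?N = 0" for L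
  proof -
    have "emeasure L (E \<inter> ?N) = 0"
      by (rule emeasure_eq_0[OF _ Ln]) (use L N in auto)
    moreover have "E = (E \<inter> ?N) \<union> (\<Union>n. E \<inter> ?D n)"
      using sets.sets_into_space[OF E] UN_disjointed_eq[of S] by auto
    moreover have "(E \<inter> ?N) \<inter> (\<Union>n. E \<inter> ?D n) = {}" using UN_disjointed_eq[of S] by auto
    ultimately have "emeasure L E = emeasure L (\<Union>n. E \<inter> ?D n)"
      using plus_emeasure[of "E \<inter> ?N" L "\<Union>n. E \<inter> ?D n"] L E N D by (metis add.left_neutral sets.Int sets.countable_UN[OF image_subsetI])
    also have "\<dots> = (\<Sum>n. emeasure L (E \<inter> ?D n))"
      using L E D disjoint_family_disjointed[of S]
      by (intro suminf_emeasure[symmetric]) (auto simp: disjoint_family_on_def, blast)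
    finally show ?thesis .
  qed
  have "emeasure A (E \<inter> ?D n) = emeasure B (E \<inter> ?D n)" for n
  proof -
    have "E \<inter> ?D n = (E \<inter> ?D n) \<inter> S n" using disjointed_subset[of S n] by auto
    then show ?thesis using eq[of "E \<inter> ?D n" n] E D by (metis sets.Int)
  qed
  then show "emeasure A E = emeasure B E"
    using decomp[of A] decomp[of B] null sets by simp
qed

text \<open>The indicator of an open set away from 0 is a limit of far test functions. On each
  \<open>S n\<close>, which has finite mass, the open sets form an intersection-stable generator,
  and the sets \<open>S n\<close> exhaust everything but the origin.\<close>

lemma measure_eqI_far_test:
  fixes \<nu> :: "(real^'n) measure"
  assumes \<nu>: "tail_finite \<nu>" and \<nu>': "tail_finite \<nu>'"
    and eq: "\<And>g. far_test g \<Longrightarrow> (\<integral>x. g x \<partial>\<nu>) = (\<integral>x. g x \<partial>\<nu>')"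
  shows "\<nu> = \<nu>'"
proof -
  define S where "S n = {x :: real^'n. 1 / real (Suc n) < norm x}" for n
  have S: "open (S n)" for n unfolding S_def by (intro open_Collect_less continuous_intros)
  have opn: "emeasure \<nu> (U \<inter> S n) = emeasure \<nu>' (U \<inter> S n)" if U: "open U" for U n
  proof -
    let ?V = "U \<inter> S n"
    \<comment> \<open>The distance to the complement is continuous and positive exactly on the open
      set; its multiples capped at 1 increase to the indicator.\<close>
    define g where "g k x = min 1 (real k * infdist x (- ?V))" for k :: nat and x :: "real^'n"
    have V: "closed (- ?V)" using U S by auto
    have "0 \<in> - ?V" by (simp add: S_def)
    then have ne: "- ?V \<noteq> {}" by blast
    have gz: "g k x = 0" if "x \<notin> ?V" for k x using that by (simp add: g_def)
    have g01: "0 \<le> g k x" "g k x \<le> 1" for k x by (auto simp: g_def infdist_nonneg)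
    have far: "far_test (g k)" for k
      unfolding far_test_def
    proof (intro conjI)
      show "continuous_on UNIV (g k)" unfolding g_def by (intro continuous_intros)
      show "\<exists>B. \<forall>x. \<bar>g k x\<bar> \<le> B" using g01 by (intro exI[of _ 1]) (auto simp: abs_of_nonneg)
      show "\<exists>r>0. \<forall>x. norm x < r \<longrightarrow> g k x = 0"
        by (intro exI[of _ "1 / real (Suc n)"]) (auto intro!: gz simp: S_def)
    qed
    have lim: "(\<lambda>k. g k x) \<longlonglongrightarrow> indicator ?V x" for x
    proof (cases "x \<in> ?V")
      case True
      then have pos: "0 < infdist x (- ?V)" using infdist_pos_not_in_closed[OF V ne] by auto
      obtain k :: nat where k: "1 / infdist x (- ?V) \<le> real k" using real_arch_simple by blast
      have "g m x = 1" if "k \<le> m" for m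
      proof -
        have "1 / infdist x (- ?V) \<le> real m" using k that by linarith
        then show ?thesis using pos by (simp add: g_def field_simps)
      qed
      then show ?thesis using True by (intro tendsto_eventually eventually_sequentiallyI[of k]) auto
    next
      case False
      then show ?thesis using gz by simp
    qed
    have L: "(\<lambda>k. \<integral>x. g k x \<partial>Q) \<longlonglongrightarrow> measure Q ?V" "emeasure Q ?V = ennreal (measure Q ?V)" if Q: "tail_finite Q" for Q
    proof -
      have [measurable_cong]: "sets Q = sets borel" by (rule tail_finite_sets[OF Q])
      have sp: "space Q = UNIV" by (rule tail_finite_space[OF Q])
      have m: "indicat_real ?V \<in> borel_measurable borel" using U S by (intro borel_measurable_indicator) auto
      have i: "integrable Q (indicat_real ?V)"
        by (rule tail_finite_integrable[OF Q m, of 1 "1 / real (Suc n)"]) (auto simp: indicator_def S_def)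
      have "(\<lambda>k. \<integral>x. g k x \<partial>Q) \<longlonglongrightarrow> (\<integral>x. indicator ?V x \<partial>Q)"
      proof (rule integral_dominated_convergence[where w="indicat_real ?V"])
        show "integrable Q (indicat_real ?V)" by (rule i)
        then show "indicat_real ?V \<in> borel_measurable Q" by simp
        show "g k \<in> borel_measurable Q" for k using far_testE[OF far[of k]] by (metis measurable_cong_sets tail_finite_sets[OF Q])
        show "AE x in Q. (\<lambda>k. g k x) \<longlonglongrightarrow> indicator ?V x" by (intro AE_I2 lim)
        show "AE x in Q. norm (g k x) \<le> indicator ?V x" for k
          using g01 gz by (intro AE_I2) (auto simp: indicator_def abs_of_nonneg)
      qed
      then show "(\<lambda>k. \<integral>x. g k x \<partial>Q) \<longlonglongrightarrow> measure Q ?V" using sp by simp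
      have "emeasure Q ?V \<le> emeasure Q {x. 1 / real (Suc n) \<le> norm x}"
        by (intro emeasure_mono) (auto simp: S_def)
      also have "\<dots> < \<infinity>" by (rule tail_finite_fin[OF Q]) simp
      finally show "emeasure Q ?V = ennreal (measure Q ?V)" by (intro emeasure_eq_ennreal_measure) auto
    qed
    have "measure \<nu> ?V = measure \<nu>' ?V"
      using L(1)[OF \<nu>] L(1)[OF \<nu>'] unfolding eq[OF far] by (rule LIMSEQ_unique)
    then show ?thesis using L(2)[OF \<nu>] L(2)[OF \<nu>'] by simp
  qed
  show ?thesis
  proof (rule measure_eqI_cover[where S=S])
    show "sets \<nu> = sets \<nu>'" using tail_finite_sets[OF \<nu>] tail_finite_sets[OF \<nu>'] by simp
    show "S n \<in> sets \<nu>" for n using S by (simp add: tail_finite_sets[OF \<nu>])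
    have "space \<nu> - (\<Union>n. S n) = {0}"
    proof -
      have "\<exists>n. 1 / real (Suc n) < norm x" if "x \<noteq> 0" for x :: "real^'n"
        using nat_approx_posE[of "norm x"] that by (metis zero_less_norm_iff)
      then show ?thesis unfolding tail_finite_space[OF \<nu>] S_def by auto
    qed
    then show "emeasure \<nu> (space \<nu> - (\<Union>n. S n)) = 0" "emeasure \<nu>' (space \<nu> - (\<Union>n. S n)) = 0"
      using \<nu> \<nu>' by (simp_all add: tail_finite_def)
    fix n E assume E: "E \<in> sets \<nu>"
    have Sm: "S n \<in> sets Q" "(indicator (S n) :: _ \<Rightarrow> ennreal) \<in> borel_measurable Q" if "tail_finite Q" for Q
      using S tail_finite_sets[OF that] by (auto intro!: borel_measurable_indicator)
    let ?d = "\<lambda>Q. density Q (indicator (S n))"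
    have d: "emeasure (?d Q) E = emeasure Q (E \<inter> S n)" if "tail_finite Q" "E \<in> sets borel" for Q E
      using Sm[OF that(1)] that tail_finite_sets[OF that(1)]
      by (subst emeasure_density) (auto simp: indicator_inter_arith[symmetric] mult.commute Int_commute)
    have "?d \<nu> = ?d \<nu>'"
    proof (rule measure_eqI_generator_eq[where E="{U. open U}" and \<Omega>=UNIV and A="\<lambda>_. UNIV"])
      show "Int_stable {U :: (real^'n) set. open U}" by (auto simp: Int_stable_def)
      show "sets (?d \<nu>) = sigma_sets UNIV {U. open U}" "sets (?d \<nu>') = sigma_sets UNIV {U. open U}"
        using tail_finite_sets[OF \<nu>] tail_finite_sets[OF \<nu>'] by (simp_all add: borel_def)
      show "emeasure (?d \<nu>) U = emeasure (?d \<nu>') U" if "U \<in> {U. open U}" for U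
        using that opn[of U n] by (simp add: d \<nu> \<nu>')
      have "emeasure \<nu> (S n) \<le> emeasure \<nu> {x. 1 / real (Suc n) \<le> norm x}"
        by (intro emeasure_mono) (auto simp: S_def tail_finite_sets[OF \<nu>])
      also have "\<dots> < \<infinity>" by (rule tail_finite_fin[OF \<nu>]) simp
      finally show "emeasure (?d \<nu>) UNIV \<noteq> \<infinity>" by (simp add: d \<nu>)
    qed auto
    then show "emeasure \<nu> (E \<inter> S n) = emeasure \<nu>' (E \<inter> S n)"
      using d[OF \<nu>, of E] d[OF \<nu>', of E] E tail_finite_sets[OF \<nu>] by simp
  qed
qed

section \<open>Continuous truncations on the extended space\<close>

definition cap :: "real \<Rightarrow> ereal \<Rightarrow> real" where
  "cap c e = real_of_ereal (min (ereal c) (max e (- e)))"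

lemma cap_real: "0 < c \<Longrightarrow> cap c (ereal x) = min c \<bar>x\<bar>"
proof -
  have "max (ereal x) (- ereal x) = ereal \<bar>x\<bar>" by (simp add: max_def abs_if)
  then show ?thesis by (simp add: cap_def min_def)
qed

lemma cap_infinity: "0 < c \<Longrightarrow> \<bar>e\<bar> = \<infinity> \<Longrightarrow> cap c e = c"
  by (cases e) (auto simp: cap_def min_def max_def)

lemma cap_bounds: "0 < c \<Longrightarrow> 0 \<le> cap c e" "0 < c \<Longrightarrow> cap c e \<le> c"
  by (cases e; simp add: cap_real cap_infinity)+

lemma cap_eq_0_iff: "0 < c \<Longrightarrow> cap c e = 0 \<longleftrightarrow> e = 0"
  by (cases e) (auto simp: cap_real cap_infinity zero_ereal_def min_def split: if_splits)

lemma cap_continuous: "0 < c \<Longrightarrow> continuous_on UNIV (cap c)"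
proof -
  assume c: "0 < c"
  have "continuous_on UNIV (\<lambda>e. min (ereal c) (max e (- e)))"
    by (intro continuous_intros)
  moreover have "min (ereal c) (max e (- e)) \<in> UNIV - {\<infinity>, -\<infinity>}" for e
    using c by (cases e) (auto simp: min_def max_def)
  ultimately show ?thesis
    unfolding cap_def[abs_def] by (intro continuous_on_compose2[OF continuous_on_real]) auto
qed

lemma cap_comp_continuous: "0 < c \<Longrightarrow> continuous_on S f \<Longrightarrow> continuous_on S (\<lambda>x. cap c (f x))"
  by (rule continuous_on_compose2[OF cap_continuous]) auto

lemma abs_integral_le:
  fixes f :: "'a \<Rightarrow> real"
  assumes "integrable M g" "\<And>x. \<bar>f x\<bar> \<le> g x"
  shows "\<bar>\<integral>x. f x \<partial>M\<bar> \<le> (\<integral>x. g x \<partial>M)"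
  using norm_integral_le[of M g f] assms by simp

lemma ereal_abs_continuous: "continuous_on S f \<Longrightarrow> continuous_on S (\<lambda>x. max (f x) (- f x :: ereal))"
  by (intro continuous_on_max continuous_on_compose2[OF continuous_uminus_ereal]) auto

lemma ereal_vec_nth: "ereal_vec x $ i = ereal (x $ i)"
  by (simp add: ereal_vec_def)

text \<open>A continuous separation of the cube [-R, R]^d, where it is 0, from a neighbourhood of
  the infinite points, where it is 1. Each summand moves from 0 to 1 while the size of that
  coordinate moves from \<open>R\<close> to \<open>R + 1\<close>.\<close>

definition cutoff :: "real \<Rightarrow> ereal^'n \<Rightarrow> real" where
  "cutoff R y = min 1 (\<Sum>i\<in>UNIV. cap (R + 1) (y $ i) - cap R (y $ i))"

lemma cap_mono: "0 < R \<Longrightarrow> cap R e \<le> cap (R + 1) e"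
  by (cases e) (auto simp: cap_real cap_infinity)

lemma cutoff_bounds: "0 < R \<Longrightarrow> 0 \<le> cutoff R y" "cutoff R y \<le> 1"
  by (auto simp: cutoff_def intro!: sum_nonneg cap_mono)

lemma cutoff_continuous: "0 < R \<Longrightarrow> continuous_on UNIV (cutoff R :: ereal^'n \<Rightarrow> real)"
  unfolding cutoff_def[abs_def] by (intro continuous_intros cap_comp_continuous) auto

lemma cutoff_eq_0: "0 < R \<Longrightarrow> (\<And>i. \<bar>y $ i\<bar> \<le> ereal R) \<Longrightarrow> cutoff R y = 0"
proof -
  assume R: "0 < R" and y: "\<And>i. \<bar>y $ i\<bar> \<le> ereal R"
  have "cap (R + 1) (y $ i) - cap R (y $ i) = 0" for i
    using R y[of i] by (cases "y $ i") (auto simp: cap_real)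
  then show ?thesis by (simp add: cutoff_def)
qed

lemma cutoff_eq_1: "0 < R \<Longrightarrow> ereal (R + 1) \<le> \<bar>y $ i\<bar> \<Longrightarrow> cutoff R y = 1"
proof -
  assume R: "0 < R" and y: "ereal (R + 1) \<le> \<bar>y $ i\<bar>"
  have "1 = cap (R + 1) (y $ i) - cap R (y $ i)"
    using R y by (cases "y $ i") (auto simp: cap_real cap_infinity)
  also have "\<dots> \<le> (\<Sum>i\<in>UNIV. cap (R + 1) (y $ i) - cap R (y $ i))"
    using R cap_mono by (intro member_le_sum) auto
  finally show ?thesis by (simp add: cutoff_def)
qed

text \<open>Infinite coordinates are sent to 0, so the map is measurable but discontinuous there. It
  is applied where infinite points are null or next to a factor that vanishes near them.\<close>

definition real_part :: "ereal^'n \<Rightarrow> real^'n" where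
  "real_part y = (\<chi> i. real_of_ereal (y $ i))"

lemma real_part_ereal_vec [simp]: "real_part (ereal_vec x) = x"
  by (simp add: real_part_def ereal_vec_def vec_eq_iff)

lemma borel_measurable_real_part: "real_part \<in> borel_measurable borel"
  unfolding real_part_def[abs_def]
  by (rule borel_measurable_vecI) (simp add: borel_measurable_real_of_ereal borel_measurable_vec_nth_gen)

lemma range_ereal_vec: "range (ereal_vec :: real^'n \<Rightarrow> _) = {y. \<forall>i. \<bar>y $ i\<bar> \<noteq> \<infinity>}"
proof -
  have "y = ereal_vec (real_part y)" if "\<And>i. \<bar>y $ i\<bar> \<noteq> \<infinity>" for y :: "ereal^'n"
    using that by (auto simp: ereal_vec_def real_part_def vec_eq_iff ereal_real')
  then show ?thesis by (auto simp: ereal_vec_def)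
qed

lemma ereal_vec_continuous: "continuous_on UNIV (ereal_vec :: real^'n \<Rightarrow> _)"
  unfolding ereal_vec_def[abs_def] by (intro continuous_intros)

lemma borel_measurable_ereal_vec: "ereal_vec \<in> borel_measurable borel"
  by (rule borel_measurable_continuous_onI) (rule ereal_vec_continuous)

text \<open>Two open sets cover the space: the finite points, where \<open>real_part\<close> is
  continuous, and the points with some coordinate beyond \<open>R + 1\<close>, where the factor 1 -
  cutoff is identically 0.\<close>

lemma cutoff_extension_continuous:
  fixes g :: "real^'n \<Rightarrow> real"
  assumes g: "continuous_on UNIV g" and R: "0 < R"
  shows "continuous_on UNIV (\<lambda>y. g (real_part y) * (1 - cutoff R y))"
proof -
  let ?f = "\<lambda>y. g (real_part y) * (1 - cutoff R y)"
  let ?U = "{y :: ereal^'n. \<forall>i. y $ i \<in> - {\<infinity>, -\<infinity>}}"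
  let ?V = "\<Union>i. {y :: ereal^'n. ereal (R + 1) < max (y $ i) (- (y $ i))}"
  have U: "open ?U" by (intro open_vector_box) (auto intro!: open_Compl)
  have V: "open ?V" by (intro open_UN ballI open_Collect_less ereal_abs_continuous continuous_intros)
  have mx: "max e (- e) = \<bar>e\<bar>" for e :: ereal by (cases e) (auto simp: max_def)
  have "continuous_on ?U (\<lambda>y. real_part y)"
    unfolding real_part_def
    by (intro continuous_intros continuous_on_compose2[OF continuous_on_real]) auto
  then have "continuous_on ?U ?f"
    by (intro continuous_intros continuous_on_compose2[OF g] continuous_on_subset[OF cutoff_continuous[OF R]]) auto
  moreover have "continuous_on ?V ?f"
  proof (subst continuous_on_cong[OF refl])
    fix y assume "y \<in> ?V"
    then obtain i where "ereal (R + 1) < \<bar>y $ i\<bar>" by (auto simp: mx)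
    then have "ereal (R + 1) \<le> \<bar>y $ i\<bar>" by (rule less_imp_le)
    then have "cutoff R y = 1" by (rule cutoff_eq_1[OF R])
    then show "?f y = 0" by simp
  qed simp
  ultimately have "continuous_on (?U \<union> ?V) ?f" using U V by (intro continuous_on_open_Un)
  moreover have "?U \<union> ?V = UNIV"
  proof -
    have "y \<in> ?V" if nU: "y \<notin> ?U" for y
    proof -
      obtain i where "y $ i = \<infinity> \<or> y $ i = - \<infinity>" using nU by auto
      then have "\<bar>y $ i\<bar> = \<infinity>" by auto
      then show ?thesis by (auto simp: mx intro!: exI[of _ i])
    qed
    then show ?thesis by blast
  qed
  ultimately show ?thesis by simp
qed

section \<open>Vague convergence and test functions on R^d\<close>

lemma scale_measure_eq_density: "scale_measure r M = density M (\<lambda>_. r)"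
  by (rule measure_eqI) (auto simp: emeasure_density_const)

lemma space_scaled_law: "space (scaled_law M X s c) = - {0}"
  by (simp add: scaled_law_def space_scale_measure space_restrict_space)

text \<open>The condition \<open>f 0 = 0\<close> lets the removed origin be put back. For
  \<open>c = 0\<close> both sides are 0, since division by 0 gives 0.\<close>

lemma integral_scaled_law:
  fixes X :: "'w \<Rightarrow> real^'n" and f :: "ereal^'n \<Rightarrow> real"
  assumes X: "X \<in> borel_measurable M" and f: "f \<in> borel_measurable borel" "f 0 = 0" and c: "0 \<le> c"
  shows "(\<integral>y. f y \<partial>scaled_law M X s c) = (\<integral>\<omega>. f (ereal_vec (inverse s *\<^sub>R X \<omega>)) \<partial>M) / c"
proof -
  let ?Y = "\<lambda>\<omega>. ereal_vec (inverse s *\<^sub>R X \<omega>)"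
  let ?R = "restrict_space (distr M borel ?Y) (- {0})"
  have Y: "?Y \<in> measurable M borel"
    using X by (intro measurable_compose[OF _ borel_measurable_ereal_vec]) measurable
  have fR: "f \<in> borel_measurable ?R"
    using f(1) by (intro measurable_restrict_space1) simp
  have "(\<integral>y. f y \<partial>scaled_law M X s c) = (\<integral>y. (1 / c) *\<^sub>R f y \<partial>?R)"
    unfolding scaled_law_def scale_measure_eq_density using c fR by (subst integral_density) auto
  also have "\<dots> = (1 / c) * (\<integral>y. f y \<partial>?R)" by simp
  also have "(\<integral>y. f y \<partial>?R) = (\<integral>y. indicator (- {0}) y *\<^sub>R f y \<partial>distr M borel ?Y)"
    using Compl_0_borel by (intro integral_restrict_space) auto
  also have "(\<lambda>y. indicator (- {0}) y *\<^sub>R f y) = f" using f(2) by (auto simp: indicator_def)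
  also have "(\<integral>y. f y \<partial>distr M borel ?Y) = (\<integral>\<omega>. f (?Y \<omega>) \<partial>M)"
    by (rule integral_distr[OF Y f(1)])
  finally show ?thesis by simp
qed

text \<open>Since the whole extended space is compact, so is the closed set where some coordinate
  has size at least \<open>r\<close>. Vanishing near 0 therefore already means compact support in
  the punctured space.\<close>

lemma vague_tendstoD:
  fixes f :: "ereal^'n \<Rightarrow> real"
  assumes v: "vague_tendsto \<nu> \<mu> F" and f: "continuous_on UNIV f"
    and r: "0 < r" "\<And>y. (\<And>i. \<bar>y $ i\<bar> < ereal r) \<Longrightarrow> f y = 0"
  shows "((\<lambda>s. \<integral>x. f x \<partial>\<nu> s) \<longlongrightarrow> (\<integral>x. f x \<partial>\<mu>)) F"
proof -
  let ?K = "\<Union>i. {y :: ereal^'n. ereal r \<le> max (y $ i) (- (y $ i))}"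
  have mx: "max e (- e) = \<bar>e\<bar>" for e :: ereal by (cases e) (auto simp: max_def)
  have "closed ?K" by (intro closed_UN finite ballI closed_Collect_le ereal_abs_continuous continuous_intros)
  then have K: "compact ?K" using closed_Int_compact[OF _ compact_UNIV_ereal_vec] by fastforce
  have K0: "?K \<subseteq> - {0}" using r(1) by (auto simp: mx)
  have z: "f x = 0" if "x \<in> - {0} - ?K" for x
    using that by (intro r(2)) (auto simp: mx not_le)
  have c: "continuous_on (- {0}) f" using f continuous_on_subset by blast
  show ?thesis
  proof (rule v[unfolded vague_tendsto_def, THEN spec, THEN mp])
    show "continuous_on (- {0}) f \<and> (\<exists>K. compact K \<and> K \<subseteq> - {0} \<and> (\<forall>x\<in>- {0} - K. f x = 0))"
      by (intro conjI exI[of _ ?K] ballI c K K0 z)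
  qed
qed

text \<open>A vague test function is continuous only off the origin and its value at 0 is arbitrary.
  Compactness keeps its support outside a cube around 0, so resetting that value to 0 makes it
  continuous everywhere.\<close>

lemma vague_test_cases:
  fixes f :: "ereal^'n \<Rightarrow> real"
  assumes f: "continuous_on (- {0}) f" and K: "compact K" "K \<subseteq> - {0}" "\<And>x. x \<in> - {0} - K \<Longrightarrow> f x = 0"
  obtains f' r where "continuous_on UNIV f'" "\<And>y. y \<noteq> 0 \<Longrightarrow> f' y = f y" "0 < r" "\<And>y. (\<And>i. \<bar>y $ i\<bar> < ereal r) \<Longrightarrow> f' y = 0"
proof -
  have mx: "max e (- e) = \<bar>e\<bar>" for e :: ereal by (cases e) (auto simp: max_def)
  define U where "U r = (\<Union>i. {y :: ereal^'n. ereal r < max (y $ i) (- (y $ i))})" for r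
  have U: "open (U r)" for r
    unfolding U_def by (intro open_UN ballI open_Collect_less ereal_abs_continuous continuous_intros)
  have cover: "- {0} \<subseteq> (\<Union>n. U (1 / real (Suc n)))"
  proof
    fix y :: "ereal^'n" assume "y \<in> - {0}"
    then obtain i where "y $ i \<noteq> 0" by (auto simp: vec_eq_iff)
    then have "0 < \<bar>y $ i\<bar>" by (cases "y $ i") (auto simp: zero_ereal_def)
    then obtain q where q: "0 < ereal q" "ereal q < \<bar>y $ i\<bar>" using ereal_dense2 by blast
    then obtain n where "1 / real (Suc n) < q" using nat_approx_posE[of q] by auto
    then have "ereal (1 / real (Suc n)) < \<bar>y $ i\<bar>" using q(2) by (meson ereal_less_le less_ereal.simps(1) less_trans)
    then show "y \<in> (\<Union>n. U (1 / real (Suc n)))" unfolding U_def mx by blast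
  qed
  \<comment> \<open>A finite subcover of \<open>K\<close> by the sets \<open>U (1 / (n + 1))\<close>
    yields a whole cube around the origin that \<open>K\<close> misses.\<close>
  obtain I where I: "finite I" "K \<subseteq> (\<Union>n\<in>I. U (1 / real (Suc n)))"
    by (rule compactE_image[OF K(1), of UNIV "\<lambda>n. U (1 / real (Suc n))"]) (use U K(2) cover in auto)
  \<comment> \<open>Inserting 1 makes the minimum meaningful when the subcover is empty.\<close>
  define r where "r = Min (insert 1 ((\<lambda>n. 1 / real (Suc n)) ` I))"
  have r: "0 < r" "\<And>n. n \<in> I \<Longrightarrow> r \<le> 1 / real (Suc n)" using I(1) by (auto simp: r_def)
  define f' where "f' y = (if y = 0 then 0 else f y)" for y
  have f'0: "f' y = 0" if "\<And>i. \<bar>y $ i\<bar> < ereal r" for y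
  proof -
    have "y \<notin> K"
    proof
      assume "y \<in> K"
      then obtain n i where n: "n \<in> I" "ereal (1 / real (Suc n)) < \<bar>y $ i\<bar>" using I(2) by (auto simp: U_def mx)
      have "\<bar>y $ i\<bar> < ereal (1 / real (Suc n))"
        by (rule less_le_trans[OF that]) (use r(2)[OF n(1)] in simp)
      with n(2) show False by (simp add: less_asym)
    qed
    then show ?thesis using K(3)[of y] by (auto simp: f'_def)
  qed
  let ?W = "{y :: ereal^'n. \<forall>i. y $ i \<in> {- ereal r<..<ereal r}}"
  have W: "open ?W" by (intro open_vector_box) auto
  have Wb: "\<bar>y $ i\<bar> < ereal r" if "y \<in> ?W" for y i
    using that by (cases "y $ i") (auto simp: abs_less_iff dest!: spec[of _ i])
  have op0: "open (- {0 :: ereal^'n})"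
  proof -
    have pe: "0 < \<bar>e\<bar> \<longleftrightarrow> e \<noteq> 0" for e :: ereal by (cases e) (auto simp: zero_ereal_def)
    have "y \<noteq> 0 \<longleftrightarrow> (\<exists>i. ereal 0 < \<bar>y $ i\<bar>)" for y :: "ereal^'n"
      unfolding zero_ereal_def[symmetric] pe by (simp add: vec_eq_iff)
    then have "- {0 :: ereal^'n} = U 0" unfolding U_def mx by blast
    then show ?thesis using U by simp
  qed
  have "continuous_on (- {0}) f'"
    using f by (subst continuous_on_cong[OF refl, of _ _ f]) (auto simp: f'_def)
  moreover have "continuous_on ?W f'"
    by (subst continuous_on_cong[OF refl, of _ _ "\<lambda>_. 0"]) (auto intro!: f'0 Wb)
  ultimately have "continuous_on (- {0} \<union> ?W) f'" using op0 W by (intro continuous_on_open_Un)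
  moreover have "- {0} \<union> ?W = UNIV" using r(1) by auto
  ultimately have c: "continuous_on UNIV f'" by simp
  show thesis
    by (rule that[OF c _ r(1) f'0]) (auto simp: f'_def)
qed

definition real_tail :: "(ereal^'n) measure \<Rightarrow> (real^'n) measure" where
  "real_tail \<mu> = distr \<mu> borel real_part"

text \<open>The word finite refers to the points that carry the measure, not to its total mass,
  which may be infinite near the origin.\<close>

locale finite_radon =
  fixes N :: "real^'n \<Rightarrow> real" and \<mu> :: "(ereal^'n) measure"
  assumes N: "is_norm N" and radon: "radon_measure N \<mu>" and no_inf: "emeasure \<mu> (- range ereal_vec) = 0"
begin

lemma sets_mu: "sets \<mu> = sets punctured_borel" and space_mu: "space \<mu> = - {0}"
proof -
  show 1: "sets \<mu> = sets punctured_borel" using radon by (simp add: radon_measure_def)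
  show "space \<mu> = - {0}" using sets_eq_imp_space_eq[OF 1] by (simp add: space_punctured_borel)
qed

lemma in_sets_mu: "B \<in> sets borel \<Longrightarrow> 0 \<notin> B \<Longrightarrow> B \<in> sets \<mu>"
  by (auto simp: sets_mu sets_punctured_borel_iff)

lemma measurable_mu: "f \<in> measurable borel L \<Longrightarrow> f \<in> measurable \<mu> L"
  by (subst measurable_cong_sets[OF sets_mu refl]) (simp add: punctured_borel_def measurable_restrict_space1)

lemma AE_finite: "AE y in \<mu>. y \<in> range ereal_vec"
proof (rule AE_I')
  have "- range (ereal_vec :: real^'n \<Rightarrow> _) \<in> sets borel"
    using sets.compl_sets[OF ereal_vec_image_borel[of UNIV]] by (simp add: Compl_eq_Diff_UNIV)
  moreover have "0 \<notin> - range (ereal_vec :: real^'n \<Rightarrow> _)" by (auto simp: range_ereal_vec)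
  ultimately show "- range ereal_vec \<in> null_sets \<mu>" using no_inf in_sets_mu by (auto intro!: null_setsI)
qed auto

lemma emeasure_far: "0 < r \<Longrightarrow> emeasure \<mu> {y. \<exists>i. ereal r \<le> \<bar>y $ i\<bar>} < \<infinity>"
proof -
  assume r: "0 < r"
  obtain c C where c: "0 < c" "\<And>x. c * norm x \<le> N x" using is_norm_equiv[OF N] by metis
  let ?B = "- (ereal_vec ` {x. N x < c * r})"
  have "{y. \<exists>i. ereal r \<le> \<bar>y $ i\<bar>} \<subseteq> ?B"
  proof clarsimp
    fix i x assume "ereal r \<le> \<bar>ereal_vec x $ i\<bar>" and Nx: "N x < c * r"
    then have "r \<le> \<bar>x $ i\<bar>" by (simp add: ereal_vec_def)
    also have "\<dots> \<le> norm x" by (rule component_le_norm_cart)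
    finally have "c * r \<le> N x" using c by (meson mult_left_mono less_imp_le order_trans)
    then show False using Nx by simp
  qed
  moreover have fin: "emeasure \<mu> ?B < \<infinity>" using radon c(1) r by (simp add: radon_measure_def)
  moreover have "?B \<in> sets \<mu>"
  proof (rule in_sets_mu)
    have "{x. N x < c * r} \<in> sets borel"
      using is_norm_continuous[OF N] by (intro borel_open open_Collect_less) auto
    then show "?B \<in> sets borel"
      using sets.compl_sets[OF ereal_vec_image_borel] by (simp add: Compl_eq_Diff_UNIV)
    have "N 0 = 0" using N by (simp add: is_norm_def)
    then show "0 \<notin> ?B" using c(1) r ereal_vec_eq_0_iff[of "0::real^'n"] by (auto intro!: image_eqI[of _ _ 0])
  qed
  ultimately show ?thesis by (meson emeasure_mono le_less_trans)
qed

lemma far_sets: "0 < r \<Longrightarrow> {y. \<exists>i. ereal r \<le> \<bar>y $ i\<bar>} \<in> sets \<mu>"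
proof (rule in_sets_mu)
  have [measurable]: "(\<lambda>y :: ereal^'n. y $ i) \<in> borel_measurable borel" for i
    by (rule borel_measurable_vec_nth_gen)
  show "{y :: ereal^'n. \<exists>i. ereal r \<le> \<bar>y $ i\<bar>} \<in> sets borel" by measurable
qed auto

lemma far_integrable:
  fixes f :: "ereal^'n \<Rightarrow> real"
  assumes f: "f \<in> borel_measurable borel" and B: "\<And>y. \<bar>f y\<bar> \<le> B"
    and r: "0 < r" "\<And>y. (\<And>i. \<bar>y $ i\<bar> < ereal r) \<Longrightarrow> f y = 0"
  shows "integrable \<mu> f"
proof (rule Bochner_Integration.integrable_bound)
  let ?S = "{y. \<exists>i. ereal r \<le> \<bar>y $ i\<bar>}"
  show "integrable \<mu> (\<lambda>y. indicator ?S y * B)"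
    by (intro integrable_mult_left integrable_real_indicator far_sets emeasure_far r)
  show "f \<in> borel_measurable \<mu>" by (rule measurable_mu[OF f])
  show "AE y in \<mu>. norm (f y) \<le> norm (indicator ?S y * B)"
    using B r(2) by (intro AE_I2) (auto simp: indicator_def not_le intro: order_trans[OF _ abs_ge_self])
qed

lemma integral_real_tail:
  fixes g :: "real^'n \<Rightarrow> 'b::{banach, second_countable_topology}"
  shows "g \<in> borel_measurable borel \<Longrightarrow> (\<integral>x. g x \<partial>real_tail \<mu>) = (\<integral>y. g (real_part y) \<partial>\<mu>)"
  unfolding real_tail_def
  by (rule integral_distr[OF measurable_mu[OF borel_measurable_real_part]])

lemma integral_mu:
  fixes f :: "ereal^'n \<Rightarrow> real"
  assumes "f \<in> borel_measurable borel"
  shows "(\<integral>y. f y \<partial>\<mu>) = (\<integral>x. f (ereal_vec x) \<partial>real_tail \<mu>)"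
proof -
  have "(\<integral>x. f (ereal_vec x) \<partial>real_tail \<mu>) = (\<integral>y. f (ereal_vec (real_part y)) \<partial>\<mu>)"
    by (rule integral_real_tail) (rule measurable_compose[OF borel_measurable_ereal_vec assms])
  also have "\<dots> = (\<integral>y. f y \<partial>\<mu>)"
  proof (rule integral_cong_AE)
    show "AE y in \<mu>. f (ereal_vec (real_part y)) = f y"
      using AE_finite by eventually_elim auto
  qed (intro measurable_mu measurable_compose[OF borel_measurable_real_part] measurable_compose[OF borel_measurable_ereal_vec] assms)+
  finally show ?thesis by simp
qed

lemma emeasure_mu:
  assumes "B \<in> sets \<mu>"
  shows "emeasure \<mu> B = emeasure (real_tail \<mu>) (ereal_vec -` B)"
proof -
  have B: "B \<in> sets borel" using assms by (auto simp: sets_mu sets_punctured_borel_iff)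
  have m: "ereal_vec -` B \<in> sets (borel :: (real^'n) measure)"
    using measurable_sets[OF borel_measurable_ereal_vec B] by simp
  have "emeasure (real_tail \<mu>) (ereal_vec -` B) = emeasure \<mu> (real_part -` (ereal_vec -` B) \<inter> space \<mu>)"
    unfolding real_tail_def by (rule emeasure_distr[OF measurable_mu[OF borel_measurable_real_part] m])
  also have "\<dots> = emeasure \<mu> B"
  proof (rule emeasure_eq_AE)
    show "AE y in \<mu>. (y \<in> real_part -` (ereal_vec -` B) \<inter> space \<mu>) = (y \<in> B)"
      using AE_finite AE_space by eventually_elim auto
    show "real_part -` (ereal_vec -` B) \<inter> space \<mu> \<in> sets \<mu>"
      by (rule measurable_sets[OF measurable_mu[OF borel_measurable_real_part] m])
  qed (rule assms)
  finally show ?thesis by simp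
qed

lemma tail_finite_real_tail: "tail_finite (real_tail \<mu>)"
  unfolding tail_finite_def
proof (intro conjI allI impI)
  show "sets (real_tail \<mu>) = sets borel" by (simp add: real_tail_def)
  have mr: "real_part \<in> measurable \<mu> borel" by (rule measurable_mu[OF borel_measurable_real_part])
  have "emeasure (real_tail \<mu>) {0} = emeasure \<mu> (real_part -` {0} \<inter> space \<mu>)"
    unfolding real_tail_def by (rule emeasure_distr[OF mr]) simp
  also have "\<dots> = emeasure \<mu> {}"
  proof (rule emeasure_eq_AE)
    show "AE y in \<mu>. (y \<in> real_part -` {0} \<inter> space \<mu>) = (y \<in> {})"
      using AE_finite AE_space by eventually_elim (auto simp: space_mu ereal_vec_eq_0_iff)
    show "real_part -` {0} \<inter> space \<mu> \<in> sets \<mu>" by (rule measurable_sets[OF mr]) simp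
  qed simp
  finally show "emeasure (real_tail \<mu>) {0} = 0" by simp
  fix r :: real assume r: "0 < r"
  let ?d = "real CARD('n)"
  have d: "0 < ?d" by simp
  have "emeasure (real_tail \<mu>) {x. r \<le> norm x} = emeasure \<mu> (real_part -` {x. r \<le> norm x} \<inter> space \<mu>)"
    unfolding real_tail_def by (rule emeasure_distr[OF mr]) simp
  \<comment> \<open>The norm is at most the sum of the coordinate sizes, so a vector of norm at
    least \<open>r\<close> has a coordinate of size at least r divided by the dimension.\<close>
  also have "\<dots> \<le> emeasure \<mu> {y. \<exists>i. ereal (r / ?d) \<le> \<bar>y $ i\<bar>}"
  proof (rule emeasure_mono_AE)
    show "AE y in \<mu>. y \<in> real_part -` {x. r \<le> norm x} \<inter> space \<mu> \<longrightarrow> y \<in> {y. \<exists>i. ereal (r / ?d) \<le> \<bar>y $ i\<bar>}"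
      using AE_finite
    proof eventually_elim
      case (elim y)
      then obtain x where y: "y = ereal_vec x" by auto
      have "\<exists>i. r / ?d \<le> \<bar>x $ i\<bar>" if "r \<le> norm x"
      proof (rule ccontr)
        assume "\<not> ?thesis"
        then have "(\<Sum>i\<in>UNIV. \<bar>x $ i\<bar>) < (\<Sum>i\<in>(UNIV::'n set). r / ?d)"
          by (intro sum_strict_mono) (auto simp: not_le)
        also have "\<dots> = r" using d by simp
        finally show False using that norm_le_l1_cart[of x] by simp
      qed
      then show ?case by (auto simp: y ereal_vec_nth)
    qed
    show "{y. \<exists>i. ereal (r / ?d) \<le> \<bar>y $ i\<bar>} \<in> sets \<mu>" using r d by (intro far_sets) simp
  qed
  also have "\<dots> < \<infinity>" using r d by (intro emeasure_far) simp
  finally show "emeasure (real_tail \<mu>) {x. r \<le> norm x} < \<infinity>" .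
qed

text \<open>Tightness at infinity: the cutoffs tend to 0 at every finite point and the infinite
  points carry no mass. All cutoffs are dominated by the indicator of one set of finite
  mass.\<close>

lemma cutoff_integral_tendsto: "(\<lambda>n. \<integral>y. cutoff (real (Suc n)) y \<partial>\<mu>) \<longlonglongrightarrow> 0"
proof -
  have "(\<lambda>n. \<integral>y. cutoff (real (Suc n)) y \<partial>\<mu>) \<longlonglongrightarrow> (\<integral>y. 0 \<partial>\<mu>)"
  proof (rule integral_dominated_convergence[where w="indicator {y. \<exists>i. ereal 1 \<le> \<bar>y $ i\<bar>}"])
    show "integrable \<mu> (indicat_real {y. \<exists>i. ereal 1 \<le> \<bar>y $ i\<bar>})"
      by (intro integrable_real_indicator far_sets emeasure_far) auto
    show "cutoff (real (Suc n)) \<in> borel_measurable \<mu>" for n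
      by (intro measurable_mu borel_measurable_continuous_onI cutoff_continuous) simp
    show "AE y in \<mu>. (\<lambda>n. cutoff (real (Suc n)) y) \<longlonglongrightarrow> 0"
      using AE_finite
    proof eventually_elim
      case (elim y)
      then obtain x where y: "y = ereal_vec x" by auto
      obtain k :: nat where k: "norm x \<le> real k" using real_arch_simple by blast
      have "cutoff (real (Suc n)) y = 0" if "k \<le> n" for n
      proof (rule cutoff_eq_0)
        fix i
        have "\<bar>x $ i\<bar> \<le> norm x" by (rule component_le_norm_cart)
        then show "\<bar>y $ i\<bar> \<le> ereal (real (Suc n))" using k that by (simp add: y ereal_vec_def)
      qed simp
      then show ?case by (intro tendsto_eventually eventually_sequentiallyI[of k]) auto
    qed
    show "AE y in \<mu>. norm (cutoff (real (Suc n)) y) \<le> indicator {y. \<exists>i. ereal 1 \<le> \<bar>y $ i\<bar>} y" for n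
    proof (intro AE_I2)
      fix y
      have "cutoff (real (Suc n)) y = 0" if "\<not> (\<exists>i. ereal 1 \<le> \<bar>y $ i\<bar>)"
      proof (rule cutoff_eq_0)
        fix i
        have "\<bar>y $ i\<bar> \<le> ereal 1" using that by (auto simp: not_le intro: less_imp_le)
        also have "\<dots> \<le> ereal (real (Suc n))" by simp
        finally show "\<bar>y $ i\<bar> \<le> ereal (real (Suc n))" .
      qed simp
      then show "norm (cutoff (real (Suc n)) y) \<le> indicator {y. \<exists>i. ereal 1 \<le> \<bar>y $ i\<bar>} y"
        using cutoff_bounds[of "real (Suc n)" y] by (auto simp: indicator_def)
    qed
  qed auto
  then show ?thesis by simp
qed

text \<open>A far test function need not extend to infinity, so it is multiplied by 1 - cutoff. The
  error is at most the bound \<open>B\<close> times the integral of the cutoff. For the limit this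
  is small by \<open>cutoff_integral_tendsto\<close>, and then for the laws as well, because the
  cutoff is itself an admissible vague test function.\<close>

lemma vague_imp_far_test:
  assumes M: "prob_space M" and X: "X \<in> borel_measurable M" and b: "\<And>s. 0 \<le> b s"
    and v: "vague_tendsto (\<lambda>s. scaled_law M X (\<sigma> s) (b s)) \<mu> F" and g: "far_test g"
  shows "((\<lambda>s. (\<integral>\<omega>. g (inverse (\<sigma> s) *\<^sub>R X \<omega>) \<partial>M) / b s) \<longlongrightarrow> (\<integral>x. g x \<partial>real_tail \<mu>)) F"
proof -
  interpret prob_space M by fact
  obtain r B where r: "0 < r" "\<And>x. norm x < r \<Longrightarrow> g x = 0" and B: "\<And>x. \<bar>g x\<bar> \<le> B" and gm [measurable]: "g \<in> borel_measurable borel"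
    using far_testE[OF g] by blast
  have gc: "continuous_on UNIV g" using g by (simp add: far_test_def)
  have B0: "0 \<le> B" using B[of 0] by linarith
  let ?d = "real CARD('n)"
  have d: "0 < ?d" by simp
  have gz: "g (real_part y) = 0" if "\<And>i. \<bar>y $ i\<bar> < ereal (r / ?d)" for y
  proof (rule r(2))
    have "\<bar>real_part y $ i\<bar> < r / ?d" for i using that[of i] by (cases "y $ i") (auto simp: real_part_def)
    then have "(\<Sum>i\<in>UNIV. \<bar>real_part y $ i\<bar>) < (\<Sum>i\<in>(UNIV::'n set). r / ?d)"
      by (intro sum_strict_mono) auto
    then show "norm (real_part y) < r" using norm_le_l1_cart[of "real_part y"] d by simp
  qed
  define f where "f n y = g (real_part y) * (1 - cutoff (real (Suc n)) y)" for n and y :: "ereal^'n"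
  define h :: "nat \<Rightarrow> ereal^'n \<Rightarrow> real" where "h n = cutoff (real (Suc n))" for n
  let ?Y = "\<lambda>s \<omega>. inverse (\<sigma> s) *\<^sub>R X \<omega>"
  have Ym [measurable]: "?Y s \<in> borel_measurable M" for s using X by measurable
  have fc: "continuous_on UNIV (f n)" for n
    unfolding f_def by (rule cutoff_extension_continuous[OF gc]) simp
  have hc: "continuous_on UNIV (h n)" for n unfolding h_def by (rule cutoff_continuous) simp
  have hb: "0 \<le> h n y" "h n y \<le> 1" for n y using cutoff_bounds[of "real (Suc n)" y] by (auto simp: h_def)
  have fm: "f n \<in> borel_measurable borel" and hm: "h n \<in> borel_measurable borel" for n
    using fc hc by (auto intro: borel_measurable_continuous_onI)
  have fz: "f n y = 0" if "\<And>i. \<bar>y $ i\<bar> < ereal (r / ?d)" for n y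
    using gz[OF that] by (simp add: f_def)
  have hz: "h n y = 0" if "\<And>i. \<bar>y $ i\<bar> < ereal 1" for n y
    unfolding h_def
  proof (rule cutoff_eq_0)
    fix i
    have "\<bar>y $ i\<bar> \<le> ereal 1" using that[of i] by simp
    also have "\<dots> \<le> ereal (real (Suc n))" by simp
    finally show "\<bar>y $ i\<bar> \<le> ereal (real (Suc n))" .
  qed simp
  have rd: "0 < r / ?d" using r(1) d by simp
  have f0: "f n 0 = 0" and h0: "h n 0 = 0" for n using fz[of 0 n] hz[of 0 n] rd by auto
  define a where "a s = (\<integral>\<omega>. g (?Y s \<omega>) \<partial>M) / b s" for s
  define A where "A = (\<integral>x. g x \<partial>real_tail \<mu>)"
  have lf: "((\<lambda>s. (\<integral>\<omega>. f n (ereal_vec (?Y s \<omega>)) \<partial>M) / b s) \<longlongrightarrow> (\<integral>y. f n y \<partial>\<mu>)) F" for n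
    using vague_tendstoD[OF v fc rd fz] unfolding integral_scaled_law[OF X fm f0 b] .
  have lh: "((\<lambda>s. (\<integral>\<omega>. h n (ereal_vec (?Y s \<omega>)) \<partial>M) / b s) \<longlongrightarrow> (\<integral>y. h n y \<partial>\<mu>)) F" for n
    using vague_tendstoD[OF v hc zero_less_one hz] unfolding integral_scaled_law[OF X hm h0 b] .
  have d1: "\<bar>a s - (\<integral>\<omega>. f n (ereal_vec (?Y s \<omega>)) \<partial>M) / b s\<bar> \<le> B * ((\<integral>\<omega>. h n (ereal_vec (?Y s \<omega>)) \<partial>M) / b s)" for n s
  proof -
    have i1: "integrable M (\<lambda>\<omega>. g (?Y s \<omega>))"
      by (rule integrable_const_bound[of _ B]) (use B in auto)
    have m1: "(\<lambda>\<omega>. f n (ereal_vec (?Y s \<omega>))) \<in> borel_measurable M" "(\<lambda>\<omega>. h n (ereal_vec (?Y s \<omega>))) \<in> borel_measurable M"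
      by (intro measurable_compose[OF Ym] measurable_compose[OF borel_measurable_ereal_vec] fm hm)+
    have i3: "integrable M (\<lambda>\<omega>. h n (ereal_vec (?Y s \<omega>)))"
      by (rule integrable_const_bound[of _ 1]) (use hb m1 in auto)
    have fb: "\<bar>f n y\<bar> \<le> B" for y
    proof -
      have "\<bar>g (real_part y)\<bar> * \<bar>1 - h n y\<bar> \<le> B * 1" using B hb B0 by (intro mult_mono) auto
      then show ?thesis by (simp add: f_def h_def abs_mult)
    qed
    have i2: "integrable M (\<lambda>\<omega>. f n (ereal_vec (?Y s \<omega>)))"
      by (rule integrable_const_bound[of _ B]) (use fb m1 in auto)
    have "\<bar>(\<integral>\<omega>. g (?Y s \<omega>) \<partial>M) - (\<integral>\<omega>. f n (ereal_vec (?Y s \<omega>)) \<partial>M)\<bar> = \<bar>\<integral>\<omega>. g (?Y s \<omega>) - f n (ereal_vec (?Y s \<omega>)) \<partial>M\<bar>"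
      using i1 i2 by simp
    also have "\<dots> \<le> (\<integral>\<omega>. B * h n (ereal_vec (?Y s \<omega>)) \<partial>M)"
    proof (rule abs_integral_le)
      fix \<omega>
      have "g (?Y s \<omega>) - f n (ereal_vec (?Y s \<omega>)) = g (?Y s \<omega>) * h n (ereal_vec (?Y s \<omega>))"
        by (simp add: f_def h_def algebra_simps)
      then show "\<bar>g (?Y s \<omega>) - f n (ereal_vec (?Y s \<omega>))\<bar> \<le> B * h n (ereal_vec (?Y s \<omega>))"
        using B hb by (auto simp: abs_mult intro!: mult_mono B0)
    qed (use i1 i2 i3 in auto)
    also have "\<dots> = B * (\<integral>\<omega>. h n (ereal_vec (?Y s \<omega>)) \<partial>M)" by simp
    finally have "\<bar>(\<integral>\<omega>. g (?Y s \<omega>) \<partial>M) - (\<integral>\<omega>. f n (ereal_vec (?Y s \<omega>)) \<partial>M)\<bar> / b s \<le> B * (\<integral>\<omega>. h n (ereal_vec (?Y s \<omega>)) \<partial>M) / b s"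
      using b[of s] by (intro divide_right_mono)
    then show ?thesis using b[of s] by (simp add: a_def diff_divide_distrib[symmetric] abs_divide)
  qed
  have d2: "\<bar>A - (\<integral>y. f n y \<partial>\<mu>)\<bar> \<le> B * (\<integral>y. h n y \<partial>\<mu>)" for n
  proof -
    have A: "A = (\<integral>y. g (real_part y) \<partial>\<mu>)" unfolding A_def by (rule integral_real_tail[OF gm])
    have i1: "integrable \<mu> (\<lambda>y. g (real_part y))"
      by (rule far_integrable[OF measurable_compose[OF borel_measurable_real_part gm] B rd gz])
    have fb: "\<bar>f n y\<bar> \<le> B" for y
    proof -
      have "\<bar>g (real_part y)\<bar> * \<bar>1 - h n y\<bar> \<le> B * 1" using B hb B0 by (intro mult_mono) auto
      then show ?thesis by (simp add: f_def h_def abs_mult)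
    qed
    have i2: "integrable \<mu> (f n)" by (rule far_integrable[OF fm fb rd fz])
    have i3: "integrable \<mu> (h n)" by (rule far_integrable[OF hm _ zero_less_one hz, of n 1]) (use hb in auto)
    have "\<bar>A - (\<integral>y. f n y \<partial>\<mu>)\<bar> = \<bar>\<integral>y. g (real_part y) - f n y \<partial>\<mu>\<bar>" using i1 i2 by (simp add: A)
    also have "\<dots> \<le> (\<integral>y. B * h n y \<partial>\<mu>)"
    proof (rule abs_integral_le)
      fix y
      have "g (real_part y) - f n y = g (real_part y) * h n y"
        by (simp add: f_def h_def algebra_simps)
      then show "\<bar>g (real_part y) - f n y\<bar> \<le> B * h n y"
        using B hb by (auto simp: abs_mult intro!: mult_mono B0)
    qed (use i1 i2 i3 in auto)
    finally show ?thesis by simp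
  qed
  have "(a \<longlongrightarrow> A) F"
  proof (rule tendstoI)
    fix e :: real assume e: "0 < e"
    \<comment> \<open>Error budget: e/8 for each of the two cutoff errors and e/2 for the
      convergence of the truncated integrals. Using \<open>B + 1\<close> avoids dividing by
      0.\<close>
    have Be: "(B + 1) * (e / (8 * (B + 1))) = e / 8" using B0 by (simp add: field_simps)
    have "(\<lambda>n. (\<integral>y. h n y \<partial>\<mu>)) \<longlonglongrightarrow> 0" using cutoff_integral_tendsto by (simp add: h_def)
    from order_tendstoD(2)[OF this, of "e / (8 * (B + 1))"] obtain n where n: "(\<integral>y. h n y \<partial>\<mu>) < e / (8 * (B + 1))"
      using e B0 by (auto simp: eventually_sequentially)
    then have Bn: "B * (\<integral>y. h n y \<partial>\<mu>) \<le> e / 8"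
    proof -
      have "B * (\<integral>y. h n y \<partial>\<mu>) \<le> (B + 1) * (e / (8 * (B + 1)))"
        using n B0 hb by (intro mult_mono integral_nonneg_AE) auto
      then show ?thesis unfolding Be .
    qed
    have "\<forall>\<^sub>F s in F. (\<integral>\<omega>. h n (ereal_vec (?Y s \<omega>)) \<partial>M) / b s < e / (8 * (B + 1))"
      by (rule order_tendstoD(2)[OF lh n])
    moreover have "\<forall>\<^sub>F s in F. dist ((\<integral>\<omega>. f n (ereal_vec (?Y s \<omega>)) \<partial>M) / b s) (\<integral>y. f n y \<partial>\<mu>) < e / 2"
      using e by (intro tendstoD[OF lf]) simp
    ultimately show "\<forall>\<^sub>F s in F. dist (a s) A < e"
    proof eventually_elim
      case (elim s)
      have "B * ((\<integral>\<omega>. h n (ereal_vec (?Y s \<omega>)) \<partial>M) / b s) \<le> (B + 1) * (e / (8 * (B + 1)))"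
        using elim(1) B0 hb b[of s] by (intro mult_mono divide_nonneg_nonneg integral_nonneg_AE) auto
      then have "B * ((\<integral>\<omega>. h n (ereal_vec (?Y s \<omega>)) \<partial>M) / b s) \<le> e / 8" unfolding Be .
      then show ?case using d1[of s n] d2[of n] Bn elim(2) e unfolding dist_real_def by linarith
    qed
  qed
  then show ?thesis unfolding a_def A_def .
qed

end

text \<open>Converse passage: a continuous function on the compact extended space is bounded, so its
  restriction to R^d is a far test function once it vanishes near 0.\<close>

lemma far_test_imp_vague:
  fixes X :: "'w \<Rightarrow> real^'n" and \<mu> :: "(ereal^'n) measure"
  assumes X: "X \<in> borel_measurable M" and b: "\<And>s. 0 \<le> b s" and sp: "space \<mu> = - {0}"
    and lim: "\<And>f r. continuous_on UNIV f \<Longrightarrow> 0 < r \<Longrightarrow> (\<And>y. (\<And>i. \<bar>y $ i\<bar> < ereal r) \<Longrightarrow> f y = 0) \<Longrightarrow>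
       far_test (\<lambda>x. f (ereal_vec x)) \<Longrightarrow>
       ((\<lambda>s. (\<integral>\<omega>. f (ereal_vec (inverse (\<sigma> s) *\<^sub>R X \<omega>)) \<partial>M) / b s) \<longlongrightarrow> (\<integral>y. f y \<partial>\<mu>)) F"
  shows "vague_tendsto (\<lambda>s. scaled_law M X (\<sigma> s) (b s)) \<mu> F"
  unfolding vague_tendsto_def
proof (intro allI impI, elim conjE exE)
  fix f :: "ereal^'n \<Rightarrow> real" and K
  assume f: "continuous_on (- {0}) f" and K: "compact K" "K \<subseteq> - {0}" "\<forall>x\<in>- {0} - K. f x = 0"
  obtain f' r where f': "continuous_on UNIV f'" "\<And>y. y \<noteq> 0 \<Longrightarrow> f' y = f y" and r: "0 < r" "\<And>y. (\<And>i. \<bar>y $ i\<bar> < ereal r) \<Longrightarrow> f' y = 0"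
    using vague_test_cases[OF f K(1,2)] K(3) by blast
  have "bounded (f' ` UNIV)"
    by (intro compact_imp_bounded compact_continuous_image f' compact_UNIV_ereal_vec)
  then obtain B where B: "\<And>x. \<bar>f' x\<bar> \<le> B" unfolding bounded_iff by auto
  have z: "f' (ereal_vec x) = 0" if "norm x < r" for x
  proof (rule r(2))
    fix i
    have "\<bar>x $ i\<bar> \<le> norm x" by (rule component_le_norm_cart)
    then show "\<bar>ereal_vec x $ i\<bar> < ereal r" using that by (simp add: ereal_vec_def)
  qed
  have far: "far_test (\<lambda>x. f' (ereal_vec x))"
    unfolding far_test_def
    using B r(1) z by (auto intro!: continuous_on_compose2[OF f'(1) ereal_vec_continuous])
  have f'm: "f' \<in> borel_measurable borel" using f'(1) by (rule borel_measurable_continuous_onI)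
  have f'0: "f' 0 = 0" using r by simp
  have eq: "(\<integral>y. f y \<partial>L) = (\<integral>y. f' y \<partial>L)" if "space L = - {0}" for L
    using that f'(2) by (intro Bochner_Integration.integral_cong) auto
  show "((\<lambda>s. \<integral>y. f y \<partial>scaled_law M X (\<sigma> s) (b s)) \<longlongrightarrow> (\<integral>y. f y \<partial>\<mu>)) F"
    unfolding eq[OF space_scaled_law] eq[OF sp] integral_scaled_law[OF X f'm f'0 b]
    by (rule lim[OF f'(1) r far])
qed

section \<open>Regularly varying tails\<close>

text \<open>The set on the left is t B, written as a preimage so that its measurability is
  immediate.\<close>

definition homog :: "real \<Rightarrow> (real^'n) measure \<Rightarrow> bool" where
  "homog \<alpha> \<nu> \<longleftrightarrow> (\<forall>t>0. \<forall>B\<in>sets borel. emeasure \<nu> {x. inverse t *\<^sub>R x \<in> B} = ennreal (t powr - \<alpha>) * emeasure \<nu> B)"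

lemma is_normD:
  assumes "is_norm N"
  shows "0 \<le> N x" "N (t *\<^sub>R x) = \<bar>t\<bar> * N x" "N 0 = 0"
  using assms by (auto simp: is_norm_def)

text \<open>The comparison of \<open>V s\<close> with \<open>V (l * s)\<close> is iterated until l^k
  passes s / u. The overshoot is at most one factor \<open>l\<close>, which costs l^p in the
  constant.\<close>

lemma potter_bound:
  fixes V :: "real \<Rightarrow> real"
  assumes anti: "\<And>s t. s \<le> t \<Longrightarrow> V t \<le> V s" and pos: "\<And>s. 0 < V s" and le1: "\<And>s. V s \<le> 1"
    and l: "1 < l" and s0: "0 < s0" and p: "0 < p"
    and step: "\<And>s. s0 \<le> s \<Longrightarrow> V s \<le> l powr p * V (l * s)"
  shows "\<exists>C>0. \<forall>s\<ge>s0. \<forall>u>0. V u \<le> C * (1 + (s / u) powr p) * V s"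
proof -
  have it: "V u \<le> l powr (p * real k) * V (l ^ k * u)" if "s0 \<le> u" for u k
  proof (induction k)
    case (Suc k)
    have "s0 \<le> l ^ k * u" using l that s0 by (smt (verit) mult_le_cancel_right1 one_le_power)
    then have "V (l ^ k * u) \<le> l powr p * V (l * (l ^ k * u))" by (rule step)
    then have "l powr (p * real k) * V (l ^ k * u) \<le> l powr (p * real k) * (l powr p * V (l * (l ^ k * u)))"
      by (intro mult_left_mono) auto
    also have "\<dots> = l powr (p * real (Suc k)) * V (l ^ Suc k * u)"
      by (simp add: powr_add algebra_simps)
    finally show ?case using Suc by simp
  qed (use l in simp)
  have mid: "V u \<le> l powr p * (s / u) powr p * V s" if u: "s0 \<le> u" "u \<le> s" for s u
  proof -
    \<comment> \<open>The least number of steps that carry \<open>u\<close> to \<open>s\<close> or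
      beyond.\<close>
    define k where "k = nat \<lceil>log l (s / u)\<rceil>"
    have u0: "0 < u" using u s0 by linarith
    have su: "1 \<le> s / u" using u u0 by simp
    have lg0: "0 \<le> log l (s / u)" using su l by (simp add: zero_le_log_cancel_iff)
    have k1: "log l (s / u) \<le> real k" "real k \<le> log l (s / u) + 1"
      using lg0 by (auto simp: k_def)
    have "s / u = l powr log l (s / u)" using su l by (simp add: powr_log_cancel)
    also have "\<dots> \<le> l powr real k" using k1 l by (intro powr_mono) auto
    also have "\<dots> = l ^ k" using l by (simp add: powr_realpow)
    finally have "s \<le> l ^ k * u" using u0 by (simp add: field_simps)
    then have "V u \<le> l powr (p * real k) * V s"
      using it[OF u(1), of k] anti[of s "l ^ k * u"] by (smt (verit) mult_left_mono powr_ge_zero)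
    also have "l powr (p * real k) \<le> l powr (p * (log l (s / u) + 1))"
      using k1 l p by (intro powr_mono mult_left_mono) auto
    also have "l powr (p * (log l (s / u) + 1)) = l powr p * (s / u) powr p"
    proof -
      have "l powr (p * (log l (s / u) + 1)) = l powr p * (l powr log l (s / u)) powr p"
        by (simp add: powr_add[symmetric] powr_powr algebra_simps)
      also have "l powr log l (s / u) = s / u" using su l by (simp add: powr_log_cancel)
      finally show ?thesis .
    qed
    finally show ?thesis using pos[of s] by (simp add: mult_right_mono less_imp_le)
  qed
  \<comment> \<open>The summand 1 / V s0 pays for arguments below \<open>s0\<close>: there
    \<open>V u\<close> is at most 1 and the comparison starts at \<open>s0\<close> instead.\<close>
  define C where "C = l powr p * (1 + 1 / V s0)"
  have lp: "1 \<le> l powr p" using l p by (simp add: ge_one_powr_ge_zero)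
  have C: "l powr p \<le> C" "1 \<le> C" "l powr p / V s0 \<le> C"
    using lp pos[of s0] by (auto simp: C_def algebra_simps) (smt (verit) divide_nonneg_pos)
  have "V u \<le> C * (1 + (s / u) powr p) * V s" if s: "s0 \<le> s" and u: "0 < u" for s u
  proof -
    consider "s \<le> u" | "s0 \<le> u" "u \<le> s" | "u < s0" by linarith
    then show ?thesis
    proof cases
      case 1
      have "1 * 1 \<le> C * (1 + (s / u) powr p)" using C by (intro mult_mono) auto
      then have "1 * V s \<le> C * (1 + (s / u) powr p) * V s" using pos[of s] by (intro mult_right_mono) auto
      then show ?thesis using anti[OF 1] by simp
    next
      case 2
      have "l powr p * (s / u) powr p \<le> C * (1 + (s / u) powr p)" using C by (intro mult_mono) auto
      then have "l powr p * (s / u) powr p * V s \<le> C * (1 + (s / u) powr p) * V s" using pos[of s] by (intro mult_right_mono) auto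
      then show ?thesis using mid[OF 2] by linarith
    next
      case 3
      have "V s0 \<le> l powr p * (s / s0) powr p * V s" by (rule mid) (use s in auto)
      also have "\<dots> \<le> l powr p * (s / u) powr p * V s"
        using 3 u s s0 p pos[of s] by (intro mult_right_mono mult_left_mono powr_mono2 divide_left_mono) auto
      finally have "1 \<le> l powr p / V s0 * (s / u) powr p * V s" using pos[of s0] by (simp add: field_simps)
      also have "l powr p / V s0 * (s / u) powr p \<le> C * (1 + (s / u) powr p)" using C by (intro mult_mono) auto
      finally show ?thesis using le1[of u] pos[of s] by (smt (verit) mult_right_mono)
    qed
  qed
  then show ?thesis using C(2) by (intro exI[of _ C]) auto
qed

section \<open>Homogeneous measures and ramp functions\<close>

locale hom_tail =
  fixes N :: "real^'n \<Rightarrow> real" and \<nu> :: "(real^'n) measure" and \<alpha> :: real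
  assumes norm: "is_norm N" and tf: "tail_finite \<nu>"
    and hom: "homog \<alpha> \<nu>" and nonnull: "emeasure \<nu> UNIV \<noteq> 0" and \<alpha>: "0 < \<alpha>"
begin

lemma N_borel [measurable]: "N \<in> borel_measurable borel"
  by (rule borel_measurable_continuous_onI) (rule is_norm_continuous[OF norm])

lemma nu_sets [measurable_cong]: "sets \<nu> = sets borel" and nu_space: "space \<nu> = UNIV"
  using tf tail_finite_sets tail_finite_space by auto

definition T :: "real \<Rightarrow> (real^'n) set" where "T r = {x. r \<le> N x}"

lemma T_sets [measurable]: "T r \<in> sets borel"
proof -
  have "T r = {x \<in> space borel. r \<le> N x}" by (simp add: T_def)
  also have "\<dots> \<in> sets borel" by measurable
  finally show ?thesis .
qed

lemma T_finite: "0 < r \<Longrightarrow> emeasure \<nu> (T r) < \<infinity>"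
proof -
  assume r: "0 < r"
  obtain c C where C: "0 < C" "\<And>x. N x \<le> C * norm x" using is_norm_equiv[OF norm] by metis
  have "emeasure \<nu> (T r) \<le> emeasure \<nu> {x. r / C \<le> norm x}"
  proof (rule emeasure_mono)
    have "r / C \<le> norm x" if "r \<le> N x" for x
      using C(2)[of x] C(1) that by (simp add: field_simps)
    then show "T r \<subseteq> {x. r / C \<le> norm x}" by (auto simp: T_def)
  qed (simp add: nu_sets)
  also have "\<dots> < \<infinity>" using r C(1) by (intro tail_finite_fin[OF tf]) simp
  finally show ?thesis .
qed

definition m1 :: real where "m1 = measure \<nu> (T 1)"

lemma T_measure: assumes "0 < r" shows "measure \<nu> (T r) = r powr - \<alpha> * m1"
proof -
  have "{x. inverse r *\<^sub>R x \<in> T 1} = T r"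
    using assms by (auto simp: T_def is_normD[OF norm] field_simps)
  then have "emeasure \<nu> (T r) = ennreal (r powr - \<alpha>) * emeasure \<nu> (T 1)"
    using hom assms unfolding homog_def by (metis T_sets)
  then show ?thesis by (simp add: measure_def m1_def enn2real_mult)
qed

text \<open>If {N >= 1} were null, homogeneity would make every {N >= r} null; these sets exhaust
  the complement of the origin, which is null too.\<close>

lemma m1_pos: "0 < m1"
proof (rule ccontr)
  assume "\<not> 0 < m1"
  then have "m1 = 0" by (simp add: m1_def zero_less_measure_iff)
  then have "emeasure \<nu> (T r) = 0" if "0 < r" for r
    using T_measure[OF that] T_finite[OF that] by (simp add: emeasure_eq_ennreal_measure less_top)
  then have "emeasure \<nu> (\<Union>n. T (1 / real (Suc n))) = 0"
    by (intro emeasure_UN_eq_0) (auto simp: nu_sets)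
  moreover have "UNIV = {0} \<union> (\<Union>n. T (1 / real (Suc n)))"
  proof -
    have "\<exists>n. 1 / real (Suc n) \<le> N x" if "x \<noteq> 0" for x
    proof -
      have "0 < N x" using that norm is_normD(1)[OF norm, of x] unfolding is_norm_def by (metis less_le)
      then show ?thesis using nat_approx_posE[of "N x"] by (metis less_imp_le)
    qed
    then show ?thesis unfolding T_def by blast
  qed
  moreover have "emeasure \<nu> {0} = 0" using tf by (simp add: tail_finite_def)
  moreover have "(\<Union>n. T (1 / real (Suc n))) \<in> sets \<nu>" "{0} \<in> sets \<nu>" by (auto simp: nu_sets)
  ultimately have "emeasure \<nu> UNIV \<le> 0 + 0" using emeasure_subadditive by metis
  then show False using nonnull by simp
qed

text \<open>A continuous replacement for the indicator of a norm tail, lying between the indicators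
  at levels \<open>b\<close> and \<open>a\<close>. It allows integrals of test functions to be used
  without discussing boundary masses.\<close>

definition ramp :: "real \<Rightarrow> real \<Rightarrow> real^'n \<Rightarrow> real" where
  "ramp a b x = max 0 (min 1 ((N x - a) / (b - a)))"

lemma ramp_bounds: "0 \<le> ramp a b x" "ramp a b x \<le> 1"
  by (auto simp: ramp_def)

lemma ramp_0: "a < b \<Longrightarrow> N x \<le> a \<Longrightarrow> ramp a b x = 0"
  by (simp add: ramp_def divide_nonpos_pos)

lemma ramp_1: "a < b \<Longrightarrow> b \<le> N x \<Longrightarrow> ramp a b x = 1"
  by (simp add: ramp_def)

lemma far_test_ramp: "0 < a \<Longrightarrow> a < b \<Longrightarrow> far_test (ramp a b)"
proof -
  assume a: "0 < a" "a < b"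
  obtain c C where C: "0 < C" "\<And>x. N x \<le> C * norm x" using is_norm_equiv[OF norm] by metis
  show ?thesis
    unfolding far_test_def
  proof (intro conjI)
    show "continuous_on UNIV (ramp a b)"
      unfolding ramp_def using a by (intro continuous_intros is_norm_continuous[OF norm]) auto
    show "\<exists>B. \<forall>x. \<bar>ramp a b x\<bar> \<le> B" using ramp_bounds by (intro exI[of _ 1]) (auto simp: abs_of_nonneg)
    show "\<exists>r>0. \<forall>x. norm x < r \<longrightarrow> ramp a b x = 0"
    proof (intro exI[of _ "a / C"] conjI allI impI)
      fix x :: "real^'n" assume "norm x < a / C"
      then have "N x \<le> a" using C(1) C(2)[of x] by (simp add: field_simps)
      then show "ramp a b x = 0" using a by (intro ramp_0)
    qed (use a C in simp)
  qed
qed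

lemma integral_ramp:
  assumes "0 < a" "a < b"
  shows "b powr - \<alpha> * m1 \<le> (\<integral>x. ramp a b x \<partial>\<nu>)" "(\<integral>x. ramp a b x \<partial>\<nu>) \<le> a powr - \<alpha> * m1"
proof -
  have ib: "integrable \<nu> (indicat_real (T r))" if "0 < r" for r
    using that T_finite[OF that] by (intro integrable_real_indicator) (auto simp: nu_sets)
  have i: "integrable \<nu> (ramp a b)" by (rule far_test_integrable[OF tf far_test_ramp[OF assms]])
  have "(\<integral>x. indicator (T b) x \<partial>\<nu>) \<le> (\<integral>x. ramp a b x \<partial>\<nu>)"
    using assms ramp_bounds ramp_1[OF assms(2)] by (intro integral_mono ib i) (auto simp: indicator_def T_def)
  then show "b powr - \<alpha> * m1 \<le> (\<integral>x. ramp a b x \<partial>\<nu>)" using assms by (simp add: nu_space T_measure)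
  have "(\<integral>x. ramp a b x \<partial>\<nu>) \<le> (\<integral>x. indicator (T a) x \<partial>\<nu>)"
    using assms ramp_bounds[of a b] ramp_0[OF assms(2)] by (intro integral_mono ib i) (auto simp: indicator_def T_def not_le)
  then show "(\<integral>x. ramp a b x \<partial>\<nu>) \<le> a powr - \<alpha> * m1" using assms by (simp add: nu_space T_measure)
qed

lemma expect_ramp:
  assumes M: "prob_space M" and Y [measurable]: "Y \<in> borel_measurable M" and assms: "0 < s" "0 < a" "a < b"
  shows "measure M {\<omega> \<in> space M. N (Y \<omega>) > b * s} \<le> (\<integral>\<omega>. ramp a b (inverse s *\<^sub>R Y \<omega>) \<partial>M)" "(\<integral>\<omega>. ramp a b (inverse s *\<^sub>R Y \<omega>) \<partial>M) \<le> measure M {\<omega> \<in> space M. N (Y \<omega>) > a * s}"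
proof -
  interpret prob_space M by fact
  have m: "ramp a b \<in> borel_measurable borel" unfolding ramp_def[abs_def] by measurable
  have i: "integrable M (\<lambda>\<omega>. ramp a b (inverse s *\<^sub>R Y \<omega>))"
    using ramp_bounds by (intro integrable_const_bound[of _ 1] measurable_compose[OF _ m]) (auto simp: abs_of_nonneg)
  have Ns: "N (inverse s *\<^sub>R x) = N x / s" for x using assms is_normD[OF norm] by (simp add: field_simps)
  have ind: "integrable M (indicat_real {\<omega> \<in> space M. N (Y \<omega>) > t})" "measure M {\<omega> \<in> space M. N (Y \<omega>) > t} = (\<integral>\<omega>. indicator {\<omega> \<in> space M. N (Y \<omega>) > t} \<omega> \<partial>M)" for t
  proof -
    have S: "{\<omega> \<in> space M. N (Y \<omega>) > t} \<in> sets M" by measurable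
    then show "integrable M (indicat_real {\<omega> \<in> space M. N (Y \<omega>) > t})" by (intro integrable_real_indicator) (auto simp: emeasure_eq_measure)
    have "{\<omega> \<in> space M. N (Y \<omega>) > t} \<inter> space M = {\<omega> \<in> space M. N (Y \<omega>) > t}" by auto
    then show "measure M {\<omega> \<in> space M. N (Y \<omega>) > t} = (\<integral>\<omega>. indicator {\<omega> \<in> space M. N (Y \<omega>) > t} \<omega> \<partial>M)" by simp
  qed
  show "measure M {\<omega> \<in> space M. N (Y \<omega>) > b * s} \<le> (\<integral>\<omega>. ramp a b (inverse s *\<^sub>R Y \<omega>) \<partial>M)"
    unfolding ind(2)
  proof (intro integral_mono ind i)
    fix \<omega>
    show "indicat_real {\<omega> \<in> space M. N (Y \<omega>) > b * s} \<omega> \<le> ramp a b (inverse s *\<^sub>R Y \<omega>)"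
    proof (cases "b * s < N (Y \<omega>)")
      case True
      then have "b \<le> N (inverse s *\<^sub>R Y \<omega>)" unfolding Ns using assms(3) by (simp add: pos_le_divide_eq)
      then show ?thesis using ramp_1[OF assms(5)] by (simp add: indicator_def)
    qed (simp add: ramp_bounds)
  qed
  show "(\<integral>\<omega>. ramp a b (inverse s *\<^sub>R Y \<omega>) \<partial>M) \<le> measure M {\<omega> \<in> space M. N (Y \<omega>) > a * s}"
    unfolding ind(2)
  proof (intro integral_mono ind i)
    fix \<omega> assume "\<omega> \<in> space M"
    then show "ramp a b (inverse s *\<^sub>R Y \<omega>) \<le> indicat_real {\<omega> \<in> space M. N (Y \<omega>) > a * s} \<omega>"
    proof (cases "a * s < N (Y \<omega>)")
      case True
      then show ?thesis using \<open>\<omega> \<in> space M\<close> by (simp add: ramp_bounds)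
    next
      case False
      then have "N (inverse s *\<^sub>R Y \<omega>) \<le> a" unfolding Ns using assms(3) by (simp add: pos_divide_le_eq)
      then show ?thesis using ramp_0[OF assms(5)] by simp
    qed
  qed
qed

end

section \<open>Tail bounds for the norm of a regularly varying vector\<close>

locale regvar = prob_space M + hom_tail N \<nu> \<alpha>
  for M :: "'w measure" and N :: "real^'n \<Rightarrow> real" and X :: "'w \<Rightarrow> real^'n" and \<nu> :: "(real^'n) measure" and \<alpha> :: real +
  assumes X [measurable]: "X \<in> borel_measurable M"
    and conv: "\<And>g. far_test g \<Longrightarrow> ((\<lambda>s. (\<integral>\<omega>. g (inverse s *\<^sub>R X \<omega>) \<partial>M) / measure M {\<omega> \<in> space M. N (X \<omega>) > s}) \<longlongrightarrow> (\<integral>x. g x \<partial>\<nu>)) at_top"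
begin

definition V :: "real \<Rightarrow> real" where "V s = prob {\<omega> \<in> space M. N (X \<omega>) > s}"

lemma V_anti: "s \<le> t \<Longrightarrow> V t \<le> V s"
  unfolding V_def by (intro finite_measure_mono) auto

lemma V_le_1: "V s \<le> 1"
  by (simp add: V_def)

text \<open>If \<open>V\<close> vanished somewhere it would vanish from there on, and all quotients,
  being divisions by 0, would be 0. This contradicts the positive limit for a ramp.\<close>

lemma V_pos: "0 < V s"
proof -
  have "0 < (\<integral>x. ramp 1 2 x \<partial>\<nu>)"
    using integral_ramp(1)[of 1 2] m1_pos by (smt (verit) mult_pos_pos powr_gt_zero)
  then have "\<forall>\<^sub>F s in at_top. 0 < (\<integral>\<omega>. ramp 1 2 (inverse s *\<^sub>R X \<omega>) \<partial>M) / V s"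
    unfolding V_def by (intro order_tendstoD(1)[OF conv[OF far_test_ramp]]) auto
  then obtain s' where s': "\<And>t. s' \<le> t \<Longrightarrow> 0 < (\<integral>\<omega>. ramp 1 2 (inverse t *\<^sub>R X \<omega>) \<partial>M) / V t"
    unfolding eventually_at_top_linorder by auto
  have "V (max s s') \<noteq> 0" using s'[of "max s s'"] by auto
  moreover have "0 \<le> V (max s s')" by (simp add: V_def)
  ultimately show ?thesis using V_anti[of s "max s s'"] by linarith
qed

lemma V_potter:
  assumes p: "\<alpha> < p"
  shows "\<exists>C>0. \<exists>s0>0. \<forall>s\<ge>s0. \<forall>u>0. V u \<le> C * (1 + (s / u) powr p) * V s"
proof -
  define m2 where "m2 = 2 powr - \<alpha> * m1"
  have m2: "0 < m2" using m1_pos by (simp add: m2_def)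
  \<comment> \<open>Since \<open>p\<close> exceeds \<alpha>, a large \<open>l\<close> makes l^(-p)
    smaller than (2 l)^(-\<alpha>) m1, the lower bound for the limit of V(l s) / V(s). The exponent
    1 / (p - \<alpha>) solves this with a factor 2 to spare, which gives strictness.\<close>
  define l where "l = max 2 ((2 / m2) powr (1 / (p - \<alpha>)))"
  have l: "1 < l" by (simp add: l_def)
  have "2 / m2 = ((2 / m2) powr (1 / (p - \<alpha>))) powr (p - \<alpha>)" using p m2 by (simp add: powr_powr)
  also have "\<dots> \<le> l powr (p - \<alpha>)" using p by (intro powr_mono2) (auto simp: l_def)
  finally have "2 / m2 \<le> l powr (p - \<alpha>)" .
  then have "2 \<le> l powr (p - \<alpha>) * m2" using m2 by (simp add: field_simps)
  then have "l powr - p * 2 \<le> l powr - p * (l powr (p - \<alpha>) * m2)" by (intro mult_left_mono) auto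
  also have "\<dots> = (2 * l) powr - \<alpha> * m1"
    using l by (simp add: m2_def powr_mult powr_add[symmetric] mult.assoc[symmetric])
  finally have "l powr - p < (2 * l) powr - \<alpha> * m1" using l by (smt (verit) powr_gt_zero)
  also have "\<dots> \<le> (\<integral>x. ramp l (2 * l) x \<partial>\<nu>)" using l by (intro integral_ramp(1)) auto
  finally have "\<forall>\<^sub>F s in at_top. l powr - p < (\<integral>\<omega>. ramp l (2 * l) (inverse s *\<^sub>R X \<omega>) \<partial>M) / V s"
    unfolding V_def using l by (intro order_tendstoD(1)[OF conv[OF far_test_ramp]]) auto
  then obtain s' where s': "\<And>s. s' \<le> s \<Longrightarrow> l powr - p < (\<integral>\<omega>. ramp l (2 * l) (inverse s *\<^sub>R X \<omega>) \<partial>M) / V s"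
    unfolding eventually_at_top_linorder by auto
  define s0 where "s0 = max 1 s'"
  have "\<exists>C>0. \<forall>s\<ge>s0. \<forall>u>0. V u \<le> C * (1 + (s / u) powr p) * V s"
  proof (rule potter_bound[OF V_anti V_pos V_le_1 l])
    show "0 < s0" "0 < p" using \<alpha> p by (auto simp: s0_def)
    fix s assume s: "s0 \<le> s"
    then have s0: "0 < s" by (simp add: s0_def)
    have "l powr - p * V s < (\<integral>\<omega>. ramp l (2 * l) (inverse s *\<^sub>R X \<omega>) \<partial>M)"
      using s'[of s] s V_pos[of s] by (simp add: s0_def field_simps)
    also have "\<dots> \<le> V (l * s)" using s0 l by (intro expect_ramp(2)[OF prob_space_axioms X, folded V_def]) auto
    finally have "l powr p * (l powr - p * V s) \<le> l powr p * V (l * s)" by (intro mult_left_mono) auto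
    then show "V s \<le> l powr p * V (l * s)" using l by (simp add: powr_minus field_simps)
  qed
  then show ?thesis by (metis max.strict_coboundedI1 s0_def zero_less_one)
qed

text \<open>A one-sided bound of the right order. Using a ramp from t/2 to t costs the factor
  2^\<alpha>, and the added 1 makes the inequality strict. The exact limit is found in
  \<open>V_regular\<close>.\<close>

lemma V_ratio:
  assumes t: "0 < t"
  shows "\<forall>\<^sub>F s in at_top. V (t * s) / V s < (2 powr \<alpha> * m1 + 1) * t powr - \<alpha>"
proof -
  have "(\<integral>x. ramp (t / 2) t x \<partial>\<nu>) \<le> (t / 2) powr - \<alpha> * m1" using t by (intro integral_ramp(2)) auto
  also have "\<dots> = 2 powr \<alpha> * m1 * t powr - \<alpha>"
    using t by (simp add: powr_divide powr_minus field_simps)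
  also have "\<dots> < (2 powr \<alpha> * m1 + 1) * t powr - \<alpha>" using t by (simp add: algebra_simps)
  finally have "\<forall>\<^sub>F s in at_top. (\<integral>\<omega>. ramp (t / 2) t (inverse s *\<^sub>R X \<omega>) \<partial>M) / V s < (2 powr \<alpha> * m1 + 1) * t powr - \<alpha>"
    unfolding V_def using t by (intro order_tendstoD(2)[OF conv[OF far_test_ramp]]) auto
  then show ?thesis
    using eventually_gt_at_top[of 0]
  proof eventually_elim
    case (elim s)
    have "V (t * s) / V s \<le> (\<integral>\<omega>. ramp (t / 2) t (inverse s *\<^sub>R X \<omega>) \<partial>M) / V s"
      using t elim V_pos[of s] by (intro divide_right_mono expect_ramp(1)[OF prob_space_axioms X, folded V_def]) auto
    then show ?case using elim by linarith
  qed
qed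

end

section \<open>Injectivity of the random scaling of a measure\<close>

text \<open>Characters of the multiplicative group of nonzero reals, extended by 0; the flag \<open>z\<close> selects
  instead the indicator of the point 0.\<close>
definition char_fun :: "bool \<Rightarrow> real \<Rightarrow> nat \<Rightarrow> real \<Rightarrow> complex" where
  "char_fun z \<theta> m x = (if z then (if x = 0 then 1 else 0)
     else if x = 0 then 0 else cis (\<theta> * ln \<bar>x\<bar>) * complex_of_real (sgn x) ^ m)"

text \<open>The factor by which scaling with a nonzero number acts on \<open>char_fun\<close>. Under
  the flag it is 1, because such scaling preserves both {0} and its complement.\<close>

definition char_mult :: "bool \<Rightarrow> real \<Rightarrow> nat \<Rightarrow> real \<Rightarrow> complex" where
  "char_mult z \<theta> m x = (if z then 1 else cis (\<theta> * ln \<bar>x\<bar>) * complex_of_real (sgn x) ^ m)"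

lemma borel_measurable_cis [measurable]: "cis \<in> borel_measurable borel"
  unfolding cis_conv_exp[abs_def] by measurable

lemma borel_measurable_char_fun [measurable]: "char_fun z \<theta> m \<in> borel_measurable borel"
  unfolding char_fun_def[abs_def] by measurable

lemma borel_measurable_char_mult [measurable]: "char_mult z \<theta> m \<in> borel_measurable borel"
  unfolding char_mult_def[abs_def] by measurable

lemma char_fun_mult: "a \<noteq> 0 \<Longrightarrow> char_fun z \<theta> m (a * x) = char_mult z \<theta> m a * char_fun z \<theta> m x"
  by (auto simp: char_fun_def char_mult_def abs_mult ln_mult sgn_mult power_mult_distrib cis_mult[symmetric] distrib_left mult_ac)

lemma norm_char_fun_le: "cmod (char_fun z \<theta> m x) \<le> 1"
  by (auto simp: char_fun_def norm_mult norm_power sgn_if)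

lemma norm_char_mult: "x \<noteq> 0 \<Longrightarrow> cmod (char_mult z \<theta> m x) = 1"
  by (auto simp: char_mult_def norm_mult norm_power sgn_if)

text \<open>The flagged character gives the mass at 0, and the choices m = 0, 1 together separate
  the two signs. On each half-line the characters are exponentials in ln |x|, so
  \<open>fourier_unique\<close> applies there.\<close>

lemma char_fun_unique:
  fixes h1 :: "'a \<Rightarrow> complex" and h2 :: "'b \<Rightarrow> complex"
  assumes 1: "sigma_finite_measure M1" "integrable M1 h1" "Y1 \<in> borel_measurable M1"
    and 2: "sigma_finite_measure M2" "integrable M2 h2" "Y2 \<in> borel_measurable M2"
    and eq: "\<And>z \<theta> m. m \<in> {0, 1} \<Longrightarrow> (\<integral>x. char_fun z \<theta> m (Y1 x) * h1 x \<partial>M1) = (\<integral>x. char_fun z \<theta> m (Y2 x) * h2 x \<partial>M2)"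
  shows "(\<integral>x. indicator {..c} (Y1 x) * h1 x \<partial>M1) = (\<integral>x. indicator {..c} (Y2 x) * h2 x \<partial>M2)"
proof -
  have [measurable]: "h1 \<in> borel_measurable M1" "Y1 \<in> borel_measurable M1" "h2 \<in> borel_measurable M2" "Y2 \<in> borel_measurable M2"
    using 1 2 by auto
  define bd :: "(real \<Rightarrow> complex) \<Rightarrow> bool" where "bd f \<longleftrightarrow> f \<in> borel_measurable borel \<and> (\<forall>x. cmod (f x) \<le> 1)" for f
  define E :: "(real \<Rightarrow> complex) \<Rightarrow> bool" where "E f \<longleftrightarrow> (\<integral>x. f (Y1 x) * h1 x \<partial>M1) = (\<integral>x. f (Y2 x) * h2 x \<partial>M2)" for f
  have i1: "integrable M1 (\<lambda>x. f (Y1 x) * h1 x)" if "bd f" for f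
  proof (rule Bochner_Integration.integrable_bound[OF 1(2)])
    have [measurable]: "f \<in> borel_measurable borel" using that by (simp add: bd_def)
    show "(\<lambda>x. f (Y1 x) * h1 x) \<in> borel_measurable M1" by measurable
  qed (use that in \<open>auto simp: bd_def norm_mult intro!: AE_I2 mult_left_le_one_le\<close>)
  have i2: "integrable M2 (\<lambda>x. f (Y2 x) * h2 x)" if "bd f" for f
  proof (rule Bochner_Integration.integrable_bound[OF 2(2)])
    have [measurable]: "f \<in> borel_measurable borel" using that by (simp add: bd_def)
    show "(\<lambda>x. f (Y2 x) * h2 x) \<in> borel_measurable M2" by measurable
  qed (use that in \<open>auto simp: bd_def norm_mult intro!: AE_I2 mult_left_le_one_le\<close>)
  have E_add: "E (\<lambda>x. f x + g x)" if "E f" "E g" "bd f" "bd g" for f g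
  proof -
    have "(\<integral>x. (f (Y1 x) + g (Y1 x)) * h1 x \<partial>M1) = (\<integral>x. f (Y1 x) * h1 x \<partial>M1) + (\<integral>x. g (Y1 x) * h1 x \<partial>M1)"
      unfolding distrib_right by (rule Bochner_Integration.integral_add) (intro i1 that)+
    moreover have "(\<integral>x. (f (Y2 x) + g (Y2 x)) * h2 x \<partial>M2) = (\<integral>x. f (Y2 x) * h2 x \<partial>M2) + (\<integral>x. g (Y2 x) * h2 x \<partial>M2)"
      unfolding distrib_right by (rule Bochner_Integration.integral_add) (intro i2 that)+
    ultimately show ?thesis using that(1,2) by (simp add: E_def)
  qed
  have E_mult: "E (\<lambda>x. a * f x)" if "E f" for f a
    using that unfolding E_def mult.assoc integral_mult_right_zero by simp
  have Ec: "E (char_fun z \<theta> m)" if "m \<in> {0, 1}" for z \<theta> m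
    unfolding E_def by (rule eq[OF that])
  have bc: "bd (char_fun z \<theta> m)" for z \<theta> m unfolding bd_def using norm_char_fun_le by auto
  \<comment> \<open>Half the sum, or half the difference, of the characters with m = 0 and m = 1 is
    the exponential restricted to one sign.\<close>
  define P where "P s \<theta> x = (if sgn x = s then cis (\<theta> * ln \<bar>x\<bar>) else 0)" for s \<theta> x :: real
  have half: "bd (\<lambda>x. a * char_fun z \<theta> m x)" if "cmod a \<le> 1" for a z \<theta> m
    unfolding bd_def using norm_char_fun_le[of z \<theta> m] that by (auto simp: norm_mult intro!: mult_le_one)
  have EP: "E (P s \<theta>)" if s: "s = 1 \<or> s = -1" for s \<theta>
  proof -
    have "E (\<lambda>x. (1/2) * char_fun False \<theta> 0 x + (complex_of_real s / 2) * char_fun False \<theta> 1 x)"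
      by (intro E_add E_mult Ec half) (use s in \<open>auto simp: norm_divide\<close>)
    also have "(\<lambda>x. (1/2) * char_fun False \<theta> 0 x + (complex_of_real s / 2) * char_fun False \<theta> 1 x) = P s \<theta>"
      using s by (auto simp: char_fun_def P_def sgn_if fun_eq_iff)
    finally show ?thesis .
  qed
  \<comment> \<open>The orientation \<open>s\<close> is needed because on the negative half-line x
    <= c means that ln |x| is bounded below.\<close>
  have Q': "E (\<lambda>x. indicator {..c} (s * ln \<bar>x\<bar>) * (if sgn x = s' then 1 else 0))" if s: "s' = 1 \<or> s' = -1" for s s' c
  proof -
    let ?g = "\<lambda>x. if sgn x = s' then 1 else 0 :: complex"
    have bg: "bd ?g" unfolding bd_def by auto
    have "(\<integral>x. indicator {..c} (s * ln \<bar>Y1 x\<bar>) *\<^sub>R (?g (Y1 x) * h1 x) \<partial>M1) = (\<integral>x. indicator {..c} (s * ln \<bar>Y2 x\<bar>) *\<^sub>R (?g (Y2 x) * h2 x) \<partial>M2)"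
    proof (rule fourier_unique[OF 1(1) i1[OF bg] _ 2(1) i2[OF bg]])
      fix \<theta>
      have P: "cis (\<theta> * (s * ln \<bar>y\<bar>)) * (?g y * h) = P s' (\<theta> * s) y * h" for y h
        by (simp add: P_def mult.assoc)
      show "(\<integral>x. cis (\<theta> * (s * ln \<bar>Y1 x\<bar>)) * (?g (Y1 x) * h1 x) \<partial>M1) = (\<integral>x. cis (\<theta> * (s * ln \<bar>Y2 x\<bar>)) * (?g (Y2 x) * h2 x) \<partial>M2)"
        unfolding P by (rule EP[OF s, unfolded E_def])
    qed measurable
    moreover have "indicat_real {..c} y *\<^sub>R (?g y' * h) = (indicator {..c} y * ?g y') * h" for y y' h
      by (auto simp: indicator_def)
    ultimately show ?thesis unfolding E_def by (simp only:)
  qed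
  have bdI: "bd (\<lambda>x. if p x then 1 else 0)" if "Measurable.pred borel p" for p
    using that unfolding bd_def by auto
  have "E (indicator {..c})"
  proof (cases "c < 0")
    case True
    have "(\<lambda>x. indicator {..- ln (- c)} (- 1 * ln \<bar>x\<bar>) * (if sgn x = - 1 then 1 else 0)) = (indicator {..c} :: real \<Rightarrow> complex)"
    proof
      fix x :: real
      show "indicator {..- ln (- c)} (- 1 * ln \<bar>x\<bar>) * (if sgn x = - 1 then 1 else 0) = (indicator {..c} x :: complex)"
      proof (cases "x < 0")
        case x: True
        then have "sgn x = -1" by simp
        moreover have "(- 1 * ln \<bar>x\<bar> \<le> - ln (- c)) \<longleftrightarrow> x \<le> c" using x True by auto
        ultimately show ?thesis by (auto simp: indicator_def)
      next
        case False
        then have "sgn x \<noteq> -1" "\<not> x \<le> c" using True by (auto simp: sgn_if)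
        then show ?thesis by (simp add: indicator_def)
      qed
    qed
    then show ?thesis using Q'[of "-1" "- ln (- c)" "-1"] by simp
  next
    case False
    have eN: "E (\<lambda>x. if x < 0 then 1 else 0)"
    proof -
      have "P (-1) 0 = (\<lambda>x. if x < 0 then 1 else 0)" by (auto simp: P_def sgn_if fun_eq_iff)
      then show ?thesis using EP[of "-1" 0] by simp
    qed
    have eZ: "E (\<lambda>x. if x = 0 then 1 else 0)"
    proof -
      have "char_fun True 0 0 = (\<lambda>x. if x = 0 then 1 else 0)" by (auto simp: char_fun_def fun_eq_iff)
      then show ?thesis using Ec[of 0 True 0] by simp
    qed
    have eP: "E (\<lambda>x. if 0 < x \<and> x \<le> c then 1 else 0)"
    proof (cases "c = 0")
      case True
      then have "(\<lambda>x. if 0 < x \<and> x \<le> c then 1 else 0) = (\<lambda>x::real. 0::complex)" by auto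
      then show ?thesis by (simp add: E_def)
    next
      case c: False
      have "(\<lambda>x. indicator {..ln c} (1 * ln \<bar>x\<bar>) * (if sgn x = 1 then 1 else 0)) = (\<lambda>x. if 0 < x \<and> x \<le> c then 1 else 0 :: complex)"
        using c False by (auto simp: indicator_def sgn_if fun_eq_iff)
      then show ?thesis using Q'[of 1 "ln c" 1] by simp
    qed
    have e2: "E (\<lambda>x. (if x < 0 then 1 else 0) + (if x = 0 then 1 else 0))"
      by (intro E_add eN eZ bdI) measurable
    have e2': "(\<lambda>x. (if x < 0 then 1 else 0) + (if x = 0 then 1 else 0)) = (\<lambda>x::real. if x \<le> 0 then 1 else 0 :: complex)"
      by auto
    have "E (\<lambda>x. (if x \<le> 0 then 1 else 0) + (if 0 < x \<and> x \<le> c then 1 else 0))"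
      using e2 unfolding e2' by (intro E_add eP bdI) measurable
    also have "(\<lambda>x. (if x \<le> 0 then 1 else 0) + (if 0 < x \<and> x \<le> c then 1 else 0)) = (indicator {..c} :: real \<Rightarrow> complex)"
      using False by (auto simp: indicator_def fun_eq_iff)
    finally show ?thesis .
  qed
  then show ?thesis unfolding E_def .
qed

text \<open>Coordinates are converted from characters to half-lines one at a time. The induction
  runs over the set \<open>S\<close> of converted coordinates; for the next one, all other factors
  and the tail indicator form the integrable weight required by
  \<open>char_fun_unique\<close>.\<close>

lemma tail_char_unique:
  fixes \<nu> \<nu>' :: "(real^'n) measure"
  assumes \<nu>: "tail_finite \<nu>" and \<nu>': "tail_finite \<nu>'" and R: "0 < R"
    and eq: "\<And>z \<theta> m. (\<forall>k. m k \<in> {0, 1}) \<Longrightarrow>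
      (\<integral>x. (if R < \<bar>x $ j\<bar> then 1 else 0) * (\<Prod>k\<in>UNIV. char_fun (z k) (\<theta> k) (m k) (x $ k)) \<partial>\<nu>) =
      (\<integral>x. (if R < \<bar>x $ j\<bar> then 1 else 0) * (\<Prod>k\<in>UNIV. char_fun (z k) (\<theta> k) (m k) (x $ k)) \<partial>\<nu>')"
  shows "measure \<nu> {x. R < \<bar>x $ j\<bar> \<and> (\<forall>k. x $ k \<le> c k)} = measure \<nu>' {x. R < \<bar>x $ j\<bar> \<and> (\<forall>k. x $ k \<le> c k)}"
proof -
  have [measurable]: "(\<lambda>x :: real^'n. x $ i) \<in> borel_measurable borel" for i
    by (intro borel_measurable_continuous_onI continuous_intros)
  define U where "U S z \<theta> m k x = (if k \<in> S then indicator {..c k} x else char_fun (z k) (\<theta> k) (m k) x)"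
    for S :: "'n set" and z :: "'n \<Rightarrow> bool" and \<theta> :: "'n \<Rightarrow> real" and m :: "'n \<Rightarrow> nat" and k and x :: real
  define b :: "real^'n \<Rightarrow> complex" where "b x = (if R < \<bar>x $ j\<bar> then 1 else 0)" for x
  have Um [measurable]: "U S z \<theta> m k \<in> borel_measurable borel" for S z \<theta> m k unfolding U_def[abs_def] by auto
  have Ub: "cmod (U S z \<theta> m k x) \<le> 1" for S z \<theta> m k x unfolding U_def using norm_char_fun_le by (auto simp: indicator_def)
  have int: "integrable Q (\<lambda>x. b x * (\<Prod>k\<in>K. U S z \<theta> m k (x $ k)))" if Q: "tail_finite Q" for Q K S z \<theta> m
  proof (rule tail_finite_integrable[OF Q, of _ 1 R])
    show "(\<lambda>x. b x * (\<Prod>k\<in>K. U S z \<theta> m k (x $ k))) \<in> borel_measurable borel" unfolding b_def by measurable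
    show "cmod (b x * (\<Prod>k\<in>K. U S z \<theta> m k (x $ k))) \<le> 1" for x
    proof -
      have "cmod (\<Prod>k\<in>K. U S z \<theta> m k (x $ k)) \<le> 1"
        by (subst prod_norm[symmetric]) (intro prod_le_1 conjI norm_ge_zero Ub)
      then show ?thesis by (auto simp: b_def)
    qed
    show "b x * (\<Prod>k\<in>K. U S z \<theta> m k (x $ k)) = 0" if "norm x < R" for x
      using component_le_norm_cart[of x j] that by (simp add: b_def)
  qed (rule R)
  have "\<forall>z \<theta> m. (\<forall>k. m k \<in> {0, 1}) \<longrightarrow> (\<integral>x. b x * (\<Prod>k\<in>UNIV. U S z \<theta> m k (x $ k)) \<partial>\<nu>) = (\<integral>x. b x * (\<Prod>k\<in>UNIV. U S z \<theta> m k (x $ k)) \<partial>\<nu>')"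
    if "finite S" for S
    using that
  proof (induction S rule: finite_induct)
    case empty
    then show ?case using eq by (simp add: U_def b_def)
  next
    case (insert l S)
    show ?case
    proof (intro allI impI)
      fix z \<theta> and m :: "'n \<Rightarrow> nat" assume m: "\<forall>k. m k \<in> {0, 1}"
      define h where "h x = b x * (\<Prod>k\<in>UNIV - {l}. U S z \<theta> m k (x $ k))" for x
      have split: "(\<Prod>k\<in>UNIV. f k) = f l * (\<Prod>k\<in>UNIV - {l}. f k)" for f :: "'n \<Rightarrow> complex"
        by (rule prod.remove) auto
      have U1: "b x * (\<Prod>k\<in>UNIV. U (insert l S) z \<theta> m k (x $ k)) = indicator {..c l} (x $ l) * h x" for x
      proof -
        have "(\<Prod>k\<in>UNIV - {l}. U (insert l S) z \<theta> m k (x $ k)) = (\<Prod>k\<in>UNIV - {l}. U S z \<theta> m k (x $ k))"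
          by (intro prod.cong) (auto simp: U_def)
        then show ?thesis unfolding split h_def by (simp add: U_def)
      qed
      have U2: "b x * (\<Prod>k\<in>UNIV. U S (z(l := z')) (\<theta>(l := \<theta>')) (m(l := m')) k (x $ k)) = char_fun z' \<theta>' m' (x $ l) * h x" for x z' \<theta>' m'
      proof -
        have "(\<Prod>k\<in>UNIV - {l}. U S (z(l := z')) (\<theta>(l := \<theta>')) (m(l := m')) k (x $ k)) = (\<Prod>k\<in>UNIV - {l}. U S z \<theta> m k (x $ k))"
          by (intro prod.cong) (auto simp: U_def)
        then show ?thesis unfolding split h_def using insert.hyps(2) by (simp add: U_def)
      qed
      show "(\<integral>x. b x * (\<Prod>k\<in>UNIV. U (insert l S) z \<theta> m k (x $ k)) \<partial>\<nu>) = (\<integral>x. b x * (\<Prod>k\<in>UNIV. U (insert l S) z \<theta> m k (x $ k)) \<partial>\<nu>')"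
        unfolding U1
      proof (rule char_fun_unique)
        show "sigma_finite_measure \<nu>" "sigma_finite_measure \<nu>'" using \<nu> \<nu>' by (auto intro: tail_finite_sigma_finite)
        show "integrable \<nu> h" "integrable \<nu>' h" unfolding h_def by (intro int \<nu> \<nu>')+
        show "(\<lambda>x. x $ l) \<in> borel_measurable \<nu>" "(\<lambda>x. x $ l) \<in> borel_measurable \<nu>'"
          by (simp_all cong: measurable_cong_sets add: tail_finite_sets \<nu> \<nu>')
        fix z' \<theta>' and m' :: nat assume m': "m' \<in> {0, 1}"
        have "\<forall>k. (m(l := m')) k \<in> {0, 1}" using m m' by simp
        then show "(\<integral>x. char_fun z' \<theta>' m' (x $ l) * h x \<partial>\<nu>) = (\<integral>x. char_fun z' \<theta>' m' (x $ l) * h x \<partial>\<nu>')"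
          using insert.IH unfolding U2[symmetric] by blast
      qed
    qed
  qed
  \<comment> \<open>Once every coordinate has been converted no character is left, so any flags,
    frequencies and exponents may be inserted.\<close>
  from this[of UNIV, OF finite, rule_format, of "\<lambda>_. 0" "\<lambda>_. True" "\<lambda>_. 0"]
  have eqU: "(\<integral>x. b x * (\<Prod>k\<in>UNIV. indicator {..c k} (x $ k)) \<partial>\<nu>) = (\<integral>x. b x * (\<Prod>k\<in>UNIV. indicator {..c k} (x $ k)) \<partial>\<nu>')"
    by (simp add: U_def)
  have ind: "b x * (\<Prod>k\<in>UNIV. indicator {..c k} (x $ k)) = complex_of_real (indicator {x. R < \<bar>x $ j\<bar> \<and> (\<forall>k. x $ k \<le> c k)} x)" for x
  proof (cases "\<forall>k. x $ k \<le> c k")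
    case False
    then obtain k where "\<not> x $ k \<le> c k" by auto
    then have "(\<Prod>k\<in>UNIV. indicator {..c k} (x $ k) :: complex) = 0"
      by (intro prod_zero bexI[of _ k]) auto
    then show ?thesis using False by simp
  qed (simp add: b_def indicator_def)
  have M: "complex_of_real (measure Q {x. R < \<bar>x $ j\<bar> \<and> (\<forall>k. x $ k \<le> c k)}) = (\<integral>x. b x * (\<Prod>k\<in>UNIV. indicator {..c k} (x $ k)) \<partial>Q)"
    if "tail_finite Q" for Q :: "(real^'n) measure"
    unfolding ind integral_complex_of_real using tail_finite_space[OF that] by simp
  have "complex_of_real (measure \<nu> {x. R < \<bar>x $ j\<bar> \<and> (\<forall>k. x $ k \<le> c k)}) = complex_of_real (measure \<nu>' {x. R < \<bar>x $ j\<bar> \<and> (\<forall>k. x $ k \<le> c k)})"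
    unfolding M[OF \<nu>] M[OF \<nu>'] by (rule eqU)
  then show ?thesis by (simp only: of_real_eq_iff)
qed

text \<open>On each set {x. 1/(n+1) < |x_j|}, which has finite mass, the lower orthants generate the
  Borel sets and are stable under intersection. Countably many such sets cover all but the
  origin.\<close>

lemma measure_eqI_tail_boxes:
  fixes \<nu> \<nu>' :: "(real^'n) measure"
  assumes \<nu>: "tail_finite \<nu>" and \<nu>': "tail_finite \<nu>'"
    and eq: "\<And>R j c. 0 < R \<Longrightarrow> measure \<nu> {x. R < \<bar>x $ j\<bar> \<and> (\<forall>k. x $ k \<le> c k)} = measure \<nu>' {x. R < \<bar>x $ j\<bar> \<and> (\<forall>k. x $ k \<le> c k)}"
  shows "\<nu> = \<nu>'"
proof -
  have [measurable]: "(\<lambda>x :: real^'n. x $ i) \<in> borel_measurable borel" for i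
    by (intro borel_measurable_continuous_onI continuous_intros)
  define A where "A p = {x :: real^'n. 1 / real (Suc (snd p)) < \<bar>x $ fst p\<bar>}" for p :: "'n \<times> nat"
  have Ab: "A p \<in> sets borel" for p unfolding A_def by measurable
  have Afin: "emeasure Q (A p \<inter> B) < \<infinity>" if Q: "tail_finite Q" and "B \<in> sets borel" for Q p B
  proof -
    have "emeasure Q (A p \<inter> B) \<le> emeasure Q {x. 1 / real (Suc (snd p)) \<le> norm x}"
    proof (rule emeasure_mono)
      show "A p \<inter> B \<subseteq> {x. 1 / real (Suc (snd p)) \<le> norm x}"
      proof
        fix x assume "x \<in> A p \<inter> B"
        then have "1 / real (Suc (snd p)) \<le> \<bar>x $ fst p\<bar>" by (simp add: A_def)
        also have "\<dots> \<le> norm x" by (rule component_le_norm_cart)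
        finally show "x \<in> {x. 1 / real (Suc (snd p)) \<le> norm x}" by simp
      qed
    qed (simp add: tail_finite_sets[OF Q])
    also have "\<dots> < \<infinity>" by (rule tail_finite_fin[OF Q]) simp
    finally show ?thesis .
  qed
  have main: "emeasure \<nu> (E \<inter> A p) = emeasure \<nu>' (E \<inter> A p)" if E: "E \<in> sets borel" for E p
  proof -
    let ?d = "\<lambda>Q. density Q (indicator (A p))"
    have d: "emeasure (?d Q) E = emeasure Q (A p \<inter> E)" if "tail_finite Q" "E \<in> sets borel" for Q E
      using Ab that tail_finite_sets[OF that(1)]
      by (subst emeasure_density) (auto simp: indicator_inter_arith[symmetric])
    have "?d \<nu> = ?d \<nu>'"
    proof (rule measure_eqI_generator_eq[where E="range atMost" and \<Omega>=UNIV and A="\<lambda>i::nat. {..(\<chi> k. real i)}"])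
      show "Int_stable (range (atMost :: real^'n \<Rightarrow> _))"
      proof (rule Int_stableI_image)
        fix a b :: "real^'n"
        have "{..a} \<inter> {..b} = {..(\<chi> k. min (a $ k) (b $ k))}" by (auto simp: less_eq_vec_def)
        then show "\<exists>c\<in>UNIV. {..a} \<inter> {..b} = {..c}" by blast
      qed
      have "sets borel = sigma_sets UNIV (range (atMost :: real^'n \<Rightarrow> _))"
        using borel_eq_atMost[where 'a="real^'n"] by (metis sets_measure_of top_greatest Pow_UNIV)
      then show "sets (?d \<nu>) = sigma_sets UNIV (range atMost)" "sets (?d \<nu>') = sigma_sets UNIV (range atMost)"
        by (simp_all add: tail_finite_sets \<nu> \<nu>')
      have am: "{..a} \<in> sets borel" for a :: "real^'n" by simp
      have A_at: "A p \<inter> {..a} = {x. 1 / real (Suc (snd p)) < \<bar>x $ fst p\<bar> \<and> (\<forall>k. x $ k \<le> a $ k)}" for a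
        by (auto simp: A_def less_eq_vec_def)
      have fm: "emeasure Q (A p \<inter> {..a}) = ennreal (measure Q (A p \<inter> {..a}))" if "tail_finite Q" for Q a
        using Afin[OF that am] by (intro emeasure_eq_ennreal_measure) (auto simp: less_top)
      show "emeasure (?d \<nu>) X = emeasure (?d \<nu>') X" if X': "X \<in> range atMost" for X
      proof -
        obtain a where X: "X = {..a}" using X' by auto
        have "measure \<nu> (A p \<inter> {..a}) = measure \<nu>' (A p \<inter> {..a})" unfolding A_at by (rule eq) simp
        then show ?thesis unfolding X d[OF \<nu> am] d[OF \<nu>' am] fm[OF \<nu>] fm[OF \<nu>'] by simp
      qed
      show "(\<Union>i::nat. {..(\<chi> k. real i) :: real^'n}) = UNIV"
      proof -
        have "\<exists>i::nat. x \<le> (\<chi> k. real i)" for x :: "real^'n"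
        proof -
          obtain i :: nat where "norm x \<le> real i" using real_arch_simple by blast
          then show ?thesis using component_le_norm_cart[of x]
            by (intro exI[of _ i]) (auto simp: less_eq_vec_def intro: order_trans[OF abs_ge_self] order_trans)
        qed
        then show ?thesis by auto
      qed
      show "emeasure (?d \<nu>) {..(\<chi> k. real i)} \<noteq> \<infinity>" for i :: nat
        using Afin[OF \<nu> am] unfolding d[OF \<nu> am] by (simp add: less_top)
    qed auto
    then show ?thesis using d[OF \<nu> E] d[OF \<nu>' E] by (simp add: Int_commute)
  qed
  define B where "B n = A (from_nat n)" for n
  show ?thesis
  proof (rule measure_eqI_cover[where S=B])
    show "sets \<nu> = sets \<nu>'" by (simp add: tail_finite_sets \<nu> \<nu>')
    show "B n \<in> sets \<nu>" for n by (simp add: B_def Ab tail_finite_sets[OF \<nu>])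
    show "emeasure \<nu> (E \<inter> B n) = emeasure \<nu>' (E \<inter> B n)" if "E \<in> sets \<nu>" for n E
      using main[of E] that by (simp add: B_def tail_finite_sets[OF \<nu>])
    have "space \<nu> - (\<Union>n. B n) = {0}"
    proof -
      have "\<exists>n. x \<in> B n" if "x \<noteq> 0" for x
      proof -
        obtain j where "x $ j \<noteq> 0" using \<open>x \<noteq> 0\<close> by (auto simp: vec_eq_iff)
        then obtain n where "1 / real (Suc n) < \<bar>x $ j\<bar>" using nat_approx_posE[of "\<bar>x $ j\<bar>"] by auto
        then have "x \<in> B (to_nat (j, n))" by (simp add: B_def A_def)
        then show ?thesis ..
      qed
      moreover have "0 \<notin> B n" for n by (simp add: B_def A_def)
      ultimately show ?thesis by (auto simp: tail_finite_space[OF \<nu>])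
    qed
    then show "emeasure \<nu> (space \<nu> - (\<Union>n. B n)) = 0" "emeasure \<nu>' (space \<nu> - (\<Union>n. B n)) = 0"
      using \<nu> \<nu>' by (simp_all add: tail_finite_def)
  qed
qed

section \<open>Random diagonal scaling of measures\<close>

lemma norm_times_le: "norm (w * z :: real^'n) \<le> norm w * norm z"
proof -
  have "norm (w * z) \<le> norm (norm w *\<^sub>R z)"
    by (rule norm_le_componentwise_cart) (auto simp: abs_mult intro!: mult_right_mono component_le_norm_cart)
  then show ?thesis by simp
qed

lemma borel_measurable_nth [measurable]: "(\<lambda>x :: real^'n. x $ i) \<in> borel_measurable borel"
  by (intro borel_measurable_continuous_onI continuous_intros)

lemma borel_measurable_times_vec:
  fixes f g :: "'a \<Rightarrow> real^'n"
  assumes [measurable]: "f \<in> borel_measurable M" "g \<in> borel_measurable M"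
  shows "(\<lambda>x. f x * g x) \<in> borel_measurable M"
  by (rule borel_measurable_vecI) simp

text \<open>\<open>E[\<nu> \<circ> A\<^sup>-\<^sup>1]\<close> for \<open>A = diag v\<close>.\<close>
definition mult_image :: "'w measure \<Rightarrow> ('w \<Rightarrow> real^'n) \<Rightarrow> (real^'n) measure \<Rightarrow> (real^'n) measure" where
  "mult_image M v \<nu> = distr (M \<Otimes>\<^sub>M \<nu>) borel (\<lambda>p. v (fst p) * snd p)"

lemma mult_image_measurable:
  assumes [measurable]: "v \<in> borel_measurable M" and \<nu>: "tail_finite \<nu>"
  shows "(\<lambda>p. v (fst p) * snd p) \<in> borel_measurable (M \<Otimes>\<^sub>M \<nu>)"
proof -
  have [measurable_cong]: "sets \<nu> = sets borel" by (rule tail_finite_sets[OF \<nu>])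
  show ?thesis by (rule borel_measurable_times_vec) measurable
qed

lemma emeasure_mult_image:
  assumes v: "v \<in> borel_measurable M" and \<nu>: "tail_finite \<nu>" and B: "B \<in> sets borel"
  shows "emeasure (mult_image M v \<nu>) B = (\<integral>\<^sup>+\<omega>. emeasure \<nu> {z. v \<omega> * z \<in> B} \<partial>M)"
proof -
  interpret sigma_finite_measure \<nu> by (rule tail_finite_sigma_finite[OF \<nu>])
  note m = mult_image_measurable[OF v \<nu>]
  have "emeasure (mult_image M v \<nu>) B = emeasure (M \<Otimes>\<^sub>M \<nu>) ((\<lambda>p. v (fst p) * snd p) -` B \<inter> space (M \<Otimes>\<^sub>M \<nu>))"
    unfolding mult_image_def by (rule emeasure_distr[OF m B])
  also have "\<dots> = (\<integral>\<^sup>+\<omega>. emeasure \<nu> (Pair \<omega> -` ((\<lambda>p. v (fst p) * snd p) -` B \<inter> space (M \<Otimes>\<^sub>M \<nu>))) \<partial>M)"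
    by (rule emeasure_pair_measure_alt) (rule measurable_sets[OF m B])
  also have "\<dots> = (\<integral>\<^sup>+\<omega>. emeasure \<nu> {z. v \<omega> * z \<in> B} \<partial>M)"
    by (intro nn_integral_cong arg_cong2[where f=emeasure]) (auto simp: space_pair_measure tail_finite_space[OF \<nu>])
  finally show ?thesis .
qed

text \<open>A product of norm at least \<open>r\<close> forces norm z >= r / norm v, and
  \<open>h\<close> bounds that tail. Keeping \<open>h\<close> abstract serves two cases: the pure
  power in \<open>mult_image_unique\<close> and the bound 1 + y^p in \<open>breiman\<close>. The
  origin stays null because almost surely no coordinate of \<open>v\<close> vanishes.\<close>

lemma tail_finite_mult_image:
  fixes v :: "'w \<Rightarrow> real^'n"
  assumes v: "v \<in> borel_measurable M" and nz: "AE \<omega> in M. \<forall>j. v \<omega> $ j \<noteq> 0" and \<nu>: "tail_finite \<nu>"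
    and h: "\<And>r. 0 < r \<Longrightarrow> integrable M (\<lambda>\<omega>. h r (norm (v \<omega>)))"
    and bound: "\<And>r y. 0 < r \<Longrightarrow> 0 < y \<Longrightarrow> measure \<nu> {x. r / y \<le> norm x} \<le> h r y"
  shows "tail_finite (mult_image M v \<nu>)"
  unfolding tail_finite_def
proof (intro conjI allI impI)
  show "sets (mult_image M v \<nu>) = sets borel" by (simp add: mult_image_def)
  have "emeasure (mult_image M v \<nu>) {0} = (\<integral>\<^sup>+\<omega>. emeasure \<nu> {z. v \<omega> * z \<in> {0}} \<partial>M)"
    by (rule emeasure_mult_image[OF v \<nu>]) simp
  also have "\<dots> = (\<integral>\<^sup>+\<omega>. 0 \<partial>M)"
  proof (rule nn_integral_cong_AE)
    show "AE \<omega> in M. emeasure \<nu> {z. v \<omega> * z \<in> {0}} = 0"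
      using nz
    proof eventually_elim
      case (elim \<omega>)
      then have "{z. v \<omega> * z \<in> {0}} = {0}" by (auto simp: vec_eq_iff)
      then show ?case using \<nu> by (simp add: tail_finite_def)
    qed
  qed
  finally show "emeasure (mult_image M v \<nu>) {0} = 0" by simp
  fix r :: real assume r: "0 < r"
  have "emeasure (mult_image M v \<nu>) {x. r \<le> norm x} = (\<integral>\<^sup>+\<omega>. emeasure \<nu> {z. v \<omega> * z \<in> {x. r \<le> norm x}} \<partial>M)"
    by (rule emeasure_mult_image[OF v \<nu>]) simp
  also have "\<dots> \<le> (\<integral>\<^sup>+\<omega>. ennreal (norm (h r (norm (v \<omega>)))) \<partial>M)"
  proof (rule nn_integral_mono)
    fix \<omega>
    show "emeasure \<nu> {z. v \<omega> * z \<in> {x. r \<le> norm x}} \<le> ennreal (norm (h r (norm (v \<omega>))))"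
    proof (cases "v \<omega> = 0")
      case True
      then have "{z. v \<omega> * z \<in> {x. r \<le> norm x}} = {}" using r by (auto simp: not_le)
      then show ?thesis by simp
    next
      case False
      then have v0: "0 < norm (v \<omega>)" by simp
      have "r / norm (v \<omega>) \<le> norm z" if "r \<le> norm (v \<omega> * z)" for z
        using norm_times_le[of "v \<omega>" z] that v0 by (simp add: field_simps)
      then have "emeasure \<nu> {z. v \<omega> * z \<in> {x. r \<le> norm x}} \<le> emeasure \<nu> {x. r / norm (v \<omega>) \<le> norm x}"
        by (intro emeasure_mono) (auto simp: tail_finite_sets[OF \<nu>])
      also have "\<dots> = ennreal (measure \<nu> {x. r / norm (v \<omega>) \<le> norm x})"
        using tail_finite_fin[OF \<nu>, of "r / norm (v \<omega>)"] r v0 by (intro emeasure_eq_ennreal_measure) (simp add: less_top)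
      also have "\<dots> \<le> ennreal (norm (h r (norm (v \<omega>))))"
        using bound[OF r v0] by (intro ennreal_leI) auto
      finally show ?thesis .
    qed
  qed
  also have "\<dots> < \<infinity>" using h[OF r] by (simp add: integrable_iff_bounded)
  finally show "emeasure (mult_image M v \<nu>) {x. r \<le> norm x} < \<infinity>" .
qed

lemma mult_image_integral:
  fixes f :: "real^'n \<Rightarrow> 'b::{banach, second_countable_topology}"
  assumes M: "sigma_finite_measure M" and v: "v \<in> borel_measurable M" and \<nu>: "tail_finite \<nu>" and L: "tail_finite (mult_image M v \<nu>)"
    and f: "f \<in> borel_measurable borel" "\<And>x. norm (f x) \<le> B" and r: "0 < r" "\<And>x. norm x < r \<Longrightarrow> f x = 0"
  shows "integrable (M \<Otimes>\<^sub>M \<nu>) (\<lambda>p. f (v (fst p) * snd p))"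
    and "(\<integral>x. f x \<partial>mult_image M v \<nu>) = (\<integral>p. f (v (fst p) * snd p) \<partial>(M \<Otimes>\<^sub>M \<nu>))"
    and "(\<integral>x. f x \<partial>mult_image M v \<nu>) = (\<integral>\<omega>. (\<integral>z. f (v \<omega> * z) \<partial>\<nu>) \<partial>M)"
proof -
  interpret M: sigma_finite_measure M by fact
  interpret \<nu>: sigma_finite_measure \<nu> by (rule tail_finite_sigma_finite[OF \<nu>])
  interpret pair_sigma_finite M \<nu> ..
  note m = mult_image_measurable[OF v \<nu>]
  have "integrable (mult_image M v \<nu>) f" by (rule tail_finite_integrable[OF L f r])
  then show i: "integrable (M \<Otimes>\<^sub>M \<nu>) (\<lambda>p. f (v (fst p) * snd p))"
    unfolding mult_image_def by (subst (asm) integrable_distr_eq[OF m f(1)])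
  show e: "(\<integral>x. f x \<partial>mult_image M v \<nu>) = (\<integral>p. f (v (fst p) * snd p) \<partial>(M \<Otimes>\<^sub>M \<nu>))"
    unfolding mult_image_def by (rule integral_distr[OF m f(1)])
  show "(\<integral>x. f x \<partial>mult_image M v \<nu>) = (\<integral>\<omega>. (\<integral>z. f (v \<omega> * z) \<partial>\<nu>) \<partial>M)"
    unfolding e using integral_fst'[OF i] by simp
qed

lemma cis_powr: "complex_of_real \<bar>x\<bar> powr (\<i> * complex_of_real \<theta>) = (if x = 0 then 0 else cis (\<theta> * ln \<bar>x\<bar>))"
  by (simp add: powr_def cis_conv_exp Ln_of_real mult_ac)

text \<open>A cutoff for which multiplying \<open>x\<close> by \<open>a\<close> becomes the shift of \<open>t\<close> by \<open>- ln \<bar>a\<bar>\<close>.\<close>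
definition log_ramp :: "real \<Rightarrow> real \<Rightarrow> real \<Rightarrow> real" where
  "log_ramp \<epsilon> t x = (if x = 0 then 0 else max 0 (min 1 ((ln \<bar>x\<bar> - t) / \<epsilon>)))"

lemma log_ramp_bounds: "0 \<le> log_ramp \<epsilon> t x" "log_ramp \<epsilon> t x \<le> 1"
  by (auto simp: log_ramp_def)

lemma log_ramp_mult: "a \<noteq> 0 \<Longrightarrow> log_ramp \<epsilon> t (a * x) = log_ramp \<epsilon> (t - ln \<bar>a\<bar>) x"
  by (auto simp: log_ramp_def abs_mult ln_mult algebra_simps)

lemma log_ramp_0: "0 < \<epsilon> \<Longrightarrow> \<bar>x\<bar> \<le> exp t \<Longrightarrow> log_ramp \<epsilon> t x = 0"
proof -
  assume \<epsilon>: "0 < \<epsilon>" and x: "\<bar>x\<bar> \<le> exp t"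
  have "ln \<bar>x\<bar> \<le> t" if "x \<noteq> 0" using that x by (metis exp_gt_zero ln_exp ln_le_cancel_iff zero_less_abs_iff)
  then have le: "(ln \<bar>x\<bar> - t) / \<epsilon> \<le> 0" if "x \<noteq> 0" using \<epsilon> that by (intro divide_nonpos_pos) auto
  have "max 0 (min 1 q) = 0" if "q \<le> 0" for q :: real using that by simp
  from this[OF le] show ?thesis by (simp add: log_ramp_def)
qed

lemma borel_measurable_log_ramp [measurable]: "log_ramp \<epsilon> t \<in> borel_measurable borel"
  unfolding log_ramp_def[abs_def] by measurable

lemma log_ramp_continuous: "0 < \<epsilon> \<Longrightarrow> continuous_on UNIV (\<lambda>t. log_ramp \<epsilon> t x)"
  unfolding log_ramp_def by (cases "x = 0") (auto intro!: continuous_intros)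

text \<open>A logarithmic cutoff in coordinate \<open>j\<close> times a product of characters is
  mapped by scaling to a multiple of a shifted copy of itself. The outer expectation thus becomes a
  convolution, to which \<open>wiener_uniqueness\<close> applies. What it yields is equality of
  character integrals over the tails |x_j| > R, and these determine the measure.\<close>

theorem mult_image_unique:
  fixes v :: "'w \<Rightarrow> real^'n"
  assumes M: "prob_space M" and v: "v \<in> borel_measurable M" and nz: "AE \<omega> in M. \<forall>j. v \<omega> $ j \<noteq> 0"
    and mom: "integrable M (\<lambda>\<omega>. norm (v \<omega>) powr \<alpha>)"
    and fourier: "\<And>j m \<theta>. (\<forall>k. m k \<in> {0, 1}) \<Longrightarrow>
           (\<integral>\<omega>. complex_of_real (\<bar>v \<omega> $ j\<bar> powr \<alpha>) *
               (\<Prod>k\<in>UNIV. complex_of_real \<bar>v \<omega> $ k\<bar> powr (\<i> * complex_of_real (\<theta> k)) *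
                            complex_of_real (sgn (v \<omega> $ k)) ^ m k) \<partial>M) \<noteq> 0"
    and \<nu>: "tail_finite \<nu>" "\<And>r. 0 < r \<Longrightarrow> measure \<nu> {x. r \<le> norm x} \<le> C * r powr - \<alpha>"
    and \<nu>': "tail_finite \<nu>'" "\<And>r. 0 < r \<Longrightarrow> measure \<nu>' {x. r \<le> norm x} \<le> C * r powr - \<alpha>"
    and \<alpha>: "0 < \<alpha>"
    and eq: "\<And>g. far_test g \<Longrightarrow> (\<integral>p. g (v (fst p) * snd p) \<partial>(M \<Otimes>\<^sub>M \<nu>)) = (\<integral>p. g (v (fst p) * snd p) \<partial>(M \<Otimes>\<^sub>M \<nu>'))"
  shows "\<nu> = \<nu>'"
proof -
  interpret prob_space M by fact
  have sM: "sigma_finite_measure M" by (rule sigma_finite_measure_axioms)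
  note [measurable] = v
  have C0: "0 \<le> C" using \<nu>(2)[of 1] order_trans[OF measure_nonneg] by fastforce
  have tfL: "tail_finite (mult_image M v Q)"
    if Q: "tail_finite Q" and Qb: "\<And>r. 0 < r \<Longrightarrow> measure Q {x. r \<le> norm x} \<le> C * r powr - \<alpha>" for Q
  proof (rule tail_finite_mult_image[OF v nz Q, of "\<lambda>r y. C * r powr - \<alpha> * y powr \<alpha>"])
    show "integrable M (\<lambda>\<omega>. C * r powr - \<alpha> * norm (v \<omega>) powr \<alpha>)" for r using mom by simp
    show "measure Q {x. r / y \<le> norm x} \<le> C * r powr - \<alpha> * y powr \<alpha>" if "0 < r" "0 < y" for r y
      using Qb[of "r / y"] that by (simp add: powr_divide powr_minus field_simps)
  qed
  have L: "tail_finite (mult_image M v \<nu>)" "tail_finite (mult_image M v \<nu>')"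
    by (intro tfL \<nu> \<nu>'; assumption)+
  \<comment> \<open>Agreement on far test functions is first raised to equality of the image
    measures, because the functions used below are complex and discontinuous.\<close>
  have Leq: "mult_image M v \<nu> = mult_image M v \<nu>'"
  proof (rule measure_eqI_far_test[OF L])
    fix g :: "real^'n \<Rightarrow> real" assume g: "far_test g"
    then obtain r B where r: "0 < r" "\<And>x. norm x < r \<Longrightarrow> g x = 0" and B: "\<And>x. norm (g x) \<le> B" and gm: "g \<in> borel_measurable borel"
      using far_testE[OF g] by (metis real_norm_def)
    show "(\<integral>x. g x \<partial>mult_image M v \<nu>) = (\<integral>x. g x \<partial>mult_image M v \<nu>')"
      using mult_image_integral(2)[OF sM v \<nu>(1) L(1) gm B r] mult_image_integral(2)[OF sM v \<nu>'(1) L(2) gm B r] eq[OF g] by simp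
  qed
  have key: "(\<integral>\<omega>. (\<integral>z. f (v \<omega> * z) \<partial>\<nu>) \<partial>M) = (\<integral>\<omega>. (\<integral>z. f (v \<omega> * z) \<partial>\<nu>') \<partial>M)"
    and int: "integrable M (\<lambda>\<omega>. \<integral>z. f (v \<omega> * z) \<partial>\<nu>)" "integrable M (\<lambda>\<omega>. \<integral>z. f (v \<omega> * z) \<partial>\<nu>')"
    if f: "f \<in> borel_measurable borel" "\<And>x. cmod (f x) \<le> 1" and r: "0 < r" "\<And>x. norm x < r \<Longrightarrow> f x = 0" for f r
  proof -
    show "(\<integral>\<omega>. (\<integral>z. f (v \<omega> * z) \<partial>\<nu>) \<partial>M) = (\<integral>\<omega>. (\<integral>z. f (v \<omega> * z) \<partial>\<nu>') \<partial>M)"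
      using mult_image_integral(3)[OF sM v \<nu>(1) L(1) f r] mult_image_integral(3)[OF sM v \<nu>'(1) L(2) f r] Leq by simp
    interpret \<nu>: sigma_finite_measure \<nu> by (rule tail_finite_sigma_finite[OF \<nu>(1)])
    interpret \<nu>': sigma_finite_measure \<nu>' by (rule tail_finite_sigma_finite[OF \<nu>'(1)])
    interpret P: pair_sigma_finite M \<nu> ..
    interpret P': pair_sigma_finite M \<nu>' ..
    show "integrable M (\<lambda>\<omega>. \<integral>z. f (v \<omega> * z) \<partial>\<nu>)"
      using P.integrable_fst'[OF mult_image_integral(1)[OF sM v \<nu>(1) L(1) f r]] by simp
    show "integrable M (\<lambda>\<omega>. \<integral>z. f (v \<omega> * z) \<partial>\<nu>')"
      using P'.integrable_fst'[OF mult_image_integral(1)[OF sM v \<nu>'(1) L(2) f r]] by simp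
  qed
  show ?thesis
  proof (rule measure_eqI_tail_boxes[OF \<nu>(1) \<nu>'(1)])
    fix R :: real and j :: 'n and c :: "'n \<Rightarrow> real" assume R: "0 < R"
    show "measure \<nu> {x. R < \<bar>x $ j\<bar> \<and> (\<forall>k. x $ k \<le> c k)} = measure \<nu>' {x. R < \<bar>x $ j\<bar> \<and> (\<forall>k. x $ k \<le> c k)}"
    proof (rule tail_char_unique[OF \<nu>(1) \<nu>'(1) R])
      fix z :: "'n \<Rightarrow> bool" and \<theta> :: "'n \<Rightarrow> real" and m :: "'n \<Rightarrow> nat" assume m: "\<forall>k. m k \<in> {0, 1}"
      define u where "u x = (\<Prod>k\<in>UNIV. char_fun (z k) (\<theta> k) (m k) (x $ k))" for x :: "real^'n"
      define ch where "ch a = (\<Prod>k\<in>UNIV. char_mult (z k) (\<theta> k) (m k) (a $ k))" for a :: "real^'n"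
      have um [measurable]: "u \<in> borel_measurable borel" unfolding u_def[abs_def] by measurable
      have chm [measurable]: "ch \<in> borel_measurable borel" unfolding ch_def[abs_def] by measurable
      have ub: "cmod (u x) \<le> 1" for x
        unfolding u_def by (subst prod_norm[symmetric]) (intro prod_le_1 conjI norm_ge_zero norm_char_fun_le)
      have chb: "cmod (ch a) = 1" if "\<forall>j. a $ j \<noteq> 0" for a
        using that unfolding ch_def by (subst prod_norm[symmetric]) (simp add: norm_char_mult)
      have u_mult: "u (a * x) = ch a * u x" if "\<forall>j. a $ j \<noteq> 0" for a x
        unfolding u_def ch_def prod.distrib[symmetric] using that by (intro prod.cong) (auto simp: char_fun_mult)
      define G where "G Q \<epsilon> t = (\<integral>x. complex_of_real (log_ramp \<epsilon> t (x $ j)) * u x \<partial>Q)" for Q \<epsilon> t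
      have fz: "complex_of_real (log_ramp \<epsilon> t (x $ j)) * u x = 0" if "0 < \<epsilon>" "norm x < exp t" for \<epsilon> t x
        using log_ramp_0[OF that(1), of "x $ j" t] component_le_norm_cart[of x j] that(2) by simp
      have fb: "cmod (complex_of_real (log_ramp \<epsilon> t (x $ j)) * u x) \<le> 1" for \<epsilon> t x
        using ub[of x] log_ramp_bounds[of \<epsilon> t "x $ j"] by (auto simp: norm_mult intro!: mult_le_one)
      have fm: "(\<lambda>x. complex_of_real (log_ramp \<epsilon> t (x $ j)) * u x) \<in> borel_measurable borel" for \<epsilon> t
        by measurable
      \<comment> \<open>Sequential continuity by dominated convergence. Discarding finitely many
        terms keeps the cutoff levels above t - 1, so the integrands have a common integrable bound
        away from 0.\<close>
      have Gcont: "continuous_on UNIV (G Q \<epsilon>)" if Q: "tail_finite Q" and \<epsilon>: "0 < \<epsilon>" for Q \<epsilon>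
      proof -
        have "(\<lambda>n. G Q \<epsilon> (s n)) \<longlonglongrightarrow> G Q \<epsilon> t" if s: "s \<longlonglongrightarrow> t" for s t
        proof -
          have ev: "\<forall>\<^sub>F n in sequentially. t - 1 < s n" by (rule order_tendstoD(1)[OF s]) simp
          then obtain n0 where n0: "\<And>n. n0 \<le> n \<Longrightarrow> t - 1 < s n" unfolding eventually_sequentially by auto
          have "(\<lambda>n. G Q \<epsilon> (s (n + n0))) \<longlonglongrightarrow> G Q \<epsilon> t"
            unfolding G_def
          proof (rule integral_dominated_convergence[where w="indicator {x. exp (t - 1) \<le> norm x}"])
            show "integrable Q (indicat_real {x. exp (t - 1) \<le> norm x})"
              using tail_finite_fin[OF Q, of "exp (t - 1)"] by (intro integrable_real_indicator) (auto simp: tail_finite_sets[OF Q])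
            show "(\<lambda>x. complex_of_real (log_ramp \<epsilon> t (x $ j)) * u x) \<in> borel_measurable Q"
              "\<And>n. (\<lambda>x. complex_of_real (log_ramp \<epsilon> (s (n + n0)) (x $ j)) * u x) \<in> borel_measurable Q"
              using fm by (simp_all cong: measurable_cong_sets add: tail_finite_sets[OF Q])
            have "(\<lambda>n. log_ramp \<epsilon> (s (n + n0)) y) \<longlonglongrightarrow> log_ramp \<epsilon> t y" for y
              by (rule continuous_on_tendsto_compose[OF log_ramp_continuous[OF \<epsilon>] LIMSEQ_ignore_initial_segment[OF s]]) auto
            then show "AE x in Q. (\<lambda>n. complex_of_real (log_ramp \<epsilon> (s (n + n0)) (x $ j)) * u x) \<longlonglongrightarrow> complex_of_real (log_ramp \<epsilon> t (x $ j)) * u x"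
              by (intro AE_I2 tendsto_mult tendsto_of_real tendsto_const)
            show "AE x in Q. cmod (complex_of_real (log_ramp \<epsilon> (s (n + n0)) (x $ j)) * u x) \<le> indicator {x. exp (t - 1) \<le> norm x} x" for n
            proof (intro AE_I2)
              fix x
              show "cmod (complex_of_real (log_ramp \<epsilon> (s (n + n0)) (x $ j)) * u x) \<le> indicator {x. exp (t - 1) \<le> norm x} x"
              proof (cases "exp (t - 1) \<le> norm x")
                case False
                then have "norm x < exp (s (n + n0))" using n0[of "n + n0"] by (smt (verit) exp_less_cancel_iff le_add2)
                then have "complex_of_real (log_ramp \<epsilon> (s (n + n0)) (x $ j)) * u x = 0" by (rule fz[OF \<epsilon>])
                then show ?thesis by (simp only: norm_zero) simp
              qed (use fb in simp)
            qed
          qed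
          then show ?thesis by (rule LIMSEQ_offset)
        qed
        then show ?thesis unfolding continuous_on_sequentially by (auto simp: o_def)
      qed
      have Gb: "cmod (G Q \<epsilon> t) \<le> C * exp t powr - \<alpha>"
        if Q: "tail_finite Q" and Qb: "\<And>r. 0 < r \<Longrightarrow> measure Q {x. r \<le> norm x} \<le> C * r powr - \<alpha>" and \<epsilon>: "0 < \<epsilon>" for Q \<epsilon> t
      proof -
        have "cmod (G Q \<epsilon> t) \<le> (\<integral>x. indicator {x. exp t \<le> norm x} x \<partial>Q)"
          unfolding G_def
        proof (rule norm_integral_le)
          show "integrable Q (indicat_real {x. exp t \<le> norm x})"
            using tail_finite_fin[OF Q, of "exp t"] by (intro integrable_real_indicator) (auto simp: tail_finite_sets[OF Q])
          show "cmod (complex_of_real (log_ramp \<epsilon> t (x $ j)) * u x) \<le> indicator {x. exp t \<le> norm x} x" for x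
          proof (cases "exp t \<le> norm x")
            case False
            then have "complex_of_real (log_ramp \<epsilon> t (x $ j)) * u x = 0" by (intro fz[OF \<epsilon>]) simp
            then show ?thesis by (simp only: norm_zero) simp
          qed (use fb in simp)
        qed
        also have "\<dots> \<le> C * exp t powr - \<alpha>" using Qb[of "exp t"] by (simp add: tail_finite_space[OF Q])
        finally show ?thesis .
      qed
      have Geq: "G \<nu> \<epsilon> t = G \<nu>' \<epsilon> t" if \<epsilon>: "0 < \<epsilon>" for \<epsilon> t
      proof -
        \<comment> \<open>The factor exp(\<alpha> t) compensates the tail bound C exp(-\<alpha> t),
          so \<open>g\<close> is bounded by 2 C. In the convolution it reappears as the weight
          |v_j|^\<alpha>.\<close>
        define g where "g t = complex_of_real (exp (\<alpha> * t)) * (G \<nu> \<epsilon> t - G \<nu>' \<epsilon> t)" for t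
        define w where "w \<omega> = complex_of_real (\<bar>v \<omega> $ j\<bar> powr \<alpha>) * ch (v \<omega>)" for \<omega>
        have "g t = 0"
        proof (rule wiener_uniqueness[OF sM, of w "\<lambda>\<omega>. ln \<bar>v \<omega> $ j\<bar>" g "2 * C"])
          show "integrable M w"
          proof (rule Bochner_Integration.integrable_bound[OF mom])
            show "w \<in> borel_measurable M" unfolding w_def[abs_def] by measurable
            show "AE \<omega> in M. cmod (w \<omega>) \<le> norm (norm (v \<omega>) powr \<alpha>)"
              using nz
            proof eventually_elim
              case (elim \<omega>)
              have "\<bar>v \<omega> $ j\<bar> powr \<alpha> \<le> norm (v \<omega>) powr \<alpha>"
                using \<alpha> by (intro powr_mono2 component_le_norm_cart) auto
              then show ?case using chb[OF elim] by (simp add: w_def norm_mult)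
            qed
          qed
          show "(\<lambda>\<omega>. ln \<bar>v \<omega> $ j\<bar>) \<in> borel_measurable M" by measurable
          show "(\<integral>\<omega>. w \<omega> * cis (\<theta>' * ln \<bar>v \<omega> $ j\<bar>) \<partial>M) \<noteq> 0" for \<theta>'
          proof -
            \<comment> \<open>Flagged coordinates have multiplier 1, that is, exponents 0 in the
              moment hypothesis; the Fourier variable of ln |v_j| is added to the frequency of
              coordinate \<open>j\<close>.\<close>
            define \<theta>2 where "\<theta>2 k = (if z k then 0 else \<theta> k) + (if k = j then \<theta>' else 0)" for k
            define m2 where "m2 k = (if z k then 0 else m k)" for k
            have m2: "\<forall>k. m2 k \<in> {0, 1}" using m by (auto simp: m2_def)
            have "(\<integral>\<omega>. w \<omega> * cis (\<theta>' * ln \<bar>v \<omega> $ j\<bar>) \<partial>M) =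
              (\<integral>\<omega>. complex_of_real (\<bar>v \<omega> $ j\<bar> powr \<alpha>) *
               (\<Prod>k\<in>UNIV. complex_of_real \<bar>v \<omega> $ k\<bar> powr (\<i> * complex_of_real (\<theta>2 k)) *
                            complex_of_real (sgn (v \<omega> $ k)) ^ m2 k) \<partial>M)"
            proof (rule integral_cong_AE)
              show "AE \<omega> in M. w \<omega> * cis (\<theta>' * ln \<bar>v \<omega> $ j\<bar>) = complex_of_real (\<bar>v \<omega> $ j\<bar> powr \<alpha>) *
               (\<Prod>k\<in>UNIV. complex_of_real \<bar>v \<omega> $ k\<bar> powr (\<i> * complex_of_real (\<theta>2 k)) *
                            complex_of_real (sgn (v \<omega> $ k)) ^ m2 k)"
                using nz
              proof eventually_elim
                case (elim \<omega>)
                have "complex_of_real \<bar>v \<omega> $ k\<bar> powr (\<i> * complex_of_real (\<theta>2 k)) * complex_of_real (sgn (v \<omega> $ k)) ^ m2 k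
                   = char_mult (z k) (\<theta> k) (m k) (v \<omega> $ k) * (if k = j then cis (\<theta>' * ln \<bar>v \<omega> $ j\<bar>) else 1)" for k
                  unfolding cis_powr using elim by (auto simp: \<theta>2_def m2_def char_mult_def cis_mult[symmetric] distrib_right)
                then have "(\<Prod>k\<in>UNIV. complex_of_real \<bar>v \<omega> $ k\<bar> powr (\<i> * complex_of_real (\<theta>2 k)) * complex_of_real (sgn (v \<omega> $ k)) ^ m2 k)
                  = ch (v \<omega>) * cis (\<theta>' * ln \<bar>v \<omega> $ j\<bar>)"
                  by (simp add: prod.distrib ch_def)
                then show ?case by (simp add: w_def mult.assoc)
              qed
              show "(\<lambda>\<omega>. w \<omega> * cis (\<theta>' * ln \<bar>v \<omega> $ j\<bar>)) \<in> borel_measurable M" unfolding w_def by measurable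
              show "(\<lambda>\<omega>. complex_of_real (\<bar>v \<omega> $ j\<bar> powr \<alpha>) *
               (\<Prod>k\<in>UNIV. complex_of_real \<bar>v \<omega> $ k\<bar> powr (\<i> * complex_of_real (\<theta>2 k)) *
                            complex_of_real (sgn (v \<omega> $ k)) ^ m2 k)) \<in> borel_measurable M"
                unfolding cis_powr by measurable
            qed
            then show ?thesis using fourier[OF m2, of j \<theta>2] by simp
          qed
          show "continuous_on UNIV g"
            unfolding g_def by (intro continuous_intros Gcont \<nu> \<nu>' \<epsilon>)
          show "cmod (g t) \<le> 2 * C" for t
          proof -
            have "cmod (G \<nu> \<epsilon> t - G \<nu>' \<epsilon> t) \<le> 2 * C * exp t powr - \<alpha>"
              using norm_triangle_ineq4[of "G \<nu> \<epsilon> t" "G \<nu>' \<epsilon> t"] Gb[OF \<nu> \<epsilon>, of t] Gb[OF \<nu>' \<epsilon>, of t] by linarith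
            then have "exp (\<alpha> * t) * cmod (G \<nu> \<epsilon> t - G \<nu>' \<epsilon> t) \<le> exp (\<alpha> * t) * (2 * C * exp t powr - \<alpha>)"
              by (intro mult_left_mono) auto
            also have "\<dots> = 2 * C" by (simp add: powr_def exp_minus)
            finally show ?thesis by (simp add: g_def norm_mult)
          qed
          show "(\<integral>\<omega>. w \<omega> * g (t - ln \<bar>v \<omega> $ j\<bar>) \<partial>M) = 0" for t
          proof -
            let ?f = "\<lambda>x. complex_of_real (log_ramp \<epsilon> t (x $ j)) * u x"
            have "(\<integral>\<omega>. w \<omega> * g (t - ln \<bar>v \<omega> $ j\<bar>) \<partial>M) = (\<integral>\<omega>. complex_of_real (exp (\<alpha> * t)) * ((\<integral>x. ?f (v \<omega> * x) \<partial>\<nu>) - (\<integral>x. ?f (v \<omega> * x) \<partial>\<nu>')) \<partial>M)"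
            proof (rule integral_cong_AE)
              show "AE \<omega> in M. w \<omega> * g (t - ln \<bar>v \<omega> $ j\<bar>) = complex_of_real (exp (\<alpha> * t)) * ((\<integral>x. ?f (v \<omega> * x) \<partial>\<nu>) - (\<integral>x. ?f (v \<omega> * x) \<partial>\<nu>'))"
                using nz
              proof eventually_elim
                case (elim \<omega>)
                have "(\<integral>x. ?f (v \<omega> * x) \<partial>Q) = ch (v \<omega>) * G Q \<epsilon> (t - ln \<bar>v \<omega> $ j\<bar>)" for Q
                proof -
                  have "(\<integral>x. ?f (v \<omega> * x) \<partial>Q) = (\<integral>x. ch (v \<omega>) * (complex_of_real (log_ramp \<epsilon> (t - ln \<bar>v \<omega> $ j\<bar>) (x $ j)) * u x) \<partial>Q)"
                    using elim by (intro Bochner_Integration.integral_cong) (auto simp: u_mult log_ramp_mult)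
                  then show ?thesis unfolding G_def by simp
                qed
                moreover have "\<bar>v \<omega> $ j\<bar> powr \<alpha> * exp (\<alpha> * (t - ln \<bar>v \<omega> $ j\<bar>)) = exp (\<alpha> * t)"
                  using elim by (simp add: powr_def exp_add[symmetric] algebra_simps)
                then have "complex_of_real (\<bar>v \<omega> $ j\<bar> powr \<alpha>) * complex_of_real (exp (\<alpha> * (t - ln \<bar>v \<omega> $ j\<bar>))) = complex_of_real (exp (\<alpha> * t))"
                  by (metis of_real_mult)
                ultimately show ?case unfolding w_def g_def by (simp only: right_diff_distrib mult_ac)
              qed
              have [measurable]: "g \<in> borel_measurable borel"
                unfolding g_def by (intro borel_measurable_continuous_onI continuous_intros Gcont \<nu> \<nu>' \<epsilon>)
              show "(\<lambda>\<omega>. w \<omega> * g (t - ln \<bar>v \<omega> $ j\<bar>)) \<in> borel_measurable M" unfolding w_def by measurable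
              show "(\<lambda>\<omega>. complex_of_real (exp (\<alpha> * t)) * ((\<integral>x. ?f (v \<omega> * x) \<partial>\<nu>) - (\<integral>x. ?f (v \<omega> * x) \<partial>\<nu>'))) \<in> borel_measurable M"
                using int[OF fm fb exp_gt_zero fz[OF \<epsilon>], of t] by (intro borel_measurable_times borel_measurable_diff borel_measurable_const borel_measurable_integrable)
            qed
            also have "\<dots> = complex_of_real (exp (\<alpha> * t)) * ((\<integral>\<omega>. (\<integral>x. ?f (v \<omega> * x) \<partial>\<nu>) \<partial>M) - (\<integral>\<omega>. (\<integral>x. ?f (v \<omega> * x) \<partial>\<nu>') \<partial>M))"
              using int[OF fm fb exp_gt_zero fz[OF \<epsilon>], of t] by (subst integral_mult_right_zero, subst Bochner_Integration.integral_diff) auto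
            also have "\<dots> = 0"
            proof -
              have keyt: "(\<integral>\<omega>. (\<integral>x. ?f (v \<omega> * x) \<partial>\<nu>) \<partial>M) = (\<integral>\<omega>. (\<integral>x. ?f (v \<omega> * x) \<partial>\<nu>') \<partial>M)"
                by (rule key[OF fm fb exp_gt_zero fz[OF \<epsilon>]])
              show ?thesis unfolding keyt by (simp only: diff_self mult_zero_right)
            qed
            finally show ?thesis .
          qed
        qed
        then show ?thesis by (simp add: g_def)
      qed
      \<comment> \<open>Letting the width of the logarithmic ramp at level ln R tend to 0 produces
        the strict indicator R < |x_j|.\<close>
      have lim: "(\<lambda>n. G Q (1 / real (Suc n)) (ln R)) \<longlonglongrightarrow> (\<integral>x. (if R < \<bar>x $ j\<bar> then 1 else 0) * u x \<partial>Q)" if Q: "tail_finite Q" for Q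
        unfolding G_def
      proof (rule integral_dominated_convergence[where w="indicator {x. R \<le> norm x}"])
        show "integrable Q (indicat_real {x. R \<le> norm x})"
          using tail_finite_fin[OF Q R] by (intro integrable_real_indicator) (auto simp: tail_finite_sets[OF Q])
        have "(\<lambda>x. (if R < \<bar>x $ j\<bar> then 1 else 0) * u x) \<in> borel_measurable borel" by measurable
        then show "(\<lambda>x. (if R < \<bar>x $ j\<bar> then 1 else 0) * u x) \<in> borel_measurable Q"
          by (simp cong: measurable_cong_sets add: tail_finite_sets[OF Q])
        show "(\<lambda>x. complex_of_real (log_ramp (1 / real (Suc n)) (ln R) (x $ j)) * u x) \<in> borel_measurable Q" for n
          using fm by (simp cong: measurable_cong_sets add: tail_finite_sets[OF Q])
        have "(\<lambda>n. log_ramp (1 / real (Suc n)) (ln R) y) \<longlonglongrightarrow> (if R < \<bar>y\<bar> then 1 else 0)" for y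
        proof (cases "R < \<bar>y\<bar>")
          case True
          then have d: "0 < ln \<bar>y\<bar> - ln R" using R by simp
          obtain k :: nat where k: "1 / (ln \<bar>y\<bar> - ln R) \<le> real k" using real_arch_simple by blast
          have "log_ramp (1 / real (Suc n)) (ln R) y = 1" if "k \<le> n" for n
          proof -
            have "1 / (ln \<bar>y\<bar> - ln R) \<le> real (Suc n)" using k that by simp
            then have "1 \<le> (ln \<bar>y\<bar> - ln R) / (1 / real (Suc n))" using d by (simp add: field_simps)
            moreover have "y \<noteq> 0" using True R by auto
            ultimately show ?thesis by (simp add: log_ramp_def)
          qed
          then show ?thesis using True by (intro tendsto_eventually eventually_sequentiallyI[of k]) auto
        next
          case False
          then have "log_ramp (1 / real (Suc n)) (ln R) y = 0" for n using R by (intro log_ramp_0) auto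
          then show ?thesis using False by simp
        qed
        then have "(\<lambda>n. complex_of_real (log_ramp (1 / real (Suc n)) (ln R) y)) \<longlonglongrightarrow> complex_of_real (if R < \<bar>y\<bar> then 1 else 0)" for y
          by (rule tendsto_of_real)
        then have "(\<lambda>n. complex_of_real (log_ramp (1 / real (Suc n)) (ln R) y)) \<longlonglongrightarrow> (if R < \<bar>y\<bar> then 1 else 0)" for y
          by (metis (mono_tags, lifting) of_real_0 of_real_1)
        then show "AE x in Q. (\<lambda>n. complex_of_real (log_ramp (1 / real (Suc n)) (ln R) (x $ j)) * u x) \<longlonglongrightarrow> (if R < \<bar>x $ j\<bar> then 1 else 0) * u x"
          by (intro AE_I2 tendsto_mult tendsto_const)
        show "AE x in Q. cmod (complex_of_real (log_ramp (1 / real (Suc n)) (ln R) (x $ j)) * u x) \<le> indicator {x. R \<le> norm x} x" for n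
        proof (intro AE_I2)
          fix x
          show "cmod (complex_of_real (log_ramp (1 / real (Suc n)) (ln R) (x $ j)) * u x) \<le> indicator {x. R \<le> norm x} x"
          proof (cases "R \<le> norm x")
            case False
            then have "complex_of_real (log_ramp (1 / real (Suc n)) (ln R) (x $ j)) * u x = 0" using R by (intro fz) simp_all
            then show ?thesis by (simp only: norm_zero) simp
          qed (use fb in simp)
        qed
      qed
      show "(\<integral>x. (if R < \<bar>x $ j\<bar> then 1 else 0) * (\<Prod>k\<in>UNIV. char_fun (z k) (\<theta> k) (m k) (x $ k)) \<partial>\<nu>) =
        (\<integral>x. (if R < \<bar>x $ j\<bar> then 1 else 0) * (\<Prod>k\<in>UNIV. char_fun (z k) (\<theta> k) (m k) (x $ k)) \<partial>\<nu>')"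
        unfolding u_def[symmetric]
      proof (rule LIMSEQ_unique[OF lim[OF \<nu>(1)]])
        have "G \<nu> (1 / real (Suc n)) (ln R) = G \<nu>' (1 / real (Suc n)) (ln R)" for n by (rule Geq) simp
        then show "(\<lambda>n. G \<nu> (1 / real (Suc n)) (ln R)) \<longlonglongrightarrow> (\<integral>x. (if R < \<bar>x $ j\<bar> then 1 else 0) * u x \<partial>\<nu>')"
          using lim[OF \<nu>'(1)] by simp
      qed
    qed
  qed
qed

section \<open>Breiman's lemma and compactness\<close>

text \<open>The analogue of \<open>ramp\<close> for the Euclidean norm, rising from 0 at rho/2 to 1
  at rho.\<close>

definition norm_ramp :: "real \<Rightarrow> real^'n \<Rightarrow> real" where
  "norm_ramp \<rho> x = max 0 (min 1 (2 * norm x / \<rho> - 1))"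

lemma norm_ramp_bounds: "0 \<le> norm_ramp \<rho> x" "norm_ramp \<rho> x \<le> 1"
  by (auto simp: norm_ramp_def)

lemma norm_ramp_abs: "\<bar>norm_ramp \<rho> x\<bar> \<le> 1"
  using norm_ramp_bounds[of \<rho> x] by linarith

lemma norm_ramp_0: "0 < \<rho> \<Longrightarrow> norm x \<le> \<rho> / 2 \<Longrightarrow> norm_ramp \<rho> x = 0"
proof -
  assume "0 < \<rho>" "norm x \<le> \<rho> / 2"
  then have "2 * norm x / \<rho> - 1 \<le> 0" by (simp add: field_simps)
  then show ?thesis by (simp add: norm_ramp_def)
qed

lemma norm_ramp_1: "0 < \<rho> \<Longrightarrow> \<rho> \<le> norm x \<Longrightarrow> norm_ramp \<rho> x = 1"
proof -
  assume "0 < \<rho>" "\<rho> \<le> norm x"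
  then have "1 \<le> 2 * norm x / \<rho> - 1" by (simp add: field_simps)
  then show ?thesis by (simp add: norm_ramp_def)
qed

lemma far_test_norm_ramp: "0 < \<rho> \<Longrightarrow> far_test (norm_ramp \<rho> :: real^'n \<Rightarrow> real)"
  unfolding far_test_def
proof (intro conjI)
  assume \<rho>: "0 < \<rho>"
  show "continuous_on UNIV (norm_ramp \<rho> :: real^'n \<Rightarrow> real)"
    unfolding norm_ramp_def using \<rho> by (intro continuous_intros) auto
  show "\<exists>B. \<forall>x :: real^'n. \<bar>norm_ramp \<rho> x\<bar> \<le> B" using norm_ramp_abs by blast
  show "\<exists>r>0. \<forall>x :: real^'n. norm x < r \<longrightarrow> norm_ramp \<rho> x = 0"
    using \<rho> by (intro exI[of _ "\<rho> / 2"]) (auto intro: norm_ramp_0)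
qed

lemma expectation_far_le:
  fixes Z :: "'w \<Rightarrow> real^'n" and g :: "real^'n \<Rightarrow> real"
  assumes M: "prob_space M" and Z: "Z \<in> borel_measurable M" and s: "0 < s"
    and B: "0 \<le> B" "\<And>x. \<bar>g x\<bar> \<le> B" and z: "\<And>x. norm x \<le> \<rho> \<Longrightarrow> g x = 0"
  shows "\<bar>\<integral>\<omega>. g (inverse s *\<^sub>R Z \<omega>) \<partial>M\<bar> \<le> B * measure M {\<omega> \<in> space M. norm (Z \<omega>) > \<rho> * s}"
proof -
  interpret prob_space M by fact
  have S: "{\<omega> \<in> space M. norm (Z \<omega>) > \<rho> * s} \<in> sets M" using Z by measurable
  have "\<bar>\<integral>\<omega>. g (inverse s *\<^sub>R Z \<omega>) \<partial>M\<bar> \<le> (\<integral>\<omega>. B * (if norm (Z \<omega>) > \<rho> * s then 1 else 0) \<partial>M)"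
  proof (rule abs_integral_le)
    show "integrable M (\<lambda>\<omega>. B * (if norm (Z \<omega>) > \<rho> * s then 1 else 0))"
      using Z by (intro integrable_const_bound[of _ B]) (auto simp: B)
    fix \<omega>
    show "\<bar>g (inverse s *\<^sub>R Z \<omega>)\<bar> \<le> B * (if norm (Z \<omega>) > \<rho> * s then 1 else 0)"
    proof (cases "norm (Z \<omega>) > \<rho> * s")
      case False
      then have "norm (inverse s *\<^sub>R Z \<omega>) \<le> \<rho>" using s by (simp add: field_simps)
      then show ?thesis using z B(1) by simp
    qed (use B in simp)
  qed
  also have "\<dots> = (\<integral>\<omega>. B * indicator {\<omega> \<in> space M. norm (Z \<omega>) > \<rho> * s} \<omega> \<partial>M)"
    by (intro Bochner_Integration.integral_cong) (auto simp: indicator_def)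
  also have "\<dots> = B * measure M {\<omega> \<in> space M. norm (Z \<omega>) > \<rho> * s}"
    using sets.sets_into_space[OF S] by (simp add: Int_absorb2)
  finally show ?thesis .
qed

text \<open>The ramp dominates the indicator at level rho in the limit, and its expectation is at
  most the probability beyond rho/2 before the limit. Hence the tail bound is required at
  rho/2.\<close>

lemma tail_limit_bound:
  fixes Z :: "'w \<Rightarrow> real^'n"
  assumes M: "prob_space M" and Z: "Z \<in> borel_measurable M" and \<sigma>: "\<And>n. 0 < \<sigma> n" and b: "\<And>n. 0 < b n"
    and \<nu>: "tail_finite \<nu>" and conv: "\<And>g. far_test g \<Longrightarrow> (\<lambda>n. (\<integral>\<omega>. g (inverse (\<sigma> n) *\<^sub>R Z \<omega>) \<partial>M) / b n) \<longlonglongrightarrow> (\<integral>x. g x \<partial>\<nu>)"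
    and \<rho>: "0 < \<rho>" and K: "\<forall>\<^sub>F n in sequentially. measure M {\<omega> \<in> space M. norm (Z \<omega>) > \<rho> / 2 * \<sigma> n} / b n \<le> K"
  shows "measure \<nu> {x. \<rho> \<le> norm x} \<le> K"
proof -
  have far: "far_test (norm_ramp \<rho> :: real^'n \<Rightarrow> real)" by (rule far_test_norm_ramp[OF \<rho>])
  have "measure \<nu> {x. \<rho> \<le> norm x} = (\<integral>x. indicator {x. \<rho> \<le> norm x} x \<partial>\<nu>)" by (simp add: tail_finite_space[OF \<nu>])
  also have "\<dots> \<le> (\<integral>x. norm_ramp \<rho> x \<partial>\<nu>)"
  proof (rule integral_mono)
    show "integrable \<nu> (indicat_real {x. \<rho> \<le> norm x})"
      using tail_finite_fin[OF \<nu> \<rho>] by (intro integrable_real_indicator) (auto simp: tail_finite_sets[OF \<nu>])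
    show "integrable \<nu> (norm_ramp \<rho>)" by (rule far_test_integrable[OF \<nu> far])
    show "indicat_real {x. \<rho> \<le> norm x} x \<le> norm_ramp \<rho> x" for x :: "real^'n"
      using norm_ramp_bounds(1)[of \<rho> x] norm_ramp_1[OF \<rho>, of x] by (auto simp: indicator_def)
  qed
  also have "\<dots> \<le> K"
  proof (rule tendsto_upperbound[OF conv[OF far]])
    show "\<forall>\<^sub>F n in sequentially. (\<integral>\<omega>. norm_ramp \<rho> (inverse (\<sigma> n) *\<^sub>R Z \<omega>) \<partial>M) / b n \<le> K"
      using K
    proof eventually_elim
      case (elim n)
      have "\<bar>\<integral>\<omega>. norm_ramp \<rho> (inverse (\<sigma> n) *\<^sub>R Z \<omega>) \<partial>M\<bar> \<le> 1 * measure M {\<omega> \<in> space M. norm (Z \<omega>) > \<rho> / 2 * \<sigma> n}"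
        by (intro expectation_far_le[OF M Z \<sigma>] norm_ramp_abs norm_ramp_0[OF \<rho>]) auto
      then have "(\<integral>\<omega>. norm_ramp \<rho> (inverse (\<sigma> n) *\<^sub>R Z \<omega>) \<partial>M) / b n \<le> measure M {\<omega> \<in> space M. norm (Z \<omega>) > \<rho> / 2 * \<sigma> n} / b n"
        using b[of n] by (intro divide_right_mono) auto
      then show ?case using elim by linarith
    qed
  qed simp
  finally show ?thesis .
qed

lemma expectation_indep_pair:
  fixes v Z :: "'w \<Rightarrow> real^'n" and g :: "(real^'n) \<times> (real^'n) \<Rightarrow> real"
  assumes M: "prob_space M" and ind: "prob_space.indep_var M borel v borel Z"
    and g: "g \<in> borel_measurable (borel \<Otimes>\<^sub>M borel)" and B: "\<And>x. \<bar>g x\<bar> \<le> B"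
  shows "(\<integral>\<omega>. g (v \<omega>, Z \<omega>) \<partial>M) = (\<integral>\<omega>. (\<integral>\<omega>'. g (v \<omega>, Z \<omega>') \<partial>M) \<partial>M)"
proof -
  interpret prob_space M by fact
  have v: "v \<in> borel_measurable M" and Z: "Z \<in> borel_measurable M"
    and prod: "distr M borel v \<Otimes>\<^sub>M distr M borel Z = distr M (borel \<Otimes>\<^sub>M borel) (\<lambda>x. (v x, Z x))"
    using ind unfolding indep_var_distribution_eq by auto
  interpret V: prob_space "distr M borel v" by (rule prob_space_distr[OF v])
  interpret Z: prob_space "distr M borel Z" by (rule prob_space_distr[OF Z])
  interpret P: pair_prob_space "distr M borel v" "distr M borel Z" ..
  have gm: "g \<in> borel_measurable (distr M borel v \<Otimes>\<^sub>M distr M borel Z)"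
    using g by (simp cong: measurable_cong_sets sets_pair_measure_cong)
  have i: "integrable (distr M borel v \<Otimes>\<^sub>M distr M borel Z) g"
    by (rule P.integrable_const_bound[of _ B]) (use B gm in auto)
  have "(\<integral>\<omega>. g (v \<omega>, Z \<omega>) \<partial>M) = (\<integral>p. g p \<partial>distr M (borel \<Otimes>\<^sub>M borel) (\<lambda>x. (v x, Z x)))"
    by (rule integral_distr[symmetric]) (use v Z g in measurable)
  also have "\<dots> = (\<integral>x. (\<integral>y. g (x, y) \<partial>distr M borel Z) \<partial>distr M borel v)"
    unfolding prod[symmetric] by (rule P.integral_fst'[OF i, symmetric])
  also have "\<dots> = (\<integral>\<omega>. (\<integral>y. g (v \<omega>, y) \<partial>distr M borel Z) \<partial>M)"
  proof (rule integral_distr[OF v])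
    have "(\<lambda>x. \<integral>y. g (x, y) \<partial>distr M borel Z) \<in> borel_measurable (distr M borel v)"
      by (rule borel_measurable_integrable[OF P.integrable_fst'[OF i]])
    then show "(\<lambda>x. \<integral>y. g (x, y) \<partial>distr M borel Z) \<in> borel_measurable borel" by simp
  qed
  also have "\<dots> = (\<integral>\<omega>. (\<integral>\<omega>'. g (v \<omega>, Z \<omega>') \<partial>M) \<partial>M)"
  proof (rule Bochner_Integration.integral_cong[OF refl])
    fix \<omega>
    have "(\<lambda>y. g (v \<omega>, y)) \<in> borel_measurable borel" using g by measurable
    then show "(\<integral>y. g (v \<omega>, y) \<partial>distr M borel Z) = (\<integral>\<omega>'. g (v \<omega>, Z \<omega>') \<partial>M)"
      by (rule integral_distr[OF Z])
  qed
  finally show ?thesis .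
qed

lemma far_test_times: "far_test g \<Longrightarrow> far_test (\<lambda>z :: real^'n. g (w * z))"
proof -
  assume g: "far_test g"
  then obtain r B where r: "0 < r" "\<And>x. norm x < r \<Longrightarrow> g x = 0" and B: "\<And>x. \<bar>g x\<bar> \<le> B" using far_testE by metis
  have gc: "continuous_on UNIV g" using g by (simp add: far_test_def)
  have "w * z = (\<chi> i. w $ i * z $ i)" for z by (simp add: vec_eq_iff)
  then have "continuous_on UNIV (\<lambda>z :: real^'n. w * z)" by (simp only:) (intro continuous_intros)
  then have "continuous_on UNIV (\<lambda>z. g (w * z))" by (intro continuous_on_compose2[OF gc]) auto
  moreover have "g (w * z) = 0" if "norm z < r / (norm w + 1)" for z
  proof (rule r(2))
    have p: "0 < norm w + 1" by (simp add: add_nonneg_pos)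
    have "norm (w * z) \<le> norm w * norm z" by (rule norm_times_le)
    also have "\<dots> \<le> (norm w + 1) * norm z" by (intro mult_right_mono) auto
    also have "\<dots> < r" using that p by (simp add: field_simps)
    finally show "norm (w * z) < r" .
  qed
  moreover have "0 < r / (norm w + 1)" using r(1) by (simp add: add_nonneg_pos)
  ultimately show ?thesis unfolding far_test_def using B by blast
qed

text \<open>Given v = w, the inner expectation converges by the hypothesis on \<open>Z\<close>. By
  \<open>dom\<close> it is bounded by a constant times 1 + |w|^p, which is integrable by the moment
  assumption, so dominated convergence over \<open>v\<close> applies.\<close>

lemma breiman:
  fixes v Z :: "'w \<Rightarrow> real^'n"
  assumes M: "prob_space M" and v: "v \<in> borel_measurable M" and Z: "Z \<in> borel_measurable M"
    and ind: "prob_space.indep_var M borel v borel Z" and nz: "AE \<omega> in M. \<forall>j. v \<omega> $ j \<noteq> 0"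
    and p: "0 < p" and mom: "integrable M (\<lambda>\<omega>. norm (v \<omega>) powr p)"
    and \<sigma>: "\<And>n. 0 < \<sigma> n" and b: "\<And>n. 0 < b n"
    and dom: "\<And>n y. 0 < y \<Longrightarrow> measure M {\<omega> \<in> space M. norm (Z \<omega>) > \<sigma> n / y} \<le> C * (1 + y powr p) * b n"
    and \<nu>: "tail_finite \<nu>" and conv: "\<And>g. far_test g \<Longrightarrow> (\<lambda>n. (\<integral>\<omega>. g (inverse (\<sigma> n) *\<^sub>R Z \<omega>) \<partial>M) / b n) \<longlonglongrightarrow> (\<integral>x. g x \<partial>\<nu>)"
  shows "tail_finite (mult_image M v \<nu>)"
    and "far_test g \<Longrightarrow> (\<lambda>n. (\<integral>\<omega>. g (inverse (\<sigma> n) *\<^sub>R (v \<omega> * Z \<omega>)) \<partial>M) / b n) \<longlonglongrightarrow> (\<integral>x. g x \<partial>mult_image M v \<nu>)"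
proof -
  interpret prob_space M by fact
  have sM: "sigma_finite_measure M" by (rule sigma_finite_measure_axioms)
  have C0: "0 \<le> C"
  proof -
    have "0 \<le> C * (1 + 1 powr p) * b 0" using dom[of 1 0] order_trans[OF measure_nonneg] by fastforce
    then show ?thesis using b[of 0] by (simp add: zero_le_mult_iff)
  qed
  have scale: "(2 * y / r) powr p = (2 / r) powr p * y powr p" if "0 < r" "0 \<le> y" for r y
    using that by (subst powr_mult[symmetric]) auto
  show tfL: "tail_finite (mult_image M v \<nu>)"
  proof (rule tail_finite_mult_image[OF v nz \<nu>, of "\<lambda>r y. C * (1 + (2 / r) powr p * y powr p)"])
    show "integrable M (\<lambda>\<omega>. C * (1 + (2 / r) powr p * norm (v \<omega>) powr p))" for r
      using mom by simp
    fix r y :: real assume ry: "0 < r" "0 < y"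
    show "measure \<nu> {x. r / y \<le> norm x} \<le> C * (1 + (2 / r) powr p * y powr p)"
    proof (rule tail_limit_bound[OF M Z \<sigma> b \<nu> conv])
      show "\<forall>\<^sub>F n in sequentially. measure M {\<omega> \<in> space M. norm (Z \<omega>) > r / y / 2 * \<sigma> n} / b n \<le> C * (1 + (2 / r) powr p * y powr p)"
      proof (intro always_eventually allI)
        fix n
        have e: "r / y / 2 * \<sigma> n = \<sigma> n / (2 * y / r)" using ry by (simp add: field_simps)
        have "measure M {\<omega> \<in> space M. norm (Z \<omega>) > r / y / 2 * \<sigma> n} \<le> C * (1 + (2 * y / r) powr p) * b n"
          unfolding e using ry by (intro dom) auto
        then show "measure M {\<omega> \<in> space M. norm (Z \<omega>) > r / y / 2 * \<sigma> n} / b n \<le> C * (1 + (2 / r) powr p * y powr p)"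
          using b[of n] scale[of r y] ry by (simp add: pos_divide_le_eq)
      qed
    qed (use ry in auto)
  qed
  assume g: "far_test g"
  then obtain r B where r: "0 < r" "\<And>x. norm x < r \<Longrightarrow> g x = 0" and B: "\<And>x. \<bar>g x\<bar> \<le> B" and gm [measurable]: "g \<in> borel_measurable borel"
    using far_testE by metis
  have B': "norm (g x) \<le> B" for x using B by simp
  have B0: "0 \<le> B" using B[of 0] by linarith
  define h where "h n w = (\<integral>\<omega>. g (inverse (\<sigma> n) *\<^sub>R (w * Z \<omega>)) \<partial>M) / b n" for n w
  have comm: "inverse s *\<^sub>R (w * z) = w * (inverse s *\<^sub>R z)" for s and w z :: "real^'n" by (simp add: vec_eq_iff)
  have pm: "(\<lambda>p. g (inverse s *\<^sub>R (fst p * snd p))) \<in> borel_measurable (borel \<Otimes>\<^sub>M borel)" for s :: real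
    by (intro measurable_compose[OF _ gm] borel_measurable_scaleR borel_measurable_const borel_measurable_times_vec) measurable
  have E: "(\<integral>\<omega>. g (inverse (\<sigma> n) *\<^sub>R (v \<omega> * Z \<omega>)) \<partial>M) / b n = (\<integral>\<omega>. h n (v \<omega>) \<partial>M)" for n
    using expectation_indep_pair[OF M ind pm, of "\<sigma> n" B] B unfolding h_def by simp
  have lim: "(\<lambda>n. h n w) \<longlonglongrightarrow> (\<integral>z. g (w * z) \<partial>\<nu>)" for w
    unfolding h_def comm by (rule conv[OF far_test_times[OF g]])
  have hm: "(\<lambda>\<omega>. h n (v \<omega>)) \<in> borel_measurable M" for n
  proof -
    have "(\<lambda>p. g (inverse (\<sigma> n) *\<^sub>R (v (fst p) * Z (snd p)))) \<in> borel_measurable (M \<Otimes>\<^sub>M M)"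
      using measurable_compose[OF measurable_fst v] measurable_compose[OF measurable_snd Z]
      by (intro measurable_compose[OF _ gm] borel_measurable_scaleR borel_measurable_const borel_measurable_times_vec) measurable
    then have "(\<lambda>(\<omega>, \<omega>'). g (inverse (\<sigma> n) *\<^sub>R (v \<omega> * Z \<omega>'))) \<in> borel_measurable (M \<Otimes>\<^sub>M M)"
      by (simp add: case_prod_beta')
    from borel_measurable_lebesgue_integral[OF this]
    have "(\<lambda>\<omega>. \<integral>\<omega>'. g (inverse (\<sigma> n) *\<^sub>R (v \<omega> * Z \<omega>')) \<partial>M) \<in> borel_measurable M" by simp
    then show ?thesis unfolding h_def by measurable
  qed
  have "(\<lambda>n. \<integral>\<omega>. h n (v \<omega>) \<partial>M) \<longlonglongrightarrow> (\<integral>\<omega>. (\<integral>z. g (v \<omega> * z) \<partial>\<nu>) \<partial>M)"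
  proof (rule integral_dominated_convergence[where w="\<lambda>\<omega>. B * (C * (1 + (2 / r) powr p * norm (v \<omega>) powr p))"])
    show "(\<lambda>\<omega>. h n (v \<omega>)) \<in> borel_measurable M" for n by (rule hm)
    show "(\<lambda>\<omega>. \<integral>z. g (v \<omega> * z) \<partial>\<nu>) \<in> borel_measurable M"
      by (rule borel_measurable_LIMSEQ_real[OF lim hm])
    show "integrable M (\<lambda>\<omega>. B * (C * (1 + (2 / r) powr p * norm (v \<omega>) powr p)))" using mom by simp
    show "AE \<omega> in M. (\<lambda>n. h n (v \<omega>)) \<longlonglongrightarrow> (\<integral>z. g (v \<omega> * z) \<partial>\<nu>)" by (intro AE_I2 lim)
    show "AE \<omega> in M. norm (h n (v \<omega>)) \<le> B * (C * (1 + (2 / r) powr p * norm (v \<omega>) powr p))" for n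
    proof (intro AE_I2)
      fix \<omega>
      define w where "w = v \<omega>"
      show "norm (h n (v \<omega>)) \<le> B * (C * (1 + (2 / r) powr p * norm (v \<omega>) powr p))"
        unfolding w_def[symmetric]
      proof (cases "w = 0")
        case True
        then have "h n w = 0" using r by (simp add: h_def)
        then show "norm (h n w) \<le> B * (C * (1 + (2 / r) powr p * norm w powr p))" using B0 C0 by simp
      next
        case False
        then have w0: "0 < norm w" by simp
        \<comment> \<open>\<open>g\<close> vanishes only strictly inside radius \<open>r\<close>,
          whereas \<open>expectation_far_le\<close> wants a closed ball; halving the radius provides
          the strict inequality.\<close>
        have "\<bar>\<integral>\<omega>. g (w * (inverse (\<sigma> n) *\<^sub>R Z \<omega>)) \<partial>M\<bar> \<le> B * measure M {\<omega> \<in> space M. norm (Z \<omega>) > r / (2 * norm w) * \<sigma> n}"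
        proof (rule expectation_far_le[OF M Z \<sigma> B0])
          show "\<bar>g (w * x)\<bar> \<le> B" for x by (rule B)
          show "g (w * x) = 0" if "norm x \<le> r / (2 * norm w)" for x
          proof (rule r(2))
            have "norm (w * x) \<le> norm w * norm x" by (rule norm_times_le)
            also have "\<dots> \<le> norm w * (r / (2 * norm w))" using that by (intro mult_left_mono) auto
            also have "\<dots> < r" using w0 r(1) by simp
            finally show "norm (w * x) < r" .
          qed
        qed
        also have "r / (2 * norm w) * \<sigma> n = \<sigma> n / (2 * norm w / r)" using r(1) w0 by (simp add: field_simps)
        also have "B * measure M {\<omega> \<in> space M. norm (Z \<omega>) > \<sigma> n / (2 * norm w / r)} \<le> B * (C * (1 + (2 * norm w / r) powr p) * b n)"
          using r(1) w0 B0 by (intro mult_left_mono dom) auto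
        finally have "\<bar>\<integral>\<omega>. g (w * (inverse (\<sigma> n) *\<^sub>R Z \<omega>)) \<partial>M\<bar> / b n \<le> B * (C * (1 + (2 / r) powr p * norm w powr p))"
          using b[of n] scale[of r "norm w"] r(1) by (simp add: pos_divide_le_eq mult.assoc)
        then show "norm (h n w) \<le> B * (C * (1 + (2 / r) powr p * norm w powr p))"
          unfolding h_def comm using b[of n] by (simp add: abs_divide)
      qed
    qed
  qed
  also have "(\<integral>\<omega>. (\<integral>z. g (v \<omega> * z) \<partial>\<nu>) \<partial>M) = (\<integral>x. g x \<partial>mult_image M v \<nu>)"
    by (rule mult_image_integral(3)[OF sM v \<nu> tfL gm B' r, symmetric])
  finally show "(\<lambda>n. (\<integral>\<omega>. g (inverse (\<sigma> n) *\<^sub>R (v \<omega> * Z \<omega>)) \<partial>M) / b n) \<longlonglongrightarrow> (\<integral>x. g x \<partial>mult_image M v \<nu>)"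
    unfolding E .
qed

section \<open>Tilting near the origin and vague compactness\<close>

lemma powr_tail_sum:
  fixes P :: "'w measure" and T :: "'w \<Rightarrow> real"
  assumes P: "prob_space P" and T: "T \<in> borel_measurable P" and p: "0 < p" "p < real q" and K: "0 \<le> K"
    and tail: "\<And>y. 0 < y \<Longrightarrow> measure P {\<omega> \<in> space P. T \<omega> > 1 / y} \<le> K * (1 + y powr p)"
  shows "(\<integral>\<omega>. (max 0 (min 1 (T \<omega>))) ^ q \<partial>P) \<le> K * (\<Sum>k. (1/2) ^ (k * q) * (1 + 2 powr (real (Suc k) * p)))"
    and "summable (\<lambda>k. (1/2::real) ^ (k * q) * (1 + 2 powr (real (Suc k) * p)))"
proof -
  interpret prob_space P by fact
  note [measurable] = T
  let ?a = "\<lambda>k::nat. (1/2::real) ^ (k * q) * (1 + 2 powr (real (Suc k) * p))"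
  let ?c = "\<lambda>\<omega>. max 0 (min 1 (T \<omega>))"
  \<comment> \<open>The terms are dominated by a geometric series of ratio 2^(p - q), which is below
    1 because the power \<open>q\<close> exceeds the growth exponent \<open>p\<close>.\<close>
  show summ: "summable ?a"
  proof (rule summable_comparison_test)
    show "\<exists>N. \<forall>k\<ge>N. norm (?a k) \<le> 2 powr (p + 1) * (2 powr (p - real q)) ^ k"
    proof (intro exI allI impI)
      fix k :: nat
      have "1 + 2 powr (real (Suc k) * p) \<le> 2 * 2 powr (real (Suc k) * p)"
        using p ge_one_powr_ge_zero[of 2 "real (Suc k) * p"] by simp
      then have "?a k \<le> (1/2) ^ (k * q) * (2 * 2 powr (real (Suc k) * p))" by (intro mult_left_mono) auto
      also have half: "(1/2::real) ^ (k * q) = 2 powr (- (real k * real q))"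
      proof -
        have "2 powr (- (real k * real q)) = 1 / 2 powr real (k * q)" by (simp add: powr_minus inverse_eq_divide)
        also have "2 powr real (k * q) = 2 ^ (k * q)" by (rule powr_realpow) simp
        finally show ?thesis by (simp add: power_one_over)
      qed
      also have "2 powr (- (real k * real q)) * (2 * 2 powr (real (Suc k) * p)) = 2 powr (- (real k * real q)) * (2 powr 1 * 2 powr (real (Suc k) * p))"
        by simp
      also have "\<dots> = 2 powr (- (real k * real q) + (1 + real (Suc k) * p))" by (simp only: powr_add)
      also have "- (real k * real q) + (1 + real (Suc k) * p) = (p + 1) + (p - real q) * real k" by (simp add: algebra_simps)
      also have "2 powr ((p + 1) + (p - real q) * real k) = 2 powr (p + 1) * (2 powr (p - real q)) ^ k"
        by (simp add: powr_add powr_powr[symmetric] powr_realpow)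
      finally show "norm (?a k) \<le> 2 powr (p + 1) * (2 powr (p - real q)) ^ k" by (simp add: half)
    qed
    have "2 powr (p - real q) < 2 powr 0" using p by (intro powr_less_mono) auto
    then show "summable (\<lambda>k. 2 powr (p + 1) * (2 powr (p - real q)) ^ k)"
      by (intro summable_mult summable_geometric) simp
  qed
  have q: "0 < q" using p by (intro gr0I) auto
  \<comment> \<open>Dyadic layers: if the truncated value lies between 2^(-k-1) and 2^(-k), its q-th
    power is at most 2^(-kq), which is the term of index \<open>k\<close>.\<close>
  have pt: "ennreal (?c \<omega> ^ q) \<le> (\<Sum>k. ennreal ((1/2) ^ (k * q)) * indicator {\<omega> \<in> space P. T \<omega> > (1/2) ^ Suc k} \<omega>)" if "\<omega> \<in> space P" for \<omega>
  proof (cases "T \<omega> \<le> 0")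
    case True
    then have "?c \<omega> = 0" by simp
    then show ?thesis using q by (simp add: power_0_left)
  next
    case False
    define y where "y = min 1 (T \<omega>)"
    have y: "0 < y" "y \<le> 1" using False by (auto simp: y_def)
    obtain n where n: "(1/2::real) ^ n < y" using real_arch_pow_inv[OF y(1), of "1/2"] by auto
    \<comment> \<open>The least exponent is not 0, because y <= 1. Its predecessor is the index of
      the layer containing \<open>y\<close>.\<close>
    define m where "m = (LEAST n. (1/2::real) ^ n < y)"
    have m: "(1/2::real) ^ m < y" unfolding m_def by (rule LeastI) (rule n)
    have "m \<noteq> 0" using m y by (intro notI) simp
    then obtain k where k: "m = Suc k" using not0_implies_Suc by blast
    have "\<not> (1/2::real) ^ k < y" using not_less_Least[of k "\<lambda>n. (1/2::real) ^ n < y"] k by (simp add: m_def)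
    then have "y ^ q \<le> ((1/2) ^ k) ^ q" using y by (intro power_mono) auto
    then have le: "ennreal (y ^ q) \<le> ennreal ((1/2) ^ (k * q)) * indicator {\<omega> \<in> space P. T \<omega> > (1/2) ^ Suc k} \<omega>"
      using m \<open>\<omega> \<in> space P\<close> unfolding k by (simp add: power_mult y_def ennreal_leI)
    define F :: "nat \<Rightarrow> ennreal" where "F k = ennreal ((1/2) ^ (k * q)) * indicator {\<omega> \<in> space P. T \<omega> > (1/2) ^ Suc k} \<omega>" for k
    have "F k \<le> (\<Sum>k. F k)" using sum_le_suminf[of F "{k}"] by simp
    moreover have "?c \<omega> = y" using y by (simp add: y_def)
    ultimately show ?thesis using le unfolding F_def by simp
  qed
  have "(\<integral>\<^sup>+\<omega>. ennreal (?c \<omega> ^ q) \<partial>P) \<le> (\<integral>\<^sup>+\<omega>. (\<Sum>k. ennreal ((1/2) ^ (k * q)) * indicator {\<omega> \<in> space P. T \<omega> > (1/2) ^ Suc k} \<omega>) \<partial>P)"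
    by (rule nn_integral_mono) (rule pt)
  also have "\<dots> = (\<Sum>k. \<integral>\<^sup>+\<omega>. ennreal ((1/2) ^ (k * q)) * indicator {\<omega> \<in> space P. T \<omega> > (1/2) ^ Suc k} \<omega> \<partial>P)"
    by (rule nn_integral_suminf) measurable
  also have "\<dots> \<le> (\<Sum>k. ennreal (K * ?a k))"
  proof (intro suminf_le summableI)
    fix k
    have "(\<integral>\<^sup>+\<omega>. ennreal ((1/2) ^ (k * q)) * indicator {\<omega> \<in> space P. T \<omega> > (1/2) ^ Suc k} \<omega> \<partial>P)
       = ennreal ((1/2) ^ (k * q)) * emeasure P {\<omega> \<in> space P. T \<omega> > (1/2) ^ Suc k}"
      by (rule nn_integral_cmult_indicator) measurable
    also have "\<dots> = ennreal ((1/2) ^ (k * q) * measure P {\<omega> \<in> space P. T \<omega> > (1/2) ^ Suc k})"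
      by (simp add: emeasure_eq_measure ennreal_mult)
    also have "\<dots> \<le> ennreal (K * ?a k)"
    proof (rule ennreal_leI)
      have "(1/2::real) ^ Suc k = 1 / 2 ^ Suc k" by (simp add: power_one_over)
      then have "measure P {\<omega> \<in> space P. T \<omega> > (1/2) ^ Suc k} \<le> K * (1 + (2 ^ Suc k) powr p)"
        using tail[of "2 ^ Suc k"] by simp
      also have "(2 ^ Suc k :: real) powr p = 2 powr (real (Suc k) * p)"
        by (simp add: powr_powr[symmetric] powr_realpow del: of_nat_Suc power_Suc)
      finally have "(1/2) ^ (k * q) * measure P {\<omega> \<in> space P. T \<omega> > (1/2) ^ Suc k} \<le> (1/2) ^ (k * q) * (K * (1 + 2 powr (real (Suc k) * p)))"
        by (intro mult_left_mono) auto
      then show "(1/2) ^ (k * q) * measure P {\<omega> \<in> space P. T \<omega> > (1/2) ^ Suc k} \<le> K * ?a k" by (simp add: mult_ac)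
    qed
    finally show "(\<integral>\<^sup>+\<omega>. ennreal ((1/2) ^ (k * q)) * indicator {\<omega> \<in> space P. T \<omega> > (1/2) ^ Suc k} \<omega> \<partial>P) \<le> ennreal (K * ?a k)" .
  qed
  also have "\<dots> = ennreal (\<Sum>k. K * ?a k)"
    using K by (intro suminf_ennreal2 summable_mult summ) auto
  also have "(\<Sum>k. K * ?a k) = K * (\<Sum>k. ?a k)" by (rule suminf_mult[OF summ])
  finally have le: "(\<integral>\<^sup>+\<omega>. ennreal (?c \<omega> ^ q) \<partial>P) \<le> ennreal (K * (\<Sum>k. ?a k))" .
  have i: "integrable P (\<lambda>\<omega>. ?c \<omega> ^ q)"
    by (rule integrable_const_bound[of _ 1]) (auto simp: power_le_one)
  have "ennreal (\<integral>\<omega>. ?c \<omega> ^ q \<partial>P) = (\<integral>\<^sup>+\<omega>. ennreal (?c \<omega> ^ q) \<partial>P)"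
    by (rule nn_integral_eq_integral[symmetric, OF i]) auto
  then have "ennreal (\<integral>\<omega>. ?c \<omega> ^ q \<partial>P) \<le> ennreal (K * (\<Sum>k. ?a k))" using le by simp
  moreover have "0 \<le> K * (\<Sum>k. ?a k)" using K by (intro mult_nonneg_nonneg suminf_nonneg summ) auto
  ultimately show "(\<integral>\<omega>. ?c \<omega> ^ q \<partial>P) \<le> K * (\<Sum>k. ?a k)" by (simp add: ennreal_le_iff)
qed

text \<open>A bounded continuous weight that vanishes only at the origin, to order \<open>q\<close>.
  For \<open>q\<close> above the growth exponent, its integrals against the normalised laws stay
  bounded although their masses near 0 do not.\<close>

definition cap_weight :: "nat \<Rightarrow> ereal^'n \<Rightarrow> real" where
  "cap_weight q y = (\<Sum>i\<in>UNIV. cap 1 (y $ i) ^ q)"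

lemma cap_weight_nonneg: "0 \<le> cap_weight q y"
  unfolding cap_weight_def by (intro sum_nonneg zero_le_power cap_bounds) simp

lemma cap_weight_le: "cap_weight q (y :: ereal^'n) \<le> real CARD('n)"
proof -
  have "cap_weight q y \<le> (\<Sum>i\<in>(UNIV::'n set). 1)"
    unfolding cap_weight_def by (intro sum_mono power_le_one cap_bounds) auto
  then show ?thesis by simp
qed

lemma cap_weight_continuous: "continuous_on UNIV (cap_weight q :: ereal^'n \<Rightarrow> real)"
  unfolding cap_weight_def[abs_def] by (intro continuous_intros cap_comp_continuous) auto

lemma cap_weight_ge:
  assumes \<rho>: "0 < \<rho>" and y: "ereal \<rho> \<le> \<bar>y $ i\<bar>"
  shows "(min 1 \<rho>) ^ q \<le> cap_weight q y"
proof -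
  have "min 1 \<rho> \<le> cap 1 (y $ i)"
    using y by (cases "y $ i") (auto simp: cap_real cap_infinity)
  then have "(min 1 \<rho>) ^ q \<le> cap 1 (y $ i) ^ q" using \<rho> by (intro power_mono) auto
  also have "\<dots> \<le> cap_weight q y"
    unfolding cap_weight_def by (rule member_le_sum) (auto intro!: zero_le_power cap_bounds)
  finally show ?thesis .
qed

lemma ereal_far_of_norm:
  fixes x :: "real^'n"
  assumes "r \<le> norm x"
  shows "\<exists>i. ereal (r / real CARD('n)) \<le> \<bar>ereal_vec x $ i\<bar>"
proof (rule ccontr)
  assume "\<not> ?thesis"
  then have "(\<Sum>i\<in>UNIV. \<bar>x $ i\<bar>) < (\<Sum>i\<in>(UNIV::'n set). r / real CARD('n))"
    by (intro sum_strict_mono) (auto simp: not_le ereal_vec_nth)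
  also have "\<dots> = r" by simp
  finally show False using assms norm_le_l1_cart[of x] by simp
qed

lemma not_range_ereal_vecD:
  assumes "y \<notin> range ereal_vec"
  shows "\<exists>i. \<bar>y $ i\<bar> = \<infinity>"
  using assms by (simp only: range_ereal_vec mem_Collect_eq not_all not_not simp_thms)

text \<open>Tilting the laws by a weight that vanishes at 0 turns them into probability measures, for which
  \<open>ereal_vec_prohorov\<close> applies; the tilt is undone in the limit.\<close>
theorem vague_compactness:
  fixes Z :: "'w \<Rightarrow> real^'n"
  assumes N: "is_norm N" and M: "prob_space M" and Z: "Z \<in> borel_measurable M"
    and \<sigma>: "\<And>n. 0 < \<sigma> n" "filterlim \<sigma> at_top sequentially" and b: "\<And>n. 0 < b n"
    and p: "0 < p" and C: "0 \<le> C" and dom: "\<And>n y. 0 < y \<Longrightarrow> measure M {\<omega> \<in> space M. norm (Z \<omega>) > \<sigma> n / y} \<le> C * (1 + y powr p) * b n"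
    and \<alpha>: "0 < \<alpha>" and K: "0 \<le> K" and tail: "\<And>r. 0 < r \<Longrightarrow> \<forall>\<^sub>F n in sequentially. measure M {\<omega> \<in> space M. norm (Z \<omega>) > r * \<sigma> n} / b n \<le> K * r powr - \<alpha>"
  obtains r :: "nat \<Rightarrow> nat" and \<mu> where "strict_mono r" "finite_radon N \<mu>"
    "vague_tendsto (\<lambda>n. scaled_law M Z (\<sigma> (r n)) (b (r n))) \<mu> sequentially"
    "\<And>\<rho>. 0 < \<rho> \<Longrightarrow> measure (real_tail \<mu>) {x. \<rho> \<le> norm x} \<le> K * 2 powr \<alpha> * \<rho> powr - \<alpha>"
proof -
  interpret prob_space M by fact
  note [measurable] = Z
  define q where "q = Suc (nat \<lceil>p\<rceil>)"
  have q: "0 < q" "p < real q" using p by (auto simp: q_def) linarith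
  define w :: "ereal^'n \<Rightarrow> real" where "w = cap_weight q"
  let ?Y = "\<lambda>n \<omega>. inverse (\<sigma> n) *\<^sub>R Z \<omega>"
  have Ym [measurable]: "?Y n \<in> borel_measurable M" for n by measurable
  have wm: "w \<in> borel_measurable borel" unfolding w_def by (rule borel_measurable_continuous_onI[OF cap_weight_continuous])
  have eYm: "(\<lambda>\<omega>. ereal_vec (?Y n \<omega>)) \<in> borel_measurable M" for n
    by (rule measurable_compose[OF Ym borel_measurable_ereal_vec])
  have wYm [measurable]: "(\<lambda>\<omega>. w (ereal_vec (?Y n \<omega>))) \<in> borel_measurable M" for n
    by (rule measurable_compose[OF eYm wm])
  have w0: "0 \<le> w y" "w y \<le> real CARD('n)" for y unfolding w_def by (rule cap_weight_nonneg cap_weight_le)+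
  define S where "S = (\<Sum>k. (1/2) ^ (k * q) * (1 + 2 powr (real (Suc k) * p)))"
  \<comment> \<open>The second summand bounds all \<open>m n\<close>; the leading 1 makes
    \<open>D\<close> positive.\<close>
  define D where "D = 1 + real CARD('n) * (C * S)"
  have wint: "integrable M (\<lambda>\<omega>. w (ereal_vec (?Y n \<omega>)))" for n
    by (rule integrable_const_bound[of _ "real CARD('n)"]) (use w0 in \<open>auto simp: abs_of_nonneg\<close>)
  define m where "m n = (\<integral>\<omega>. w (ereal_vec (?Y n \<omega>)) \<partial>M) / b n" for n
  have m0: "0 \<le> m n" for n unfolding m_def using b[of n] w0 by (intro divide_nonneg_pos integral_nonneg_AE) auto
  have S0: "0 \<le> S"
  proof -
    have "summable (\<lambda>k. (1/2::real) ^ (k * q) * (1 + 2 powr (real (Suc k) * p)))"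
      by (rule powr_tail_sum(2)[OF M, of "\<lambda>_. 0" p q 1]) (use p q in auto)
    then show ?thesis unfolding S_def by (intro suminf_nonneg) auto
  qed
  have mD: "m n \<le> D" for n
  proof -
    have T: "(\<integral>\<omega>. (max 0 (min 1 (norm (?Y n \<omega>)))) ^ q \<partial>M) \<le> C * b n * S"
      unfolding S_def
    proof (rule powr_tail_sum(1)[OF M _ p q(2)])
      show "(\<lambda>\<omega>. norm (?Y n \<omega>)) \<in> borel_measurable M" by measurable
      show "0 \<le> C * b n" using C b[of n] by simp
      fix y :: real assume y: "0 < y"
      have "{\<omega> \<in> space M. norm (?Y n \<omega>) > 1 / y} = {\<omega> \<in> space M. norm (Z \<omega>) > \<sigma> n / y}"
        using \<sigma>(1)[of n] y by (auto simp: field_simps)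
      then show "measure M {\<omega> \<in> space M. norm (?Y n \<omega>) > 1 / y} \<le> C * b n * (1 + y powr p)"
        using dom[OF y, of n] by (simp add: mult_ac)
    qed
    have "(\<integral>\<omega>. w (ereal_vec (?Y n \<omega>)) \<partial>M) \<le> (\<integral>\<omega>. real CARD('n) * (max 0 (min 1 (norm (?Y n \<omega>)))) ^ q \<partial>M)"
    proof (rule integral_mono[OF wint])
      show "integrable M (\<lambda>\<omega>. real CARD('n) * (max 0 (min 1 (norm (?Y n \<omega>)))) ^ q)"
        by (intro integrable_mult_right integrable_const_bound[of _ 1]) (auto simp: power_le_one)
      fix \<omega>
      have "w (ereal_vec (?Y n \<omega>)) \<le> (\<Sum>i\<in>(UNIV::'n set). (max 0 (min 1 (norm (?Y n \<omega>)))) ^ q)"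
        unfolding w_def cap_weight_def
      proof (rule sum_mono)
        fix i
        have "cap 1 (ereal_vec (?Y n \<omega>) $ i) = min 1 \<bar>?Y n \<omega> $ i\<bar>"
          unfolding ereal_vec_nth by (rule cap_real) simp
        also have "\<dots> \<le> max 0 (min 1 (norm (?Y n \<omega>)))"
          using component_le_norm_cart[of "?Y n \<omega>" i] by linarith
        finally show "cap 1 (ereal_vec (?Y n \<omega>) $ i) ^ q \<le> (max 0 (min 1 (norm (?Y n \<omega>)))) ^ q"
          by (rule power_mono) (simp add: cap_bounds)
      qed
      then show "w (ereal_vec (?Y n \<omega>)) \<le> real CARD('n) * (max 0 (min 1 (norm (?Y n \<omega>)))) ^ q" by simp
    qed
    also have "\<dots> = real CARD('n) * (\<integral>\<omega>. (max 0 (min 1 (norm (?Y n \<omega>)))) ^ q \<partial>M)" by (rule integral_mult_right_zero)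
    also have "\<dots> \<le> real CARD('n) * (C * b n * S)" using T by (intro mult_left_mono) auto
    finally have "m n \<le> real CARD('n) * (C * S)" unfolding m_def using b[of n] by (simp add: pos_divide_le_eq mult_ac)
    then show ?thesis by (simp add: D_def)
  qed
  have D: "0 < D" unfolding D_def using C S0 by (simp add: add_pos_nonneg)
  \<comment> \<open>The constant 1 - m/D fills the total mass up to exactly 1. This avoids dividing
    by \<open>m n\<close>, which might tend to 0. The filling disappears in the limit, since
    \<open>Z\<close> divided by the scale tends to 0 pointwise.\<close>
  define h where "h n \<omega> = w (ereal_vec (?Y n \<omega>)) / (b n * D) + (1 - m n / D)" for n \<omega>
  have h0: "0 \<le> h n \<omega>" for n \<omega>
    unfolding h_def using w0 b[of n] D mD[of n] by (intro add_nonneg_nonneg divide_nonneg_nonneg) (auto simp: field_simps)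
  have hm [measurable]: "h n \<in> borel_measurable M" for n unfolding h_def[abs_def] by measurable
  have hint: "integrable M (h n)" for n unfolding h_def[abs_def] using wint by simp
  have h1: "(\<integral>\<omega>. h n \<omega> \<partial>M) = 1" for n
  proof -
    have "(\<integral>\<omega>. h n \<omega> \<partial>M) = (\<integral>\<omega>. w (ereal_vec (?Y n \<omega>)) \<partial>M) / (b n * D) + (1 - m n / D)"
      unfolding h_def using wint by (simp add: prob_space)
    also have "(\<integral>\<omega>. w (ereal_vec (?Y n \<omega>)) \<partial>M) / (b n * D) = m n / D" by (simp add: m_def)
    finally show ?thesis by simp
  qed
  define DM where "DM n = density M (\<lambda>\<omega>. ennreal (h n \<omega>))" for n
  have DM: "prob_space (DM n)" for n
  proof
    have "emeasure (DM n) (space (DM n)) = (\<integral>\<^sup>+\<omega>. ennreal (h n \<omega>) \<partial>M)"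
      unfolding DM_def by (simp add: emeasure_density cong: nn_integral_cong)
    also have "\<dots> = ennreal (\<integral>\<omega>. h n \<omega> \<partial>M)" by (rule nn_integral_eq_integral[OF hint]) (simp add: h0)
    finally show "emeasure (DM n) (space (DM n)) = 1" by (simp add: h1)
  qed
  define P where "P n = distr (DM n) borel (?Y n)" for n
  have YDM: "?Y n \<in> borel_measurable (DM n)" for n unfolding DM_def by simp
  have P: "prob_space (P n)" "sets (P n) = sets borel" for n
    unfolding P_def by (auto intro!: prob_space.prob_space_distr DM YDM)
  obtain r and Q :: "(ereal^'n) measure" where r: "strict_mono (r :: nat \<Rightarrow> nat)" and Q: "prob_space Q" "sets Q = sets borel"
    and Qlim: "\<And>f :: ereal^'n \<Rightarrow> real. continuous_on UNIV f \<Longrightarrow> (\<lambda>n. \<integral>x. f (ereal_vec x) \<partial>P (r n)) \<longlonglongrightarrow> (\<integral>y. f y \<partial>Q)"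
    by (rule ereal_vec_prohorov[OF P]) (rule that)
  interpret Q: prob_space Q by (rule Q)
  have spQ: "space Q = UNIV" using sets_eq_imp_space_eq[OF Q(2)] by simp
  \<comment> \<open>The tilt is undone by the reciprocal weight, and the origin, where the filling
    mass collects, is removed.\<close>
  define \<mu> where "\<mu> = density (restrict_space Q (- {0})) (\<lambda>y. ennreal (D / w y))"
  have RQ: "sets (restrict_space Q (- {0})) = sets punctured_borel"
    unfolding punctured_borel_def by (rule sets_restrict_space_cong[OF Q(2)])
  have mR: "f \<in> borel_measurable (restrict_space Q (- {0}))" if "f \<in> borel_measurable borel" for f :: "ereal^'n \<Rightarrow> 'z::topological_space"
    using that by (intro measurable_restrict_space1) (simp cong: measurable_cong_sets add: Q(2))
  have wR: "(\<lambda>y. D / w y) \<in> borel_measurable (restrict_space Q (- {0}))"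
    using wm by (intro mR) measurable
  have \<mu>sets: "sets \<mu> = sets punctured_borel" unfolding \<mu>_def using RQ by simp
  have \<mu>space: "space \<mu> = - {0}" using sets_eq_imp_space_eq[OF \<mu>sets] by (simp add: space_punctured_borel)
  have flim: "(\<lambda>n. (\<integral>\<omega>. f (ereal_vec (?Y (r n) \<omega>)) \<partial>M) / b (r n)) \<longlonglongrightarrow> (\<integral>y. f y \<partial>\<mu>)"
    if f: "continuous_on UNIV f" and \<rho>: "0 < \<rho>" "\<And>y. (\<And>i. \<bar>y $ i\<bar> < ereal \<rho>) \<Longrightarrow> f y = 0" for f \<rho>
  proof -
    define w1 where "w1 = (min 1 \<rho>) ^ q"
    have w1: "0 < w1" using \<rho> by (simp add: w1_def)
    have fw: "f y = 0 \<or> w1 \<le> w y" for y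
      using \<rho>(2)[of y] cap_weight_ge[OF \<rho>(1), of y _ q] unfolding w_def w1_def by (meson not_le)
    \<comment> \<open>The quotient of \<open>f\<close> by the weight: where \<open>f\<close> is
      nonzero the weight is at least \<open>w1\<close>, so the maximum changes nothing there, yet it
      keeps \<open>F\<close> continuous at the origin.\<close>
    define F where "F y = f y / max (w y) w1" for y
    have Fc: "continuous_on UNIV F"
      unfolding F_def w_def using w1 by (intro continuous_intros f cap_weight_continuous) auto
    have Fm: "F \<in> borel_measurable borel" by (rule borel_measurable_continuous_onI[OF Fc])
    have fm: "f \<in> borel_measurable borel" by (rule borel_measurable_continuous_onI[OF f])
    have Fw: "F y * w y = f y" for y using fw[of y] w1 by (auto simp: F_def max_def)
    have "bounded (F ` UNIV)"
      by (intro compact_imp_bounded compact_continuous_image Fc compact_UNIV_ereal_vec)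
    then obtain B where B: "\<And>y. \<bar>F y\<bar> \<le> B" unfolding bounded_iff by auto
    have FYm: "(\<lambda>\<omega>. F (ereal_vec (?Y n \<omega>))) \<in> borel_measurable M" for n
      by (rule measurable_compose[OF eYm Fm])
    have Fint: "integrable M (\<lambda>\<omega>. F (ereal_vec (?Y n \<omega>)))" for n
      by (rule integrable_const_bound[of _ B]) (use B FYm in auto)
    have fint: "integrable M (\<lambda>\<omega>. f (ereal_vec (?Y n \<omega>)))" for n
    proof (rule integrable_const_bound[of _ "B * real CARD('n)"])
      have "\<bar>F y\<bar> * \<bar>w y\<bar> \<le> B * real CARD('n)" for y
        using B[of y] w0[of y] order_trans[OF abs_ge_zero B[of y]] by (intro mult_mono) auto
      then show "AE \<omega> in M. norm (f (ereal_vec (?Y n \<omega>))) \<le> B * real CARD('n)"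
        by (intro AE_I2) (simp add: Fw[symmetric] abs_mult)
    qed (rule measurable_compose[OF eYm fm])
    have eqP: "(\<integral>x. F (ereal_vec x) \<partial>P n) = (\<integral>\<omega>. f (ereal_vec (?Y n \<omega>)) \<partial>M) / b n / D + (1 - m n / D) * (\<integral>\<omega>. F (ereal_vec (?Y n \<omega>)) \<partial>M)" for n
    proof -
      have "(\<integral>x. F (ereal_vec x) \<partial>P n) = (\<integral>\<omega>. F (ereal_vec (?Y n \<omega>)) \<partial>DM n)"
        unfolding P_def by (rule integral_distr[OF YDM measurable_compose[OF borel_measurable_ereal_vec Fm]])
      also have "\<dots> = (\<integral>\<omega>. h n \<omega> *\<^sub>R F (ereal_vec (?Y n \<omega>)) \<partial>M)"
        unfolding DM_def by (rule integral_density[OF FYm hm]) (simp add: h0)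
      also have "\<dots> = (\<integral>\<omega>. f (ereal_vec (?Y n \<omega>)) * (1 / (b n * D)) + (1 - m n / D) * F (ereal_vec (?Y n \<omega>)) \<partial>M)"
        by (intro Bochner_Integration.integral_cong refl) (simp add: h_def Fw[symmetric] field_simps)
      also have "\<dots> = (\<integral>\<omega>. f (ereal_vec (?Y n \<omega>)) * (1 / (b n * D)) \<partial>M) + (\<integral>\<omega>. (1 - m n / D) * F (ereal_vec (?Y n \<omega>)) \<partial>M)"
        by (rule Bochner_Integration.integral_add) (intro integrable_mult_left integrable_mult_right fint Fint)+
      also have "\<dots> = (\<integral>\<omega>. f (ereal_vec (?Y n \<omega>)) \<partial>M) / b n / D + (1 - m n / D) * (\<integral>\<omega>. F (ereal_vec (?Y n \<omega>)) \<partial>M)"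
        by simp
      finally show ?thesis .
    qed
    have F0: "F 0 = 0" using \<rho>(2)[of 0] \<rho>(1) by (simp add: F_def)
    \<comment> \<open>The contribution of the filling mass: the arguments tend to the origin, where
      \<open>F\<close> is 0.\<close>
    have Fz: "(\<lambda>n. \<integral>\<omega>. F (ereal_vec (?Y n \<omega>)) \<partial>M) \<longlonglongrightarrow> (\<integral>\<omega>. 0 \<partial>M)"
    proof (rule integral_dominated_convergence[where w="\<lambda>_. B"])
      show "AE \<omega> in M. (\<lambda>n. F (ereal_vec (?Y n \<omega>))) \<longlonglongrightarrow> 0"
      proof (intro AE_I2)
        fix \<omega>
        have "(\<lambda>n. inverse (\<sigma> n)) \<longlonglongrightarrow> 0" using \<sigma>(2) by (rule tendsto_inverse_0_at_top)
        then have "(\<lambda>n. ?Y n \<omega>) \<longlonglongrightarrow> 0 *\<^sub>R Z \<omega>" by (intro tendsto_scaleR tendsto_const)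
        then have Y0: "(\<lambda>n. ?Y n \<omega>) \<longlonglongrightarrow> 0" by simp
        have c: "continuous_on UNIV (\<lambda>x :: real^'n. F (ereal_vec x))"
          by (rule continuous_on_compose2[OF Fc ereal_vec_continuous]) auto
        have "(\<lambda>n. F (ereal_vec (?Y n \<omega>))) \<longlonglongrightarrow> F (ereal_vec 0)"
          by (rule continuous_on_tendsto_compose[OF c Y0]) auto
        moreover have "ereal_vec 0 = (0 :: ereal^'n)" by (simp add: ereal_vec_eq_0_iff)
        ultimately show "(\<lambda>n. F (ereal_vec (?Y n \<omega>))) \<longlonglongrightarrow> 0" using F0 by simp
      qed
    qed (use B FYm in auto)
    have "(\<lambda>n. (1 - m n / D) * (\<integral>\<omega>. F (ereal_vec (?Y n \<omega>)) \<partial>M)) \<longlonglongrightarrow> 0"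
    proof (rule Lim_null_comparison)
      show "\<forall>\<^sub>F n in sequentially. norm ((1 - m n / D) * (\<integral>\<omega>. F (ereal_vec (?Y n \<omega>)) \<partial>M)) \<le> \<bar>\<integral>\<omega>. F (ereal_vec (?Y n \<omega>)) \<partial>M\<bar>"
      proof (intro always_eventually allI)
        fix n
        have "\<bar>1 - m n / D\<bar> \<le> 1" using m0[of n] mD[of n] D by (auto simp: field_simps)
        then show "norm ((1 - m n / D) * (\<integral>\<omega>. F (ereal_vec (?Y n \<omega>)) \<partial>M)) \<le> \<bar>\<integral>\<omega>. F (ereal_vec (?Y n \<omega>)) \<partial>M\<bar>"
          by (simp add: abs_mult mult_left_le_one_le)
      qed
      show "(\<lambda>n. \<bar>\<integral>\<omega>. F (ereal_vec (?Y n \<omega>)) \<partial>M\<bar>) \<longlonglongrightarrow> 0" using tendsto_rabs[OF Fz] by simp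
    qed
    from LIMSEQ_subseq_LIMSEQ[OF this r] have z: "(\<lambda>n. (1 - m (r n) / D) * (\<integral>\<omega>. F (ereal_vec (?Y (r n) \<omega>)) \<partial>M)) \<longlonglongrightarrow> 0"
      by (simp add: o_def)
    have "(\<lambda>n. D * ((\<integral>x. F (ereal_vec x) \<partial>P (r n)) - (1 - m (r n) / D) * (\<integral>\<omega>. F (ereal_vec (?Y (r n) \<omega>)) \<partial>M))) \<longlonglongrightarrow> D * ((\<integral>y. F y \<partial>Q) - 0)"
      by (intro tendsto_intros Qlim[OF Fc] z)
    moreover have "(\<lambda>n. D * ((\<integral>x. F (ereal_vec x) \<partial>P (r n)) - (1 - m (r n) / D) * (\<integral>\<omega>. F (ereal_vec (?Y (r n) \<omega>)) \<partial>M))) = (\<lambda>n. (\<integral>\<omega>. f (ereal_vec (?Y (r n) \<omega>)) \<partial>M) / b (r n))"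
      unfolding eqP using D by simp
    moreover have "(\<integral>y. f y \<partial>\<mu>) = D * (\<integral>y. F y \<partial>Q)"
    proof -
      have "(\<integral>y. f y \<partial>\<mu>) = (\<integral>y. (D / w y) *\<^sub>R f y \<partial>restrict_space Q (- {0}))"
        unfolding \<mu>_def by (rule integral_density[OF mR[OF fm] wR]) (use D w0 in auto)
      also have "\<dots> = (\<integral>y. indicator (- {0}) y *\<^sub>R ((D / w y) *\<^sub>R f y) \<partial>Q)"
        by (rule integral_restrict_space) (simp add: spQ Q(2) Compl_0_borel)
      also have "\<dots> = (\<integral>y. D * F y \<partial>Q)"
      proof (rule Bochner_Integration.integral_cong[OF refl])
        fix y
        have "(D / w y) * f y = D * F y" using fw[of y] w1 by (auto simp: F_def max_def)
        then show "indicator (- {0}) y *\<^sub>R ((D / w y) *\<^sub>R f y) = D * F y" using F0 by (auto simp: indicator_def)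
      qed
      also have "\<dots> = D * (\<integral>y. F y \<partial>Q)" by (rule integral_mult_right_zero)
      finally show ?thesis .
    qed
    ultimately show ?thesis by simp
  qed
  have radon: "radon_measure N \<mu>"
    unfolding radon_measure_def
  proof (intro conjI allI impI \<mu>sets)
    fix \<rho> :: real assume \<rho>: "0 < \<rho>"
    obtain c0 c1 where c1: "0 < c1" "\<And>x. N x \<le> c1 * norm x" using is_norm_equiv[OF N] by metis
    let ?B = "- (ereal_vec ` {x. N x < \<rho>})"
    define w1 where "w1 = (min 1 (\<rho> / c1 / real CARD('n))) ^ q"
    have w1: "0 < w1" using \<rho> c1 by (simp add: w1_def)
    have wB: "w1 \<le> w y" if y: "y \<in> ?B" for y
    proof -
      have "\<exists>i. ereal (\<rho> / c1 / real CARD('n)) \<le> \<bar>y $ i\<bar>"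
      proof (cases "y \<in> range ereal_vec")
        case True
        then obtain x where x: "y = ereal_vec x" by auto
        have "\<not> N x < \<rho>" using y x by auto
        then have "\<rho> / c1 \<le> norm x" using c1(2)[of x] c1(1) by (simp add: field_simps)
        then show ?thesis unfolding x by (rule ereal_far_of_norm)
      next
        case False
        obtain i where "\<bar>y $ i\<bar> = \<infinity>" by (rule exE[OF not_range_ereal_vecD[OF False]])
        then show ?thesis by (intro exI[of _ i]) simp
      qed
      then show ?thesis unfolding w1_def w_def using \<rho> c1 by (auto intro!: cap_weight_ge)
    qed
    show "emeasure \<mu> ?B < \<infinity>"
    \<comment> \<open>Outside the sigma-algebra \<open>emeasure\<close> is 0, so only the measurable
      case needs an estimate.\<close>
    proof (cases "?B \<in> sets \<mu>")
      case True
      then have "emeasure \<mu> ?B = (\<integral>\<^sup>+y. ennreal (D / w y) * indicator ?B y \<partial>restrict_space Q (- {0}))"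
        unfolding \<mu>_def using wR by (intro emeasure_density) auto
      also have "\<dots> \<le> (\<integral>\<^sup>+y. ennreal (D / w1) \<partial>restrict_space Q (- {0}))"
      proof (rule nn_integral_mono)
        fix y
        have "D / w y \<le> D / w1" if "y \<in> ?B"
          using wB[OF that] w1 D by (intro divide_left_mono mult_pos_pos) auto
        then show "ennreal (D / w y) * indicator ?B y \<le> ennreal (D / w1)"
          by (auto simp: indicator_def intro!: ennreal_leI)
      qed
      also have "\<dots> = ennreal (D / w1) * emeasure Q (- {0})"
        by (simp add: space_restrict_space spQ emeasure_restrict_space Q(2) Compl_0_borel)
      also have "\<dots> < \<infinity>" by (simp add: Q.emeasure_eq_measure ennreal_mult_less_top)
      finally show ?thesis .
    qed (simp add: emeasure_notin_sets)
  qed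
  have no_inf: "emeasure \<mu> (- range ereal_vec) = 0"
  proof -
    let ?I = "- range (ereal_vec :: real^'n \<Rightarrow> _)"
    have Ib: "?I \<in> sets borel" using sets.compl_sets[OF ereal_vec_image_borel[of UNIV]] by (simp add: Compl_eq_Diff_UNIV)
    have I0: "0 \<notin> ?I" by (auto simp: range_ereal_vec)
    have I: "?I \<in> sets \<mu>" using Ib I0 by (auto simp: \<mu>sets sets_punctured_borel_iff)
    have "emeasure \<mu> ?I \<le> emeasure \<mu> (- (ereal_vec ` {x. N x < 1}))"
    proof (cases "- (ereal_vec ` {x. N x < 1}) \<in> sets \<mu>")
      case True
      then show ?thesis by (intro emeasure_mono) auto
    next
      case False
      have "{x. N x < 1} \<in> sets borel"
        using is_norm_continuous[OF N] by (intro borel_open open_Collect_less) auto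
      then have "- (ereal_vec ` {x. N x < 1}) \<in> sets borel"
        using sets.compl_sets[OF ereal_vec_image_borel] by (simp add: Compl_eq_Diff_UNIV)
      moreover have "N 0 = 0" using N by (simp add: is_norm_def)
      then have "0 \<notin> - (ereal_vec ` {x. N x < 1})" using ereal_vec_eq_0_iff[of "0::real^'n"] by (auto intro!: image_eqI[of _ _ 0])
      ultimately show ?thesis using False by (auto simp: \<mu>sets sets_punctured_borel_iff)
    qed
    also have "\<dots> < \<infinity>" using radon by (simp add: radon_measure_def)
    finally have Ifin: "emeasure \<mu> ?I < \<infinity>" .
    \<comment> \<open>Every cutoff equals 1 at infinite points, and its integral inherits the tail
      bound at level \<open>R\<close>; letting \<open>R\<close> grow leaves no mass at
      infinity.\<close>
    have bound: "measure \<mu> ?I \<le> K * R powr - \<alpha>" if R: "0 < R" for R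
    proof -
      have cut: "continuous_on UNIV (cutoff R :: ereal^'n \<Rightarrow> real)" by (rule cutoff_continuous[OF R])
      have cz: "cutoff R y = 0" if "\<And>i. \<bar>y $ i\<bar> < ereal R" for y :: "ereal^'n"
        using that by (intro cutoff_eq_0[OF R]) (simp add: less_imp_le)
      have "(\<integral>y. cutoff R y \<partial>\<mu>) \<le> K * R powr - \<alpha>"
      proof (rule tendsto_upperbound[OF flim[OF cut R cz]])
        have "\<forall>\<^sub>F n in sequentially. measure M {\<omega> \<in> space M. norm (Z \<omega>) > R * \<sigma> (r n)} / b (r n) \<le> K * R powr - \<alpha>"
          using eventually_subseq[OF r tail[OF R]] .
        then show "\<forall>\<^sub>F n in sequentially. (\<integral>\<omega>. cutoff R (ereal_vec (?Y (r n) \<omega>)) \<partial>M) / b (r n) \<le> K * R powr - \<alpha>"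
        proof eventually_elim
          case (elim n)
          have "\<bar>\<integral>\<omega>. cutoff R (ereal_vec (?Y (r n) \<omega>)) \<partial>M\<bar> \<le> 1 * measure M {\<omega> \<in> space M. norm (Z \<omega>) > R * \<sigma> (r n)}"
          proof (rule expectation_far_le[OF M Z \<sigma>(1)])
            show "\<bar>cutoff R (ereal_vec x)\<bar> \<le> 1" for x :: "real^'n" using cutoff_bounds(1)[OF R, of "ereal_vec x"] cutoff_bounds(2)[of R "ereal_vec x"] by linarith
            show "cutoff R (ereal_vec x) = 0" if "norm x \<le> R" for x :: "real^'n"
            proof (rule cutoff_eq_0[OF R])
              fix i show "\<bar>ereal_vec x $ i\<bar> \<le> ereal R" using component_le_norm_cart[of x i] that by (simp add: ereal_vec_nth)
            qed
          qed simp
          then have "(\<integral>\<omega>. cutoff R (ereal_vec (?Y (r n) \<omega>)) \<partial>M) / b (r n) \<le> measure M {\<omega> \<in> space M. norm (Z \<omega>) > R * \<sigma> (r n)} / b (r n)"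
            using b[of "r n"] by (intro divide_right_mono) auto
          then show ?case using elim by linarith
        qed
      qed simp_all
      moreover have "measure \<mu> ?I \<le> (\<integral>y. cutoff R y \<partial>\<mu>)"
      proof -
        have "integrable \<mu> (cutoff R)"
        proof -
          have "0 < (min 1 R) ^ q" using R by simp
          have cm: "(cutoff R :: ereal^'n \<Rightarrow> real) \<in> borel_measurable borel" by (rule borel_measurable_continuous_onI[OF cut])
          have "integrable (restrict_space Q (- {0})) (\<lambda>y. (D / w y) *\<^sub>R cutoff R y)"
          proof (rule finite_measure.integrable_const_bound)
            show "finite_measure (restrict_space Q (- {0}))"
              by (rule finite_measure_restrict_space[OF Q.finite_measure_axioms]) (simp add: spQ Q(2) Compl_0_borel)
            show "(\<lambda>y. (D / w y) *\<^sub>R cutoff R y) \<in> borel_measurable (restrict_space Q (- {0}))"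
              using wR mR[OF cm] by measurable
            show "AE y in restrict_space Q (- {0}). norm ((D / w y) *\<^sub>R cutoff R y) \<le> D / (min 1 R) ^ q"
            proof (intro AE_I2)
              fix y :: "ereal^'n"
              show "norm ((D / w y) *\<^sub>R cutoff R y) \<le> D / (min 1 R) ^ q"
              proof (cases "\<exists>i. ereal R \<le> \<bar>y $ i\<bar>")
                case True
                then have wR': "(min 1 R) ^ q \<le> w y" unfolding w_def using cap_weight_ge[OF R] by blast
                then have "0 < w y" using R by (smt (verit) zero_less_power)
                have "norm ((D / w y) *\<^sub>R cutoff R y) \<le> D / w y * 1"
                  using cutoff_bounds(1)[OF R, of y] cutoff_bounds(2)[of R y] D \<open>0 < w y\<close> by (simp add: abs_mult divide_right_mono mult_left_le)
                also have "\<dots> \<le> D / (min 1 R) ^ q" using wR' D \<open>0 < w y\<close> R by (simp add: divide_left_mono)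
                finally show ?thesis .
              next
                case False
                then have "cutoff R y = 0" by (intro cz) (auto simp: not_le)
                then show ?thesis using D R by simp
              qed
            qed
          qed
          then show ?thesis unfolding \<mu>_def
            using D w0 mR[OF cm] wR by (subst integrable_density) auto
        qed
        moreover have "integrable \<mu> (indicat_real ?I)" using I Ifin by (intro integrable_real_indicator)
        ultimately have "(\<integral>y. indicator ?I y \<partial>\<mu>) \<le> (\<integral>y. cutoff R y \<partial>\<mu>)"
        proof (intro integral_mono)
          fix y
          show "indicat_real ?I y \<le> cutoff R y"
          proof (cases "y \<in> ?I")
            case True
            then have "y \<notin> range ereal_vec" by simp
            from not_range_ereal_vecD[OF this] obtain i where "\<bar>y $ i\<bar> = \<infinity>" by (rule exE)
            then have "ereal (R + 1) \<le> \<bar>y $ i\<bar>" by simp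
            then have "cutoff R y = 1" by (rule cutoff_eq_1[OF R])
            then show ?thesis by simp
          qed (simp add: cutoff_bounds(1)[OF R])
        qed
        moreover have "?I \<inter> space \<mu> = ?I" using I0 \<mu>space by auto
        ultimately show ?thesis by simp
      qed
      ultimately show ?thesis by linarith
    qed
    have "(\<lambda>n. K * real (Suc n) powr - \<alpha>) \<longlonglongrightarrow> K * 0"
    proof (intro tendsto_mult tendsto_const)
      have "((\<lambda>x::real. x powr - \<alpha>) \<longlongrightarrow> 0) at_top" using \<alpha> by (intro tendsto_neg_powr filterlim_ident) auto
      from filterlim_compose[OF this filterlim_compose[OF filterlim_real_sequentially filterlim_Suc]]
      show "(\<lambda>n. real (Suc n) powr - \<alpha>) \<longlonglongrightarrow> 0" .
    qed
    then have "measure \<mu> ?I \<le> K * 0"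
    proof (rule LIMSEQ_le_const)
      have "measure \<mu> ?I \<le> K * real (Suc n) powr - \<alpha>" for n by (rule bound) simp
      then show "\<exists>N. \<forall>n\<ge>N. measure \<mu> ?I \<le> K * real (Suc n) powr - \<alpha>" by blast
    qed
    then have "measure \<mu> ?I = 0" using measure_nonneg[of \<mu> ?I] by simp
    then show ?thesis using Ifin by (simp add: emeasure_eq_ennreal_measure less_top)
  qed
  have fr: "finite_radon N \<mu>" by unfold_locales (rule N radon no_inf)+
  have b0: "0 \<le> b (r n)" for n using b[of "r n"] by simp
  have vag: "vague_tendsto (\<lambda>n. scaled_law M Z (\<sigma> (r n)) (b (r n))) \<mu> sequentially"
  proof (rule far_test_imp_vague[OF Z b0 \<mu>space])
    fix f :: "ereal^'n \<Rightarrow> real" and \<rho> :: real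
    assume f: "continuous_on UNIV f" "0 < \<rho>" "\<And>y. (\<And>i. \<bar>y $ i\<bar> < ereal \<rho>) \<Longrightarrow> f y = 0"
    show "(\<lambda>n. (\<integral>\<omega>. f (ereal_vec (?Y (r n) \<omega>)) \<partial>M) / b (r n)) \<longlonglongrightarrow> (\<integral>y. f y \<partial>\<mu>)"
      by (rule flim[OF f]) simp
  qed
  show thesis
  proof (rule that[OF r fr vag])
    fix \<rho> :: real assume \<rho>: "0 < \<rho>"
    interpret fr: finite_radon N \<mu> by (rule fr)
    show "measure (real_tail \<mu>) {x. \<rho> \<le> norm x} \<le> K * 2 powr \<alpha> * \<rho> powr - \<alpha>"
    proof (rule tail_limit_bound[OF M Z, of "\<lambda>n. \<sigma> (r n)" "\<lambda>n. b (r n)"])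
      show "(\<lambda>n. (\<integral>\<omega>. g (inverse (\<sigma> (r n)) *\<^sub>R Z \<omega>) \<partial>M) / b (r n)) \<longlonglongrightarrow> (\<integral>x. g x \<partial>real_tail \<mu>)" if "far_test g" for g
        by (rule fr.vague_imp_far_test[OF M Z b0 vag that])
      have "(\<rho> / 2) powr - \<alpha> = 2 powr \<alpha> * \<rho> powr - \<alpha>"
        using \<rho> by (simp add: powr_divide powr_minus field_simps)
      then have "K * (\<rho> / 2) powr - \<alpha> = K * 2 powr \<alpha> * \<rho> powr - \<alpha>" by simp
      moreover have "\<forall>\<^sub>F n in sequentially. measure M {\<omega> \<in> space M. norm (Z \<omega>) > \<rho> / 2 * \<sigma> (r n)} / b (r n) \<le> K * (\<rho> / 2) powr - \<alpha>"
        by (rule eventually_subseq[OF r tail]) (use \<rho> in simp)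
      ultimately show "\<forall>\<^sub>F n in sequentially. measure M {\<omega> \<in> space M. norm (Z \<omega>) > \<rho> / 2 * \<sigma> (r n)} / b (r n) \<le> K * 2 powr \<alpha> * \<rho> powr - \<alpha>"
        by (simp only:)
    qed (use \<sigma> b \<rho> fr.tail_finite_real_tail in auto)
  qed
qed

section \<open>The inverse problem\<close>

lemma integral_scale_measure:
  fixes f :: "'a \<Rightarrow> real"
  assumes "f \<in> borel_measurable M" "0 \<le> c"
  shows "(\<integral>x. f x \<partial>scale_measure (ennreal c) M) = c * (\<integral>x. f x \<partial>M)"
  unfolding scale_measure_eq_density using assms by (subst integral_density) auto

lemma homog_integral:
  assumes h: "homog \<alpha> \<nu>" and s: "sets \<nu> = sets borel" and t: "0 < t" and g: "g \<in> borel_measurable borel"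
  shows "(\<integral>x. g (inverse t *\<^sub>R x) \<partial>\<nu>) = t powr - \<alpha> * (\<integral>x. g x \<partial>\<nu>)"
proof -
  have sp: "space \<nu> = UNIV" using sets_eq_imp_space_eq[OF s] by simp
  have m: "(\<lambda>x. inverse t *\<^sub>R x) \<in> measurable \<nu> borel"
    by (subst measurable_cong_sets[OF s refl]) measurable
  have "distr \<nu> borel (\<lambda>x. inverse t *\<^sub>R x) = scale_measure (ennreal (t powr - \<alpha>)) \<nu>"
  proof (rule measure_eqI)
    fix B assume "B \<in> sets (distr \<nu> borel (\<lambda>x. inverse t *\<^sub>R x))"
    then have B: "B \<in> sets borel" by simp
    have "emeasure (distr \<nu> borel (\<lambda>x. inverse t *\<^sub>R x)) B = emeasure \<nu> {x. inverse t *\<^sub>R x \<in> B}"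
      by (subst emeasure_distr[OF m B]) (auto simp: sp vimage_def)
    then show "emeasure (distr \<nu> borel (\<lambda>x. inverse t *\<^sub>R x)) B = emeasure (scale_measure (ennreal (t powr - \<alpha>)) \<nu>) B"
      using h t B by (simp add: homog_def)
  qed (simp add: s)
  moreover have "(\<integral>x. g x \<partial>distr \<nu> borel (\<lambda>x. inverse t *\<^sub>R x)) = (\<integral>x. g (inverse t *\<^sub>R x) \<partial>\<nu>)"
    by (rule integral_distr[OF m g])
  moreover have "g \<in> borel_measurable \<nu>" using g by (simp cong: measurable_cong_sets add: s)
  ultimately show ?thesis by (simp add: integral_scale_measure)
qed

lemma far_test_measurable: "far_test g \<Longrightarrow> g \<in> borel_measurable borel"
  by (rule borel_measurable_continuous_onI) (simp add: far_test_def)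

lemma far_test_scale:
  assumes g: "far_test g" and t: "0 < t"
  shows "far_test (\<lambda>x. g (inverse t *\<^sub>R x))"
proof -
  from g have c: "continuous_on UNIV g" and "\<exists>B. \<forall>x. \<bar>g x\<bar> \<le> B" and ex: "\<exists>r. 0 < r \<and> (\<forall>x. norm x < r \<longrightarrow> g x = 0)"
    by (simp_all add: far_test_def)
  from this(2) obtain B where B: "\<forall>x. \<bar>g x\<bar> \<le> B" by (rule exE)
  from ex obtain r where r: "0 < r \<and> (\<forall>x. norm x < r \<longrightarrow> g x = 0)" by (rule exE)
  have z: "g (inverse t *\<^sub>R x) = 0" if x: "norm x < r * t" for x
  proof -
    have "norm (inverse t *\<^sub>R x) < r" using x t by (simp add: field_simps)
    with r show ?thesis by simp
  qed
  show ?thesis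
    unfolding far_test_def
  proof (intro conjI)
    show "continuous_on UNIV (\<lambda>x. g (inverse t *\<^sub>R x))"
      by (rule continuous_on_compose2[OF c]) (auto intro!: continuous_intros)
    show "\<exists>B. \<forall>x. \<bar>g (inverse t *\<^sub>R x)\<bar> \<le> B" using B by (intro exI[of _ B]) simp
    show "\<exists>r>0. \<forall>x. norm x < r \<longrightarrow> g (inverse t *\<^sub>R x) = 0"
      using r t z by (intro exI[of _ "r * t"]) simp
  qed
qed

text \<open>The rescaled measure and the multiple of the original are both
  \<open>tail_finite\<close>, so far test functions suffice to compare them.\<close>

lemma homog_if_integral:
  fixes \<nu> :: "(real^'n) measure"
  assumes \<nu>: "tail_finite \<nu>"
    and eq: "\<And>t g. 0 < t \<Longrightarrow> far_test g \<Longrightarrow> (\<integral>x. g (inverse t *\<^sub>R x) \<partial>\<nu>) = t powr - \<alpha> * (\<integral>x. g x \<partial>\<nu>)"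
  shows "homog \<alpha> \<nu>"
  unfolding homog_def
proof (intro allI impI ballI)
  fix t :: real and B :: "(real^'n) set" assume t: "0 < t" and B: "B \<in> sets borel"
  note s = tail_finite_sets[OF \<nu>] and sp = tail_finite_space[OF \<nu>]
  let ?D = "distr \<nu> borel (\<lambda>x. inverse t *\<^sub>R x)" and ?S = "scale_measure (ennreal (t powr - \<alpha>)) \<nu>"
  have m: "(\<lambda>x. inverse t *\<^sub>R x) \<in> measurable \<nu> borel"
    by (subst measurable_cong_sets[OF s refl]) measurable
  have eD: "emeasure ?D B = emeasure \<nu> {x. inverse t *\<^sub>R x \<in> B}" if "B \<in> sets borel" for B
    by (subst emeasure_distr[OF m that]) (auto simp: sp vimage_def)
  have "?D = ?S"
  proof (rule measure_eqI_far_test)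
    show "tail_finite ?S"
      using \<nu> by (auto simp: tail_finite_def ennreal_mult_less_top)
    show "tail_finite ?D"
      unfolding tail_finite_def
    proof (intro conjI allI impI)
      have "{x :: real^'n. inverse t *\<^sub>R x = 0} = {0}" using t by auto
      then show "emeasure ?D {0} = 0" using \<nu> by (simp add: eD tail_finite_def)
      fix r :: real assume r: "0 < r"
      have "{x :: real^'n. r \<le> norm (inverse t *\<^sub>R x)} = {x. r * t \<le> norm x}" using t by (auto simp: field_simps)
      then show "emeasure ?D {x. r \<le> norm x} < \<infinity>"
        using tail_finite_fin[OF \<nu>, of "r * t"] r t by (simp add: eD)
    qed simp
    fix g :: "real^'n \<Rightarrow> real" assume g: "far_test g"
    have gm: "g \<in> borel_measurable borel" by (rule far_test_measurable[OF g])
    then have "g \<in> borel_measurable \<nu>" by (simp cong: measurable_cong_sets add: s)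
    then show "(\<integral>x. g x \<partial>?D) = (\<integral>x. g x \<partial>?S)"
      using eq[OF t g] by (simp add: integral_distr[OF m gm] integral_scale_measure)
  qed
  then show "emeasure \<nu> {x. inverse t *\<^sub>R x \<in> B} = ennreal (t powr - \<alpha>) * emeasure \<nu> B"
    using eD[OF B] by simp
qed

context finite_radon
begin

lemma homogeneous_iff_homog: "homogeneous \<alpha> \<mu> \<longleftrightarrow> homog \<alpha> (real_tail \<mu>)"
proof -
  have scale: "ereal_vec_scale t ` B \<in> sets \<mu>" "ereal_vec -` (ereal_vec_scale t ` B) = {x. inverse t *\<^sub>R x \<in> ereal_vec -` B}"
    if t: "0 < t" and B: "B \<in> sets \<mu>" for t B
  proof -
    have inv: "ereal_vec_scale (inverse t) (ereal_vec_scale t y) = y" "ereal_vec_scale t (ereal_vec_scale (inverse t) y) = y" for y :: "ereal^'n"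
      using t by (auto simp: ereal_vec_scale_def vec_eq_iff mult.assoc[symmetric] zero_ereal_def[symmetric] one_ereal_def[symmetric])
    have img: "ereal_vec_scale t ` B = {y. ereal_vec_scale (inverse t) y \<in> B}"
    proof (intro set_eqI iffI)
      fix y assume "y \<in> {y. ereal_vec_scale (inverse t) y \<in> B}"
      then have "ereal_vec_scale t (ereal_vec_scale (inverse t) y) \<in> ereal_vec_scale t ` B" by blast
      then show "y \<in> ereal_vec_scale t ` B" unfolding inv .
    qed (auto simp: inv)
    have m: "ereal_vec_scale (inverse t) \<in> borel_measurable (borel :: (ereal^'n) measure)"
      unfolding ereal_vec_scale_def[abs_def]
      by (rule borel_measurable_vecI, unfold vec_lambda_beta)
        (intro borel_measurable_ereal_times borel_measurable_const borel_measurable_vec_nth_gen)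
    have B': "B \<in> sets borel" "0 \<notin> B" using B by (auto simp: sets_mu sets_punctured_borel_iff)
    have "ereal_vec_scale (inverse t) (0 :: ereal^'n) = 0" by (simp add: ereal_vec_scale_def vec_eq_iff)
    then have "0 \<notin> ereal_vec_scale t ` B" unfolding img using B' by simp
    moreover have "ereal_vec_scale t ` B \<in> sets borel"
      unfolding img using measurable_sets[OF m B'(1)] by (simp add: vimage_def)
    ultimately show "ereal_vec_scale t ` B \<in> sets \<mu>" by (intro in_sets_mu)
    have "ereal_vec_scale (inverse t) (ereal_vec x) = ereal_vec (inverse t *\<^sub>R x)" for x :: "real^'n"
      by (simp add: ereal_vec_scale_def ereal_vec_def vec_eq_iff)
    then show "ereal_vec -` (ereal_vec_scale t ` B) = {x. inverse t *\<^sub>R x \<in> ereal_vec -` B}"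
      unfolding img by auto
  qed
  have m: "ereal_vec -` B \<in> sets borel" if "B \<in> sets \<mu>" for B
    using measurable_sets[OF borel_measurable_ereal_vec, of B] that by (simp add: sets_mu sets_punctured_borel_iff)
  show ?thesis
  proof
    assume h: "homog \<alpha> (real_tail \<mu>)"
    show "homogeneous \<alpha> \<mu>"
      unfolding homogeneous_def
    proof (intro allI impI ballI)
      fix t :: real and B assume t: "0 < t" and B: "B \<in> sets \<mu>"
      show "emeasure \<mu> (ereal_vec_scale t ` B) = ennreal (t powr - \<alpha>) * emeasure \<mu> B"
        using h m[OF B] t unfolding emeasure_mu[OF scale(1)[OF t B]] emeasure_mu[OF B] scale(2)[OF t B] homog_def by blast
    qed
  next
    assume h: "homogeneous \<alpha> \<mu>"
    show "homog \<alpha> (real_tail \<mu>)"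
      unfolding homog_def
    proof (intro allI impI ballI)
      fix t :: real and B :: "(real^'n) set" assume t: "0 < t" and B: "B \<in> sets borel"
      \<comment> \<open>The origin is not a point of the punctured space; removing it does no harm,
        since it is null for \<open>real_tail\<close>.\<close>
      let ?B = "ereal_vec ` (B - {0})"
      have s: "sets (real_tail \<mu>) = sets borel" and z: "emeasure (real_tail \<mu>) {0} = 0"
        using tail_finite_real_tail by (auto simp: tail_finite_def)
      have B': "?B \<in> sets \<mu>"
        using B by (intro in_sets_mu ereal_vec_image_borel) (auto simp: ereal_vec_eq_0_iff eq_commute[of 0])
      have inj: "ereal_vec x = ereal_vec y \<longleftrightarrow> x = y" for x y :: "real^'n"
        by (auto simp: ereal_vec_def vec_eq_iff)
      have v: "ereal_vec -` ?B = B - {0}" by (auto simp: inj)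
      have d: "emeasure (real_tail \<mu>) (C - {0}) = emeasure (real_tail \<mu>) C" if "C \<in> sets borel" for C
        using that z by (intro emeasure_Diff_null_set) (auto simp: null_sets_def s)
      have C: "{x. inverse t *\<^sub>R x \<in> B} \<in> sets borel"
      proof -
        have "(\<lambda>x :: real^'n. inverse t *\<^sub>R x) \<in> borel_measurable borel" by measurable
        from measurable_sets[OF this B] show ?thesis by (simp add: vimage_def)
      qed
      have "emeasure (real_tail \<mu>) ({x. inverse t *\<^sub>R x \<in> B} - {0}) = emeasure \<mu> (ereal_vec_scale t ` ?B)"
        unfolding emeasure_mu[OF scale(1)[OF t B']] scale(2)[OF t B'] v using t by (intro arg_cong2[where f=emeasure]) auto
      also have "\<dots> = ennreal (t powr - \<alpha>) * emeasure \<mu> ?B" using h t B' by (simp add: homogeneous_def)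
      also have "emeasure \<mu> ?B = emeasure (real_tail \<mu>) (B - {0})" unfolding emeasure_mu[OF B'] v ..
      finally show "emeasure (real_tail \<mu>) {x. inverse t *\<^sub>R x \<in> B} = ennreal (t powr - \<alpha>) * emeasure (real_tail \<mu>) B"
        unfolding d[OF B] d[OF C] .
    qed
  qed
qed

end

text \<open>\<open>X = A Z\<close> with the diagonal matrix \<open>A\<close> encoded as the vector \<open>v\<close> of its diagonal entries.\<close>
locale diagonal_factor = regvar M N X \<nu> \<alpha>
  for M :: "'w measure" and N :: "real^'n \<Rightarrow> real" and X :: "'w \<Rightarrow> real^'n" and \<nu> :: "(real^'n) measure" and \<alpha> :: real +
  fixes v Z :: "'w \<Rightarrow> real^'n" and p :: real
  assumes v [measurable]: "v \<in> borel_measurable M" and Z [measurable]: "Z \<in> borel_measurable M"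
    and ind: "indep_var borel v borel Z" and X_eq: "X = (\<lambda>\<omega>. v \<omega> * Z \<omega>)"
    and nz: "AE \<omega> in M. \<forall>j. v \<omega> $ j \<noteq> 0" and p: "\<alpha> < p"
    and mom: "integrable M (\<lambda>\<omega>. norm (v \<omega>) powr p)"
    and fourier: "\<And>j m \<theta>. (\<forall>k. m k \<in> {0, 1}) \<Longrightarrow>
           (\<integral>\<omega>. complex_of_real (\<bar>v \<omega> $ j\<bar> powr \<alpha>) *
               (\<Prod>k\<in>UNIV. complex_of_real \<bar>v \<omega> $ k\<bar> powr (\<i> * complex_of_real (\<theta> k)) *
                            complex_of_real (sgn (v \<omega> $ k)) ^ m k) \<partial>M) \<noteq> 0"
begin

lemma p_pos: "0 < p"
  using \<alpha> p by simp

lemma mom_alpha: "integrable M (\<lambda>\<omega>. norm (v \<omega>) powr \<alpha>)"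
proof (rule Bochner_Integration.integrable_bound)
  show "integrable M (\<lambda>\<omega>. 1 + norm (v \<omega>) powr p)" using mom by simp
  show "AE \<omega> in M. norm (norm (v \<omega>) powr \<alpha>) \<le> norm (1 + norm (v \<omega>) powr p)"
  proof (intro AE_I2)
    fix \<omega>
    have "norm (v \<omega>) powr \<alpha> \<le> 1 + norm (v \<omega>) powr p"
    proof (cases "norm (v \<omega>) \<le> 1")
      case True
      then have "norm (v \<omega>) powr \<alpha> \<le> 1" using powr_mono2[of \<alpha> "norm (v \<omega>)" 1] \<alpha> by simp
      then show ?thesis by (simp add: add_increasing2)
    next
      case False
      then have "norm (v \<omega>) powr \<alpha> \<le> norm (v \<omega>) powr p" using p by (intro powr_mono) auto
      then show ?thesis by simp
    qed
    then show "norm (norm (v \<omega>) powr \<alpha>) \<le> norm (1 + norm (v \<omega>) powr p)" by simp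
  qed
qed measurable

text \<open>For each coordinate the events 1/(n+1) < |v_j| increase to an almost sure event, so one
  of them has probability at least 1/2. The largest index serves all of the finitely many
  coordinates.\<close>

lemma coordinate_away_from_0:
  obtains \<epsilon> where "0 < \<epsilon>" "\<And>j. 1 / 2 \<le> prob {\<omega> \<in> space M. \<epsilon> < \<bar>v \<omega> $ j\<bar>}"
proof -
  have "\<exists>n. 1 / 2 \<le> prob {\<omega> \<in> space M. 1 / real (Suc n) < \<bar>v \<omega> $ j\<bar>}" for j
  proof -
    define S where "S n = {\<omega> \<in> space M. 1 / real (Suc n) < \<bar>v \<omega> $ j\<bar>}" for n
    have S: "range S \<subseteq> sets M" unfolding S_def by auto
    have inc: "incseq S"
    proof (rule monoI)
      fix m n :: nat assume "m \<le> n"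
      then have "1 / real (Suc n) \<le> 1 / real (Suc m)" by (simp add: field_simps)
      then show "S m \<subseteq> S n" by (auto simp: S_def)
    qed
    have "prob (\<Union>n. S n) = prob (space M)"
    proof (rule finite_measure_eq_AE)
      show "AE \<omega> in M. (\<omega> \<in> (\<Union>n. S n)) = (\<omega> \<in> space M)"
        using nz AE_space
      proof eventually_elim
        case (elim \<omega>)
        then have "0 < \<bar>v \<omega> $ j\<bar>" by simp
        then obtain n where "1 / real (Suc n) < \<bar>v \<omega> $ j\<bar>" using nat_approx_posE by blast
        then show ?case using elim by (auto simp: S_def)
      qed
    qed (use S in auto)
    then have "prob (\<Union>n. S n) = 1" by (simp add: prob_space)
    moreover have "(\<lambda>n. prob (S n)) \<longlonglongrightarrow> prob (\<Union>n. S n)"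
      by (rule finite_Lim_measure_incseq[OF S inc])
    ultimately have "\<forall>\<^sub>F n in sequentially. 1 / 2 < prob (S n)" by (intro order_tendstoD(1)) auto
    then obtain n where "1 / 2 < prob (S n)" by (auto simp: eventually_sequentially)
    then show ?thesis unfolding S_def by (intro exI[of _ n]) simp
  qed
  then obtain n where n: "\<And>j. 1 / 2 \<le> prob {\<omega> \<in> space M. 1 / real (Suc (n j)) < \<bar>v \<omega> $ j\<bar>}" by metis
  define k where "k = Max (range n)"
  show thesis
  proof (rule that)
    show "0 < 1 / real (Suc k)" by simp
    fix j
    have "n j \<le> k" unfolding k_def by simp
    then have "1 / real (Suc k) \<le> 1 / real (Suc (n j))" by (simp add: field_simps)
    then have "prob {\<omega> \<in> space M. 1 / real (Suc (n j)) < \<bar>v \<omega> $ j\<bar>} \<le> prob {\<omega> \<in> space M. 1 / real (Suc k) < \<bar>v \<omega> $ j\<bar>}"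
      by (intro finite_measure_mono) auto
    with n[of j] show "1 / 2 \<le> prob {\<omega> \<in> space M. 1 / real (Suc k) < \<bar>v \<omega> $ j\<bar>}" by linarith
  qed
qed

text \<open>If a coordinate of \<open>Z\<close> is large then, by independence, with probability at least one half
  so is that coordinate of \<open>X\<close>.\<close>
lemma Z_tail_le_X_tail:
  obtains C c where "0 < C" "0 < c" "\<And>u. prob {\<omega> \<in> space M. norm (Z \<omega>) > u} \<le> C * V (c * u)"
proof -
  obtain \<epsilon> where \<epsilon>: "0 < \<epsilon>" "\<And>j. 1 / 2 \<le> prob {\<omega> \<in> space M. \<epsilon> < \<bar>v \<omega> $ j\<bar>}"
    by (rule coordinate_away_from_0) (rule that)
  obtain c1 where c1: "0 < c1" "\<And>x. c1 * norm x \<le> N x" using is_norm_equiv[OF norm] by metis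
  let ?d = "real CARD('n)"
  have d: "0 < ?d" by simp
  \<comment> \<open>A norm above \<open>u\<close> gives a coordinate of \<open>Z\<close> above u /
    d; the factor eps bounds the matching coordinate of \<open>v\<close> from below, and
    \<open>c1\<close> compares the Euclidean norm with \<open>N\<close>.\<close>
  define c where "c = c1 * \<epsilon> / ?d"
  have c: "0 < c" using c1 \<epsilon> d by (simp add: c_def)
  have "prob {\<omega> \<in> space M. norm (Z \<omega>) > u} \<le> 2 * ?d * V (c * u)" for u
  proof -
    let ?Z = "\<lambda>j. {\<omega> \<in> space M. u / ?d < \<bar>Z \<omega> $ j\<bar>}"
    have one: "prob (?Z j) \<le> 2 * V (c * u)" for j
    proof -
      let ?A = "{x :: real^'n. \<epsilon> < \<bar>x $ j\<bar>}" and ?B = "{x :: real^'n. u / ?d < \<bar>x $ j\<bar>}"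
      have AB: "?A \<in> sets borel" "?B \<in> sets borel"
        by (intro borel_open open_Collect_less continuous_intros)+
      have "prob ((\<lambda>x. (v x, Z x)) -` (?A \<times> ?B) \<inter> space M) = prob (v -` ?A \<inter> space M) * prob (Z -` ?B \<inter> space M)"
        by (rule indep_varD[OF ind AB])
      moreover have "(\<lambda>x. (v x, Z x)) -` (?A \<times> ?B) \<inter> space M \<subseteq> {\<omega> \<in> space M. N (X \<omega>) > c * u}"
      proof
        fix \<omega> assume "\<omega> \<in> (\<lambda>x. (v x, Z x)) -` (?A \<times> ?B) \<inter> space M"
        then have w: "\<omega> \<in> space M" "\<epsilon> < \<bar>v \<omega> $ j\<bar>" "u / ?d < \<bar>Z \<omega> $ j\<bar>" by auto
        have "\<epsilon> * (u / ?d) < \<bar>v \<omega> $ j\<bar> * \<bar>Z \<omega> $ j\<bar>"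
        proof (cases "0 \<le> u")
          case True
          then show ?thesis using w \<epsilon>(1) d by (intro mult_strict_mono) auto
        next
          case False
          then have neg: "u / ?d < 0" using d by (simp add: divide_neg_pos)
          have "\<epsilon> * (u / ?d) < 0" by (rule mult_pos_neg[OF \<epsilon>(1) neg])
          also have "0 \<le> \<bar>v \<omega> $ j\<bar> * \<bar>Z \<omega> $ j\<bar>" by simp
          finally show ?thesis .
        qed
        also have "\<dots> = \<bar>X \<omega> $ j\<bar>" by (simp add: X_eq abs_mult)
        also have "\<dots> \<le> norm (X \<omega>)" by (rule component_le_norm_cart)
        finally have "c1 * (\<epsilon> * (u / ?d)) < c1 * norm (X \<omega>)" using c1(1) by (rule mult_strict_left_mono)
        also have "\<dots> \<le> N (X \<omega>)" by (rule c1(2))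
        also have "c1 * (\<epsilon> * (u / ?d)) = c * u" by (simp add: c_def)
        finally show "\<omega> \<in> {\<omega> \<in> space M. N (X \<omega>) > c * u}" using w(1) by simp
      qed
      then have "prob ((\<lambda>x. (v x, Z x)) -` (?A \<times> ?B) \<inter> space M) \<le> V (c * u)"
        unfolding V_def by (intro finite_measure_mono) auto
      ultimately have "prob (v -` ?A \<inter> space M) * prob (Z -` ?B \<inter> space M) \<le> V (c * u)" by simp
      moreover have "v -` ?A \<inter> space M = {\<omega> \<in> space M. \<epsilon> < \<bar>v \<omega> $ j\<bar>}" "Z -` ?B \<inter> space M = ?Z j" by auto
      moreover have "1 / 2 * prob (?Z j) \<le> prob {\<omega> \<in> space M. \<epsilon> < \<bar>v \<omega> $ j\<bar>} * prob (?Z j)"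
        using \<epsilon>(2)[of j] by (intro mult_right_mono) auto
      ultimately show ?thesis by simp
    qed
    have "{\<omega> \<in> space M. norm (Z \<omega>) > u} \<subseteq> (\<Union>j. ?Z j)"
    proof
      fix \<omega> assume w: "\<omega> \<in> {\<omega> \<in> space M. norm (Z \<omega>) > u}"
      have "\<exists>j. u / ?d < \<bar>Z \<omega> $ j\<bar>"
      proof (rule ccontr)
        assume "\<not> ?thesis"
        then have "(\<Sum>j\<in>UNIV. \<bar>Z \<omega> $ j\<bar>) \<le> (\<Sum>j\<in>(UNIV::'n set). u / ?d)"
          by (intro sum_mono) (simp add: not_less)
        also have "\<dots> = u" by simp
        finally show False using w norm_le_l1_cart[of "Z \<omega>"] by simp
      qed
      then show "\<omega> \<in> (\<Union>j. ?Z j)" using w by auto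
    qed
    then have "prob {\<omega> \<in> space M. norm (Z \<omega>) > u} \<le> prob (\<Union>j. ?Z j)"
      by (intro finite_measure_mono sets.finite_UN) auto
    also have "\<dots> \<le> (\<Sum>j\<in>UNIV. prob (?Z j))"
      by (rule finite_measure_subadditive_finite) auto
    also have "\<dots> \<le> (\<Sum>j\<in>(UNIV::'n set). 2 * V (c * u))" by (intro sum_mono one)
    finally show ?thesis by simp
  qed
  then show thesis using c d by (intro that[of "2 * ?d" c]) auto
qed

lemma Z_potter:
  obtains C s0 where "0 \<le> C" "0 < s0" "\<And>s y. s0 \<le> s \<Longrightarrow> 0 < y \<Longrightarrow> prob {\<omega> \<in> space M. norm (Z \<omega>) > s / y} \<le> C * (1 + y powr p) * V s"
proof -
  obtain C1 c where C1: "0 < C1" and c: "0 < c" and le: "\<And>u. prob {\<omega> \<in> space M. norm (Z \<omega>) > u} \<le> C1 * V (c * u)"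
    by (rule Z_tail_le_X_tail) (rule that)
  obtain C s0 where C: "0 < C" and s0: "0 < s0" and pot: "\<And>s u. s0 \<le> s \<Longrightarrow> 0 < u \<Longrightarrow> V u \<le> C * (1 + (s / u) powr p) * V s"
    using V_potter[OF p] by metis
  \<comment> \<open>This absorbs the factor 1 / c that the change from \<open>Z\<close> to
    \<open>X\<close> inserts into the p-th power.\<close>
  define D where "D = 1 + (1 / c) powr p"
  have D: "1 \<le> D" "(1 / c) powr p \<le> D" by (auto simp: D_def)
  have "prob {\<omega> \<in> space M. norm (Z \<omega>) > s / y} \<le> (C1 * C * D) * (1 + y powr p) * V s" if s: "s0 \<le> s" and y: "0 < y" for s y
  proof -
    have pos: "0 < s" using s s0 by simp
    have q: "s / (c * (s / y)) = y * (1 / c)" using pos y c by (simp add: field_simps)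
    have "1 + (y * (1 / c)) powr p \<le> D * (1 + y powr p)"
    proof -
      have "(y * (1 / c)) powr p = y powr p * (1 / c) powr p" by (rule powr_mult)
      also have "\<dots> \<le> y powr p * D" using D by (intro mult_left_mono) auto
      finally show ?thesis using D by (simp add: algebra_simps)
    qed
    then have "C * (1 + (y * (1 / c)) powr p) * V s \<le> C * (D * (1 + y powr p)) * V s"
      using C V_pos[of s] by (intro mult_right_mono mult_left_mono) auto
    moreover have "V (c * (s / y)) \<le> C * (1 + (y * (1 / c)) powr p) * V s"
      using pot[OF s, of "c * (s / y)"] pos y c unfolding q by simp
    ultimately have "C1 * V (c * (s / y)) \<le> C1 * (C * (D * (1 + y powr p)) * V s)"
      using C1 by (intro mult_left_mono) auto
    with le[of "s / y"] show ?thesis by (simp add: mult.assoc)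
  qed
  then show thesis using C1 C D s0 by (intro that[of "C1 * C * D" s0]) auto
qed

lemma Z_tail_ratio:
  obtains K where "0 \<le> K" "\<And>r. 0 < r \<Longrightarrow> \<forall>\<^sub>F s in at_top. prob {\<omega> \<in> space M. norm (Z \<omega>) > r * s} / V s \<le> K * r powr - \<alpha>"
proof -
  obtain C1 c where C1: "0 < C1" and c: "0 < c" and le: "\<And>u. prob {\<omega> \<in> space M. norm (Z \<omega>) > u} \<le> C1 * V (c * u)"
    by (rule Z_tail_le_X_tail) (rule that)
  define K where "K = C1 * ((2 powr \<alpha> * m1 + 1) * c powr - \<alpha>)"
  show thesis
  proof (rule that)
    show "0 \<le> K" unfolding K_def using C1 m1_pos by simp
    fix r :: real assume r: "0 < r"
    show "\<forall>\<^sub>F s in at_top. prob {\<omega> \<in> space M. norm (Z \<omega>) > r * s} / V s \<le> K * r powr - \<alpha>"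
      using V_ratio[OF mult_pos_pos[OF c r]]
    proof eventually_elim
      case (elim s)
      have "prob {\<omega> \<in> space M. norm (Z \<omega>) > r * s} / V s \<le> C1 * V (c * (r * s)) / V s"
        using le V_pos[of s] by (intro divide_right_mono) auto
      also have "\<dots> = C1 * (V (c * r * s) / V s)" by (simp add: mult.assoc)
      also have "\<dots> \<le> C1 * ((2 powr \<alpha> * m1 + 1) * (c * r) powr - \<alpha>)"
        using elim C1 by (intro mult_left_mono) auto
      also have "(c * r) powr - \<alpha> = c powr - \<alpha> * r powr - \<alpha>" by (rule powr_mult)
      finally show ?case by (simp add: K_def mult.assoc)
    qed
  qed
qed

text \<open>Normalised by the tail of \<open>X\<close>, for which Potter bounds are available, and
  not by the tail of \<open>Z\<close>, whose asymptotics are still unknown here.\<close>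

definition EZ :: "(real^'n \<Rightarrow> real) \<Rightarrow> real \<Rightarrow> real" where
  "EZ g s = (\<integral>\<omega>. g (inverse s *\<^sub>R Z \<omega>) \<partial>M) / V s"

text \<open>Subsequence principle: every sequence of scales tending to infinity has a subsequence
  with a limit, all limits solve the same equation, and hence they agree on R^d. The tail bound with
  constant K 2^\<alpha> is carried along because uniqueness holds only among measures obeying such a
  bound.\<close>

theorem Z_limit_exists:
  obtains \<mu> where "finite_radon N \<mu>" "mult_image M v (real_tail \<mu>) = \<nu>"
    "\<And>g. far_test g \<Longrightarrow> (EZ g \<longlongrightarrow> (\<integral>x. g x \<partial>real_tail \<mu>)) at_top"
proof -
  obtain C s0 where C: "0 \<le> C" and s0: "0 < s0"
    and pot: "\<And>s y. s0 \<le> s \<Longrightarrow> 0 < y \<Longrightarrow> prob {\<omega> \<in> space M. norm (Z \<omega>) > s / y} \<le> C * (1 + y powr p) * V s"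
    by (rule Z_potter) (rule that)
  obtain K where K: "0 \<le> K" and tail: "\<And>r. 0 < r \<Longrightarrow> \<forall>\<^sub>F s in at_top. prob {\<omega> \<in> space M. norm (Z \<omega>) > r * s} / V s \<le> K * r powr - \<alpha>"
    by (rule Z_tail_ratio) (rule that)
  have sub: "\<exists>r \<mu>. strict_mono r \<and> finite_radon N \<mu> \<and> (\<forall>\<rho>>0. measure (real_tail \<mu>) {x. \<rho> \<le> norm x} \<le> K * 2 powr \<alpha> * \<rho> powr - \<alpha>) \<and>
      mult_image M v (real_tail \<mu>) = \<nu> \<and> (\<forall>g. far_test g \<longrightarrow> (\<lambda>n. EZ g (\<sigma> (r n))) \<longlonglongrightarrow> (\<integral>x. g x \<partial>real_tail \<mu>))"
    if \<sigma>: "\<And>n. s0 \<le> \<sigma> n" "filterlim \<sigma> at_top sequentially" for \<sigma>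
  proof -
    have \<sigma>0: "0 < \<sigma> n" for n using \<sigma>(1)[of n] s0 by simp
    obtain r :: "nat \<Rightarrow> nat" and \<mu> where r: "strict_mono r" and fr: "finite_radon N \<mu>"
      and vag: "vague_tendsto (\<lambda>n. scaled_law M Z (\<sigma> (r n)) (V (\<sigma> (r n)))) \<mu> sequentially"
      and bound: "\<And>\<rho>. 0 < \<rho> \<Longrightarrow> measure (real_tail \<mu>) {x. \<rho> \<le> norm x} \<le> K * 2 powr \<alpha> * \<rho> powr - \<alpha>"
    proof (rule vague_compactness[OF norm prob_space_axioms Z \<sigma>0 \<sigma>(2) V_pos p_pos C _ \<alpha> K, of \<sigma>])
      show "prob {\<omega> \<in> space M. norm (Z \<omega>) > \<sigma> n / y} \<le> C * (1 + y powr p) * V (\<sigma> n)" if "0 < y" for n y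
        by (rule pot[OF \<sigma>(1) that])
      show "\<forall>\<^sub>F n in sequentially. prob {\<omega> \<in> space M. norm (Z \<omega>) > r * \<sigma> n} / V (\<sigma> n) \<le> K * r powr - \<alpha>" if "0 < r" for r
        by (rule eventually_compose_filterlim[OF tail[OF that] \<sigma>(2)])
    qed blast
    interpret fr: finite_radon N \<mu> by (rule fr)
    have V0: "0 \<le> V s" for s using V_pos[of s] by simp
    have EZlim: "(\<lambda>n. EZ g (\<sigma> (r n))) \<longlonglongrightarrow> (\<integral>x. g x \<partial>real_tail \<mu>)" if "far_test g" for g
      unfolding EZ_def by (rule fr.vague_imp_far_test[OF prob_space_axioms Z V0 vag that])
    have \<sigma>r: "filterlim (\<lambda>n. \<sigma> (r n)) at_top sequentially"
      by (rule filterlim_compose[OF \<sigma>(2) filterlim_subseq[OF r]])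
    note breim = breiman[OF prob_space_axioms v Z ind nz p_pos mom, where \<sigma>="\<lambda>n. \<sigma> (r n)" and b="\<lambda>n. V (\<sigma> (r n))" and C=C and \<nu>="real_tail \<mu>",
        OF \<sigma>0 V_pos pot[OF \<sigma>(1)] fr.tail_finite_real_tail EZlim[unfolded EZ_def]]
    have "mult_image M v (real_tail \<mu>) = \<nu>"
    proof (rule measure_eqI_far_test[OF breim(1) tf])
      fix g :: "real^'n \<Rightarrow> real" assume g: "far_test g"
      have "(\<lambda>n. (\<integral>\<omega>. g (inverse (\<sigma> (r n)) *\<^sub>R X \<omega>) \<partial>M) / V (\<sigma> (r n))) \<longlonglongrightarrow> (\<integral>x. g x \<partial>\<nu>)"
        unfolding V_def by (rule filterlim_compose[OF conv[OF g] \<sigma>r])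
      then show "(\<integral>x. g x \<partial>mult_image M v (real_tail \<mu>)) = (\<integral>x. g x \<partial>\<nu>)"
        using breim(2)[OF _ _ g] unfolding X_eq by (rule LIMSEQ_unique[rotated])
    qed
    with r fr bound EZlim show ?thesis by blast
  qed
  have uniq: "real_tail \<mu> = real_tail \<mu>'"
    if a: "finite_radon N \<mu>" "\<forall>\<rho>>0. measure (real_tail \<mu>) {x. \<rho> \<le> norm x} \<le> K * 2 powr \<alpha> * \<rho> powr - \<alpha>" "mult_image M v (real_tail \<mu>) = \<nu>"
      and b: "finite_radon N \<mu>'" "\<forall>\<rho>>0. measure (real_tail \<mu>') {x. \<rho> \<le> norm x} \<le> K * 2 powr \<alpha> * \<rho> powr - \<alpha>" "mult_image M v (real_tail \<mu>') = \<nu>"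
    for \<mu> \<mu>'
  proof (rule mult_image_unique[OF prob_space_axioms v nz mom_alpha fourier _ _ _ _ \<alpha>, where C="K * 2 powr \<alpha>"])
    fix g :: "real^'n \<Rightarrow> real" assume g: "far_test g"
    obtain r B where r: "0 < r" "\<And>x. norm x < r \<Longrightarrow> g x = 0" and B: "\<And>x. norm (g x) \<le> B" and gm: "g \<in> borel_measurable borel"
      using far_testE[OF g] unfolding real_norm_def by metis
    have I: "(\<integral>x. g x \<partial>\<nu>) = (\<integral>q. g (v (fst q) * snd q) \<partial>(M \<Otimes>\<^sub>M real_tail \<kappa>))"
      if "finite_radon N \<kappa>" "mult_image M v (real_tail \<kappa>) = \<nu>" for \<kappa>
      using mult_image_integral(2)[OF sigma_finite_measure_axioms v finite_radon.tail_finite_real_tail[OF that(1)] _ gm B r] tf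
      unfolding that(2) by simp
    show "(\<integral>q. g (v (fst q) * snd q) \<partial>(M \<Otimes>\<^sub>M real_tail \<mu>)) = (\<integral>q. g (v (fst q) * snd q) \<partial>(M \<Otimes>\<^sub>M real_tail \<mu>'))"
      using I[OF a(1,3)] I[OF b(1,3)] by simp
  qed (use a b finite_radon.tail_finite_real_tail in auto)
  have "filterlim (\<lambda>n. s0 + real n) at_top sequentially"
    by (rule filterlim_tendsto_add_at_top[OF tendsto_const filterlim_real_sequentially])
  from sub[OF _ this] obtain \<mu> where \<mu>: "finite_radon N \<mu>" "\<forall>\<rho>>0. measure (real_tail \<mu>) {x. \<rho> \<le> norm x} \<le> K * 2 powr \<alpha> * \<rho> powr - \<alpha>"
      "mult_image M v (real_tail \<mu>) = \<nu>"
    by auto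
  show thesis
  proof (rule that[OF \<mu>(1,3)])
    fix g :: "real^'n \<Rightarrow> real" assume g: "far_test g"
    show "(EZ g \<longlongrightarrow> (\<integral>x. g x \<partial>real_tail \<mu>)) at_top"
    proof (rule ccontr)
      let ?L = "\<integral>x. g x \<partial>real_tail \<mu>"
      assume "\<not> ?thesis"
      then obtain e where e: "0 < e" "\<not> (\<forall>\<^sub>F s in at_top. dist (EZ g s) ?L < e)" by (auto simp: tendsto_iff)
      \<comment> \<open>The lower bound combines the threshold of the Potter estimate with
        divergence of the resulting sequence.\<close>
      have "\<exists>s. max s0 (real n) \<le> s \<and> e \<le> dist (EZ g s) ?L" for n
        using e(2) unfolding eventually_at_top_linorder not_ex not_all not_imp not_less by (rule spec)
      then obtain \<sigma> where \<sigma>: "\<And>n. max s0 (real n) \<le> \<sigma> n" "\<And>n. e \<le> dist (EZ g (\<sigma> n)) ?L" by metis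
      have "filterlim \<sigma> at_top sequentially"
        by (rule filterlim_at_top_mono[OF filterlim_real_sequentially]) (use \<sigma>(1) in auto)
      moreover have "s0 \<le> \<sigma> n" for n using \<sigma>(1)[of n] by simp
      ultimately obtain r \<mu>' where \<mu>': "finite_radon N \<mu>'" "\<forall>\<rho>>0. measure (real_tail \<mu>') {x. \<rho> \<le> norm x} \<le> K * 2 powr \<alpha> * \<rho> powr - \<alpha>"
        "mult_image M v (real_tail \<mu>') = \<nu>" and lim: "(\<lambda>n. EZ g (\<sigma> (r n))) \<longlonglongrightarrow> (\<integral>x. g x \<partial>real_tail \<mu>')"
        using sub[of \<sigma>] g by blast
      have "(\<lambda>n. EZ g (\<sigma> (r n))) \<longlonglongrightarrow> ?L" using lim unfolding uniq[OF \<mu> \<mu>'] .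
      from tendstoD[OF this e(1)] obtain n where "dist (EZ g (\<sigma> (r n))) ?L < e" by (auto simp: eventually_sequentially)
      with \<sigma>(2)[of "r n"] show False by simp
    qed
  qed
qed

end

section \<open>Index and tail measure of the second factor\<close>

lemma tail_finite_scale_measure: "tail_finite \<nu> \<Longrightarrow> tail_finite (scale_measure (ennreal c) \<nu>)"
  by (auto simp: tail_finite_def ennreal_mult_less_top)

lemma ereal_matrix_vec_diag: "ereal_matrix_vec (diag_matrix w) (ereal_vec x) = ereal_vec (w * x)"
proof -
  have "(\<Sum>j\<in>UNIV. ereal (diag_matrix w $ i $ j) * ereal_vec x $ j) = ereal (w $ i * x $ i)" for i
  proof -
    have "(\<Sum>j\<in>UNIV. ereal (diag_matrix w $ i $ j) * ereal_vec x $ j) = ereal (\<Sum>j\<in>UNIV. if i = j then w $ i * x $ j else 0)"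
      unfolding sum_ereal[symmetric] by (intro sum.cong refl) (simp add: diag_matrix_def ereal_vec_nth)
    then show ?thesis by simp
  qed
  then show ?thesis by (simp add: ereal_matrix_vec_def ereal_vec_def vec_eq_iff)
qed

lemma (in finite_radon) emeasure_UNIV_real_tail: "emeasure (real_tail \<mu>) UNIV = emeasure \<mu> (space \<mu>)"
  unfolding real_tail_def
  by (subst emeasure_distr[OF measurable_mu[OF borel_measurable_real_part]]) auto

lemma (in finite_radon) finite_radon_scale: "finite_radon N (scale_measure (ennreal c) \<mu>)"
proof
  show "radon_measure N (scale_measure (ennreal c) \<mu>)"
    using radon by (auto simp: radon_measure_def ennreal_mult_less_top)
qed (use N no_inf in auto)

context regvar
begin

text \<open>With \<open>E\<close> the expectation of a fixed ramp, both E(ts) / V(ts) and E(ts) /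
  V(s) have limits, the second one by homogeneity. Their quotient is the ratio wanted, with no need
  to evaluate the limit measure on a set.\<close>

lemma V_regular: 
  assumes t: "0 < t"
  shows "((\<lambda>s. V (t * s) / V s) \<longlongrightarrow> t powr - \<alpha>) at_top"
proof -
  let ?h = "ramp 1 2"
  have h: "far_test ?h" by (rule far_test_ramp) auto
  define I where "I = (\<integral>x. ?h x \<partial>\<nu>)"
  have I: "0 < I" using integral_ramp(1)[of 1 2] m1_pos unfolding I_def by (smt (verit) mult_pos_pos powr_gt_zero)
  define E where "E s = (\<integral>\<omega>. ?h (inverse s *\<^sub>R X \<omega>) \<partial>M)" for s
  have lim: "((\<lambda>s. E s / V s) \<longlongrightarrow> I) at_top" unfolding E_def I_def V_def by (rule conv[OF h])
  have "filterlim (\<lambda>s::real. t * s) at_top at_top"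
    by (rule filterlim_tendsto_pos_mult_at_top[OF tendsto_const t filterlim_ident])
  from filterlim_compose[OF lim this] have A: "((\<lambda>s. E (t * s) / V (t * s)) \<longlongrightarrow> I) at_top" .
  have "((\<lambda>s. (\<integral>\<omega>. ?h (inverse t *\<^sub>R (inverse s *\<^sub>R X \<omega>)) \<partial>M) / V s) \<longlongrightarrow> (\<integral>x. ?h (inverse t *\<^sub>R x) \<partial>\<nu>)) at_top"
    unfolding V_def by (rule conv[OF far_test_scale[OF h t]])
  moreover have "(\<integral>x. ?h (inverse t *\<^sub>R x) \<partial>\<nu>) = t powr - \<alpha> * I"
    unfolding I_def by (rule homog_integral[OF hom nu_sets t far_test_measurable[OF h]])
  moreover have "(\<integral>\<omega>. ?h (inverse t *\<^sub>R (inverse s *\<^sub>R X \<omega>)) \<partial>M) = E (t * s)" for s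
    by (simp add: E_def)
  ultimately have B: "((\<lambda>s. E (t * s) / V s) \<longlongrightarrow> t powr - \<alpha> * I) at_top" by simp
  have "((\<lambda>s. (E (t * s) / V s) / (E (t * s) / V (t * s))) \<longlongrightarrow> t powr - \<alpha> * I / I) at_top"
    using I by (intro tendsto_divide A B) auto
  then have "((\<lambda>s. (E (t * s) / V s) / (E (t * s) / V (t * s))) \<longlongrightarrow> t powr - \<alpha>) at_top" using I by simp
  \<comment> \<open>The positive limit makes \<open>E (t * s)\<close> nonzero eventually, so it may
    be cancelled.\<close>
  moreover have "\<forall>\<^sub>F s in at_top. (E (t * s) / V s) / (E (t * s) / V (t * s)) = V (t * s) / V s"
    using order_tendstoD(1)[OF A I]
  proof eventually_elim
    case (elim s)
    then have "E (t * s) \<noteq> 0" by auto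
    then show ?case by simp
  qed
  ultimately show ?thesis by (rule Lim_transform_eventually)
qed

end

context diagonal_factor
begin

text \<open>Replacing s by t s can be read in two ways, as rescaling the test function or as
  changing the normalisation. Comparing both limits and using \<open>V_regular\<close> gives
  homogeneity, which therefore passes from \<open>X\<close> to \<open>Z\<close>.\<close>

lemma homog_limit:
  assumes \<kappa>: "tail_finite \<kappa>" and lim: "\<And>g. far_test g \<Longrightarrow> (EZ g \<longlongrightarrow> (\<integral>x. g x \<partial>\<kappa>)) at_top"
  shows "homog \<alpha> \<kappa>"
proof (rule homog_if_integral[OF \<kappa>])
  fix t :: real and g :: "real^'n \<Rightarrow> real" assume t: "0 < t" and g: "far_test g"
  have ft: "filterlim (\<lambda>s::real. t * s) at_top at_top"
    by (rule filterlim_tendsto_pos_mult_at_top[OF tendsto_const t filterlim_ident])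
  have "((\<lambda>s. V (t * s) / V s * EZ g (t * s)) \<longlongrightarrow> t powr - \<alpha> * (\<integral>x. g x \<partial>\<kappa>)) at_top"
    by (intro tendsto_mult V_regular[OF t] filterlim_compose[OF lim[OF g] ft])
  moreover have "V (t * s) / V s * EZ g (t * s) = EZ (\<lambda>x. g (inverse t *\<^sub>R x)) s" for s
    using V_pos[of "t * s"] by (simp add: EZ_def)
  ultimately have "(EZ (\<lambda>x. g (inverse t *\<^sub>R x)) \<longlongrightarrow> t powr - \<alpha> * (\<integral>x. g x \<partial>\<kappa>)) at_top" by simp
  from tendsto_unique[OF trivial_limit_at_top_linorder lim[OF far_test_scale[OF g t]] this]
  show "(\<integral>x. g (inverse t *\<^sub>R x) \<partial>\<kappa>) = t powr - \<alpha> * (\<integral>x. g x \<partial>\<kappa>)" .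
qed

definition W :: "real \<Rightarrow> real" where "W s = prob {\<omega> \<in> space M. N (Z \<omega>) > s}"

lemma W_nonneg: "0 \<le> W s"
  by (simp add: W_def)

text \<open>It remains to replace the normalisation by \<open>V\<close> with that by
  \<open>W\<close>. The limit is homogeneous and nonzero, so {N >= 1} has positive mass
  \<open>c\<close>, and W / V converges to \<open>c\<close>.\<close>

theorem Z_regular:
  obtains \<mu> c where "finite_radon N \<mu>" "mult_image M v (real_tail \<mu>) = \<nu>" "homog \<alpha> (real_tail \<mu>)" "emeasure \<mu> (space \<mu>) \<noteq> 0"
    "0 < c" "\<And>g. far_test g \<Longrightarrow> ((\<lambda>s. (\<integral>\<omega>. g (inverse s *\<^sub>R Z \<omega>) \<partial>M) / W s) \<longlongrightarrow> 1 / c * (\<integral>x. g x \<partial>real_tail \<mu>)) at_top"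
    "\<And>g. far_test g \<Longrightarrow> ((\<lambda>s. (\<integral>\<omega>. g (inverse s *\<^sub>R X \<omega>) \<partial>M) / W s) \<longlongrightarrow> 1 / c * (\<integral>x. g x \<partial>\<nu>)) at_top"
proof -
  obtain \<mu> where fr: "finite_radon N \<mu>" and img: "mult_image M v (real_tail \<mu>) = \<nu>"
    and lim: "\<And>g. far_test g \<Longrightarrow> (EZ g \<longlongrightarrow> (\<integral>x. g x \<partial>real_tail \<mu>)) at_top"
    by (rule Z_limit_exists) (rule that)
  interpret fr: finite_radon N \<mu> by (rule fr)
  have tf0: "tail_finite (real_tail \<mu>)" by (rule fr.tail_finite_real_tail)
  have hom0: "homog \<alpha> (real_tail \<mu>)" by (rule homog_limit[OF tf0 lim])
  have nonnull0: "emeasure (real_tail \<mu>) UNIV \<noteq> 0"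
  proof
    assume "emeasure (real_tail \<mu>) UNIV = 0"
    then have "emeasure \<nu> UNIV = 0"
      unfolding img[symmetric] using emeasure_mult_image[OF v tf0, of UNIV] by simp
    then show False using nonnull by simp
  qed
  interpret H: hom_tail N "real_tail \<mu>" \<alpha>
    by unfold_locales (rule norm tf0 hom0 nonnull0 \<alpha>)+
  define c where "c = H.m1"
  have c: "0 < c" unfolding c_def by (rule H.m1_pos)
  \<comment> \<open>\<open>W\<close> is caught between ramps ending and starting at 1. Homogeneity
    bounds their limits by b^(-\<alpha>) c and a^(-\<alpha>) c, and both tend to \<open>c\<close> as
    b decreases and a increases to 1.\<close>
  have WV: "((\<lambda>s. W s / V s) \<longlongrightarrow> c) at_top"
  proof (rule order_tendstoI)
    fix y assume y: "y < c"
    have "((\<lambda>b. b powr - \<alpha> * c) \<longlongrightarrow> 1 powr - \<alpha> * c) (at_right 1)" by (intro tendsto_intros) auto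
    then have "\<forall>\<^sub>F b in at_right 1. y < b powr - \<alpha> * c" using y by (intro order_tendstoD(1)) auto
    moreover have "\<forall>\<^sub>F b :: real in at_right 1. 1 < b" by (rule eventually_at_rightI[of 1 2]) auto
    ultimately have "\<forall>\<^sub>F b in at_right (1::real). y < b powr - \<alpha> * c \<and> 1 < b" by (rule eventually_conj)
    from eventually_happens'[OF trivial_limit_at_right_real this] obtain b where "y < b powr - \<alpha> * c \<and> 1 < b" by (rule exE)
    then have b: "y < b powr - \<alpha> * c" "1 < b" by simp_all
    have "y < (\<integral>x. ramp 1 b x \<partial>real_tail \<mu>)"
      using H.integral_ramp(1)[of 1 b] b unfolding c_def by simp
    from order_tendstoD(1)[OF lim[OF far_test_ramp] this] b(2)
    have "\<forall>\<^sub>F s in at_top. y < EZ (ramp 1 b) s" by simp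
    then show "\<forall>\<^sub>F s in at_top. y < W s / V s"
      using eventually_gt_at_top[of 0]
    proof eventually_elim
      case (elim s)
      have "EZ (ramp 1 b) s \<le> W s / V s"
        unfolding EZ_def using expect_ramp(2)[OF prob_space_axioms Z, of s 1 b] elim(2) b(2) V_pos[of s]
        by (intro divide_right_mono) (auto simp: W_def)
      with elim(1) show ?case by simp
    qed
  next
    fix y assume y: "c < y"
    have "((\<lambda>a. a powr - \<alpha> * c) \<longlongrightarrow> 1 powr - \<alpha> * c) (at_left 1)" by (intro tendsto_intros) auto
    then have "\<forall>\<^sub>F a in at_left 1. a powr - \<alpha> * c < y" using y by (intro order_tendstoD(2)) auto
    moreover have "\<forall>\<^sub>F a :: real in at_left 1. 0 < a \<and> a < 1" by (rule eventually_at_leftI[of 0]) auto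
    ultimately have "\<forall>\<^sub>F a in at_left (1::real). a powr - \<alpha> * c < y \<and> 0 < a \<and> a < 1" by (rule eventually_conj)
    from eventually_happens'[OF trivial_limit_at_left_real this] obtain a where "a powr - \<alpha> * c < y \<and> 0 < a \<and> a < 1" by (rule exE)
    then have a: "a powr - \<alpha> * c < y" "0 < a" "a < 1" by simp_all
    have "(\<integral>x. ramp a 1 x \<partial>real_tail \<mu>) < y"
      using H.integral_ramp(2)[of a 1] a unfolding c_def by simp
    from order_tendstoD(2)[OF lim[OF far_test_ramp] this] a
    have "\<forall>\<^sub>F s in at_top. EZ (ramp a 1) s < y" by simp
    then show "\<forall>\<^sub>F s in at_top. W s / V s < y"
      using eventually_gt_at_top[of 0]
    proof eventually_elim
      case (elim s)
      have "W s / V s \<le> EZ (ramp a 1) s"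
        unfolding EZ_def using expect_ramp(1)[OF prob_space_axioms Z, of s a 1] elim(2) a V_pos[of s]
        by (intro divide_right_mono) (auto simp: W_def)
      with elim(1) show ?case by simp
    qed
  qed
  have VW: "((\<lambda>s. V s / W s) \<longlongrightarrow> 1 / c) at_top"
    using tendsto_inverse[OF WV] c by (simp add: inverse_eq_divide)
  have scale: "((\<lambda>s. x s / W s) \<longlongrightarrow> 1 / c * l) at_top" if "((\<lambda>s. x s / V s) \<longlongrightarrow> l) at_top" for x l
  proof -
    have "V s / W s * (x s / V s) = x s / W s" for s using V_pos[of s] by simp
    then show ?thesis using tendsto_mult[OF VW that] by simp
  qed
  show thesis
  proof (rule that[OF fr img hom0 _ c])
    show "emeasure \<mu> (space \<mu>) \<noteq> 0" using nonnull0 fr.emeasure_UNIV_real_tail by simp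
    fix g :: "real^'n \<Rightarrow> real" assume g: "far_test g"
    show "((\<lambda>s. (\<integral>\<omega>. g (inverse s *\<^sub>R Z \<omega>) \<partial>M) / W s) \<longlongrightarrow> 1 / c * (\<integral>x. g x \<partial>real_tail \<mu>)) at_top"
      by (rule scale[OF lim[OF g, unfolded EZ_def[abs_def]]])
    show "((\<lambda>s. (\<integral>\<omega>. g (inverse s *\<^sub>R X \<omega>) \<partial>M) / W s) \<longlongrightarrow> 1 / c * (\<integral>x. g x \<partial>\<nu>)) at_top"
      by (rule scale[OF conv[OF g, folded V_def]])
  qed
qed

text \<open>Since neither measure charges infinite points, masses can be read on R^d, where the
  matrix acts as the componentwise product and the expected image becomes
  \<open>mult_image\<close>.\<close>

lemma expected_image_eq:
  fixes \<kappa> \<mu>X :: "(ereal^'n) measure"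
  assumes fk: "finite_radon N \<kappa>" and fX: "finite_radon N \<mu>X" and X: "real_tail \<mu>X = \<nu>"
    and \<kappa>: "real_tail \<kappa> = scale_measure c \<nu>0" and \<nu>0: "tail_finite \<nu>0" "mult_image M v \<nu>0 = \<nu>"
  shows "expected_image M (\<lambda>\<omega>. diag_matrix (v \<omega>)) \<kappa> = scale_measure c \<mu>X"
proof (rule measure_eqI)
  interpret fk: finite_radon N \<kappa> by (rule fk)
  interpret fX: finite_radon N \<mu>X by (rule fX)
  have sub: "sets (punctured_borel :: (ereal^'n) measure) \<subseteq> Pow (- {0})"
    by (auto simp: sets_punctured_borel_iff)
  have sE: "sets (expected_image M (\<lambda>\<omega>. diag_matrix (v \<omega>)) \<kappa>) = sets punctured_borel"
    unfolding expected_image_def sets_measure_of[OF sub]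
    using sets.sigma_sets_eq[of "punctured_borel :: (ereal^'n) measure"] by (simp add: space_punctured_borel)
  show "sets (expected_image M (\<lambda>\<omega>. diag_matrix (v \<omega>)) \<kappa>) = sets (scale_measure c \<mu>X)"
    by (simp add: sE fX.sets_mu)
  fix B assume "B \<in> sets (expected_image M (\<lambda>\<omega>. diag_matrix (v \<omega>)) \<kappa>)"
  then have B: "B \<in> sets punctured_borel" by (simp add: sE)
  then have B': "B \<in> sets borel" "0 \<notin> B" by (auto simp: sets_punctured_borel_iff)
  have Bv: "ereal_vec -` B \<in> sets borel" using measurable_sets[OF borel_measurable_ereal_vec B'(1)] by simp
  have dm: "(\<lambda>\<omega>. diag_matrix (v \<omega>)) \<in> borel_measurable M"
    unfolding diag_matrix_def
  proof (intro borel_measurable_vecI, unfold vec_lambda_beta)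
    fix i j :: 'n
    show "(\<lambda>\<omega>. if i = j then v \<omega> $ i else 0) \<in> borel_measurable M" by measurable
  qed
  have "emeasure \<kappa> {z \<in> space \<kappa>. ereal_matrix_vec (diag_matrix (v \<omega>)) z \<in> B} = c * emeasure \<nu>0 {x. v \<omega> * x \<in> ereal_vec -` B}" for \<omega>
  proof -
    have "(\<lambda>z. (diag_matrix (v \<omega>), z)) \<in> measurable borel (borel \<Otimes>\<^sub>M (borel :: (ereal^'n) measure))" by measurable
    from measurable_compose[OF this borel_measurable_ereal_matrix_vec]
    have "(\<lambda>z :: ereal^'n. ereal_matrix_vec (diag_matrix (v \<omega>)) z) \<in> borel_measurable borel" by simp
    from measurable_sets[OF fk.measurable_mu[OF this] B'(1)]
    have s: "{z \<in> space \<kappa>. ereal_matrix_vec (diag_matrix (v \<omega>)) z \<in> B} \<in> sets \<kappa>" by (simp add: vimage_def Int_def conj_commute)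
    \<comment> \<open>The origin is missing from the space of \<open>\<kappa>\<close> but present in
      R^d; it is excluded automatically, because its image 0 is not in \<open>B\<close>.\<close>
    have z: "ereal_vec (v \<omega> * x) \<in> B \<Longrightarrow> ereal_vec x \<noteq> 0" for x
      using B'(2) by (metis ereal_vec_eq_0_iff mult_zero_right)
    have "ereal_vec -` {z \<in> space \<kappa>. ereal_matrix_vec (diag_matrix (v \<omega>)) z \<in> B} = {x. v \<omega> * x \<in> ereal_vec -` B}"
      using z by (auto simp: fk.space_mu ereal_matrix_vec_diag)
    then show ?thesis unfolding fk.emeasure_mu[OF s] \<kappa> by simp
  qed
  then have "emeasure (expected_image M (\<lambda>\<omega>. diag_matrix (v \<omega>)) \<kappa>) B = (\<integral>\<^sup>+\<omega>. c * emeasure \<nu>0 {x. v \<omega> * x \<in> ereal_vec -` B} \<partial>M)"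
    unfolding emeasure_expected_image[OF norm fk.radon dm B] by simp
  also have "\<dots> = c * (\<integral>\<^sup>+\<omega>. emeasure \<nu>0 {x. v \<omega> * x \<in> ereal_vec -` B} \<partial>M)"
  proof (rule nn_integral_cmult)
    interpret s: sigma_finite_measure \<nu>0 by (rule tail_finite_sigma_finite[OF \<nu>0(1)])
    have "(\<lambda>q. v (fst q) * snd q) -` (ereal_vec -` B) \<inter> space (M \<Otimes>\<^sub>M \<nu>0) \<in> sets (M \<Otimes>\<^sub>M \<nu>0)"
      by (rule measurable_sets[OF mult_image_measurable[OF v \<nu>0(1)] Bv])
    from s.measurable_emeasure_Pair[OF this]
    have "(\<lambda>\<omega>. emeasure \<nu>0 (Pair \<omega> -` ((\<lambda>q. v (fst q) * snd q) -` (ereal_vec -` B) \<inter> space (M \<Otimes>\<^sub>M \<nu>0)))) \<in> borel_measurable M" .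
    then show "(\<lambda>\<omega>. emeasure \<nu>0 {x. v \<omega> * x \<in> ereal_vec -` B}) \<in> borel_measurable M"
      by (rule measurable_cong[THEN iffD1, rotated]) (auto intro!: arg_cong[where f="emeasure \<nu>0"] simp: space_pair_measure tail_finite_space[OF \<nu>0(1)])
  qed
  also have "\<dots> = c * emeasure \<nu> (ereal_vec -` B)"
    using emeasure_mult_image[OF v \<nu>0(1) Bv] by (simp add: \<nu>0(2))
  also have "\<dots> = emeasure (scale_measure c \<mu>X) B"
    using fX.emeasure_mu[of B] B by (simp add: X fX.sets_mu)
  finally show "emeasure (expected_image M (\<lambda>\<omega>. diag_matrix (v \<omega>)) \<kappa>) B = emeasure (scale_measure c \<mu>X) B" .
qed

theorem Z_regularly_varying: "regularly_varying M N Z \<alpha>"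
  and X_vague_limit: "finite_radon N \<mu>X \<Longrightarrow> real_tail \<mu>X = \<nu> \<Longrightarrow> tail_measure M N Z \<kappa> \<Longrightarrow>
    vague_tendsto (\<lambda>s. scaled_law M X s (W s)) (expected_image M (\<lambda>\<omega>. diag_matrix (v \<omega>)) \<kappa>) at_top"
proof -
  obtain \<mu> c where fr: "finite_radon N \<mu>" and img: "mult_image M v (real_tail \<mu>) = \<nu>" and hom0: "homog \<alpha> (real_tail \<mu>)"
    and nn: "emeasure \<mu> (space \<mu>) \<noteq> 0" and c: "0 < c"
    and Zlim: "\<And>g. far_test g \<Longrightarrow> ((\<lambda>s. (\<integral>\<omega>. g (inverse s *\<^sub>R Z \<omega>) \<partial>M) / W s) \<longlongrightarrow> 1 / c * (\<integral>x. g x \<partial>real_tail \<mu>)) at_top"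
    and Xlim: "\<And>g. far_test g \<Longrightarrow> ((\<lambda>s. (\<integral>\<omega>. g (inverse s *\<^sub>R X \<omega>) \<partial>M) / W s) \<longlongrightarrow> 1 / c * (\<integral>x. g x \<partial>\<nu>)) at_top"
    by (rule Z_regular) (rule that)
  interpret fr: finite_radon N \<mu> by (rule fr)
  have c0: "0 \<le> 1 / c" using c by simp
  let ?\<mu> = "scale_measure (ennreal (1 / c)) \<mu>"
  have scale_int: "(\<integral>y. f y \<partial>scale_measure (ennreal (1 / c)) \<kappa>) = 1 / c * (\<integral>x. f (ereal_vec x) \<partial>real_tail \<kappa>)"
    if "finite_radon N \<kappa>" and f: "continuous_on UNIV f" for \<kappa> and f :: "ereal^'n \<Rightarrow> real"
  proof -
    interpret fk: finite_radon N \<kappa> by fact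
    have fm: "f \<in> borel_measurable borel" by (rule borel_measurable_continuous_onI[OF f])
    show ?thesis using integral_scale_measure[OF fk.measurable_mu[OF fm] c0] fk.integral_mu[OF fm] by simp
  qed
  interpret s: finite_radon N ?\<mu> by (rule fr.finite_radon_scale)
  have "vague_tendsto (\<lambda>s. scaled_law M Z s (W s)) ?\<mu> at_top"
  proof (rule far_test_imp_vague[OF Z W_nonneg s.space_mu])
    fix f :: "ereal^'n \<Rightarrow> real"
    assume f: "continuous_on UNIV f" "far_test (\<lambda>x. f (ereal_vec x))"
    show "((\<lambda>s. (\<integral>\<omega>. f (ereal_vec (inverse s *\<^sub>R Z \<omega>)) \<partial>M) / W s) \<longlongrightarrow> (\<integral>y. f y \<partial>?\<mu>)) at_top"
      unfolding scale_int[OF fr f(1)] by (rule Zlim[OF f(2)])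
  qed
  moreover have "emeasure ?\<mu> (space ?\<mu>) \<noteq> 0"
    using nn c by (simp add: space_scale_measure)
  ultimately have "tail_measure M N Z ?\<mu>"
    unfolding tail_measure_def W_def using s.radon s.no_inf by simp
  moreover have "homogeneous \<alpha> ?\<mu>"
    using hom0 unfolding fr.homogeneous_iff_homog[symmetric] homogeneous_def by (simp add: mult.left_commute)
  ultimately show "regularly_varying M N Z \<alpha>"
    unfolding regularly_varying_def by (intro conjI exI[of _ ?\<mu>] Z \<alpha>)
  fix \<mu>X \<kappa> assume fX: "finite_radon N \<mu>X" and X\<nu>: "real_tail \<mu>X = \<nu>" and k: "tail_measure M N Z \<kappa>"
  interpret fX: finite_radon N \<mu>X by (rule fX)
  have vk: "vague_tendsto (\<lambda>s. scaled_law M Z s (W s)) \<kappa> at_top"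
    using k by (simp add: tail_measure_def W_def)
  have fk: "finite_radon N \<kappa>"
    using k norm by unfold_locales (auto simp: tail_measure_def)
  interpret fk: finite_radon N \<kappa> by (rule fk)
  \<comment> \<open>Any tail measure of \<open>Z\<close> arises from the same limit, so it is 1 / c
    times the limit found under normalisation by \<open>V\<close>. This yields the vague limit for
    an arbitrary tail measure.\<close>
  have rk: "real_tail \<kappa> = scale_measure (ennreal (1 / c)) (real_tail \<mu>)"
  proof (rule measure_eqI_far_test[OF fk.tail_finite_real_tail tail_finite_scale_measure[OF fr.tail_finite_real_tail]])
    fix g :: "real^'n \<Rightarrow> real" assume g: "far_test g"
    have gm: "g \<in> borel_measurable (real_tail \<mu>)"
      using far_test_measurable[OF g] by (simp cong: measurable_cong_sets add: tail_finite_sets[OF fr.tail_finite_real_tail])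
    have "(\<integral>x. g x \<partial>real_tail \<kappa>) = 1 / c * (\<integral>x. g x \<partial>real_tail \<mu>)"
      by (rule tendsto_unique[OF trivial_limit_at_top_linorder fk.vague_imp_far_test[OF prob_space_axioms Z W_nonneg vk g] Zlim[OF g]])
    then show "(\<integral>x. g x \<partial>real_tail \<kappa>) = (\<integral>x. g x \<partial>scale_measure (ennreal (1 / c)) (real_tail \<mu>))"
      by (simp only: integral_scale_measure[OF gm c0])
  qed
  interpret sX: finite_radon N "scale_measure (ennreal (1 / c)) \<mu>X" by (rule fX.finite_radon_scale)
  show "vague_tendsto (\<lambda>s. scaled_law M X s (W s)) (expected_image M (\<lambda>\<omega>. diag_matrix (v \<omega>)) \<kappa>) at_top"
    unfolding expected_image_eq[OF fk fX X\<nu> rk fr.tail_finite_real_tail img]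
  proof (rule far_test_imp_vague[OF X W_nonneg sX.space_mu])
    fix f :: "ereal^'n \<Rightarrow> real"
    assume f: "continuous_on UNIV f" "far_test (\<lambda>x. f (ereal_vec x))"
    show "((\<lambda>s. (\<integral>\<omega>. f (ereal_vec (inverse s *\<^sub>R X \<omega>)) \<partial>M) / W s) \<longlongrightarrow> (\<integral>y. f y \<partial>scale_measure (ennreal (1 / c)) \<mu>X)) at_top"
      unfolding scale_int[OF fX f(1)] X\<nu> by (rule Xlim[OF f(2)])
  qed
qed

end

section \<open>Operator norms of diagonal matrices and conclusion\<close>

lemma diag_matrix_mult_vec: "diag_matrix w *v x = w * x"
proof -
  have "(\<Sum>j\<in>UNIV. diag_matrix w $ i $ j * x $ j) = w $ i * x $ i" for i
  proof -
    have "(\<Sum>j\<in>UNIV. diag_matrix w $ i $ j * x $ j) = (\<Sum>j\<in>UNIV. if i = j then w $ i * x $ j else 0)"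
      by (intro sum.cong refl) (simp add: diag_matrix_def)
    then show ?thesis by simp
  qed
  then show ?thesis by (simp add: matrix_vector_mult_def vec_eq_iff)
qed

text \<open>Each entry is the stretching factor of a unit vector. Boundedness of the quotients is
  proved first because a supremum bounds its members only for sets bounded above.\<close>

lemma norm_le_matrix_norm_diag:
  fixes w :: "real^'n"
  assumes N: "is_norm N"
  shows "norm w \<le> real CARD('n) * matrix_norm N (diag_matrix w)"
proof -
  obtain c C where c: "0 < c" "\<And>x. c * norm x \<le> N x" and C: "0 < C" "\<And>x. N x \<le> C * norm x"
    using is_norm_equiv[OF N] by metis
  have bdd: "bdd_above (range (\<lambda>x. N (diag_matrix w *v x) / N x))"
  proof (rule bdd_aboveI2)
    fix x
    show "N (diag_matrix w *v x) / N x \<le> C * norm w / c"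
    proof (cases "x = 0")
      case True
      then show ?thesis using c C by (simp add: is_normD(3)[OF N])
    next
      case False
      then have Nx: "0 < N x" using c by (smt (verit) mult_pos_pos zero_less_norm_iff)
      have "N (w * x) \<le> C * norm (w * x)" by (rule C(2))
      also have "\<dots> \<le> C * (norm w * norm x)" using C(1) norm_times_le[of w x] by (intro mult_left_mono) auto
      also have "\<dots> = C * norm w / c * (c * norm x)" using c by simp
      also have "\<dots> \<le> C * norm w / c * N x" using c C by (intro mult_left_mono) auto
      finally show ?thesis using Nx by (simp add: diag_matrix_mult_vec pos_divide_le_eq)
    qed
  qed
  have le: "\<bar>w $ j\<bar> \<le> matrix_norm N (diag_matrix w)" for j
  proof -
    have "w * axis j 1 = w $ j *\<^sub>R axis j 1" by (simp add: vec_eq_iff axis_def)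
    then have "N (diag_matrix w *v axis j 1) = \<bar>w $ j\<bar> * N (axis j 1)"
      by (simp add: diag_matrix_mult_vec is_normD(2)[OF N])
    moreover have "N (axis j 1) \<noteq> 0" using N by (simp add: is_norm_def axis_eq_0_iff)
    ultimately have "\<bar>w $ j\<bar> = N (diag_matrix w *v axis j 1) / N (axis j 1)" by simp
    also have "\<dots> \<le> matrix_norm N (diag_matrix w)"
      unfolding matrix_norm_def by (rule cSUP_upper[OF UNIV_I bdd])
    finally show ?thesis .
  qed
  have "norm w \<le> (\<Sum>j\<in>UNIV. \<bar>w $ j\<bar>)" by (rule norm_le_l1_cart)
  also have "\<dots> \<le> (\<Sum>j\<in>(UNIV::'n set). matrix_norm N (diag_matrix w))" by (intro sum_mono le)
  finally show ?thesis by simp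
qed

theorem theorem4p1:
  fixes M :: "'w measure"
    and N :: "real^'n \<Rightarrow> real"
    and a :: "'n \<Rightarrow> 'w \<Rightarrow> real"
    and A :: "'w \<Rightarrow> real^'n^'n"
    and Z X :: "'w \<Rightarrow> real^'n"
    and \<alpha> :: real
  assumes "prob_space M"
    and "is_norm N"
    and "\<And>j. a j \<in> borel_measurable M"
    and "\<And>j. measure M {\<omega> \<in> space M. a j \<omega> = 0} = 0"
    and "A = (\<lambda>\<omega>. diag_matrix (\<chi> j. a j \<omega>))"
    and "Z \<in> borel_measurable M"
    and "prob_space.indep_var M borel (\<lambda>\<omega>. \<chi> j. a j \<omega>) borel Z"
    and "X = (\<lambda>\<omega>. A \<omega> *v Z \<omega>)"
    and "\<alpha> > 0"
    and "regularly_varying M N X \<alpha>"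
    and "\<exists>\<delta>>0. integrable M (\<lambda>\<omega>. matrix_norm N (A \<omega>) powr (\<alpha> + \<delta>))"
    and "\<And>(j :: 'n) (m :: 'n \<Rightarrow> nat) (\<theta> :: 'n \<Rightarrow> real). (\<forall>k. m k \<in> {0, 1}) \<Longrightarrow>
           (\<integral>\<omega>. complex_of_real (\<bar>a j \<omega>\<bar> powr \<alpha>) *
               (\<Prod>k\<in>UNIV. complex_of_real \<bar>a k \<omega>\<bar> powr (\<i> * complex_of_real (\<theta> k)) *
                            complex_of_real (sgn (a k \<omega>)) ^ m k) \<partial>M) \<noteq> 0"
  shows "regularly_varying M N Z \<alpha> \<and>
    (\<forall>\<mu>. tail_measure M N Z \<mu> \<longrightarrow>
       vague_tendsto (\<lambda>s. scaled_law M X s (measure M {\<omega> \<in> space M. N (Z \<omega>) > s}))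
         (expected_image M A \<mu>) at_top)"
proof -
  interpret prob_space M by fact
  define v :: "'w \<Rightarrow> real^'n" where "v \<omega> = (\<chi> j. a j \<omega>)" for \<omega>
  have vj: "v \<omega> $ j = a j \<omega>" for \<omega> j by (simp add: v_def)
  have A: "A = (\<lambda>\<omega>. diag_matrix (v \<omega>))" using assms(5) by (simp add: v_def)
  have X: "X = (\<lambda>\<omega>. v \<omega> * Z \<omega>)" using assms(8) by (simp add: A diag_matrix_mult_vec)
  have v [measurable]: "v \<in> borel_measurable M"
    by (rule borel_measurable_vecI) (use assms(3) in \<open>simp add: vj\<close>)
  obtain \<mu>X where tm: "tail_measure M N X \<mu>X" and hom: "homogeneous \<alpha> \<mu>X" and Xm: "X \<in> borel_measurable M"
    using assms(10) unfolding regularly_varying_def by auto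
  have fX: "finite_radon N \<mu>X"
    using tm assms(2) by unfold_locales (auto simp: tail_measure_def)
  interpret fX: finite_radon N \<mu>X by (rule fX)
  obtain \<delta> where \<delta>: "0 < \<delta>" and int: "integrable M (\<lambda>\<omega>. matrix_norm N (A \<omega>) powr (\<alpha> + \<delta>))"
    using assms(11) by auto
  \<comment> \<open>The moment hypothesis is moved from the operator norm of the matrix to the
    Euclidean norm of its diagonal, at the price of a power of the dimension.\<close>
  have mom: "integrable M (\<lambda>\<omega>. norm (v \<omega>) powr (\<alpha> + \<delta>))"
  proof (rule Bochner_Integration.integrable_bound)
    let ?d = "real CARD('n)"
    show "integrable M (\<lambda>\<omega>. ?d powr (\<alpha> + \<delta>) * matrix_norm N (A \<omega>) powr (\<alpha> + \<delta>))"
      by (intro integrable_mult_right int)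
    show "AE \<omega> in M. norm (norm (v \<omega>) powr (\<alpha> + \<delta>)) \<le> norm (?d powr (\<alpha> + \<delta>) * matrix_norm N (A \<omega>) powr (\<alpha> + \<delta>))"
    proof (intro AE_I2)
      fix \<omega>
      have "norm (v \<omega>) \<le> ?d * matrix_norm N (A \<omega>)"
        unfolding A by (rule norm_le_matrix_norm_diag[OF assms(2)])
      then have "norm (v \<omega>) powr (\<alpha> + \<delta>) \<le> (?d * matrix_norm N (A \<omega>)) powr (\<alpha> + \<delta>)"
        using assms(9) \<delta> by (intro powr_mono2) auto
      also have "\<dots> = ?d powr (\<alpha> + \<delta>) * matrix_norm N (A \<omega>) powr (\<alpha> + \<delta>)" by (rule powr_mult)
      finally show "norm (norm (v \<omega>) powr (\<alpha> + \<delta>)) \<le> norm (?d powr (\<alpha> + \<delta>) * matrix_norm N (A \<omega>) powr (\<alpha> + \<delta>))" by simp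
    qed
  qed measurable
  have nz: "AE \<omega> in M. \<forall>j. v \<omega> $ j \<noteq> 0"
  proof -
    have "AE \<omega> in M. a j \<omega> \<noteq> 0" for j
    proof (rule AE_I'[of "{\<omega> \<in> space M. a j \<omega> = 0}"])
      have "{\<omega> \<in> space M. a j \<omega> = 0} \<in> sets M" using assms(3)[of j] by measurable
      then show "{\<omega> \<in> space M. a j \<omega> = 0} \<in> null_sets M"
        using assms(4)[of j] by (intro null_setsI) (auto simp: emeasure_eq_measure)
    qed auto
    then show ?thesis by (simp add: vj AE_all_countable)
  qed
  \<comment> \<open>The exponent \<open>p\<close> is \<alpha> + \<delta>, and the limit measure of
    \<open>X\<close> enters through its restriction to R^d.\<close>
  interpret D: diagonal_factor M N X "real_tail \<mu>X" \<alpha> v Z "\<alpha> + \<delta>"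
  proof unfold_locales
    show "emeasure (real_tail \<mu>X) UNIV \<noteq> 0"
      using tm by (simp add: fX.emeasure_UNIV_real_tail tail_measure_def)
    show "homog \<alpha> (real_tail \<mu>X)" using hom by (simp add: fX.homogeneous_iff_homog)
    show "indep_var borel v borel Z" using assms(7) by (simp add: v_def[abs_def])
    show "((\<lambda>s. (\<integral>\<omega>. g (inverse s *\<^sub>R X \<omega>) \<partial>M) / prob {\<omega> \<in> space M. N (X \<omega>) > s}) \<longlongrightarrow> (\<integral>x. g x \<partial>real_tail \<mu>X)) at_top"
      if "far_test g" for g
      by (rule fX.vague_imp_far_test[OF prob_space_axioms Xm _ _ that]) (use tm in \<open>simp_all add: tail_measure_def\<close>)
    show "(\<integral>\<omega>. complex_of_real (\<bar>v \<omega> $ j\<bar> powr \<alpha>) *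
               (\<Prod>k\<in>UNIV. complex_of_real \<bar>v \<omega> $ k\<bar> powr (\<i> * complex_of_real (\<theta> k)) *
                            complex_of_real (sgn (v \<omega> $ k)) ^ m k) \<partial>M) \<noteq> 0"
      if "\<forall>k. m k \<in> {0, 1}" for j m \<theta>
      unfolding vj by (rule assms(12)[OF that])
  qed (use assms \<delta> v Xm mom nz X fX.tail_finite_real_tail in auto)
  show ?thesis
    using D.Z_regularly_varying D.X_vague_limit[OF fX refl] unfolding A D.W_def by blast
qed

end
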